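(* Let $G$ be a matching covered graph and let $\mathcal{S}$ be a torso in $G$. Then there exists exactly one torsoid $\mathcal{T}$ in $G$ such that $\mathcal{S}$ cleaves $\mathcal{T}$.
   Context: Graphs may be infinite. For $X\subseteq V(G)$, $\partial(X)$ is the set of edges of $G$ with exactly one endpoint in $X$. For a perfect matching $M$ of $G$, $\mathrm{Perf}(G,M)$ is the set of perfect matchings of $G$ with finite symmetric difference to $M$. $G$ is matching covered with respect to $M$ if $G$ is connected and every edge of $G$ lies in some member of $\mathrm{Perf}(G,M)$; it is matching covered if this holds for some $M$. For each matching covered graph such an $M$ is arbitrary but fixed, and all notions below refer to it. Tight sets: $X\subseteq V(G)$ is tight if every $M'\in\mathrm{Perf}(G,M)$ has exactly one edge in $\partial(X)$; then $\partial(X)$ is a tight cut. A tight set $X$ is trivial if $|X|=1$ or $|V(G)\setminus X|=1$. Tight cuts $C_1,C_2$ are nested if there are disjoint $X_1,X_2\subset V(G)$ with $C_i=\partial(X_i)$. A maximal family of nested tight cuts is an inclusion-maximal set of pairwise nested tight cuts. A BoB ("brick or brace") is a matching covered graph with no non-trivial tight sets. Tight set partitions: a partition $\mathcal{P}$ of $V(G)$ into tight sets is a tight set partition. Its collapse is the graph with vertex set $\mathcal{P}$ in which distinct $P,Q$ are adjacent iff $G$ has an edge between $P$ and $Q$. The collapse is matching covered with respect to the perfect matching consisting of all pairs $\{P,Q\}$ of distinct classes joined by an edge of $M$, and this is its fixed matching. Torsos: for a maximal family $\mathcal{C}$ of nested tight cuts in $G$, a maximal star of $\mathcal{C}$ is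 a tight set partition $\mathcal{P}$ with at least $4$ elements such that its collapse is a BoB and $\partial(P)\in\mathcal{C}$ for every $P\in\mathcal{P}$; its collapse is then called a torso of $\mathcal{C}$. A torso in $G$ is a torso of some maximal family of nested tight cuts in $G$. Passable sets: a set $S\subseteq V(G)$ is passable for a set $P$ if $P\setminus S$ and $P\cup S$ are tight. Torsoids: a torsoid in $G$ is a pair $(H,\varepsilon)$ such that: (T1) $H$ is a matching covered graph on at least $4$ vertices that is a BoB or a cycle; (T2) the elements of $V(H)$ are tight sets of $G$; (T3) $\varepsilon\colon E(H)\to 2^{V(G)}$; (T4) the vertices of $H$ together with the sets $\varepsilon(e)$, $e\in E(H)$, form a near partition of $V(G)$ (they are pairwise disjoint with union $V(G)$; empty sets are allowed); (T5) for $vw\in E(H)$ there is an edge of $G$ from $v\cup\varepsilon(vw)$ to $w$, and $\varepsilon(vw)$ is the largest among all subsets of $v\cup\varepsilon(vw)\cup w$ that are passable for both $v$ and $w$; (T6) for distinct $v,w\in V(H)$ with $vw\notin E(H)$ there is no edge of $G$ from $v$ to $w$; (T7) if $H$ is a cycle and $v$ is a vertex of $H$ with neighbours $u$ and $w$, then there is no partition of $\varepsilon(uv)\cup v\cup\varepsilon(vw)$ into tight sets $P_1,P_2,P_3$ such that both $u\cup P_1\cup P_2$ and $P_2\cup P_3\cup w$ are tight. Cleaving: a torso $\mathcal{S}$ cleaves a torsoid $(H,\varepsilon)$ if every vertex of $\mathcal{S}$ (a subset of $V(G)$) contains as a subset some vertex of $H$. *)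

theory Defs
  imports Main "HOL-Library.Disjoint_Sets" "HOL-Library.FuncSet"
begin

section \<open>Graphs and perfect matchings\<close>

text \<open>Graphs are simple and possibly infinite; edges are two-element vertex sets.\<close>

record 'v sgraph =
  verts :: "'v set"
  edges :: "'v set set"

definition simple_graph :: "'v sgraph \<Rightarrow> bool" where
  "simple_graph G \<longleftrightarrow> (\<forall>e\<in>edges G. e \<subseteq> verts G \<and> card e = 2)"

definition connected_graph :: "'v sgraph \<Rightarrow> bool" where
  "connected_graph G \<longleftrightarrow> verts G \<noteq> {} \<and>
     (\<forall>v\<in>verts G. \<forall>w\<in>verts G. (v, w) \<in> {(x, y). {x, y} \<in> edges G}\<^sup>*)"

definition is_cycle :: "'v sgraph \<Rightarrow> bool" where
  "is_cycle G \<longleftrightarrow> (\<exists>n\<ge>3. \<exists>c :: nat \<Rightarrow> 'v. bij_betw c {..<n} (verts G) \<and>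
     edges G = {{c i, c (Suc i mod n)} | i. i < n})"

definition edge_between :: "'v set set \<Rightarrow> 'v set \<Rightarrow> 'v set \<Rightarrow> bool" where
  "edge_between E X Y \<longleftrightarrow> (\<exists>x\<in>X. \<exists>y\<in>Y. {x, y} \<in> E)"

definition boundary :: "'v sgraph \<Rightarrow> 'v set \<Rightarrow> 'v set set" where
  "boundary G X = {e \<in> edges G. card (e \<inter> X) = 1}"

definition perfect_matching :: "'v sgraph \<Rightarrow> 'v set set \<Rightarrow> bool" where
  "perfect_matching G M \<longleftrightarrow> M \<subseteq> edges G \<and> (\<forall>v\<in>verts G. \<exists>!e. e \<in> M \<and> v \<in> e)"

definition Perf :: "'v sgraph \<Rightarrow> 'v set set \<Rightarrow> 'v set set set" where
  "Perf G M = {M'. perfect_matching G M' \<and> finite ((M - M') \<union> (M' - M))}"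

text \<open>The fixed matching of a matching covered graph is carried along as an explicit
  parameter \<open>M\<close> of every notion that refers to it.\<close>

definition matching_covered :: "'v sgraph \<Rightarrow> 'v set set \<Rightarrow> bool" where
  "matching_covered G M \<longleftrightarrow> simple_graph G \<and> perfect_matching G M \<and> connected_graph G \<and>
     (\<forall>e\<in>edges G. \<exists>M'\<in>Perf G M. e \<in> M')"

section \<open>Tight sets and tight cuts\<close>

definition tight :: "'v sgraph \<Rightarrow> 'v set set \<Rightarrow> 'v set \<Rightarrow> bool" where
  "tight G M X \<longleftrightarrow> X \<subseteq> verts G \<and> (\<forall>M'\<in>Perf G M. \<exists>!e. e \<in> M' \<and> e \<in> boundary G X)"

definition tight_cut :: "'v sgraph \<Rightarrow> 'v set set \<Rightarrow> 'v set set \<Rightarrow> bool" where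
  "tight_cut G M C \<longleftrightarrow> (\<exists>X. tight G M X \<and> C = boundary G X)"

definition trivial_set :: "'v sgraph \<Rightarrow> 'v set \<Rightarrow> bool" where
  "trivial_set G X \<longleftrightarrow> card X = 1 \<or> card (verts G - X) = 1"

definition BoB :: "'v sgraph \<Rightarrow> 'v set set \<Rightarrow> bool" where
  "BoB G M \<longleftrightarrow> matching_covered G M \<and> (\<forall>X. tight G M X \<longrightarrow> trivial_set G X)"

definition nested :: "'v sgraph \<Rightarrow> 'v set set \<Rightarrow> 'v set set \<Rightarrow> bool" where
  "nested G C1 C2 \<longleftrightarrow> (\<exists>X1 X2. X1 \<subseteq> verts G \<and> X2 \<subseteq> verts G \<and> X1 \<inter> X2 = {} \<and>
     C1 = boundary G X1 \<and> C2 = boundary G X2)"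

definition nested_tight_cuts :: "'v sgraph \<Rightarrow> 'v set set \<Rightarrow> 'v set set set \<Rightarrow> bool" where
  "nested_tight_cuts G M \<C> \<longleftrightarrow> (\<forall>C\<in>\<C>. tight_cut G M C) \<and> (\<forall>C1\<in>\<C>. \<forall>C2\<in>\<C>. nested G C1 C2)"

definition maximal_nested_tight_cuts :: "'v sgraph \<Rightarrow> 'v set set \<Rightarrow> 'v set set set \<Rightarrow> bool" where
  "maximal_nested_tight_cuts G M \<C> \<longleftrightarrow> nested_tight_cuts G M \<C> \<and>
     (\<forall>\<D>. nested_tight_cuts G M \<D> \<and> \<C> \<subseteq> \<D> \<longrightarrow> \<D> = \<C>)"

section \<open>Collapses and torsos\<close>

definition tight_set_partition :: "'v sgraph \<Rightarrow> 'v set set \<Rightarrow> 'v set set \<Rightarrow> bool" where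
  "tight_set_partition G M \<P> \<longleftrightarrow> partition_on (verts G) \<P> \<and> (\<forall>P\<in>\<P>. tight G M P)"

definition quotient_edges :: "'v set set \<Rightarrow> 'v set set \<Rightarrow> 'v set set set" where
  "quotient_edges E \<P> = {{P, Q} | P Q. P \<in> \<P> \<and> Q \<in> \<P> \<and> P \<noteq> Q \<and> edge_between E P Q}"

definition collapse :: "'v sgraph \<Rightarrow> 'v set set \<Rightarrow> 'v set sgraph" where
  "collapse G \<P> = \<lparr>verts = \<P>, edges = quotient_edges (edges G) \<P>\<rparr>"

definition collapse_matching :: "'v set set \<Rightarrow> 'v set set \<Rightarrow> 'v set set set" where
  "collapse_matching M \<P> = quotient_edges M \<P>"

definition maximal_star ::
  "'v sgraph \<Rightarrow> 'v set set \<Rightarrow> 'v set set set \<Rightarrow> 'v set set \<Rightarrow> bool" where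
  "maximal_star G M \<C> \<P> \<longleftrightarrow> tight_set_partition G M \<P> \<and> (infinite \<P> \<or> 4 \<le> card \<P>) \<and>
     BoB (collapse G \<P>) (collapse_matching M \<P>) \<and> (\<forall>P\<in>\<P>. boundary G P \<in> \<C>)"

definition torso :: "'v sgraph \<Rightarrow> 'v set set \<Rightarrow> 'v set sgraph \<Rightarrow> bool" where
  "torso G M S \<longleftrightarrow> (\<exists>\<C> \<P>. maximal_nested_tight_cuts G M \<C> \<and> maximal_star G M \<C> \<P> \<and>
     S = collapse G \<P>)"

section \<open>Torsoids\<close>

definition passable :: "'v sgraph \<Rightarrow> 'v set set \<Rightarrow> 'v set \<Rightarrow> 'v set \<Rightarrow> bool" where
  "passable G M S P \<longleftrightarrow> S \<subseteq> verts G \<and> tight G M (P - S) \<and> tight G M (P \<union> S)"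

text \<open>For an infinite graph, the tight sets can depend on which matching has been fixed, so
  the BoB condition needs a fixed matching of the graph \<open>H\<close>. As for collapses, it is the
  one induced by the matching \<open>M\<close> of \<open>G\<close>. An edge \<open>vw\<close> of \<open>H\<close> stands for the edges of \<open>G\<close>
  between \<open>v \<union> \<epsilon>(vw)\<close> and \<open>w\<close>, and it belongs to the induced matching if
  one of them is in \<open>M\<close>. If all sets \<open>\<epsilon>(vw)\<close> are empty, then \<open>H\<close> is a collapse of \<open>G\<close> and this
  is \<^const>\<open>collapse_matching\<close>.\<close>

definition torsoid_matching ::
  "'v set set \<Rightarrow> 'v set sgraph \<Rightarrow> ('v set set \<Rightarrow> 'v set) \<Rightarrow> 'v set set set" where
  "torsoid_matching M H \<epsilon> =
     {{v, w} | v w. {v, w} \<in> edges H \<and> edge_between M (v \<union> \<epsilon> {v, w}) w}"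

text \<open>The function \<open>\<epsilon>\<close> is an element of \<^const>\<open>PiE\<close>, so that it is determined by its values on
  the edges of \<open>H\<close>, and equality of torsoids is equality of pairs.\<close>

definition torsoid ::
  "'v sgraph \<Rightarrow> 'v set set \<Rightarrow> 'v set sgraph \<times> ('v set set \<Rightarrow> 'v set) \<Rightarrow> bool" where
  "torsoid G M T \<longleftrightarrow> (case T of (H, \<epsilon>) \<Rightarrow>
     matching_covered H (torsoid_matching M H \<epsilon>) \<and>
     (infinite (verts H) \<or> 4 \<le> card (verts H)) \<and>
     (BoB H (torsoid_matching M H \<epsilon>) \<or> is_cycle H) \<and>
     (\<forall>v\<in>verts H. tight G M v) \<and>
     \<epsilon> \<in> edges H \<rightarrow>\<^sub>E Pow (verts G) \<and>
     disjoint (verts H) \<and>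
     disjoint_family_on \<epsilon> (edges H) \<and>
     (\<forall>v\<in>verts H. \<forall>e\<in>edges H. v \<inter> \<epsilon> e = {}) \<and>
     \<Union>(verts H) \<union> \<Union>(\<epsilon> ` edges H) = verts G \<and>
     (\<forall>v w. {v, w} \<in> edges H \<longrightarrow>
        edge_between (edges G) (v \<union> \<epsilon> {v, w}) w \<and>
        passable G M (\<epsilon> {v, w}) v \<and> passable G M (\<epsilon> {v, w}) w \<and>
        (\<forall>S. S \<subseteq> v \<union> \<epsilon> {v, w} \<union> w \<and> passable G M S v \<and> passable G M S w \<longrightarrow>
             S \<subseteq> \<epsilon> {v, w})) \<and>
     (\<forall>v\<in>verts H. \<forall>w\<in>verts H. v \<noteq> w \<and> {v, w} \<notin> edges H \<longrightarrow>
        \<not> edge_between (edges G) v w) \<and>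
     (is_cycle H \<longrightarrow> (\<forall>u v w. {u, v} \<in> edges H \<and> {v, w} \<in> edges H \<and> u \<noteq> w \<longrightarrow>
        \<not> (\<exists>P1 P2 P3. tight G M P1 \<and> tight G M P2 \<and> tight G M P3 \<and>
             P1 \<inter> P2 = {} \<and> P1 \<inter> P3 = {} \<and> P2 \<inter> P3 = {} \<and>
             P1 \<union> P2 \<union> P3 = \<epsilon> {u, v} \<union> v \<union> \<epsilon> {v, w} \<and>
             tight G M (u \<union> P1 \<union> P2) \<and> tight G M (P2 \<union> P3 \<union> w)))))"

definition cleaves ::
  "'v set sgraph \<Rightarrow> 'v set sgraph \<times> ('v set set \<Rightarrow> 'v set) \<Rightarrow> bool" where
  "cleaves S T \<longleftrightarrow> (\<forall>X\<in>verts S. \<exists>Y\<in>verts (fst T). Y \<subseteq> X)"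

end

theory Submission
  imports Defs
begin

text \<open>
  Write \<open>\<P>\<close> for the tight set partition whose collapse is the torso. The finite modifications of the
  fixed matching are handled as involutions \<open>m\<close> that send a vertex to its mate. A set \<open>X\<close> is tight iff every
  such \<open>m\<close> leaves \<open>X\<close> at exactly one point. For any \<open>X\<close> with a finite cut in the matching, the parity of the
  number of points at which \<open>m\<close> leaves \<open>X\<close> does not depend on \<open>m\<close>. This parity replaces the parity of
  \<open>card X\<close>, which has no meaning in an infinite graph. With it the usual uncrossing of tight cuts works: if
  \<open>X \<inter> Y\<close> is odd then \<open>X \<inter> Y\<close> and \<open>X \<union> Y\<close> are tight, otherwise \<open>X - Y\<close> and \<open>Y - X\<close> are. Torsoids
  and collapses of tight set partitions are both frames (\<open>frame\<close>): every matching of \<open>G\<close> induces one of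
  the frame, every matching of the frame arises in this way (\<open>lift\<close>), and so a frame is matching covered.

  Existence. For adjacent classes \<open>P\<close> and \<open>Q\<close> there is a largest set that is passable for both, their
  gap. If the gaps at every class are disjoint, cutting them off leaves a tight set of each class; these sets
  are the vertices, and the gaps are the values of \<open>\<epsilon>\<close>, of a frame that is isomorphic to the collapse
  (\<open>trimmed_graph_torsoid\<close>). When the collapse is a brick or brace but not a cycle, each class has three
  neighbours, and a matching that pairs \<open>P\<close> with a third class separates the gap to \<open>Q\<close> from the gap to
  \<open>Q'\<close> (\<open>brick_torsoid\<close>). When the collapse is a cycle, two gaps may overlap, or
  the last condition on torsoids may fail, which forbids certain three-part splittings along a cycle. In
  both situations a class splits into three tight sets that can replace it on the cycle, which gives a
  longer cyclic tight set partition (\<open>refine_cycle\<close>). Two matchings that disagree on the cycle differ at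
  some vertex of every class of any cyclic refinement. As they differ at finitely many vertices, a longest
  cyclic refinement exists. It has the required torsoid (\<open>cyclic_torsoid\<close>).

  Uniqueness. The vertices of a torsoid determine its edges and its map \<open>\<epsilon>\<close>
  (\<open>torsoid_determined_by_vertices\<close>), so they only have to be recovered from \<open>\<P>\<close>. Call a tight subset \<open>X\<close>
  of a class \<open>P\<close> a core if \<open>P - X\<close> falls into pieces without edges between them such that each piece
  sends edges only to \<open>X\<close> and to one other class. Every vertex of a torsoid cleaved by \<open>\<P>\<close> is a core, and
  every core contains a vertex. As vertices are disjoint, they are the inclusion-minimal cores
  (\<open>torsoid_vertices\<close>). For a brick or brace this comes from the parities of tight sets on vertices and
  on sets \<open>\<epsilon> e\<close> (\<open>brick_or_brace_pattern\<close>). For a cycle it comes from counting the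
  edges at which classes change, and from the condition on three-part splittings.
\<close>

section \<open>Perfect matchings as involutions\<close>

text \<open>Working with mate functions instead of edge sets makes statements such as
  \<open>m\<close> leaves \<open>X\<close> at \<open>x\<close> equational. Values outside
  \<open>verts G\<close> are arbitrary. The finiteness condition only bounds the edges outside
  \<open>M\<close>; for a perfect matching this bounds the symmetric difference, see
  \<open>mates_Perf\<close>.\<close>

definition mates :: "'v sgraph \<Rightarrow> 'v set set \<Rightarrow> ('v \<Rightarrow> 'v) set" where
  "mates G M = {m. (\<forall>x\<in>verts G. {x, m x} \<in> edges G \<and> m (m x) = x) \<and>
     finite {x \<in> verts G. {x, m x} \<notin> M}}"

definition exits :: "('v \<Rightarrow> 'v) \<Rightarrow> 'v set \<Rightarrow> 'v set" where
  "exits m X = {x \<in> X. m x \<notin> X}"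

definition closed_under :: "('v \<Rightarrow> 'v) \<Rightarrow> 'v set \<Rightarrow> bool" where
  "closed_under m C \<longleftrightarrow> (\<forall>x\<in>C. m x \<in> C)"

text \<open>Meaningful for tight \<open>X\<close>, which every \<open>m\<close> leaves at exactly
  one point.\<close>

definition exit_point :: "('v \<Rightarrow> 'v) \<Rightarrow> 'v set \<Rightarrow> 'v" where
  "exit_point m X = (THE x. x \<in> X \<and> m x \<notin> X)"

lemma simple_edge:
  assumes "simple_graph G" "{x, y} \<in> edges G"
  shows "x \<in> verts G" "y \<in> verts G" "x \<noteq> y"
proof -
  have *: "{x, y} \<subseteq> verts G \<and> card {x, y} = 2"
    using assms unfolding simple_graph_def by blast
  then show "x \<in> verts G" "y \<in> verts G" by auto
  show "x \<noteq> y"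
  proof
    assume "x = y"
    then show False using * by simp
  qed
qed

lemma simple_edgeE:
  assumes "simple_graph G" "e \<in> edges G"
  obtains x y where "e = {x, y}" "x \<in> verts G" "y \<in> verts G" "x \<noteq> y"
proof -
  have "e \<subseteq> verts G" "card e = 2" using assms unfolding simple_graph_def by auto
  then obtain x y where "e = {x, y}" "x \<noteq> y" by (meson card_2_iff)
  then show ?thesis using that \<open>e \<subseteq> verts G\<close> by auto
qed

lemma perfect_matching_mate:
  assumes "simple_graph G" "perfect_matching G N"
  shows "\<exists>m. (\<forall>x\<in>verts G. {x, m x} \<in> N) \<and> (\<forall>x\<in>verts G. m (m x) = x) \<and>
    (\<forall>x y. {x, y} \<in> N \<longrightarrow> m x = y)"
proof -
  have NE: "N \<subseteq> edges G" and ex1: "\<And>v. v \<in> verts G \<Longrightarrow> \<exists>!e. e \<in> N \<and> v \<in> e"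
    using assms unfolding perfect_matching_def by auto
  define m where "m x = (THE y. {x, y} \<in> N)" for x
  have uniq: "y = z" if "{x, y} \<in> N" "{x, z} \<in> N" for x y z
  proof -
    have "x \<in> verts G" using simple_edge[OF assms(1)] NE that by blast
    then have "{x, y} = {x, z}" using ex1 that by blast
    then show ?thesis by (metis doubleton_eq_iff)
  qed
  have eq: "m x = y" if "{x, y} \<in> N" for x y
    unfolding m_def using that uniq by blast
  have ex: "\<exists>y. {x, y} \<in> N" if "x \<in> verts G" for x
  proof -
    obtain e where e: "e \<in> N" "x \<in> e" using ex1[OF \<open>x \<in> verts G\<close>] by blast
    then have "e \<in> edges G" using NE by auto
    then obtain a b where "e = {a, b}" by (rule simple_edgeE[OF assms(1)])
    then show ?thesis using e by (metis insert_commute insertE singletonD)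
  qed
  have "{x, m x} \<in> N" if "x \<in> verts G" for x
    using ex[OF that] eq by blast
  moreover from this have "m (m x) = x" if "x \<in> verts G" for x
    using that eq by (metis insert_commute)
  ultimately show ?thesis using eq by blast
qed

lemma odd_le_2: "k \<le> 2 \<Longrightarrow> odd k \<Longrightarrow> k = (1::nat)"
  by presburger

text \<open>Isolates the arithmetic from the set reasoning in
  \<open>odd_cut_Un_disjoint\<close>.\<close>

lemma parity_aux: "even i \<Longrightarrow> u = e + i \<Longrightarrow> u = a + b \<Longrightarrow> odd (e::nat) \<longleftrightarrow> (odd a \<noteq> odd b)"
  by presburger

lemma even_card_involution:
  assumes "finite A" "\<And>x. x \<in> A \<Longrightarrow> f x \<in> A" "\<And>x. x \<in> A \<Longrightarrow> f (f x) = x" "\<And>x. x \<in> A \<Longrightarrow> f x \<noteq> x"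
  shows "even (card A)"
  using assms
proof (induction "card A" arbitrary: A rule: less_induct)
  case less
  show ?case
  proof (cases "A = {}")
    case False
    then obtain a where a: "a \<in> A" by blast
    let ?B = "A - {a, f a}"
    have fa: "f a \<in> A" "f a \<noteq> a" using less.prems a by auto
    have cB: "card A = card ?B + 2"
    proof -
      have "card {a, f a} = 2" using fa by simp
      moreover have "card ?B = card A - card {a, f a}"
        using fa a by (intro card_Diff_subset) auto
      moreover have "card {a, f a} \<le> card A" using fa a less.prems(1) by (intro card_mono) auto
      ultimately show ?thesis by linarith
    qed
    have "even (card ?B)"
    proof (rule less.hyps)
      show "card ?B < card A" using cB by simp
      show "finite ?B" using less.prems by simp
      show "f x \<in> ?B" if "x \<in> ?B" for x
        using that less.prems(2,3) a by (metis Diff_iff insert_iff singletonD)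
      show "f (f x) = x" "f x \<noteq> x" if "x \<in> ?B" for x using that less.prems by auto
    qed
    then show ?thesis using cB by simp
  qed simp
qed

text \<open>An edge of \<open>M\<close> that \<open>m\<close> does not use has both ends at
  vertices where \<open>m\<close> leaves \<open>M\<close>, so finitely many edges outside
  \<open>M\<close> force finitely many unused edges of \<open>M\<close>.\<close>

lemma mates_Perf:
  assumes "simple_graph G" "perfect_matching G M" "m \<in> mates G M"
  shows "(\<lambda>x. {x, m x}) ` verts G \<in> Perf G M"
proof -
  let ?V = "verts G"
  let ?N = "(\<lambda>x. {x, m x}) ` ?V"
  have mE: "\<And>x. x \<in> ?V \<Longrightarrow> {x, m x} \<in> edges G" and mm: "\<And>x. x \<in> ?V \<Longrightarrow> m (m x) = x"
    and fB: "finite {x \<in> ?V. {x, m x} \<notin> M}"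
    using assms(3) unfolding mates_def by auto
  have ME: "M \<subseteq> edges G" using assms(2) unfolding perfect_matching_def by auto
  obtain m0 where m0: "\<forall>x y. {x, y} \<in> M \<longrightarrow> m0 x = y"
    using perfect_matching_mate[OF assms(1,2)] by blast
  have "perfect_matching G ?N"
    unfolding perfect_matching_def
  proof (intro conjI ballI)
    show "?N \<subseteq> edges G" using mE by auto
    fix v assume v: "v \<in> ?V"
    show "\<exists>!e. e \<in> ?N \<and> v \<in> e"
    proof (rule ex1I[of _ "{v, m v}"])
      show "{v, m v} \<in> ?N \<and> v \<in> {v, m v}" using v by auto
      fix e assume "e \<in> ?N \<and> v \<in> e"
      then obtain x where "x \<in> ?V" "e = {x, m x}" "v = x \<or> v = m x" by auto
      then show "e = {v, m v}" using mm by auto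
    qed
  qed
  moreover have "finite ((M - ?N) \<union> (?N - M))"
  proof -
    let ?B = "{x \<in> ?V. {x, m x} \<notin> M}"
    have "?N - M \<subseteq> (\<lambda>x. {x, m x}) ` ?B" by auto
    moreover have "M - ?N \<subseteq> (\<lambda>x. {x, m0 x}) ` ?B"
    proof
      fix e assume e: "e \<in> M - ?N"
      then have "e \<in> edges G" using ME by auto
      then obtain x y where xy: "e = {x, y}" "x \<in> ?V" "y \<in> ?V" "x \<noteq> y"
        by (rule simple_edgeE[OF assms(1)])
      then have y: "y = m0 x" using m0 e by auto
      have "{x, m x} \<notin> M"
      proof
        assume "{x, m x} \<in> M"
        then have "m x = m0 x" using m0 by metis
        then show False using e xy y by auto
      qed
      then show "e \<in> (\<lambda>x. {x, m0 x}) ` ?B" using xy y by auto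
    qed
    ultimately show ?thesis using fB by (meson finite_UnI finite_imageI finite_subset)
  qed
  ultimately show ?thesis unfolding Perf_def by auto
qed

locale matching_covered_graph =
  fixes G :: "'v sgraph" and M :: "'v set set"
  assumes mc: "matching_covered G M"
begin

abbreviation "V \<equiv> verts G"
abbreviation "MM \<equiv> mates G M"
abbreviation "T X \<equiv> tight G M X"

lemma simple: "simple_graph G" and perfect: "perfect_matching G M" and conn: "connected_graph G"
  and covered: "\<And>e. e \<in> edges G \<Longrightarrow> \<exists>M'\<in>Perf G M. e \<in> M'"
  using mc unfolding matching_covered_def by auto

lemma edgeD: "{x, y} \<in> edges G \<Longrightarrow> x \<in> V" "{x, y} \<in> edges G \<Longrightarrow> y \<in> V" "{x, y} \<in> edges G \<Longrightarrow> x \<noteq> y"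
  using simple_edge[OF simple] by auto

lemma mateD:
  assumes "m \<in> MM" "x \<in> V"
  shows "{x, m x} \<in> edges G" "m (m x) = x" "m x \<in> V" "m x \<noteq> x"
proof -
  show 1: "{x, m x} \<in> edges G" and "m (m x) = x" using assms unfolding mates_def by auto
  show "m x \<in> V" "m x \<noteq> x" using edgeD[OF 1] by auto
qed

lemma mate_inj: "m \<in> MM \<Longrightarrow> x \<in> V \<Longrightarrow> y \<in> V \<Longrightarrow> m x = m y \<Longrightarrow> x = y"
  by (metis mateD(2))

lemma mate_of_Perf:
  assumes "N \<in> Perf G M"
  shows "\<exists>m\<in>MM. (\<forall>x\<in>V. {x, m x} \<in> N) \<and> (\<forall>x y. {x, y} \<in> N \<longrightarrow> m x = y)"
proof -
  have pN: "perfect_matching G N" and fin: "finite ((M - N) \<union> (N - M))"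
    using assms unfolding Perf_def by auto
  obtain m where m: "\<forall>x\<in>V. {x, m x} \<in> N" "\<forall>x\<in>V. m (m x) = x" "\<forall>x y. {x, y} \<in> N \<longrightarrow> m x = y"
    using perfect_matching_mate[OF simple pN] by (elim exE conjE) (rule that; assumption)
  have NE: "N \<subseteq> edges G" using pN unfolding perfect_matching_def by auto
  have "{x \<in> V. {x, m x} \<notin> M} \<subseteq> \<Union>(N - M)" using m by auto
  moreover have "finite (\<Union>(N - M))"
  proof (rule finite_Union)
    show "finite (N - M)" using fin by simp
    show "finite e" if "e \<in> N - M" for e
      using that NE simple unfolding simple_graph_def
      by (metis DiffD1 card.infinite subsetD zero_neq_numeral)
  qed
  ultimately have "finite {x \<in> V. {x, m x} \<notin> M}" by (rule finite_subset)
  moreover have "\<forall>x\<in>V. {x, m x} \<in> edges G \<and> m (m x) = x"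
    using m(1,2) NE by blast
  ultimately have "m \<in> MM" unfolding mates_def by blast
  then show ?thesis using m(1,3) by (intro bexI[of _ m] conjI)
qed

lemma M_Perf: "M \<in> Perf G M" unfolding Perf_def using perfect by auto

text \<open>The mate function of the fixed matching.\<close>

definition m0 where "m0 = (SOME m. m \<in> MM \<and> (\<forall>x\<in>V. {x, m x} \<in> M) \<and> (\<forall>x y. {x, y} \<in> M \<longrightarrow> m x = y))"

lemma m0: "m0 \<in> MM" "\<And>x. x \<in> V \<Longrightarrow> {x, m0 x} \<in> M" "\<And>x y. {x, y} \<in> M \<Longrightarrow> m0 x = y"
proof -
  have "\<exists>m. m \<in> MM \<and> (\<forall>x\<in>V. {x, m x} \<in> M) \<and> (\<forall>x y. {x, y} \<in> M \<longrightarrow> m x = y)"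
    using mate_of_Perf[OF M_Perf] unfolding Bex_def by simp
  from someI_ex[OF this] show "m0 \<in> MM" "\<And>x. x \<in> V \<Longrightarrow> {x, m0 x} \<in> M" "\<And>x y. {x, y} \<in> M \<Longrightarrow> m0 x = y"
    unfolding m0_def by auto
qed

lemma Perf_of_mate: "m \<in> MM \<Longrightarrow> (\<lambda>x. {x, m x}) ` V \<in> Perf G M"
  by (rule mates_Perf[OF simple perfect])

lemma edge_mate:
  assumes "{x, y} \<in> edges G"
  obtains m where "m \<in> MM" "m x = y" "m y = x"
proof -
  obtain N where N: "N \<in> Perf G M" "{x, y} \<in> N" using covered assms by blast
  obtain m where m: "m \<in> MM" "\<forall>x\<in>V. {x, m x} \<in> N" "\<forall>x y. {x, y} \<in> N \<longrightarrow> m x = y"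
    using mate_of_Perf[OF N(1)] by (elim bexE conjE) (rule that; assumption)
  have "m x = y" "m y = x" using m(3) N(2) by (auto simp: insert_commute)
  then show ?thesis using that m by blast
qed

lemma mate_boundary:
  assumes "m \<in> MM" "x \<in> V"
  shows "{x, m x} \<in> boundary G X \<longleftrightarrow> (x \<in> X) \<noteq> (m x \<in> X)"
proof -
  have 1: "{x, m x} \<in> edges G" "m x \<noteq> x" using mateD assms by auto
  have "{x, m x} \<inter> X = (if x \<in> X then {x} else {}) \<union> (if m x \<in> X then {m x} else {})" by auto
  then show ?thesis unfolding boundary_def using 1 by auto
qed

text \<open>Matching edges in the cut of \<open>X\<close> correspond to the points of
  \<open>X\<close> whose mate lies outside.\<close>

lemma tight_iff: "T X \<longleftrightarrow> X \<subseteq> V \<and> (\<forall>m\<in>MM. \<exists>!x. x \<in> X \<and> m x \<notin> X)"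
proof
  assume t: "T X"
  then have XV: "X \<subseteq> V" unfolding tight_def by auto
  moreover have "\<exists>!x. x \<in> X \<and> m x \<notin> X" if m: "m \<in> MM" for m
  proof -
    define N where "N = (\<lambda>x. {x, m x}) ` V"
    have "N \<in> Perf G M" unfolding N_def by (rule Perf_of_mate[OF m])
    then have "\<exists>!e. e \<in> N \<and> e \<in> boundary G X" using t unfolding tight_def by simp
    then obtain e where e0: "e \<in> N \<and> e \<in> boundary G X" "\<forall>e'. e' \<in> N \<and> e' \<in> boundary G X \<longrightarrow> e' = e"
      by (rule ex1E)
    from e0(1) have e: "e \<in> N" "e \<in> boundary G X" by blast+
    obtain z where z: "z \<in> V" "e = {z, m z}" using e(1) unfolding N_def by blast
    then have z2: "(z \<in> X) \<noteq> (m z \<in> X)" using e mate_boundary[OF m] by auto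
    have ex: "\<exists>x. x \<in> X \<and> m x \<notin> X" using z2 mateD(2)[OF m] z by metis
    moreover have "x = y" if "x \<in> X" "m x \<notin> X" "y \<in> X" "m y \<notin> X" for x y
    proof -
      have "{z, m z} = e" if "z \<in> X" "m z \<notin> X" for z
      proof -
        have "z \<in> V" using that XV by blast
        then have "{z, m z} \<in> N" "{z, m z} \<in> boundary G X"
          using mate_boundary[OF m, of z X] that unfolding N_def by auto
        then show ?thesis using e0(2) by blast
      qed
      then have "{x, m x} = e" "{y, m y} = e" using that by auto
      then show ?thesis using that by (metis insertE insertI1 singletonD)
    qed
    ultimately show ?thesis by blast
  qed
  ultimately show "X \<subseteq> V \<and> (\<forall>m\<in>MM. \<exists>!x. x \<in> X \<and> m x \<notin> X)" by blast
next
  assume R: "X \<subseteq> V \<and> (\<forall>m\<in>MM. \<exists>!x. x \<in> X \<and> m x \<notin> X)"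
  show "T X" unfolding tight_def
  proof (intro conjI ballI)
    show "X \<subseteq> V" using R by auto
    fix N assume N: "N \<in> Perf G M"
    obtain m where m: "m \<in> MM" "\<forall>x\<in>V. {x, m x} \<in> N" "\<forall>x y. {x, y} \<in> N \<longrightarrow> m x = y"
      using mate_of_Perf[OF N] by (elim bexE conjE) (rule that; assumption)
    have NE: "N \<subseteq> edges G" using N unfolding Perf_def perfect_matching_def by auto
    obtain x where x: "x \<in> X" "m x \<notin> X" "\<And>y. y \<in> X \<Longrightarrow> m y \<notin> X \<Longrightarrow> y = x" using R m(1) by blast
    show "\<exists>!e. e \<in> N \<and> e \<in> boundary G X"
    proof (rule ex1I[of _ "{x, m x}"])
      have "x \<in> V" using x(1) R by blast
      then show "{x, m x} \<in> N \<and> {x, m x} \<in> boundary G X"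
        using m(2) mate_boundary[OF m(1), of x X] x(1,2) by blast
      fix e assume e: "e \<in> N \<and> e \<in> boundary G X"
      then have "e \<in> edges G" using NE by auto
      then obtain a b where ab: "e = {a, b}" "a \<in> V" "b \<in> V" "a \<noteq> b"
        by (rule simple_edgeE[OF simple])
      then have mab: "m a = b" "m b = a" using m(3) e by (auto simp: insert_commute)
      then have "(a \<in> X) \<noteq> (b \<in> X)" using e ab mate_boundary[OF m(1), of a] by auto
      then show "e = {x, m x}" using x(3) ab mab by (metis insert_commute)
    qed
  qed
qed

lemma tightI: "X \<subseteq> V \<Longrightarrow> (\<And>m. m \<in> MM \<Longrightarrow> \<exists>x. exits m X = {x}) \<Longrightarrow> T X"
  unfolding tight_iff exits_def by (metis (mono_tags, lifting) mem_Collect_eq singletonD singletonI)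

lemma tight_sub: "T X \<Longrightarrow> X \<subseteq> V" unfolding tight_iff by auto

lemma exit_point:
  assumes "T X" "m \<in> MM"
  shows "exit_point m X \<in> X" "m (exit_point m X) \<notin> X"
    "\<And>x. x \<in> X \<Longrightarrow> m x \<notin> X \<Longrightarrow> exit_point m X = x" "exits m X = {exit_point m X}"
    "exit_point m X \<in> V" "m (exit_point m X) \<in> V" "m (m (exit_point m X)) = exit_point m X"
proof -
  have ex1: "\<exists>!x. x \<in> X \<and> m x \<notin> X" using assms tight_iff by auto
  show 1: "exit_point m X \<in> X" and 2: "m (exit_point m X) \<notin> X"
    using theI'[OF ex1] unfolding exit_point_def by auto
  show 3: "exit_point m X = x" if "x \<in> X" "m x \<notin> X" for x
    using the1_equality[OF ex1, of x] that unfolding exit_point_def by simp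
  show "exits m X = {exit_point m X}"
  proof
    show "exits m X \<subseteq> {exit_point m X}"
      unfolding exits_def using 3 by (metis (mono_tags, lifting) mem_Collect_eq singletonI subsetI)
    show "{exit_point m X} \<subseteq> exits m X" unfolding exits_def using 1 2 by blast
  qed
  show 4: "exit_point m X \<in> V" using 1 tight_sub assms by auto
  then show "m (exit_point m X) \<in> V" "m (m (exit_point m X)) = exit_point m X"
    using mateD assms by auto
qed

lemma exit_eq: "T X \<Longrightarrow> m \<in> MM \<Longrightarrow> x \<in> X \<Longrightarrow> m x \<notin> X \<Longrightarrow> exit_point m X = x"
  by (rule exit_point(3))

lemma tight_ne: "T X \<Longrightarrow> X \<noteq> {}" using exit_point(1)[OF _ m0(1)] by auto

lemma mates_differ_finite:
  assumes "m \<in> MM" "n \<in> MM"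
  shows "finite {x \<in> V. m x \<noteq> n x}"
proof -
  have "{x \<in> V. m x \<noteq> n x} \<subseteq> {x \<in> V. {x, m x} \<notin> M} \<union> {x \<in> V. {x, n x} \<notin> M}"
    using m0(3) by (auto) (metis)
  moreover have "finite {x \<in> V. {x, m x} \<notin> M}" "finite {x \<in> V. {x, n x} \<notin> M}"
    using assms unfolding mates_def by auto
  ultimately show ?thesis by (meson finite_UnI finite_subset)
qed

text \<open>Matchings can be chosen locally: \<open>\<mu> x\<close> is the matching used at
  \<open>x\<close>. It is enough that \<open>x\<close> and its mate agree on the choice, and that
  finitely many matchings are used.\<close>

lemma glue:
  assumes "\<And>x. x \<in> V \<Longrightarrow> \<mu> x \<in> MM" "\<And>x. x \<in> V \<Longrightarrow> \<mu> (\<mu> x x) = \<mu> x" "finite (\<mu> ` V)"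
  shows "(\<lambda>x. \<mu> x x) \<in> MM"
  unfolding mates_def
proof (intro CollectI conjI ballI)
  show "{x, \<mu> x x} \<in> edges G" if "x \<in> V" for x using mateD(1) assms(1) that by blast
  show "\<mu> (\<mu> x x) (\<mu> x x) = x" if "x \<in> V" for x
    using mateD(2)[OF assms(1)[OF that] that] assms(2)[OF that] by simp
  have "{x \<in> V. {x, \<mu> x x} \<notin> M} \<subseteq> (\<Union>n\<in>\<mu> ` V. {x \<in> V. {x, n x} \<notin> M})" by auto
  moreover have "finite (\<Union>n\<in>\<mu> ` V. {x \<in> V. {x, n x} \<notin> M})"
  proof (rule finite_UN_I[OF assms(3)])
    fix n assume "n \<in> \<mu> ` V"
    then have "n \<in> MM" using assms(1) by blast
    then show "finite {x \<in> V. {x, n x} \<notin> M}" unfolding mates_def by blast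
  qed
  ultimately show "finite {x \<in> V. {x, \<mu> x x} \<notin> M}" by (rule finite_subset)
qed

lemma cross_edge:
  assumes "X \<subseteq> V" "X \<noteq> {}" "X \<noteq> V"
  obtains x y where "x \<in> X" "y \<in> V" "y \<notin> X" "{x, y} \<in> edges G"
proof -
  obtain a b where ab: "a \<in> X" "b \<in> V" "b \<notin> X" using assms by blast
  then have "(a, b) \<in> {(x, y). {x, y} \<in> edges G}\<^sup>*"
    using conn assms unfolding connected_graph_def by blast
  then have "b \<notin> X \<longrightarrow> (\<exists>x\<in>X. \<exists>y. y \<notin> X \<and> {x, y} \<in> edges G)"
  proof (induction rule: rtrancl_induct)
    case base
    then show ?case using ab by simp
  next
    case (step y z)
    then show ?case by blast
  qed
  then show ?thesis using ab that edgeD by blast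
qed

lemma cross_mate:
  assumes "X \<subseteq> V" "X \<noteq> {}" "X \<noteq> V"
  obtains m x where "m \<in> MM" "x \<in> X" "m x \<in> V" "m x \<notin> X" "{x, m x} \<in> edges G"
proof -
  obtain x y where xy: "x \<in> X" "y \<in> V" "y \<notin> X" "{x, y} \<in> edges G" using cross_edge[OF assms] .
  obtain m where "m \<in> MM" "m x = y" using edge_mate[OF xy(4)] .
  then show ?thesis using that xy by blast
qed

text \<open>By connectedness and since every edge lies in some matching, only the whole vertex set
  is closed under all matchings. This is the source of most contradictions below.\<close>

lemma all_closed_V:
  assumes "X \<subseteq> V" "X \<noteq> {}" "\<And>m. m \<in> MM \<Longrightarrow> closed_under m X"
  shows "X = V"
  using cross_mate[OF assms(1,2)] assms(3) unfolding closed_under_def by metis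

lemma closedD: "closed_under m C \<Longrightarrow> x \<in> C \<Longrightarrow> m x \<in> C"
  unfolding closed_under_def by blast

lemma closed_Un: "closed_under m A \<Longrightarrow> closed_under m B \<Longrightarrow> closed_under m (A \<union> B)"
  unfolding closed_under_def by auto

section \<open>The parity of a cut\<close>

text \<open>The choice of \<open>m0\<close> is immaterial by \<open>odd_cut_iff\<close>. For
  finite graphs this is the parity of \<open>card Z\<close>.\<close>

definition odd_cut :: "'v set \<Rightarrow> bool" where
  "odd_cut Z \<longleftrightarrow> odd (card (exits m0 Z))"

text \<open>The sets for which parities add up: they form a Boolean algebra containing all tight
  sets.\<close>

definition fin_cut :: "'v set \<Rightarrow> bool" where
  "fin_cut Z \<longleftrightarrow> Z \<subseteq> V \<and> finite (exits m0 Z)"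

text \<open>Two matchings agree outside a finite set \<open>D\<close>. Within \<open>D\<close> the
  mate of a point that stays in \<open>Z\<close> is again in \<open>D\<close>, so the points of
  \<open>D\<close> that do not leave \<open>Z\<close> come in pairs.\<close>

lemma exits_differ:
  assumes "Z \<subseteq> V" "m \<in> MM" "n \<in> MM"
  defines "D \<equiv> {x \<in> Z. m x \<noteq> n x}"
  shows "exits m Z - D = exits n Z - D" "finite D"
    "finite (exits m Z \<inter> D)" "even (card (exits m Z \<inter> D)) \<longleftrightarrow> even (card D)"
proof -
  show "exits m Z - D = exits n Z - D" unfolding D_def exits_def by auto
  show fD: "finite D" using assms(1) unfolding D_def
    by (intro finite_subset[OF _ mates_differ_finite[OF assms(2,3)]]) blast
  then show "finite (exits m Z \<inter> D)" by auto
  let ?I = "{x \<in> D. m x \<in> Z}"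
  have inv: "m x \<in> ?I" "m (m x) = x" "m x \<noteq> x" if "x \<in> ?I" for x
  proof -
    have x: "x \<in> V" "x \<in> Z" "m x \<in> Z" "m x \<noteq> n x" using that assms(1) unfolding D_def by blast+
    show "m (m x) = x" "m x \<noteq> x" using mateD[OF assms(2)] x by auto
    have "n (m x) \<noteq> x" using x(3,4) mateD(2)[OF assms(3), of "m x"] assms(1) by (metis subsetD)
    then have "m (m x) \<noteq> n (m x)" "m (m x) \<in> Z" using \<open>m (m x) = x\<close> x(2) by simp_all
    then show "m x \<in> ?I" unfolding D_def using x(3) by blast
  qed
  have "even (card ?I)"
    by (rule even_card_involution[of _ m, OF finite_subset[OF _ fD] inv]) auto
  moreover have "D = ?I \<union> (exits m Z \<inter> D)" "?I \<inter> (exits m Z \<inter> D) = {}"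
    unfolding exits_def D_def by auto
  then have "card D = card ?I + card (exits m Z \<inter> D)"
    using fD by (metis (no_types, lifting) card_Un_disjoint finite_Un)
  ultimately show "even (card (exits m Z \<inter> D)) \<longleftrightarrow> even (card D)" by simp
qed

lemma exits_parity:
  assumes "Z \<subseteq> V" "m \<in> MM" "n \<in> MM"
  shows "finite (exits m Z) \<longleftrightarrow> finite (exits n Z)"
    "odd (card (exits m Z)) \<longleftrightarrow> odd (card (exits n Z))"
proof -
  define D where "D = {x \<in> Z. m x \<noteq> n x}"
  have D': "D = {x \<in> Z. n x \<noteq> m x}" unfolding D_def by auto
  note a = exits_differ[OF assms, folded D_def]
  note b = exits_differ[OF assms(1,3,2), folded D']
  have "finite (exits m Z) \<longleftrightarrow> finite (exits m Z - D)" "finite (exits n Z) \<longleftrightarrow> finite (exits n Z - D)"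
    using a(2) by auto
  then show fin: "finite (exits m Z) \<longleftrightarrow> finite (exits n Z)" using a(1) by simp
  show "odd (card (exits m Z)) \<longleftrightarrow> odd (card (exits n Z))"
  proof (cases "finite (exits m Z)")
    case True
    then have "finite (exits n Z)" using fin by simp
    have "card (exits m Z) = card (exits m Z - D) + card (exits m Z \<inter> D)"
      "card (exits n Z) = card (exits n Z - D) + card (exits n Z \<inter> D)"
      using card_Int_Diff[OF True, of D] card_Int_Diff[OF \<open>finite (exits n Z)\<close>, of D] by linarith+
    then show ?thesis using a(1,4) b(4) by simp
  next
    case False
    then show ?thesis using fin by simp
  qed
qed

lemma odd_cut_iff: "Z \<subseteq> V \<Longrightarrow> m \<in> MM \<Longrightarrow> odd_cut Z \<longleftrightarrow> odd (card (exits m Z))"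
  unfolding odd_cut_def using exits_parity m0(1) by blast

lemma fin_cut_sub: "fin_cut Z \<Longrightarrow> Z \<subseteq> V" unfolding fin_cut_def by auto

lemma fin_cutI: "Z \<subseteq> V \<Longrightarrow> m \<in> MM \<Longrightarrow> finite (exits m Z) \<Longrightarrow> fin_cut Z"
  unfolding fin_cut_def using exits_parity m0(1) by blast

lemma fin_cut_Un [intro]: "fin_cut A \<Longrightarrow> fin_cut B \<Longrightarrow> fin_cut (A \<union> B)"
proof -
  assume a: "fin_cut A" "fin_cut B"
  have "exits m0 (A \<union> B) \<subseteq> exits m0 A \<union> exits m0 B" unfolding exits_def by auto
  then show ?thesis using a unfolding fin_cut_def by (auto intro: finite_subset)
qed

lemma exits_compl:
  assumes "A \<subseteq> V" "m \<in> MM" shows "exits m (V - A) = m ` exits m A"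
proof
  show "m ` exits m A \<subseteq> exits m (V - A)"
    using assms mateD(2,3)[OF assms(2)] unfolding exits_def by fastforce
  show "exits m (V - A) \<subseteq> m ` exits m A"
  proof
    fix x assume "x \<in> exits m (V - A)"
    then have "x \<in> V" "x \<notin> A" "m x \<in> A" using mateD(3)[OF assms(2)] unfolding exits_def by auto
    then have "m x \<in> exits m A" "x = m (m x)" using mateD(2)[OF assms(2)] unfolding exits_def by auto
    then show "x \<in> m ` exits m A" by blast
  qed
qed

lemma fin_cut_compl [intro]: "fin_cut A \<Longrightarrow> fin_cut (V - A)"
  unfolding fin_cut_def using exits_compl m0(1) by auto

lemma fin_cut_Diff [intro]: "fin_cut A \<Longrightarrow> fin_cut B \<Longrightarrow> fin_cut (A - B)"
proof -
  assume a: "fin_cut A" "fin_cut B"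
  then have "fin_cut (V - ((V - A) \<union> B))" by blast
  moreover have "V - ((V - A) \<union> B) = A - B" using fin_cut_sub[OF a(1)] by auto
  ultimately show ?thesis by simp
qed

lemma fin_cut_Int [intro]: "fin_cut A \<Longrightarrow> fin_cut B \<Longrightarrow> fin_cut (A \<inter> B)"
proof -
  assume a: "fin_cut A" "fin_cut B"
  then have "fin_cut (A - (A - B))" by blast
  moreover have "A - (A - B) = A \<inter> B" by auto
  ultimately show ?thesis by simp
qed

lemma fin_cut_tight [intro]: "T X \<Longrightarrow> fin_cut X"
  using exit_point(4)[OF _ m0(1)] tight_sub unfolding fin_cut_def by auto

lemma odd_cut_tight: "T X \<Longrightarrow> odd_cut X"
  using exit_point(4)[OF _ m0(1)] unfolding odd_cut_def by auto

lemma tight_compl: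
  assumes "T X" shows "T (V - X)"
proof (rule tightI)
  fix m assume "m \<in> MM"
  then show "\<exists>x. exits m (V - X) = {x}"
    using exits_compl[OF tight_sub[OF assms]] exit_point(4)[OF assms] by auto
qed auto

text \<open>Points of \<open>A \<union> B\<close> that leave one of the two sets but not the union
  are matched between \<open>A\<close> and \<open>B\<close>, hence even in number.\<close>

lemma odd_cut_Un_disjoint:
  assumes "fin_cut A" "fin_cut B" "A \<inter> B = {}"
  shows "odd_cut (A \<union> B) \<longleftrightarrow> odd_cut A \<noteq> odd_cut B"
proof -
  let ?m = m0
  let ?I = "{x \<in> A. ?m x \<in> B} \<union> {x \<in> B. ?m x \<in> A}"
  have AV: "A \<subseteq> V" "B \<subseteq> V" using assms fin_cut_sub by auto
  have fin: "finite (exits ?m A)" "finite (exits ?m B)" using assms unfolding fin_cut_def by auto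
  have sub: "?I \<subseteq> exits ?m A \<union> exits ?m B" using assms(3) unfolding exits_def by auto
  then have fI: "finite ?I" using fin by (meson finite_UnI finite_subset)
  have "even (card ?I)"
  proof (rule even_card_involution[of _ ?m])
    show "finite ?I" using fI .
    show "m0 x \<in> ?I" "m0 (m0 x) = x" "m0 x \<noteq> x" if "x \<in> ?I" for x
      using that mateD(2,4)[OF m0(1), of x] AV by auto
  qed
  moreover have eqs: "exits ?m A \<union> exits ?m B = exits ?m (A \<union> B) \<union> ?I" "exits ?m (A \<union> B) \<inter> ?I = {}"
    using assms(3) unfolding exits_def by auto
  have "finite (exits ?m (A \<union> B))"
    by (rule finite_subset[of _ "exits ?m A \<union> exits ?m B"]) (use fin in \<open>auto simp: exits_def\<close>)
  then have "card (exits ?m A \<union> exits ?m B) = card (exits ?m (A \<union> B)) + card ?I"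
    unfolding eqs(1) by (rule card_Un_disjoint[OF _ fI eqs(2)])
  moreover have "card (exits ?m A \<union> exits ?m B) = card (exits ?m A) + card (exits ?m B)"
    using assms(3) unfolding exits_def by (intro card_Un_disjoint fin[unfolded exits_def]) blast
  ultimately show ?thesis unfolding odd_cut_def by (rule parity_aux)
qed

lemma odd_cut_split:
  assumes "fin_cut A" "fin_cut B" shows "odd_cut A \<longleftrightarrow> odd_cut (A \<inter> B) \<noteq> odd_cut (A - B)"
proof -
  have "odd_cut ((A \<inter> B) \<union> (A - B)) \<longleftrightarrow> odd_cut (A \<inter> B) \<noteq> odd_cut (A - B)"
    using assms by (intro odd_cut_Un_disjoint) auto
  moreover have "(A \<inter> B) \<union> (A - B) = A" by auto
  ultimately show ?thesis by simp
qed

lemma odd_cut_empty [simp]: "\<not> odd_cut {}" unfolding odd_cut_def exits_def by simp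

lemma odd_cut_V [simp]: "\<not> odd_cut V"
proof -
  have "exits m0 V = {}" unfolding exits_def using mateD(3)[OF m0(1)] by blast
  then show ?thesis unfolding odd_cut_def by simp
qed

lemma odd_cut_Diff_sub: "fin_cut A \<Longrightarrow> fin_cut B \<Longrightarrow> B \<subseteq> A \<Longrightarrow> odd_cut (A - B) \<longleftrightarrow> odd_cut A \<noteq> odd_cut B"
  using odd_cut_split[of A B] by (metis Int_absorb1)

lemma odd_cut_compl: "fin_cut A \<Longrightarrow> odd_cut (V - A) \<longleftrightarrow> odd_cut A"
proof -
  assume a: "fin_cut A"
  have "odd_cut (A \<union> (V - A)) \<longleftrightarrow> odd_cut A \<noteq> odd_cut (V - A)" using a by (intro odd_cut_Un_disjoint) auto
  moreover have "A \<union> (V - A) = V" using fin_cut_sub[OF a] by auto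
  ultimately show ?thesis by simp
qed

lemma closed_exits: "closed_under m C \<longleftrightarrow> exits m C = {}"
  unfolding closed_under_def exits_def by auto

text \<open>The workhorse of the parity arguments: the parity of \<open>X \<inter> C\<close> tells
  whether the exit of a tight set lies in the closed set \<open>C\<close>.\<close>

lemma exit_in_closed:
  assumes "T X" "m \<in> MM" "closed_under m C" "C \<subseteq> V"
  shows "odd_cut (X \<inter> C) \<longleftrightarrow> exit_point m X \<in> C"
proof -
  have "exits m (X \<inter> C) = exits m X \<inter> C"
    using assms(3) unfolding exits_def closed_under_def by auto
  then have "exits m (X \<inter> C) = (if exit_point m X \<in> C then {exit_point m X} else {})"
    using exit_point(4)[OF assms(1,2)] by auto
  moreover have "odd_cut (X \<inter> C) \<longleftrightarrow> odd (card (exits m (X \<inter> C)))"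
    using odd_cut_iff[of "X \<inter> C" m] assms by auto
  ultimately show ?thesis by simp
qed

section \<open>Uncrossing tight sets\<close>

text \<open>A point leaving \<open>X \<inter> Y\<close> leaves \<open>X\<close> or
  \<open>Y\<close>, so there are at most two of them, and an odd number.\<close>

lemma tight_Int_odd:
  assumes "T X" "T Y" "odd_cut (X \<inter> Y)"
  shows "T (X \<inter> Y)"
proof (rule tightI)
  show "X \<inter> Y \<subseteq> V" using tight_sub assms by auto
  fix m assume m: "m \<in> MM"
  have sub: "exits m (X \<inter> Y) \<subseteq> {exit_point m X, exit_point m Y}"
  proof
    fix x assume "x \<in> exits m (X \<inter> Y)"
    then have x: "x \<in> X" "x \<in> Y" "m x \<notin> X \<or> m x \<notin> Y" unfolding exits_def by auto
    then show "x \<in> {exit_point m X, exit_point m Y}"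
      using exit_eq[OF assms(1) m x(1)] exit_eq[OF assms(2) m x(2)] by blast
  qed
  have odd: "odd (card (exits m (X \<inter> Y)))" using odd_cut_iff[OF \<open>X \<inter> Y \<subseteq> V\<close> m] assms(3) by auto
  have "card (exits m (X \<inter> Y)) \<le> 2"
    by (rule order_trans[OF card_mono[OF _ sub]]) (auto simp: card_insert_if)
  then have "card (exits m (X \<inter> Y)) = 1" using odd by (rule odd_le_2)
  then show "\<exists>x. exits m (X \<inter> Y) = {x}" by (meson card_1_singletonE)
qed

lemma uncross_odd:
  assumes "T X" "T Y" "odd_cut (X \<inter> Y)"
  shows "T (X \<inter> Y)" "T (X \<union> Y)" "\<And>x y. x \<in> X - Y \<Longrightarrow> y \<in> Y - X \<Longrightarrow> {x, y} \<notin> edges G"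
proof -
  show I: "T (X \<inter> Y)" by (rule tight_Int_odd[OF assms])
  have XV: "X \<subseteq> V" "Y \<subseteq> V" using tight_sub assms by auto
  have "odd_cut (X \<union> Y)"
  proof -
    have fin_cut: "fin_cut X" "fin_cut Y" using assms by auto
    have "odd_cut (X \<union> (Y - X)) \<longleftrightarrow> odd_cut X \<noteq> odd_cut (Y - X)" using fin_cut by (intro odd_cut_Un_disjoint) auto
    moreover have "odd_cut Y \<longleftrightarrow> odd_cut (Y \<inter> X) \<noteq> odd_cut (Y - X)" using odd_cut_split fin_cut by auto
    ultimately show ?thesis using odd_cut_tight assms by (simp add: Int_commute)
  qed
  moreover have eq: "(V - X) \<inter> (V - Y) = V - (X \<union> Y)" by auto
  ultimately have "odd_cut ((V - X) \<inter> (V - Y))" using odd_cut_compl[of "X \<union> Y"] assms by auto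
  then have "T (V - (X \<union> Y))" using tight_Int_odd[OF tight_compl tight_compl] assms eq by metis
  then have "T (V - (V - (X \<union> Y)))" by (rule tight_compl)
  moreover have "V - (V - (X \<union> Y)) = X \<union> Y" using XV by auto
  ultimately show "T (X \<union> Y)" by simp
  fix x y assume xy: "x \<in> X - Y" "y \<in> Y - X"
  show "{x, y} \<notin> edges G"
  proof
    assume "{x, y} \<in> edges G"
    then obtain m where m: "m \<in> MM" "m x = y" "m y = x" by (rule edge_mate)
    let ?z = "exit_point m (X \<inter> Y)"
    have eX: "exit_point m X = x" by (rule exit_eq[OF assms(1) m(1)]) (use xy m(2) in auto)
    have eY: "exit_point m Y = y" by (rule exit_eq[OF assms(2) m(1)]) (use xy m(3) in auto)
    have z: "?z \<in> X" "?z \<in> Y" "m ?z \<notin> X \<or> m ?z \<notin> Y"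
      using exit_point(1,2)[OF I m(1)] by auto
    then have "?z = x \<or> ?z = y"
      using exit_eq[OF assms(1) m(1) z(1)] exit_eq[OF assms(2) m(1) z(2)] eX eY by metis
    then show False using z(1,2) xy by auto
  qed
qed

text \<open>This is \<open>uncross_odd\<close> for \<open>X\<close> and the complement of
  \<open>Y\<close>.\<close>

lemma uncross_even:
  assumes "T X" "T Y" "\<not> odd_cut (X \<inter> Y)"
  shows "T (X - Y)" "T (Y - X)" "\<And>x y. x \<in> X \<inter> Y \<Longrightarrow> y \<notin> X \<union> Y \<Longrightarrow> {x, y} \<notin> edges G"
proof -
  have XV: "X \<subseteq> V" "Y \<subseteq> V" using tight_sub assms by auto
  have eq: "X \<inter> (V - Y) = X - Y" "V - (X \<union> (V - Y)) = Y - X" using XV by auto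
  have "odd_cut (X \<inter> (V - Y))" using odd_cut_split[of X Y] odd_cut_tight[OF assms(1)] assms eq by auto
  note u = uncross_odd[OF assms(1) tight_compl[OF assms(2)] this]
  show "T (X - Y)" using u(1) eq by simp
  show "T (Y - X)" using tight_compl[OF u(2)] eq by simp
  fix x y assume xy: "x \<in> X \<inter> Y" "y \<notin> X \<union> Y"
  show "{x, y} \<notin> edges G"
  proof
    assume e: "{x, y} \<in> edges G"
    then have "y \<in> V" using edgeD by auto
    then show False using u(3)[of x y] xy e by auto
  qed
qed

text \<open>An even set \<open>S\<close> that has edges only to two tight sets can be added to
  either. A matching leaves \<open>S\<close> only through the exits of \<open>v\<close> and
  \<open>w\<close>; by parity it uses both or none of these two ways, so the exit of \<open>v
  \<union> S\<close> is that of \<open>v\<close> or is the mate of the exit of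
  \<open>w\<close>.\<close>

lemma bridge:
  assumes "T v" "T w" "v \<inter> w = {}" "S \<subseteq> V" "S \<inter> v = {}" "S \<inter> w = {}" "\<not> odd_cut S"
    "\<And>x y. x \<in> S \<Longrightarrow> {x, y} \<in> edges G \<Longrightarrow> y \<in> S \<union> v \<union> w"
  shows "T (v \<union> S)"
proof (rule tightI)
  show "v \<union> S \<subseteq> V" using tight_sub assms by auto
  fix m assume m: "m \<in> MM"
  let ?a = "exit_point m v" and ?b = "exit_point m w"
  have ev: "even (card (exits m S))" using odd_cut_iff[OF assms(4) m] assms(7) by auto
  have sub: "exits m S \<subseteq> {m ?a, m ?b}"
  proof
    fix x assume x: "x \<in> exits m S"
    then have "x \<in> S" "m x \<notin> S" unfolding exits_def by auto
    then have xV: "x \<in> V" "m x \<in> v \<or> m x \<in> w" "m (m x) = x"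
      using assms(4) assms(8)[of x "m x"] mateD(1,2)[OF m, of x] by auto
    moreover have "m (m x) \<notin> v" "m (m x) \<notin> w" using \<open>x \<in> S\<close> assms(5,6) xV(3) by auto
    ultimately have "m x = ?a \<or> m x = ?b"
      using exit_eq[OF assms(1) m, of "m x"] exit_eq[OF assms(2) m, of "m x"] by auto
    then show "x \<in> {m ?a, m ?b}" using xV by auto
  qed
  have aS: "m ?a \<in> exits m S" if "m ?a \<in> S"
    using that exit_point(1,2,5,6,7)[OF assms(1) m] assms(5) unfolding exits_def by auto
  show "\<exists>x. exits m (v \<union> S) = {x}"
  proof (cases "m ?a \<in> S")
    case False
    then have "m ?a \<notin> exits m S" unfolding exits_def by auto
    then have "exits m S \<subseteq> {m ?b}" using sub by auto
    then have "exits m S = {}" using ev by (metis card.empty is_singletonI is_singleton_altdef odd_one subset_singletonD)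
    then have "m x \<in> v \<union> S" if "x \<in> S" for x using that unfolding exits_def by blast
    moreover have "x = ?a" if "x \<in> v" "m x \<notin> v" for x using exit_eq[OF assms(1) m] that by metis
    ultimately have "exits m (v \<union> S) = {?a}"
      using False exit_point(1,2)[OF assms(1) m] unfolding exits_def by blast
    then show ?thesis by blast
  next
    case True
    have ne: "m ?a \<noteq> m ?b" 
      using mate_inj[OF m, of ?a ?b] exit_point(1,2,5,6,7)[OF assms(1) m] exit_point(1,2,5,6,7)[OF assms(2) m] assms(3) by auto
    have "exits m S \<noteq> {m ?a}" using ev by auto
    then have "exits m S = {m ?a, m ?b}" using aS[OF True] sub ne by blast
    then have S: "m ?a \<in> S" "m ?b \<in> S" "\<And>x. x \<in> S \<Longrightarrow> m x \<notin> S \<Longrightarrow> x = m ?a \<or> x = m ?b" unfolding exits_def by auto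
    have "exits m (v \<union> S) = {m ?b}"
    proof
      show "exits m (v \<union> S) \<subseteq> {m ?b}"
      proof
        fix x assume "x \<in> exits m (v \<union> S)"
        then have x: "x \<in> v \<or> x \<in> S" "m x \<notin> v" "m x \<notin> S" unfolding exits_def by auto
        show "x \<in> {m ?b}"
        proof (cases "x \<in> v")
          case True
          then have "?a = x" using exit_eq[OF assms(1) m, of x] x by blast
          then show ?thesis using x(3) S(1) by blast
        next
          case False
          then have "x = m ?a \<or> x = m ?b" using S(3) x by auto
          then show ?thesis using x(2) exit_point(1,7)[OF assms(1) m] by auto
        qed
      qed
      show "{m ?b} \<subseteq> exits m (v \<union> S)"
        using S(2) exit_point(1,7)[OF assms(2) m] assms(3,6) unfolding exits_def by auto
    qed
    then show ?thesis by blast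
  qed
qed

text \<open>Replaces the symmetric definition by conditions that are easy to check: one parity and
  a bound on the neighbourhood.\<close>

lemma passable_iff:
  assumes "T v" "T w" "v \<inter> w = {}" "S \<subseteq> V"
  shows "passable G M S v \<and> passable G M S w \<longleftrightarrow>
    T (v - S) \<and> T (w - S) \<and> \<not> odd_cut S \<and> (\<forall>x\<in>S. \<forall>y. {x, y} \<in> edges G \<longrightarrow> y \<in> S \<union> v \<union> w)"
proof
  assume "passable G M S v \<and> passable G M S w"
  then have a: "T (v - S)" "T (v \<union> S)" "T (w - S)" "T (w \<union> S)" unfolding passable_def by auto
  have "fin_cut S"
  proof -
    have "fin_cut ((v \<union> S) \<inter> (w \<union> S))" using a by blast
    moreover have "(v \<union> S) \<inter> (w \<union> S) = S" using assms(3) by auto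
    ultimately show ?thesis by simp
  qed
  have "odd_cut ((v - S) \<union> S) \<longleftrightarrow> odd_cut (v - S) \<noteq> odd_cut S"
    using a \<open>fin_cut S\<close> by (intro odd_cut_Un_disjoint) auto
  moreover have "(v - S) \<union> S = v \<union> S" by auto
  ultimately have nod: "\<not> odd_cut S" using a odd_cut_tight by auto
  have "(v \<union> S) \<inter> (w \<union> S) = S" using assms(3) by auto
  then have "\<not> odd_cut ((v \<union> S) \<inter> (w \<union> S))" using nod by simp
  note u = uncross_even(3)[OF a(2,4) this]
  have "\<forall>x\<in>S. \<forall>y. {x, y} \<in> edges G \<longrightarrow> y \<in> S \<union> v \<union> w" using u by blast
  then show "T (v - S) \<and> T (w - S) \<and> \<not> odd_cut S \<and> (\<forall>x\<in>S. \<forall>y. {x, y} \<in> edges G \<longrightarrow> y \<in> S \<union> v \<union> w)"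
    using a nod by auto
next
  assume r: "T (v - S) \<and> T (w - S) \<and> \<not> odd_cut S \<and> (\<forall>x\<in>S. \<forall>y. {x, y} \<in> edges G \<longrightarrow> y \<in> S \<union> v \<union> w)"
  have "T ((v - S) \<union> S)"
    by (rule bridge[of _ "w - S"]) (use r assms in auto)
  moreover have "T ((w - S) \<union> S)"
    by (rule bridge[of _ "v - S"]) (use r assms in auto)
  moreover have "(v - S) \<union> S = v \<union> S" "(w - S) \<union> S = w \<union> S" by auto
  ultimately show "passable G M S v \<and> passable G M S w" unfolding passable_def using r assms(4) by auto
qed

text \<open>Suppose that some matching leaves \<open>K\<close> at \<open>x\<close>. The mate of
  \<open>x\<close> is then the exit of \<open>v - K\<close>. But the exit of \<open>v\<close> also
  lies in \<open>v - K\<close>, and its mate is outside \<open>v\<close>.\<close>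

lemma even_pocket:
  assumes "T v" "T (v - K)" "K \<subseteq> v" "\<And>x y. x \<in> K \<Longrightarrow> {x, y} \<in> edges G \<Longrightarrow> y \<in> v"
  shows "K = {}"
proof (rule ccontr)
  assume ne: "K \<noteq> {}"
  have KV: "K \<subseteq> V" using tight_sub[OF assms(1)] assms(3) by auto
  have "K \<noteq> V" using tight_ne[OF assms(2)] tight_sub[OF assms(1)] by auto
  then obtain m x where m: "m \<in> MM" "x \<in> K" "m x \<in> V" "m x \<notin> K" "{x, m x} \<in> edges G"
    by (rule cross_mate[OF KV ne])
  then have "m x \<in> v - K" using assms(4) by auto
  moreover have "m (m x) = x" using m mateD(2) KV by auto
  moreover from this have "m (m x) \<notin> v - K" using m(2) by simp
  ultimately have 1: "exit_point m (v - K) = m x"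
    using exit_eq[OF assms(2) m(1)] by blast
  let ?p = "exit_point m v"
  have p: "?p \<in> v" "m ?p \<notin> v" using exit_point(1,2,5,6,7)[OF assms(1) m(1)] by auto
  have "{?p, m ?p} \<in> edges G" using mateD(1)[OF m(1)] exit_point(5)[OF assms(1) m(1)] by auto
  then have "?p \<notin> K" using assms(4) p by auto
  then have "exit_point m (v - K) = ?p" using exit_eq[OF assms(2) m(1), of ?p] p by blast
  then have "m ?p = x" using 1 \<open>m (m x) = x\<close> by metis
  then show False using p m assms(3) by auto
qed

text \<open>If \<open>K\<close> has edges only to one tight set \<open>v\<close>, then each
  matching leaves \<open>K\<close> in at most one point, and parity makes every matching leave
  \<open>K\<close> through the exit of \<open>v\<close>. So \<open>K \<union> v\<close> is closed
  under all of them.\<close>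

lemma pendant:
  assumes "T v" "K \<subseteq> V" "K \<inter> v = {}" "K \<noteq> {}" "\<And>x y. x \<in> K \<Longrightarrow> {x, y} \<in> edges G \<Longrightarrow> y \<in> K \<union> v"
  shows "V = K \<union> v"
proof -
  have "K \<noteq> V" using tight_ne[OF assms(1)] tight_sub[OF assms(1)] assms(3) by auto
  then obtain m x where m: "m \<in> MM" "x \<in> K" "m x \<in> V" "m x \<notin> K" "{x, m x} \<in> edges G"
    by (rule cross_mate[OF assms(2,4)])
  have sub: "exits n K \<subseteq> {n (exit_point n v)}" if n: "n \<in> MM" for n
  proof
    fix z assume "z \<in> exits n K"
    then have z: "z \<in> K" "n z \<notin> K" unfolding exits_def by auto
    then have nz: "n z \<in> v" "n (n z) = z" using assms(5)[of z "n z"] mateD(1,2)[OF n, of z] assms(2) by auto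
    then have "exit_point n v = n z" using exit_eq[OF assms(1) n, of "n z"] z assms(3) by auto
    then show "z \<in> {n (exit_point n v)}" using nz(2) by simp
  qed
  have "x \<in> exits m K" using m unfolding exits_def by auto
  then have "exits m K = {x}" using sub[OF m(1)] by auto
  then have odd_cut: "odd_cut K" using odd_cut_iff[OF assms(2) m(1)] by auto
  have "K \<union> v = V"
  proof (rule all_closed_V)
    show "K \<union> v \<subseteq> V" using assms tight_sub by auto
    show "K \<union> v \<noteq> {}" using assms by auto
    fix n assume n: "n \<in> MM"
    have "exits n K \<noteq> {}" using odd_cut odd_cut_iff[OF assms(2) n] by auto
    then have "n (exit_point n v) \<in> K" using sub[OF n] unfolding exits_def by blast
    then have "n z \<in> K \<union> v" if "z \<in> v" for z using exit_eq[OF assms(1) n, of z] that by blast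
    moreover have "n z \<in> K \<union> v" if "z \<in> K" for z
      using assms(2,5) mateD(1)[OF n] that by blast
    ultimately show "closed_under n (K \<union> v)" unfolding closed_under_def by auto
  qed
  then show ?thesis by simp
qed

end

section \<open>Frames and the matchings they inherit\<close>

text \<open>The part of the notion of a torsoid that is shared with collapses, for which all sets
  \<open>\<epsilon> e\<close> are empty: it does not mention bricks, braces, cycles or the
  maximality of \<open>\<epsilon>\<close>. Passability of \<open>\<epsilon> {v, w}\<close> amounts
  to tightness of \<open>v \<union> \<epsilon> {v, w}\<close>, since vertices are tight and
  disjoint from it.\<close>

locale frame = matching_covered_graph G M for G :: "'v sgraph" and M +
  fixes H :: "'v set sgraph" and \<epsilon> :: "'v set set \<Rightarrow> 'v set"
  assumes simpleH: "simple_graph H"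
    and tightv: "v \<in> verts H \<Longrightarrow> T v"
    and disjv: "v \<in> verts H \<Longrightarrow> w \<in> verts H \<Longrightarrow> v \<noteq> w \<Longrightarrow> v \<inter> w = {}"
    and dise: "e \<in> edges H \<Longrightarrow> f \<in> edges H \<Longrightarrow> e \<noteq> f \<Longrightarrow> \<epsilon> e \<inter> \<epsilon> f = {}"
    and disve: "v \<in> verts H \<Longrightarrow> e \<in> edges H \<Longrightarrow> v \<inter> \<epsilon> e = {}"
    and cover: "x \<in> V \<Longrightarrow> (\<exists>v\<in>verts H. x \<in> v) \<or> (\<exists>e\<in>edges H. x \<in> \<epsilon> e)"
    and subV: "e \<in> edges H \<Longrightarrow> \<epsilon> e \<subseteq> V"
    and edgeb: "{v, w} \<in> edges H \<Longrightarrow> \<exists>x\<in>v \<union> \<epsilon> {v, w}. \<exists>y\<in>w. {x, y} \<in> edges G"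
    and passv: "{v, w} \<in> edges H \<Longrightarrow> T (v \<union> \<epsilon> {v, w})"
    and nonadj: "v \<in> verts H \<Longrightarrow> w \<in> verts H \<Longrightarrow> v \<noteq> w \<Longrightarrow> x \<in> v \<Longrightarrow> y \<in> w \<Longrightarrow>
      {x, y} \<in> edges G \<Longrightarrow> {v, w} \<in> edges H"
begin

text \<open>The part of \<open>G\<close> that the edge \<open>vw\<close> of \<open>H\<close>
  stands for.\<close>

definition link :: "'v set \<Rightarrow> 'v set \<Rightarrow> 'v set" where
  "link v w = v \<union> \<epsilon> {v, w} \<union> w"

text \<open>The mate function that \<open>m\<close> induces on \<open>H\<close>. A matching is
  compatible with an edge \<open>vw\<close> if it matches the link of \<open>v\<close> and
  \<open>w\<close> within itself; \<open>partner_ex\<close> and \<open>partner_unique\<close> show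
  that this holds for exactly one edge at \<open>v\<close>.\<close>

definition partner :: "('v \<Rightarrow> 'v) \<Rightarrow> 'v set \<Rightarrow> 'v set" where
  "partner m v = (THE w. {v, w} \<in> edges H \<and> closed_under m (link v w))"

abbreviation "MH \<equiv> torsoid_matching M H \<epsilon>"

lemma edgeH: "{v, w} \<in> edges H \<Longrightarrow> v \<in> verts H" "{v, w} \<in> edges H \<Longrightarrow> w \<in> verts H"
  "{v, w} \<in> edges H \<Longrightarrow> v \<noteq> w"
  using simple_edge[OF simpleH] by auto

lemma edgeH_sym: "{v, w} \<in> edges H \<Longrightarrow> {w, v} \<in> edges H"
  by (simp add: insert_commute)

lemma edgeHE:
  assumes "e \<in> edges H"
  obtains v w where "e = {v, w}" "v \<in> verts H" "w \<in> verts H" "v \<noteq> w"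
  using simple_edgeE[OF simpleH assms] .

lemma link_commute: "link v w = link w v"
  unfolding link_def by (auto simp: insert_commute)

lemma passw: "{v, w} \<in> edges H \<Longrightarrow> T (w \<union> \<epsilon> {v, w})"
  using passv[of w v] by (simp add: insert_commute)

lemma vert_sub: "v \<in> verts H \<Longrightarrow> v \<subseteq> V"
  using tightv tight_sub by blast

lemma vert_ne: "v \<in> verts H \<Longrightarrow> v \<noteq> {}"
  using tightv tight_ne by blast

lemma vert_eq: "v \<in> verts H \<Longrightarrow> w \<in> verts H \<Longrightarrow> x \<in> v \<Longrightarrow> x \<in> w \<Longrightarrow> v = w"
  using disjv by blast

lemma eps_eq: "e \<in> edges H \<Longrightarrow> f \<in> edges H \<Longrightarrow> x \<in> \<epsilon> e \<Longrightarrow> x \<in> \<epsilon> f \<Longrightarrow> e = f"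
  using dise by blast

lemma vert_eps: "v \<in> verts H \<Longrightarrow> e \<in> edges H \<Longrightarrow> x \<in> v \<Longrightarrow> x \<in> \<epsilon> e \<Longrightarrow> False"
  using disve by blast

lemma link_sub: "{v, w} \<in> edges H \<Longrightarrow> link v w \<subseteq> V"
  unfolding link_def using vert_sub edgeH subV by blast

lemma fin_cut_eps: assumes "e \<in> edges H" shows "fin_cut (\<epsilon> e)"
proof -
  obtain v w where e: "e = {v, w}" "v \<in> verts H" by (rule edgeHE[OF assms])
  have "fin_cut ((v \<union> \<epsilon> e) - v)" using passv[of v w] tightv assms e by blast
  moreover have "(v \<union> \<epsilon> e) - v = \<epsilon> e" using disve[OF e(2) assms] by blast
  ultimately show ?thesis by simp
qed

lemma even_eps: assumes "e \<in> edges H" shows "\<not> odd_cut (\<epsilon> e)"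
proof -
  obtain v w where e: "e = {v, w}" "v \<in> verts H" by (rule edgeHE[OF assms])
  have "odd_cut (v \<union> \<epsilon> e) \<longleftrightarrow> odd_cut v \<noteq> odd_cut (\<epsilon> e)"
    using fin_cut_eps[OF assms] tightv[OF e(2)] disve[OF e(2) assms] by (intro odd_cut_Un_disjoint) auto
  then show ?thesis using odd_cut_tight[OF tightv[OF e(2)]] odd_cut_tight[OF passv[of v w]] assms e by simp
qed

text \<open>The two tight sets \<open>v \<union> \<epsilon>\<close> and \<open>w \<union>
  \<epsilon>\<close> meet in the even set \<open>\<epsilon>\<close>, so
  \<open>uncross_even\<close> bounds its neighbourhood.\<close>

lemma N_eps:
  assumes "{v, w} \<in> edges H" "x \<in> \<epsilon> {v, w}" "{x, y} \<in> edges G"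
  shows "y \<in> link v w"
proof -
  have vw: "v \<in> verts H" "w \<in> verts H" "v \<noteq> w" using edgeH assms(1) by auto
  have "(v \<union> \<epsilon> {v, w}) \<inter> (w \<union> \<epsilon> {v, w}) = \<epsilon> {v, w}"
    using disjv[OF vw] by blast
  then have "\<not> odd_cut ((v \<union> \<epsilon> {v, w}) \<inter> (w \<union> \<epsilon> {v, w}))" using even_eps[OF assms(1)] by simp
  then have "y \<in> (v \<union> \<epsilon> {v, w}) \<union> (w \<union> \<epsilon> {v, w})"
    using uncross_even(3)[OF passv[OF assms(1)] passw[OF assms(1)], of x y] assms(2,3) by blast
  then show ?thesis unfolding link_def by blast
qed

text \<open>The mate of the exit of \<open>v\<close> lies in some \<open>w\<close> or in some
  \<open>\<epsilon> {v, w}\<close>. In the second case the matching leaves the even set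
  \<open>\<epsilon> {v, w}\<close> a second time, which is only possible through the exit of
  \<open>w\<close>. So the link of \<open>v\<close> and \<open>w\<close> is closed.\<close>

lemma partner_ex:
  assumes m: "m \<in> MM" and v: "v \<in> verts H"
  shows "\<exists>w. {v, w} \<in> edges H \<and> closed_under m (link v w)"
proof -
  define a where "a = exit_point m v"
  have a: "a \<in> v" "m a \<notin> v" "a \<in> V" "m a \<in> V" "m (m a) = a"
    unfolding a_def by (rule exit_point[OF tightv[OF v] m])+
  have aE: "{a, m a} \<in> edges G" "{m a, a} \<in> edges G"
    using mateD(1)[OF m a(3)] by (simp_all add: insert_commute)
  have "\<exists>w. {v, w} \<in> edges H \<and> m a \<in> \<epsilon> {v, w} \<union> w"
  proof (cases "\<exists>w\<in>verts H. m a \<in> w")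
    case True
    then obtain w where w: "w \<in> verts H" "m a \<in> w" by blast
    then have "{v, w} \<in> edges H" using nonadj[OF v w(1) _ a(1) w(2) aE(1)] a(2) by blast
    then show ?thesis using w by blast
  next
    case False
    then obtain e where e: "e \<in> edges H" "m a \<in> \<epsilon> e" using cover[OF a(4)] by blast
    obtain x y where xy: "e = {x, y}" "x \<in> verts H" "y \<in> verts H" by (rule edgeHE[OF e(1)])
    have "a \<in> link x y" using N_eps[of x y "m a" a] e xy aE by simp
    moreover have "a \<notin> \<epsilon> e" using vert_eps[OF v e(1) a(1)] by blast
    ultimately have "v = x \<or> v = y" unfolding link_def using vert_eq[OF v _ a(1)] xy by blast
    then show ?thesis using e xy by (metis UnI1 insert_commute)
  qed
  then obtain w where w: "{v, w} \<in> edges H" "m a \<in> \<epsilon> {v, w} \<union> w" by blast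
  have wH: "w \<in> verts H" "v \<noteq> w" using edgeH w(1) by blast+
  define c where "c = exit_point m w"
  have c: "c \<in> w" "m c \<notin> w" "c \<in> V" "m c \<in> V" "m (m c) = c"
    unfolding c_def by (rule exit_point[OF tightv[OF wH(1)] m])+
  have mc: "m c \<in> link v w"
  proof (cases "m a \<in> w")
    case True
    have "c = m a" unfolding c_def
      by (rule exit_eq[OF tightv[OF wH(1)] m True]) (use a disjv[OF v wH] in auto)
    then show ?thesis unfolding link_def using a by simp
  next
    case False
    then have ma: "m a \<in> \<epsilon> {v, w}" using w by blast
    let ?E = "\<epsilon> {v, w}"
    have "a \<notin> ?E" using vert_eps[OF v w(1) a(1)] by blast
    then have "m a \<in> exits m ?E" unfolding exits_def using ma a by simp
    moreover have "even (card (exits m ?E))" using odd_cut_iff[OF subV[OF w(1)] m] even_eps[OF w(1)] by simp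
    ultimately have "exits m ?E \<noteq> {m a}" "exits m ?E \<noteq> {}" by auto
    then obtain z where z: "z \<in> exits m ?E" "z \<noteq> m a" by blast
    then have z': "z \<in> ?E" "m z \<notin> ?E" "z \<in> V" using subV[OF w(1)] unfolding exits_def by auto
    then have "m z \<in> link v w" using N_eps[OF w(1) z'(1) mateD(1)[OF m z'(3)]] by blast
    moreover have "m z \<notin> v"
    proof
      assume "m z \<in> v"
      moreover have "m (m z) \<notin> v" using mateD(2)[OF m z'(3)] z'(1) vert_eps[OF v w(1)] by auto
      ultimately have "a = m z" unfolding a_def by (rule exit_eq[OF tightv[OF v] m])
      then show False using z(2) mateD(2)[OF m z'(3)] by simp
    qed
    ultimately have mzw: "m z \<in> w" unfolding link_def using z' by blast
    have "m (m z) \<notin> w" using mateD(2)[OF m z'(3)] z'(1) vert_eps[OF wH(1) w(1)] by auto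
    then have "c = m z" unfolding c_def using exit_eq[OF tightv[OF wH(1)] m mzw] by simp
    then show ?thesis unfolding link_def using z' mateD(2)[OF m z'(3)] by simp
  qed
  have "closed_under m (link v w)"
    unfolding closed_under_def
  proof
    fix x assume x: "x \<in> link v w"
    then consider "x \<in> v" | "x \<in> \<epsilon> {v, w}" | "x \<in> w" unfolding link_def by blast
    then show "m x \<in> link v w"
    proof cases
      case 1
      then show ?thesis using exit_eq[OF tightv[OF v] m 1] w(2) unfolding link_def a_def by blast
    next
      case 2
      then show ?thesis using N_eps[OF w(1) 2 mateD(1)[OF m]] subV[OF w(1)] by blast
    next
      case 3
      then show ?thesis using exit_eq[OF tightv[OF wH(1)] m 3] mc unfolding link_def c_def by blast
    qed
  qed
  then show ?thesis using w(1) by blast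
qed

lemma link_Int:
  assumes "{v, w} \<in> edges H" "{v, w'} \<in> edges H" "w \<noteq> w'"
  shows "link v w \<inter> link v w' = v"
proof -
  have H: "v \<in> verts H" "w \<in> verts H" "w' \<in> verts H" using assms edgeH by blast+
  have "{v, w} \<noteq> {v, w'}" using assms(3) by (simp add: doubleton_eq_iff)
  then have "\<epsilon> {v, w} \<inter> \<epsilon> {v, w'} = {}" using dise assms by blast
  then show ?thesis unfolding link_def
    using disjv[OF H(2,3) assms(3)] disve[OF H(2) assms(2)] disve[OF H(3) assms(1)] by blast
qed

lemma link_disj:
  assumes "{u, u'} \<in> edges H" "{v, v'} \<in> edges H" "u \<noteq> v" "u \<noteq> v'" "u' \<noteq> v" "u' \<noteq> v'"
  shows "link u u' \<inter> link v v' = {}"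
proof -
  have H: "u \<in> verts H" "u' \<in> verts H" "v \<in> verts H" "v' \<in> verts H" using assms edgeH by blast+
  have "{u, u'} \<noteq> {v, v'}" using assms by (simp add: doubleton_eq_iff)
  then have 1: "\<epsilon> {u, u'} \<inter> \<epsilon> {v, v'} = {}" using dise assms by blast
  have 2: "u \<inter> v = {}" "u \<inter> v' = {}" "u' \<inter> v = {}" "u' \<inter> v' = {}" using disjv H assms by blast+
  have 3: "u \<inter> \<epsilon> {v, v'} = {}" "u' \<inter> \<epsilon> {v, v'} = {}" "\<epsilon> {u, u'} \<inter> v = {}" "\<epsilon> {u, u'} \<inter> v' = {}"
    using disve H assms by blast+
  show ?thesis unfolding link_def by (simp add: Int_Un_distrib Int_Un_distrib2 1 2 3)
qed

lemma partner_unique: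
  assumes m: "m \<in> MM" and "{v, w} \<in> edges H" "closed_under m (link v w)"
    "{v, w'} \<in> edges H" "closed_under m (link v w')"
  shows "w = w'"
proof (rule ccontr)
  assume "w \<noteq> w'"
  then have I: "link v w \<inter> link v w' = v" using link_Int assms by blast
  have v: "v \<in> verts H" using edgeH assms(2) by blast
  have "m (exit_point m v) \<in> link v w" "m (exit_point m v) \<in> link v w'"
    using closedD[OF assms(3), of "exit_point m v"] closedD[OF assms(5), of "exit_point m v"]
      exit_point(1)[OF tightv[OF v] m] unfolding link_def by blast+
  then show False using I exit_point(2)[OF tightv[OF v] m] by blast
qed

lemma partnerD:
  assumes "m \<in> MM" "v \<in> verts H"
  shows "{v, partner m v} \<in> edges H" "closed_under m (link v (partner m v))" "partner m v \<in> verts H" "partner m v \<noteq> v"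
proof -
  have "\<exists>!w. {v, w} \<in> edges H \<and> closed_under m (link v w)"
    using partner_ex[OF assms] partner_unique[OF assms(1)] by blast
  from theI'[OF this] show 1: "{v, partner m v} \<in> edges H" "closed_under m (link v (partner m v))"
    unfolding partner_def by blast+
  show "partner m v \<in> verts H" "partner m v \<noteq> v" using edgeH[OF 1(1)] by auto
qed

lemma partner_eqI: "m \<in> MM \<Longrightarrow> {v, w} \<in> edges H \<Longrightarrow> closed_under m (link v w) \<Longrightarrow> partner m v = w"
  using partner_unique partnerD edgeH(1) by metis

lemma partner_partner: "m \<in> MM \<Longrightarrow> v \<in> verts H \<Longrightarrow> partner m (partner m v) = v"
  by (rule partner_eqI) (use partnerD edgeH_sym link_commute in metis)+

lemma partner_sym: "m \<in> MM \<Longrightarrow> v \<in> verts H \<Longrightarrow> partner m v = w \<Longrightarrow> partner m w = v"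
  using partner_partner by metis

lemma partner_pointI:
  assumes m: "m \<in> MM" and e: "{v, w} \<in> edges H" and x: "x \<in> v" "m x \<in> w \<union> \<epsilon> {v, w}"
  shows "partner m v = w"
proof (rule ccontr)
  assume ne: "partner m v \<noteq> w"
  have v: "v \<in> verts H" using edgeH e by blast
  have "m x \<in> link v (partner m v)" using closedD[OF partnerD(2)[OF m v]] x(1) unfolding link_def by blast
  moreover have "m x \<in> link v w" using x unfolding link_def by blast
  ultimately have "m x \<in> v" using link_Int[OF partnerD(1)[OF m v] e ne] by blast
  moreover have "m x \<notin> v" using x(2) disjv[OF v] disve[OF v e] edgeH[OF e] by blast
  ultimately show False by blast
qed

lemma exit_partner:
  assumes m: "m \<in> MM" and v: "v \<in> verts H"
  shows "m (exit_point m v) \<in> \<epsilon> {v, partner m v} \<union> partner m v"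
  using closedD[OF partnerD(2)[OF m v], of "exit_point m v"] exit_point(1,2)[OF tightv[OF v] m]
  unfolding link_def by blast

text \<open>Along edges outside the induced matching, the set \<open>\<epsilon> {v, w}\<close> is
  matched within itself.\<close>

lemma closed_eps:
  assumes m: "m \<in> MM" and e: "{v, w} \<in> edges H" and ne: "partner m v \<noteq> w"
  shows "closed_under m (\<epsilon> {v, w})"
proof -
  have *: "m x \<notin> a" if "x \<in> \<epsilon> {v, w}" "{a, b} = {v, w}" "partner m a \<noteq> b" for x a b
  proof
    assume mx: "m x \<in> a"
    have e': "{a, b} \<in> edges H" and x': "x \<in> \<epsilon> {a, b}" using e that by auto
    have a: "a \<in> verts H" using edgeH[OF e'] by blast
    have "x \<in> V" using subV[OF e] that by blast
    then have "m (m x) = x" using mateD m by blast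
    then have "partner m a = b" using partner_pointI[OF m e' mx] x' by simp
    then show False using that by blast
  qed
  have "partner m w \<noteq> v" using ne partner_sym[OF m] edgeH e by blast
  show ?thesis unfolding closed_under_def
  proof
    fix x assume x: "x \<in> \<epsilon> {v, w}"
    then have "x \<in> V" using subV[OF e] by blast
    then have "m x \<in> link v w" using N_eps[OF e x] mateD(1)[OF m] by blast
    moreover have "m x \<notin> v" using *[OF x refl ne] .
    moreover have "m x \<notin> w" using *[OF x _ \<open>partner m w \<noteq> v\<close>] by (simp add: insert_commute)
    ultimately show "m x \<in> \<epsilon> {v, w}" unfolding link_def by blast
  qed
qed

lemma partner_edge:
  assumes m: "m \<in> MM" and e: "{v, w} \<in> edges H" and "x \<in> v \<union> \<epsilon> {v, w}" "y \<in> w" "m y = x"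
  shows "partner m v = w"
proof -
  have "partner m w = v"
    by (rule partner_pointI[OF m edgeH_sym[OF e] assms(4)]) (use assms(3,5) in \<open>auto simp: insert_commute\<close>)
  then show ?thesis using partner_sym m edgeH e by blast
qed

lemma edge_real:
  assumes "{v, w} \<in> edges H"
  obtains m where "m \<in> MM" "partner m v = w" "partner m w = v"
proof -
  obtain x y where xy: "x \<in> v \<union> \<epsilon> {v, w}" "y \<in> w" "{x, y} \<in> edges G" using edgeb[OF assms] by blast
  obtain m where m: "m \<in> MM" "m x = y" "m y = x" by (rule edge_mate[OF xy(3)])
  have "partner m v = w" by (rule partner_edge[OF m(1) assms xy(1,2) m(3)])
  then show ?thesis using that[OF m(1)] partner_sym[OF m(1)] edgeH assms by blast
qed

text \<open>The matching that the definition of torsoids puts on \<open>H\<close> is the one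
  induced by \<open>m0\<close>.\<close>

lemma MH_iff: "{v, w} \<in> MH \<longleftrightarrow> {v, w} \<in> edges H \<and> partner m0 v = w"
proof
  assume "{v, w} \<in> MH"
  then obtain a b where ab: "{v, w} = {a, b}" "{a, b} \<in> edges H" "edge_between M (a \<union> \<epsilon> {a, b}) b"
    unfolding torsoid_matching_def by (elim CollectE exE conjE) (rule that)
  then obtain x y where xy: "x \<in> a \<union> \<epsilon> {a, b}" "y \<in> b" "{x, y} \<in> M" unfolding edge_between_def by blast
  have "m0 y = x" using m0(3)[of y x] xy(3) by (simp add: insert_commute)
  then have "partner m0 a = b" by (rule partner_edge[OF m0(1) ab(2) xy(1,2)])
  moreover have "partner m0 b = a" using calculation partner_sym[OF m0(1)] edgeH ab(2) by blast
  moreover have "v = a \<and> w = b \<or> v = b \<and> w = a" using ab(1) by (simp add: doubleton_eq_iff)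
  ultimately show "{v, w} \<in> edges H \<and> partner m0 v = w" using ab(1,2) by auto
next
  assume r: "{v, w} \<in> edges H \<and> partner m0 v = w"
  then have vw: "v \<in> verts H" "w \<in> verts H" "partner m0 w = v" using edgeH partner_sym[OF m0(1)] by blast+
  let ?y = "exit_point m0 w"
  have y: "?y \<in> w" "m0 ?y \<in> v \<union> \<epsilon> {v, w}" "?y \<in> V"
    using exit_partner[OF m0(1) vw(2)] exit_point(1,5)[OF tightv[OF vw(2)] m0(1)] vw(3)
    by (auto simp: insert_commute)
  moreover have "{m0 ?y, ?y} \<in> M" using m0(2)[OF y(3)] by (simp add: insert_commute)
  ultimately have "edge_between M (v \<union> \<epsilon> {v, w}) w" unfolding edge_between_def by blast
  then show "{v, w} \<in> MH" unfolding torsoid_matching_def using r by blast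
qed

lemma partner_differ:
  assumes "m \<in> MM" "n \<in> MM" "v \<in> verts H" "m (exit_point m v) = n (exit_point m v)"
  shows "partner n v = partner m v"
proof (rule partner_pointI[OF assms(2) partnerD(1)[OF assms(1,3)]])
  show "exit_point m v \<in> v" by (rule exit_point(1)[OF tightv[OF assms(3)] assms(1)])
  show "n (exit_point m v) \<in> partner m v \<union> \<epsilon> {v, partner m v}"
    using exit_partner[OF assms(1,3)] unfolding assms(4) by blast
qed

lemma exit_point_inj: "m \<in> MM \<Longrightarrow> inj_on (exit_point m) (verts H)"
  using exit_point(1)[OF tightv] vert_eq by (metis inj_onI)

text \<open>If the induced matchings of \<open>m\<close> and \<open>m0\<close> differ at
  \<open>v\<close>, then \<open>m\<close> and \<open>m0\<close> differ at the exit of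
  \<open>v\<close>. So they differ at finitely many vertices of \<open>H\<close>.\<close>

lemma partner_mates:
  assumes m: "m \<in> MM"
  shows "partner m \<in> mates H MH"
  unfolding mates_def
proof (intro CollectI conjI ballI)
  show "{v, partner m v} \<in> edges H" "partner m (partner m v) = v" if "v \<in> verts H" for v
    using partnerD[OF m that] partner_partner[OF m that] by blast+
  let ?B = "{v \<in> verts H. {v, partner m v} \<notin> MH}"
  have "exit_point m ` ?B \<subseteq> {x \<in> V. m x \<noteq> m0 x}"
  proof
    fix x assume "x \<in> exit_point m ` ?B"
    then obtain v where v: "v \<in> verts H" "{v, partner m v} \<notin> MH" "x = exit_point m v" by blast
    then have "partner m0 v \<noteq> partner m v" using MH_iff partnerD(1)[OF m v(1)] by blast
    then have "m x \<noteq> m0 x" using partner_differ[OF m m0(1) v(1)] v(3) by blast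
    moreover have "x \<in> V" using exit_point(5)[OF tightv[OF v(1)] m] v(3) by simp
    ultimately show "x \<in> {x \<in> V. m x \<noteq> m0 x}" by blast
  qed
  then have "finite (exit_point m ` ?B)" using mates_differ_finite[OF m m0(1)] by (rule finite_subset)
  moreover have "inj_on (exit_point m) ?B" using exit_point_inj[OF m] by (rule inj_on_subset) blast
  ultimately show "finite ?B" by (rule finite_imageD)
qed

lemma vertsH_ne: "verts H \<noteq> {}"
proof
  assume "verts H = {}"
  moreover obtain x where "x \<in> V" using conn unfolding connected_graph_def by blast
  ultimately obtain e where "e \<in> edges H" using cover by blast
  then show False using edgeHE \<open>verts H = {}\<close> by (metis empty_iff)
qed

lemma perfectH: "perfect_matching H MH"
  unfolding perfect_matching_def
proof (intro conjI ballI)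
  show "MH \<subseteq> edges H" unfolding torsoid_matching_def by blast
  fix v assume v: "v \<in> verts H"
  show "\<exists>!e. e \<in> MH \<and> v \<in> e"
  proof (rule ex1I[of _ "{v, partner m0 v}"])
    show "{v, partner m0 v} \<in> MH \<and> v \<in> {v, partner m0 v}" using MH_iff partnerD(1)[OF m0(1) v] by simp
    fix e assume e: "e \<in> MH \<and> v \<in> e"
    then have "e \<in> edges H" unfolding torsoid_matching_def by blast
    then obtain a b where ab: "e = {a, b}" "a \<in> verts H" "b \<in> verts H" "a \<noteq> b" by (rule edgeHE)
    then have "partner m0 a = b" using MH_iff e by blast
    then have "partner m0 b = a" using partner_sym[OF m0(1) ab(2)] by blast
    then show "e = {v, partner m0 v}" using e ab \<open>partner m0 a = b\<close> by auto
  qed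
qed

text \<open>The union of a component of \<open>H\<close> and of the sets \<open>\<epsilon>
  e\<close> at it is closed under all matchings.\<close>

lemma connH: "connected_graph H"
  unfolding connected_graph_def
proof (intro conjI ballI)
  show "verts H \<noteq> {}" by (rule vertsH_ne)
  fix v w assume v: "v \<in> verts H" and w: "w \<in> verts H"
  let ?r = "{(x, y). {x, y} \<in> edges H}"
  define R where "R = {u \<in> verts H. (v, u) \<in> ?r\<^sup>*}"
  define X where "X = \<Union>R \<union> \<Union>{\<epsilon> e | e. e \<in> edges H \<and> e \<inter> R \<noteq> {}}"
  have step: "b \<in> R" if "a \<in> R" "{a, b} \<in> edges H" for a b
  proof -
    have "(a, b) \<in> ?r" using that by blast
    then have "(v, b) \<in> ?r\<^sup>*" using that(1) unfolding R_def by (auto intro: rtrancl_into_rtrancl)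
    then show ?thesis using edgeH(2)[OF that(2)] unfolding R_def by blast
  qed
  have link: "link a b \<subseteq> X" if "a \<in> R" "{a, b} \<in> edges H" for a b
    using that step[OF that] unfolding X_def link_def by blast
  have "X = V"
  proof (rule all_closed_V)
    show "X \<subseteq> V" unfolding X_def R_def using vert_sub subV by blast
    have "v \<in> R" unfolding R_def using v by blast
    then show "X \<noteq> {}" unfolding X_def using vert_ne[OF v] by blast
    fix m assume m: "m \<in> MM"
    show "closed_under m X" unfolding closed_under_def
    proof
      fix x assume "x \<in> X"
      then consider u where "u \<in> R" "x \<in> u" | e where "e \<in> edges H" "e \<inter> R \<noteq> {}" "x \<in> \<epsilon> e"
        unfolding X_def by blast
      then show "m x \<in> X"
      proof cases
        case 1
        then have u: "u \<in> verts H" unfolding R_def by blast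
        have "m x \<in> link u (partner m u)" using closedD[OF partnerD(2)[OF m u], of x] 1(2) unfolding link_def by blast
        then show ?thesis using link[OF 1(1) partnerD(1)[OF m u]] by blast
      next
        case 2
        obtain a b where ab: "e = {a, b}" "a \<in> verts H" "b \<in> verts H" "a \<noteq> b" by (rule edgeHE[OF 2(1)])
        have ex: "{x, m x} \<in> edges G" using mateD(1)[OF m] subV[OF 2(1)] 2(3) by blast
        have "m x \<in> link a b" using N_eps[of a b x] 2(1,3) ab ex by blast
        moreover have "a \<in> R \<or> b \<in> R" using 2(2) ab by blast
        ultimately show ?thesis using link[of a b] link[of b a] 2(1) ab link_commute edgeH_sym by blast
      qed
    qed
  qed
  moreover obtain x where x: "x \<in> w" using vert_ne[OF w] by blast
  ultimately have "x \<in> X" using vert_sub[OF w] by blast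
  then obtain u where "u \<in> R" "x \<in> u"
    unfolding X_def using vert_eps[OF w _ x] by blast
  then have "w \<in> R" using vert_eq[OF w _ x] unfolding R_def by blast
  then show "(v, w) \<in> ?r\<^sup>*" unfolding R_def by blast
qed

theorem matching_covered_H: "matching_covered H MH"
  unfolding matching_covered_def
proof (intro conjI ballI)
  show "simple_graph H" by (rule simpleH)
  show "perfect_matching H MH" by (rule perfectH)
  show "connected_graph H" by (rule connH)
  fix e assume e: "e \<in> edges H"
  obtain v w where vw: "e = {v, w}" "v \<in> verts H" by (rule edgeHE[OF e])
  then have "{v, w} \<in> edges H" using e by simp
  then obtain m where m: "m \<in> MM" "partner m v = w" "partner m w = v" by (rule edge_real)
  have "(\<lambda>x. {x, partner m x}) ` verts H \<in> Perf H MH"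
    by (rule mates_Perf[OF simpleH perfectH partner_mates[OF m(1)]])
  moreover have "e \<in> (\<lambda>x. {x, partner m x}) ` verts H" using vw m by auto
  ultimately show "\<exists>M'\<in>Perf H MH. e \<in> M'" by (rule bexI[rotated])
qed

sublocale Q: matching_covered_graph H MH
  by unfold_locales (rule matching_covered_H)

text \<open>Links of edges in \<open>n\<close> and sets \<open>\<epsilon> e\<close> for the other
  edges \<open>e\<close> partition the vertices of \<open>G\<close>. On each part choose a
  matching under which it is closed, taking \<open>m0\<close> on all but finitely many parts, and
  glue.\<close>

theorem lift:
  assumes n: "n \<in> mates H MH"
  shows "\<exists>m\<in>MM. \<forall>v\<in>verts H. partner m v = n v"
proof -
  have nE: "{v, n v} \<in> edges H" "n (n v) = v" "n v \<in> verts H" if "v \<in> verts H" for v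
    using Q.mateD[OF n that] by blast+
  define B where "B = {v \<in> verts H. n v \<noteq> partner m0 v}"
  have "B \<subseteq> {v \<in> verts H. {v, n v} \<notin> MH}" unfolding B_def using MH_iff by auto
  then have fB: "finite B" using n finite_subset unfolding mates_def by blast
  have "\<forall>e\<in>edges H. \<exists>m\<in>MM. \<forall>v w. e = {v, w} \<longrightarrow> partner m v = w"
  proof
    fix e assume e: "e \<in> edges H"
    obtain a b where ab: "e = {a, b}" "a \<in> verts H" by (rule edgeHE[OF e])
    then have "{a, b} \<in> edges H" using e by simp
    then obtain m where m: "m \<in> MM" "partner m a = b" "partner m b = a" by (rule edge_real)
    have "partner m v = w" if "e = {v, w}" for v w
      using that ab m by (auto simp: doubleton_eq_iff)
    then show "\<exists>m\<in>MM. \<forall>v w. e = {v, w} \<longrightarrow> partner m v = w" using m(1) by blast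
  qed
  then obtain k where k: "\<And>e. e \<in> edges H \<Longrightarrow> k e \<in> MM"
    "\<And>v w. {v, w} \<in> edges H \<Longrightarrow> partner (k {v, w}) v = w" by metis
  define c where "c v = (if n v = partner m0 v then m0 else k {v, n v})" for v
  have cM: "c v \<in> MM" and cH: "partner (c v) v = n v" if "v \<in> verts H" for v
    unfolding c_def using k nE[OF that] m0(1) by auto
  have cn: "c (n v) = c v" if v: "v \<in> verts H" for v
  proof -
    have "n v = partner m0 v \<longleftrightarrow> n (n v) = partner m0 (n v)"
      using nE[OF v] partner_partner[OF m0(1) v] partner_partner[OF m0(1) nE(3)[OF v]] by metis
    then show ?thesis unfolding c_def using nE(2)[OF v] by (simp add: insert_commute)
  qed
  \<comment> \<open>Preferring \<open>m0\<close> keeps the range of \<open>\<mu>\<close>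
    finite.\<close>
  define d where "d e = (if closed_under m0 (\<epsilon> e) then m0 else (SOME m. m \<in> MM \<and> closed_under m (\<epsilon> e)))" for e
  define unm where "unm e \<longleftrightarrow> e \<in> edges H \<and> (\<forall>v\<in>verts H. e \<noteq> {v, n v})" for e
  have d: "d e \<in> MM \<and> closed_under (d e) (\<epsilon> e)" if "unm e" for e
  proof -
    have e: "e \<in> edges H" using that unfolding unm_def by blast
    obtain a b where ab: "e = {a, b}" "a \<in> verts H" by (rule edgeHE[OF e])
    have "n a \<noteq> b" using that ab unfolding unm_def by blast
    then have "closed_under (c a) (\<epsilon> e)" using closed_eps[OF cM[OF ab(2)], of a b] cH[OF ab(2)] e ab by simp
    then have "\<exists>m. m \<in> MM \<and> closed_under m (\<epsilon> e)" using cM[OF ab(2)] by blast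
    from someI_ex[OF this] show ?thesis unfolding d_def using m0(1) by simp
  qed
  define \<mu> where "\<mu> x = (if \<exists>v\<in>verts H. x \<in> link v (n v) then c (SOME v. v \<in> verts H \<and> x \<in> link v (n v))
    else d (SOME e. unm e \<and> x \<in> \<epsilon> e))" for x
  have \<mu>1: "\<mu> x = c v" if "v \<in> verts H" "x \<in> link v (n v)" for x v
  proof -
    define u where "u = (SOME v. v \<in> verts H \<and> x \<in> link v (n v))"
    have "u \<in> verts H \<and> x \<in> link u (n u)" unfolding u_def by (rule someI[of _ v]) (use that in blast)
    then have u: "u \<in> verts H" "x \<in> link u (n u)" by auto
    have "u = v \<or> u = n v"
    proof (rule ccontr)
      assume ne: "\<not> (u = v \<or> u = n v)"
      then have ne2: "n u \<noteq> v" "n u \<noteq> n v" using nE(2)[OF u(1)] nE(2)[OF that(1)] by metis+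
      have "link u (n u) \<inter> link v (n v) = {}"
        by (rule link_disj[OF nE(1)[OF u(1)] nE(1)[OF that(1)]]) (use ne ne2 in auto)
      then show False using u(2) that(2) by blast
    qed
    then have "c u = c v" using cn[OF that(1)] by auto
    moreover have "\<mu> x = c u" unfolding \<mu>_def u_def using that by auto
    ultimately show ?thesis by simp
  qed
  have notU: "\<not> (\<exists>v\<in>verts H. x \<in> link v (n v))" if "unm e" "x \<in> \<epsilon> e" for x e
  proof
    assume "\<exists>v\<in>verts H. x \<in> link v (n v)"
    then obtain v where v: "v \<in> verts H" "x \<in> link v (n v)" by blast
    have e: "e \<in> edges H" "e \<noteq> {v, n v}" using that(1) v unfolding unm_def by blast+
    show False using v(2) vert_eps[OF v(1) e(1) _ that(2)] vert_eps[OF nE(3)[OF v(1)] e(1) _ that(2)]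
        eps_eq[OF e(1) nE(1)[OF v(1)] that(2)] e(2) unfolding link_def by blast
  qed
  have \<mu>2: "\<mu> x = d e" if "unm e" "x \<in> \<epsilon> e" for x e
  proof -
    define f where "f = (SOME e. unm e \<and> x \<in> \<epsilon> e)"
    have "unm f \<and> x \<in> \<epsilon> f" unfolding f_def by (rule someI[of _ e]) (use that in blast)
    then have "f = e" using eps_eq[of f e x] that unfolding unm_def by blast
    then show ?thesis unfolding \<mu>_def using notU[OF that] f_def by simp
  qed
  have cases: "(\<exists>v\<in>verts H. x \<in> link v (n v)) \<or> (\<exists>e. unm e \<and> x \<in> \<epsilon> e)" if "x \<in> V" for x
    using cover[OF that] unfolding unm_def link_def by blast
  have \<mu>M: "\<mu> x \<in> MM \<and> \<mu> (\<mu> x x) = \<mu> x" if x: "x \<in> V" for x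
    using cases[OF x]
  proof
    assume "\<exists>v\<in>verts H. x \<in> link v (n v)"
    then obtain v where v: "v \<in> verts H" "x \<in> link v (n v)" by blast
    have "closed_under (c v) (link v (n v))" using partnerD(2)[OF cM[OF v(1)] v(1)] cH[OF v(1)] by simp
    then have "\<mu> (c v x) = c v" by (intro \<mu>1[OF v(1)]) (rule closedD[OF _ v(2)])
    then show ?thesis using \<mu>1[OF v] cM[OF v(1)] by simp
  next
    assume "\<exists>e. unm e \<and> x \<in> \<epsilon> e"
    then obtain e where e: "unm e" "x \<in> \<epsilon> e" by blast
    have "\<mu> (d e x) = d e" by (intro \<mu>2[OF e(1)]) (rule closedD[OF conjunct2[OF d[OF e(1)]] e(2)])
    then show ?thesis using \<mu>2[OF e] d[OF e(1)] by simp
  qed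
  have "\<mu> ` V \<subseteq> {m0} \<union> c ` B \<union> d ` (\<lambda>a. {a, partner m0 a}) ` B"
  proof
    fix y assume "y \<in> \<mu> ` V"
    then obtain x where x: "x \<in> V" "y = \<mu> x" by blast
    from cases[OF x(1)] show "y \<in> {m0} \<union> c ` B \<union> d ` (\<lambda>a. {a, partner m0 a}) ` B"
    proof
      assume "\<exists>v\<in>verts H. x \<in> link v (n v)"
      then obtain v where v: "v \<in> verts H" "x \<in> link v (n v)" by blast
      then have "y = c v" using \<mu>1 x by simp
      then show ?thesis using v(1) unfolding c_def B_def by auto
    next
      assume "\<exists>e. unm e \<and> x \<in> \<epsilon> e"
      then obtain e where e: "unm e" "x \<in> \<epsilon> e" by blast
      then have y: "y = d e" using \<mu>2 x by simp
      show ?thesis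
      proof (cases "closed_under m0 (\<epsilon> e)")
        case True
        then show ?thesis using y unfolding d_def by simp
      next
        case False
        have eE: "e \<in> edges H" using e unfolding unm_def by blast
        obtain a b where ab: "e = {a, b}" "a \<in> verts H" by (rule edgeHE[OF eE])
        have "partner m0 a = b" using closed_eps[OF m0(1), of a b] False eE ab by blast
        moreover have "n a \<noteq> b" using e(1) ab unfolding unm_def by blast
        ultimately have "a \<in> B" "e = {a, partner m0 a}" using ab unfolding B_def by auto
        then show ?thesis using y by blast
      qed
    qed
  qed
  then have "finite (\<mu> ` V)" using fB by (meson finite.emptyI finite.insertI finite_UnI finite_imageI finite_subset)
  then have mM: "(\<lambda>x. \<mu> x x) \<in> MM" using glue[of \<mu>] \<mu>M by blast
  moreover have "partner (\<lambda>x. \<mu> x x) v = n v" if v: "v \<in> verts H" for v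
  proof (rule partner_eqI[OF mM nE(1)[OF v]])
    have cl: "closed_under (c v) (link v (n v))" using partnerD(2)[OF cM[OF v] v] cH[OF v] by simp
    show "closed_under (\<lambda>x. \<mu> x x) (link v (n v))"
      unfolding closed_under_def using \<mu>1[OF v] closedD[OF cl] by simp
  qed
  ultimately show ?thesis by blast
qed

text \<open>The links of matched edges and the sets \<open>\<epsilon> e\<close> of unmatched edges
  cover \<open>G\<close>. All of them are closed under \<open>m\<close>. Hence a tight set is odd
  on exactly one of these units, the one with its exit.\<close>

lemma unit_cases:
  assumes "m \<in> MM" "x \<in> V"
  shows "(\<exists>v\<in>verts H. x \<in> link v (partner m v)) \<or> (\<exists>v w. {v, w} \<in> edges H \<and> partner m v \<noteq> w \<and> x \<in> \<epsilon> {v, w})"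
proof (cases "\<exists>v\<in>verts H. x \<in> v")
  case True
  then show ?thesis unfolding link_def by blast
next
  case False
  then obtain e where e: "e \<in> edges H" "x \<in> \<epsilon> e" using cover assms by blast
  obtain v w where vw: "e = {v, w}" "v \<in> verts H" by (rule edgeHE[OF e(1)])
  then show ?thesis using e unfolding link_def by (cases "partner m v = w") blast+
qed

lemma link_odd:
  assumes "m \<in> MM" "v \<in> verts H" "T X"
  shows "odd_cut (X \<inter> link v (partner m v)) \<longleftrightarrow> exit_point m X \<in> link v (partner m v)"
  by (rule exit_in_closed[OF assms(3,1) partnerD(2)[OF assms(1,2)] link_sub[OF partnerD(1)[OF assms(1,2)]]])

lemma eps_odd:
  assumes "m \<in> MM" "{v, w} \<in> edges H" "partner m v \<noteq> w" "T X"
  shows "odd_cut (X \<inter> \<epsilon> {v, w}) \<longleftrightarrow> exit_point m X \<in> \<epsilon> {v, w}"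
  by (rule exit_in_closed[OF assms(4,1) closed_eps[OF assms(1-3)] subV[OF assms(2)]])

lemma odd_cut_link:
  assumes "{v, w} \<in> edges H" "fin_cut X"
  shows "odd_cut (X \<inter> link v w) \<longleftrightarrow> ((odd_cut (X \<inter> v) \<noteq> odd_cut (X \<inter> \<epsilon> {v, w})) \<noteq> odd_cut (X \<inter> w))"
proof -
  have vw: "v \<in> verts H" "w \<in> verts H" "v \<noteq> w" using edgeH[OF assms(1)] by blast+
  have f: "fin_cut (X \<inter> v)" "fin_cut (X \<inter> \<epsilon> {v, w})" "fin_cut (X \<inter> w)"
    using assms(2) tightv vw fin_cut_eps[OF assms(1)] by blast+
  have "X \<inter> link v w = ((X \<inter> v) \<union> (X \<inter> \<epsilon> {v, w})) \<union> (X \<inter> w)" unfolding link_def by blast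
  moreover have "odd_cut (((X \<inter> v) \<union> (X \<inter> \<epsilon> {v, w})) \<union> (X \<inter> w)) \<longleftrightarrow>
      odd_cut ((X \<inter> v) \<union> (X \<inter> \<epsilon> {v, w})) \<noteq> odd_cut (X \<inter> w)"
    using disjv[OF vw] disve[OF vw(2) assms(1)] f by (intro odd_cut_Un_disjoint) blast+
  moreover have "odd_cut ((X \<inter> v) \<union> (X \<inter> \<epsilon> {v, w})) \<longleftrightarrow> odd_cut (X \<inter> v) \<noteq> odd_cut (X \<inter> \<epsilon> {v, w})"
    using disve[OF vw(1) assms(1)] f by (intro odd_cut_Un_disjoint) blast+
  ultimately show ?thesis by simp
qed

end

section \<open>Tight sets and frames over bricks and braces\<close>

context matching_covered_graph
begin

text \<open>Let \<open>u\<close> and \<open>w\<close> be the neighbours of \<open>v\<close>. Every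
  matching uses \<open>uv\<close> or \<open>wv\<close>, so \<open>{v, u, w}\<close> is tight. As
  tight sets are trivial, the graph has four vertices, and it turns out to be a
  four-cycle.\<close>

lemma degree_two_cycle:
  assumes "BoB G M" "infinite V \<or> 4 \<le> card V" "v \<in> V"
    "\<And>y. {v, y} \<in> edges G \<Longrightarrow> y = a \<or> y = b"
  shows "is_cycle G"
proof -
  define u where "u = m0 v"
  have vu: "{v, u} \<in> edges G" "u \<in> V" "u \<noteq> v" unfolding u_def using mateD[OF m0(1) assms(3)] by blast+
  have V2: "V \<noteq> {v, u}"
  proof
    assume "V = {v, u}"
    then have "finite V" "card V \<le> 2" by (simp_all add: card_insert_if)
    then show False using assms(2) by simp
  qed
  have "\<exists>w. {v, w} \<in> edges G \<and> w \<noteq> u"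
  proof (rule ccontr)
    assume no: "\<not> ?thesis"
    have "{v, u} = V"
    proof (rule all_closed_V)
      show "{v, u} \<subseteq> V" using assms(3) vu by blast
      fix m assume m: "m \<in> MM"
      have "m v = u" using no mateD(1)[OF m assms(3)] by blast
      then show "closed_under m {v, u}" unfolding closed_under_def using mateD(2)[OF m assms(3)] by auto
    qed blast
    then show False using V2 by simp
  qed
  then obtain w where w: "{v, w} \<in> edges G" "w \<noteq> u" by blast
  have wV: "w \<in> V" "w \<noteq> v" using edgeD[OF w(1)] by blast+
  have nv: "y = u \<or> y = w" if "{v, y} \<in> edges G" for y
    using assms(4)[OF that] assms(4)[OF vu(1)] assms(4)[OF w(1)] w(2) by blast
  have mv: "m v = u \<or> m v = w" if "m \<in> MM" for m using nv mateD(1)[OF that assms(3)] by blast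
  have ex: "exits m {v, u, w} = {t}" if m: "m \<in> MM" and "m v = s" "s \<noteq> t" "{s, t} = {u, w}" for m s t
  proof -
    have st: "s \<in> V" "t \<in> V" "s \<noteq> v" "t \<noteq> v" using that vu w wV by (metis insertCI insertE singletonD)+
    have ms: "m s = v" using mateD(2)[OF m assms(3)] that by simp
    have "m t \<noteq> v" using mateD(2)[OF m st(2)] that by auto
    moreover have "m t \<noteq> s" using mateD(2)[OF m st(2)] ms st by auto
    moreover have "m t \<noteq> t" using mateD(4)[OF m st(2)] .
    ultimately have "m t \<notin> {v, s, t}" by blast
    moreover have "{v, u, w} = {v, s, t}" using that by auto
    ultimately show ?thesis unfolding exits_def using ms that(2) by auto
  qed
  \<comment> \<open>The exit is the neighbour of \<open>v\<close> that is not its mate.\<close>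
  have "T {v, u, w}"
  proof (rule tightI)
    show "{v, u, w} \<subseteq> V" using assms(3) vu wV by blast
    fix m assume m: "m \<in> MM"
    from mv[OF m] show "\<exists>x. exits m {v, u, w} = {x}"
      using ex[OF m _ w(2)[symmetric]] ex[OF m _ w(2)] by (metis insert_commute)
  qed
  then have "trivial_set G {v, u, w}" using assms(1) unfolding BoB_def by blast
  moreover have "card {v, u, w} = 3" using vu wV w by auto
  ultimately have "card (V - {v, u, w}) = 1" unfolding trivial_set_def by simp
  then obtain z where z: "V - {v, u, w} = {z}" by (meson card_1_singletonE)
  have zV: "z \<in> V" "z \<noteq> v" "z \<noteq> u" "z \<noteq> w" and V: "V = {v, u, w, z}"
    using z assms(3) vu wV by blast+
  have uw: "{u, w} \<notin> edges G"
  proof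
    assume "{u, w} \<in> edges G"
    then obtain m where m: "m \<in> MM" "m u = w" "m w = u" by (rule edge_mate)
    then show False using mv[OF m(1)] mateD(2)[OF m(1) assms(3)] vu wV by auto
  qed
  have vz: "{v, z} \<notin> edges G" using nv zV by blast
  have uz: "{s, z} \<in> edges G" if st: "s \<noteq> t" "{s, t} = {u, w}" for s t
  proof -
    have s: "s \<in> V" "t \<in> V" "{v, t} \<in> edges G" "s \<noteq> v" "{s, t} \<notin> edges G"
      using that vu w wV uw by (metis insertCI insertE singletonD)+
    obtain m where m: "m \<in> MM" "m v = t" "m t = v" by (rule edge_mate[OF s(3)])
    have "m s \<in> V" "m s \<noteq> s" using mateD[OF m(1) s(1)] by blast+
    moreover have "m s \<noteq> v" using mateD(2)[OF m(1) s(1)] m st by auto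
    moreover have "m s \<noteq> t" using mateD(1)[OF m(1) s(1)] s(5) by auto
    moreover have "V = {v, s, t, z}" using V st(2) by auto
    ultimately have "m s = z" by auto
    then show ?thesis using mateD(1)[OF m(1) s(1)] by auto
  qed
  have uzE: "{u, z} \<in> edges G" "{w, z} \<in> edges G" using uz w(2) by (metis insert_commute)+
  define c where "c i = [v, u, z, w] ! i" for i
  have c: "c 0 = v" "c (Suc 0) = u" "c 2 = z" "c 3 = w"
    unfolding c_def by (simp_all add: numeral_eq_Suc)
  have l4: "{..<4} = {0, Suc 0, 2, 3 :: nat}" by auto
  have "bij_betw c {..<4} V"
    unfolding bij_betw_def l4 V inj_on_def using c vu wV w zV by auto
  moreover have "edges G = {{c i, c (Suc i mod 4)} | i. i < 4}"
  proof -
    have "{{c i, c (Suc i mod 4)} | i. i < 4} = (\<lambda>i. {c i, c (Suc i mod 4)}) ` {..<4}" by auto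
    also have "\<dots> = {{v, u}, {u, z}, {z, w}, {w, v}}"
    proof -
      have "Suc 0 mod 4 = Suc 0" "Suc (Suc 0) mod 4 = 2" "Suc 2 mod 4 = 3" "Suc 3 mod 4 = (0::nat)" by auto
      then show ?thesis unfolding l4 by (simp only: image_insert image_empty c)
    qed
    finally have r: "{{c i, c (Suc i mod 4)} | i. i < 4} = {{v, u}, {u, z}, {z, w}, {w, v}}" .
    have "edges G \<subseteq> {{v, u}, {u, z}, {z, w}, {w, v}}"
    proof
      fix e assume e: "e \<in> edges G"
      obtain x y where xy: "e = {x, y}" "x \<in> V" "y \<in> V" "x \<noteq> y" by (rule simple_edgeE[OF simple e])
      then have "x \<in> {v, u, w, z}" "y \<in> {v, u, w, z}" using V by blast+
      then show "e \<in> {{v, u}, {u, z}, {z, w}, {w, v}}" using xy e uw vz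
        by (elim insertE emptyE) (simp_all add: insert_commute)
    qed
    moreover have "{{v, u}, {u, z}, {z, w}, {w, v}} \<subseteq> edges G"
      using vu uzE w by (simp add: insert_commute)
    ultimately show ?thesis unfolding r by (rule subset_antisym)
  qed
  ultimately show ?thesis unfolding is_cycle_def by (intro exI[of _ 4] conjI exI[of _ c]; (assumption | simp))
qed

end

context frame
begin

lemma link_eps_disj:
  assumes "{a, b} \<in> edges H" "{v, w} \<in> edges H" "{a, b} \<noteq> {v, w}"
  shows "link a b \<inter> \<epsilon> {v, w} = {}"
  unfolding link_def using disve[OF edgeH(1)[OF assms(1)] assms(2)] disve[OF edgeH(2)[OF assms(1)] assms(2)]
    dise[OF assms] by (simp add: Int_Un_distrib2)

text \<open>If a tight set \<open>X\<close> is odd on \<open>\<epsilon> e\<close> for an unmatched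
  edge \<open>e\<close>, it is even on all other units. On a matched edge the parities on its ends
  then differ iff \<open>X\<close> is odd on \<open>\<epsilon>\<close> of that edge.\<close>

lemma unit_unmatched:
  assumes m: "m \<in> MM" and X: "T X" and e: "{v, w} \<in> edges H" "partner m v \<noteq> w" "odd_cut (X \<inter> \<epsilon> {v, w})"
  shows "\<And>a. a \<in> verts H \<Longrightarrow> (odd_cut (X \<inter> a) \<noteq> odd_cut (X \<inter> partner m a)) = odd_cut (X \<inter> \<epsilon> {a, partner m a})"
    "\<And>a b. {a, b} \<in> edges H \<Longrightarrow> partner m a \<noteq> b \<Longrightarrow> odd_cut (X \<inter> \<epsilon> {a, b}) \<Longrightarrow> {a, b} = {v, w}"
proof -
  have x: "exit_point m X \<in> \<epsilon> {v, w}" using eps_odd[OF m e(1,2) X] e(3) by blast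
  show "(odd_cut (X \<inter> a) \<noteq> odd_cut (X \<inter> partner m a)) = odd_cut (X \<inter> \<epsilon> {a, partner m a})" if a: "a \<in> verts H" for a
  proof -
    have "{a, partner m a} \<noteq> {v, w}" using e(2) partner_partner[OF m a] by (auto simp: doubleton_eq_iff)
    then have "exit_point m X \<notin> link a (partner m a)" using link_eps_disj[OF partnerD(1)[OF m a] e(1)] x by blast
    then have "\<not> odd_cut (X \<inter> link a (partner m a))" using link_odd[OF m a X] by blast
    then show ?thesis using odd_cut_link[OF partnerD(1)[OF m a] fin_cut_tight[OF X]] by blast
  qed
  show "{a, b} = {v, w}" if "{a, b} \<in> edges H" "partner m a \<noteq> b" "odd_cut (X \<inter> \<epsilon> {a, b})" for a b
    using eps_odd[OF m that(1,2) X] that(3) x eps_eq[OF that(1) e(1)] by blast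
qed

text \<open>The same analysis when the odd unit is the link of a matched edge.\<close>

lemma unit_matched:
  assumes m: "m \<in> MM" and X: "T X" and v: "v \<in> verts H" "odd_cut (X \<inter> link v (partner m v))"
  shows "\<And>a. a \<in> verts H \<Longrightarrow> a \<noteq> v \<Longrightarrow> a \<noteq> partner m v \<Longrightarrow>
      (odd_cut (X \<inter> a) \<noteq> odd_cut (X \<inter> partner m a)) = odd_cut (X \<inter> \<epsilon> {a, partner m a})"
    "\<And>a b. {a, b} \<in> edges H \<Longrightarrow> partner m a \<noteq> b \<Longrightarrow> \<not> odd_cut (X \<inter> \<epsilon> {a, b})"
proof -
  have x: "exit_point m X \<in> link v (partner m v)" using link_odd[OF m v(1) X] v(2) by blast
  show "(odd_cut (X \<inter> a) \<noteq> odd_cut (X \<inter> partner m a)) = odd_cut (X \<inter> \<epsilon> {a, partner m a})"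
    if a: "a \<in> verts H" "a \<noteq> v" "a \<noteq> partner m v" for a
  proof -
    have ne: "partner m a \<noteq> v" "partner m a \<noteq> partner m v" using a partner_partner[OF m a(1)] partner_partner[OF m v(1)] by metis+
    have "link a (partner m a) \<inter> link v (partner m v) = {}"
      by (rule link_disj[OF partnerD(1)[OF m a(1)] partnerD(1)[OF m v(1)] a(2,3) ne])
    then have "\<not> odd_cut (X \<inter> link a (partner m a))" using link_odd[OF m a(1) X] x by blast
    then show ?thesis using odd_cut_link[OF partnerD(1)[OF m a(1)] fin_cut_tight[OF X]] by blast
  qed
  show "\<not> odd_cut (X \<inter> \<epsilon> {a, b})" if "{a, b} \<in> edges H" "partner m a \<noteq> b" for a b
  proof -
    have "{v, partner m v} \<noteq> {a, b}" using that partner_partner[OF m v(1)] by (auto simp: doubleton_eq_iff)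
    then have "exit_point m X \<notin> \<epsilon> {a, b}" using link_eps_disj[OF partnerD(1)[OF m v(1)] that(1)] x by blast
    then show ?thesis using eps_odd[OF m that X] by blast
  qed
qed

lemma odd_unit_ex:
  assumes m: "m \<in> MM" and X: "T X"
  shows "(\<exists>v\<in>verts H. odd_cut (X \<inter> link v (partner m v))) \<or> (\<exists>v w. {v, w} \<in> edges H \<and> partner m v \<noteq> w \<and> odd_cut (X \<inter> \<epsilon> {v, w}))"
  using unit_cases[OF m exit_point(5)[OF X m]] link_odd[OF m _ X] eps_odd[OF m _ _ X] by blast

lemma parity_constant:
  assumes "\<And>a b. {a, b} \<in> edges H \<Longrightarrow> p a = p b" "v \<in> verts H" "w \<in> verts H"
  shows "p v = p w"
proof (rule ccontr)
  assume ne: "p v \<noteq> p w"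
  let ?X = "{a \<in> verts H. p a = p v}"
  have "w \<notin> ?X" "v \<in> ?X" using ne assms(2) by auto
  then have "?X \<subseteq> verts H" "?X \<noteq> {}" "?X \<noteq> verts H" using assms(3) by blast+
  then obtain x y where "x \<in> ?X" "y \<in> verts H" "y \<notin> ?X" "{x, y} \<in> edges H" by (rule Q.cross_edge)
  then show False using assms(1)[of x y] by auto
qed

text \<open>Transfers a tight set \<open>X\<close> of \<open>G\<close> to \<open>H\<close>:
  collect the vertices on which \<open>X\<close> is odd. If the set \<open>D\<close> of edges with
  \<open>X \<inter> \<epsilon> e\<close> odd is a matching whose edges join odd to even vertices,
  then the vertices covered by \<open>D\<close> can be included or excluded edge by edge. The
  freedom in \<open>D'\<close> produces several tight sets, which are then too many for a brick or
  brace.\<close>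

lemma tight_in_quotient:
  fixes X
  defines "D \<equiv> {e \<in> edges H. odd_cut (X \<inter> \<epsilon> e)}"
  assumes X: "T X"
    and S1: "\<And>a b c. {a, b} \<in> D \<Longrightarrow> {a, c} \<in> D \<Longrightarrow> b = c"
    and S2: "\<And>a b. {a, b} \<in> D \<Longrightarrow> odd_cut (X \<inter> a) \<noteq> odd_cut (X \<inter> b)"
    and D': "D' \<subseteq> D"
  shows "tight H MH ({v \<in> verts H. odd_cut (X \<inter> v) \<and> v \<notin> \<Union>D} \<union> \<Union>D')"
proof -
  let ?p = "\<lambda>v. odd_cut (X \<inter> v)"
  define Y where "Y = {v \<in> verts H. ?p v \<and> v \<notin> \<Union>D} \<union> \<Union>D'"
  have inD: "\<exists>c. {a, c} \<in> D" if a: "a \<in> \<Union>D" for a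
  proof -
    obtain e where e: "e \<in> D" "a \<in> e" using a by blast
    then have "e \<in> edges H" unfolding D_def by blast
    then obtain x y where "e = {x, y}" "x \<in> verts H" "y \<in> verts H" "x \<noteq> y" by (rule edgeHE)
    then show ?thesis using e by (metis insertE insert_commute singletonD)
  qed
  have YW: "v \<in> Y \<longleftrightarrow> {v, c} \<in> D'" if "{v, c} \<in> D" for v c
  proof
    assume "v \<in> Y"
    moreover have "v \<in> \<Union>D" using that by blast
    ultimately obtain e where e: "e \<in> D'" "v \<in> e" unfolding Y_def by blast
    then have "e \<in> edges H" "e \<in> D" using D' unfolding D_def by blast+
    obtain x y where xy: "e = {x, y}" "x \<in> verts H" "y \<in> verts H" "x \<noteq> y"
      by (rule edgeHE[OF \<open>e \<in> edges H\<close>])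
    then obtain d where d: "e = {v, d}" using e(2) by (metis insertE insert_commute singletonD)
    then have "c = d" using S1[OF that] \<open>e \<in> D\<close> by blast
    then show "{v, c} \<in> D'" using e d by simp
  next
    assume "{v, c} \<in> D'"
    then show "v \<in> Y" unfolding Y_def by blast
  qed
  have Yp: "v \<in> Y \<longleftrightarrow> ?p v" if "v \<in> verts H" "v \<notin> \<Union>D" for v
    using that D' unfolding Y_def by blast
  have YV: "Y \<subseteq> verts H" using D' simpleH unfolding Y_def D_def simple_graph_def by blast
  have "tight H MH Y"
  proof (rule Q.tightI[OF YV])
    fix n assume "n \<in> mates H MH"
    then obtain m where m: "m \<in> MM" "\<And>v. v \<in> verts H \<Longrightarrow> partner m v = n v" using lift by blast
    have ex_eq: "exits n Y = exits (partner m) Y" using m(2) YV unfolding exits_def by auto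
    consider (mat) v where "v \<in> verts H" "odd_cut (X \<inter> link v (partner m v))"
      | (unm) a b where "{a, b} \<in> edges H" "partner m a \<noteq> b" "odd_cut (X \<inter> \<epsilon> {a, b})"
      using odd_unit_ex[OF m(1) X] by blast
    then have "\<exists>x. exits (partner m) Y = {x}"
    proof cases
      case mat
      note M1 = unit_matched[OF m(1) X mat]
      have all: "partner m a = b" if "{a, b} \<in> D" for a b using M1(2)[of a b] that unfolding D_def by blast
      define w where "w = partner m v"
      have w: "w \<in> verts H" "{v, w} \<in> edges H" "partner m w = v" "w \<noteq> v"
        unfolding w_def using partnerD[OF m(1) mat(1)] partner_partner[OF m(1) mat(1)] by blast+
      have "{v, w} \<notin> D"
      proof
        assume "{v, w} \<in> D"
        then have "?p v \<noteq> ?p w" "odd_cut (X \<inter> \<epsilon> {v, w})" using S2 unfolding D_def by blast+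
        then show False using mat(2) odd_cut_link[OF w(2) fin_cut_tight[OF X]] unfolding w_def by blast
      qed
      then have nW: "v \<notin> \<Union>D" "w \<notin> \<Union>D" using inD all w unfolding w_def by (metis, metis insert_commute)
      have "\<not> odd_cut (X \<inter> \<epsilon> {v, w})" using \<open>{v, w} \<notin> D\<close> w(2) unfolding D_def by blast
      then have pne: "?p v \<noteq> ?p w" using mat(2) odd_cut_link[OF w(2) fin_cut_tight[OF X]] unfolding w_def by blast
      have other: "partner m a \<in> Y" if a: "a \<in> Y" "a \<noteq> v" "a \<noteq> w" for a
      proof (cases "a \<in> \<Union>D")
        case True
        then obtain c where c: "{a, c} \<in> D" using inD by blast
        then have "partner m a = c" "{c, a} \<in> D" using all by (auto simp: insert_commute)
        moreover have "{a, c} \<in> D'" using YW[OF c] a by blast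
        ultimately show ?thesis using YW[of c a] by (simp add: insert_commute)
      next
        case False
        have aV: "a \<in> verts H" using a YV by blast
        have aW: "partner m a \<notin> \<Union>D"
        proof
          assume "partner m a \<in> \<Union>D"
          then obtain c where c: "{partner m a, c} \<in> D" using inD by blast
          then have "c = a" using all partner_partner[OF m(1) aV] by metis
          then show False using False c by blast
        qed
        have "{a, partner m a} \<notin> D" using False by blast
        then have "\<not> odd_cut (X \<inter> \<epsilon> {a, partner m a})" using partnerD(1)[OF m(1) aV] unfolding D_def by blast
        then have "?p a = ?p (partner m a)" using M1(1)[OF aV] a unfolding w_def by blast
        then show ?thesis using Yp[OF aV False] Yp[OF partnerD(3)[OF m(1) aV] aW] a by blast
      qed
      have vwY: "v \<in> Y \<longleftrightarrow> ?p v" "w \<in> Y \<longleftrightarrow> ?p w" using Yp nW mat(1) w(1) by blast+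
      have mv: "partner m v = w" unfolding w_def by simp
      show ?thesis
      proof (cases "?p v")
        case True
        then have "v \<in> Y" "w \<notin> Y" using vwY pne by blast+
        then have "exits (partner m) Y = {v}" using other mv unfolding exits_def by blast
        then show ?thesis by blast
      next
        case False
        then have "w \<in> Y" "v \<notin> Y" using vwY pne by blast+
        then have "exits (partner m) Y = {w}" using other w(3) unfolding exits_def by blast
        then show ?thesis by blast
      qed
    next
      case unm
      obtain a b where ab: "{a, b} \<in> edges H" "partner m a \<noteq> b" "odd_cut (X \<inter> \<epsilon> {a, b})" "?p a" "\<not> ?p b"
      proof -
        have ba: "{b, a} \<in> edges H" "partner m b \<noteq> a" "odd_cut (X \<inter> \<epsilon> {b, a})"
          using edgeH_sym[OF unm(1)] unm(2,3) partner_sym[OF m(1) edgeH(2)[OF unm(1)], of a]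
          by (blast, blast, simp add: insert_commute)
        have "?p a \<noteq> ?p b" using S2 unm unfolding D_def by blast
        then show ?thesis using that[OF unm] that[OF ba] by blast
      qed
      note M2 = unit_unmatched[OF m(1) X ab(1-3)]
      have abV: "a \<in> verts H" "b \<in> verts H" "a \<noteq> b" using edgeH[OF ab(1)] by blast+
      have abD: "{a, b} \<in> D" "{b, a} \<in> D" using ab unfolding D_def by (auto simp: insert_commute)
      have all: "partner m x = y" if "{x, y} \<in> D" "{x, y} \<noteq> {a, b}" for x y
        using M2(2)[of x y] that unfolding D_def by blast
      define a' b' where "a' = partner m a" and "b' = partner m b"
      have a': "a' \<in> verts H" "partner m a' = a" "a' \<noteq> a" "a' \<noteq> b" "{a, a'} \<in> edges H"
        unfolding a'_def using partnerD[OF m(1) abV(1)] partner_partner[OF m(1) abV(1)] ab(2) by blast+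
      have b': "b' \<in> verts H" "partner m b' = b" "b' \<noteq> b" "b' \<noteq> a" "{b, b'} \<in> edges H"
        unfolding b'_def using partnerD[OF m(1) abV(2)] partner_partner[OF m(1) abV(2)] ab(2) by blast+
      have notW: "partner m x \<notin> \<Union>D" if x: "x \<in> verts H" "x \<in> {a, b} \<or> x \<notin> \<Union>D" "partner m x \<notin> {a, b}" for x
      proof
        assume "partner m x \<in> \<Union>D"
        then obtain c where c: "{partner m x, c} \<in> D" using inD by blast
        have "{partner m x, c} \<noteq> {a, b}" using x by blast
        then have "c = x" using all[OF c] partner_partner[OF m(1) x(1)] by metis
        then have xD: "{x, partner m x} \<in> D" using c by (simp add: insert_commute)
        then have "x \<in> {a, b}" using x by blast
        then show False using S1[OF xD] abD x(3) by blast
      qed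
      have nW: "a' \<notin> \<Union>D" "b' \<notin> \<Union>D"
        using notW[OF abV(1)] notW[OF abV(2)] a' b' unfolding a'_def b'_def by blast+
      have pe: "?p x = ?p (partner m x)" if "x \<in> verts H" "partner m x \<notin> \<Union>D" for x
      proof -
        have "{x, partner m x} \<notin> D" using that by blast
        then have "\<not> odd_cut (X \<inter> \<epsilon> {x, partner m x})" using partnerD(1)[OF m(1) that(1)] unfolding D_def by blast
        then show ?thesis using M2(1)[OF that(1)] by blast
      qed
      have aY: "a' \<in> Y" "b' \<notin> Y"
        using Yp[OF a'(1) nW(1)] Yp[OF b'(1) nW(2)] pe[OF abV(1)] pe[OF abV(2)] nW ab(4,5)
        unfolding a'_def b'_def by blast+
      have ab_iff: "a \<in> Y \<longleftrightarrow> {a, b} \<in> D'" "b \<in> Y \<longleftrightarrow> {a, b} \<in> D'"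
        using YW[OF abD(1)] YW[OF abD(2)] by (auto simp: insert_commute)
      have other: "partner m x \<in> Y" if x: "x \<in> Y" "x \<noteq> a" "x \<noteq> b" "x \<noteq> a'" for x
      proof (cases "x \<in> \<Union>D")
        case True
        then obtain c where c: "{x, c} \<in> D" using inD by blast
        have "{x, c} \<noteq> {a, b}" using x by blast
        then have "partner m x = c" "{c, x} \<in> D" using all[OF c] c by (auto simp: insert_commute)
        moreover have "{x, c} \<in> D'" using YW[OF c] x by blast
        ultimately show ?thesis using YW[of c x] by (simp add: insert_commute)
      next
        case False
        have xV: "x \<in> verts H" using x YV by blast
        have "partner m x \<notin> {a, b}"
        proof
          assume "partner m x \<in> {a, b}"
          then have "x = a' \<or> x = b'" using partner_partner[OF m(1) xV] unfolding a'_def b'_def by auto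
          then show False using x aY by blast
        qed
        then have "partner m x \<notin> \<Union>D" using notW[OF xV] False by blast
        then show ?thesis using Yp[OF xV False] Yp[OF partnerD(3)[OF m(1) xV]] pe[OF xV] x by blast
      qed
      show ?thesis
      proof (cases "{a, b} \<in> D'")
        case True
        have "exits (partner m) Y = {b}"
        proof
          show "{b} \<subseteq> exits (partner m) Y" unfolding exits_def using True ab_iff aY b'_def by blast
          show "exits (partner m) Y \<subseteq> {b}"
          proof
            fix x assume "x \<in> exits (partner m) Y"
            then have x: "x \<in> Y" "partner m x \<notin> Y" unfolding exits_def by blast+
            have "x \<noteq> a" using x(2) aY(1) a'_def by blast
            moreover have "x \<noteq> a'" using x(2) a'(2) ab_iff True by auto
            ultimately show "x \<in> {b}" using other[OF x(1)] x(2) by blast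
          qed
        qed
        then show ?thesis by blast
      next
        case False
        have "exits (partner m) Y = {a'}"
        proof
          show "{a'} \<subseteq> exits (partner m) Y" unfolding exits_def using False ab_iff aY a'(2) by simp
          show "exits (partner m) Y \<subseteq> {a'}"
          proof
            fix x assume "x \<in> exits (partner m) Y"
            then have x: "x \<in> Y" "partner m x \<notin> Y" unfolding exits_def by blast+
            then show "x \<in> {a'}" using other[OF x(1)] ab_iff False by blast
          qed
        qed
        then show ?thesis by blast
      qed
    qed
    then show "\<exists>x. exits n Y = {x}" using ex_eq by simp
  qed
  then show ?thesis unfolding Y_def .
qed

text \<open>First, \<open>D\<close> satisfies the conditions of \<open>tight_in_quotient\<close>:
  two edges of \<open>D\<close> at a vertex \<open>a\<close> leave no third edge at
  \<open>a\<close>, and an edge of \<open>D\<close> with ends of equal parity would make the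
  parity constant. If \<open>D\<close> contained \<open>ab\<close>, both \<open>O0\<close> and
  \<open>O0 \<union> {a, b}\<close> would be tight in \<open>H\<close>, which leaves
  \<open>a\<close> with two neighbours. So \<open>D\<close> is empty, and the set
  \<open>O0\<close> of odd vertices is trivial. As its complement has two elements by hypothesis,
  it is a singleton.\<close>

theorem brick_or_brace_pattern:
  assumes bob: "BoB H MH" and nc: "\<not> is_cycle H" and large: "infinite (verts H) \<or> 4 \<le> card (verts H)"
    and X: "T X" and v0: "v0 \<in> verts H" "odd_cut (X \<inter> v0)"
    and v12: "v1 \<in> verts H" "v2 \<in> verts H" "v1 \<noteq> v2" "\<not> odd_cut (X \<inter> v1)" "\<not> odd_cut (X \<inter> v2)"
  shows "\<And>e. e \<in> edges H \<Longrightarrow> \<not> odd_cut (X \<inter> \<epsilon> e)"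
    "\<And>v. v \<in> verts H \<Longrightarrow> odd_cut (X \<inter> v) \<longleftrightarrow> v = v0"
proof -
  let ?p = "\<lambda>v. odd_cut (X \<inter> v)"
  define D where "D = {e \<in> edges H. odd_cut (X \<inter> \<epsilon> e)}"
  have deg: False if "v \<in> verts H" "\<And>y. {v, y} \<in> edges H \<Longrightarrow> y = a \<or> y = b" for v a b
    using Q.degree_two_cycle[OF bob large that] nc by blast
  have DE: "{a, b} \<in> edges H" "odd_cut (X \<inter> \<epsilon> {a, b})" if "{a, b} \<in> D" for a b
    using that unfolding D_def by blast+
  have S1: "b = c" if ab: "{a, b} \<in> D" and ac: "{a, c} \<in> D" for a b c
  proof (rule ccontr)
    assume ne: "b \<noteq> c"
    show False
    proof (rule deg[of a])
      show "a \<in> verts H" using edgeH DE(1)[OF ab] by blast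
      fix y assume "{a, y} \<in> edges H"
      then obtain m where m: "m \<in> MM" "partner m a = y" "partner m y = a" by (rule edge_real)
      show "y = b \<or> y = c"
      proof (rule ccontr)
        assume "\<not> (y = b \<or> y = c)"
        then have "{a, c} = {a, b}"
          using unit_unmatched(2)[OF m(1) X DE(1)[OF ab] _ DE(2)[OF ab] DE(1)[OF ac] _ DE(2)[OF ac]] m(2) by blast
        then show False using ne by (simp add: doubleton_eq_iff)
      qed
    qed
  qed
  have other_edge: "\<exists>m\<in>MM. partner m a \<noteq> b" if a: "a \<in> verts H" for a b
  proof (rule ccontr)
    assume no: "\<not> ?thesis"
    show False
    proof (rule deg[OF a])
      fix y assume "{a, y} \<in> edges H"
      then obtain m where "m \<in> MM" "partner m a = y" "partner m y = a" by (rule edge_real)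
      then show "y = b \<or> y = b" using no by blast
    qed
  qed
  have nonconst: "\<exists>a b. {a, b} \<in> edges H \<and> ?p a \<noteq> ?p b"
    using parity_constant[of ?p v0 v1] v0 v12 by blast
  have S2: "?p a \<noteq> ?p b" if ab: "{a, b} \<in> D" for a b
  proof
    assume eq: "?p a = ?p b"
    have aV: "a \<in> verts H" "b \<in> verts H" using edgeH[OF DE(1)[OF ab]] by blast+
    have only: "{c, d} = {a, b}" if cd: "{c, d} \<in> D" for c d
    proof (rule ccontr)
      assume ne: "{c, d} \<noteq> {a, b}"
      have cV: "c \<in> verts H" using edgeH[OF DE(1)[OF cd]] by blast
      obtain m2 where m2: "m2 \<in> MM" "partner m2 c \<noteq> d" using other_edge[OF cV, of d] by blast
      note A2 = unit_unmatched[OF m2(1) X DE(1)[OF cd] m2(2) DE(2)[OF cd]]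
      have "partner m2 a = b" using A2(2)[OF DE(1)[OF ab] _ DE(2)[OF ab]] ne by blast
      then show False using A2(1)[OF aV(1)] eq DE(2)[OF ab] by simp
    qed
    have "?p x = ?p y" if xy: "{x, y} \<in> edges H" for x y
    proof (cases "{x, y} = {a, b}")
      case True
      then show ?thesis using eq by (auto simp: doubleton_eq_iff)
    next
      case False
      then have nq: "\<not> odd_cut (X \<inter> \<epsilon> {x, y})" using only xy unfolding D_def by blast
      have xV: "x \<in> verts H" using edgeH[OF xy] by blast
      obtain m where m: "m \<in> MM" "partner m x = y" "partner m y = x" using xy by (rule edge_real)
      show ?thesis
      proof (cases "partner m a = b")
        case False
        show ?thesis using unit_unmatched(1)[OF m(1) X DE(1)[OF ab] False DE(2)[OF ab] xV] m(2) nq by simp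
      next
        case True
        have "odd_cut (X \<inter> link a (partner m a))"
          using odd_cut_link[OF DE(1)[OF ab] fin_cut_tight[OF X]] True eq DE(2)[OF ab] by simp
        note A3 = unit_matched(1)[OF m(1) X aV(1) this xV]
        have "x \<noteq> a" "x \<noteq> b" using False True m partner_partner[OF m(1) aV(1)] by (auto simp: insert_commute)
        then show ?thesis using A3 True m(2) nq by simp
      qed
    qed
    then show False using nonconst by blast
  qed
  \<comment> \<open>The odd vertices off \<open>D\<close>, with any choice of edges of
    \<open>D\<close> added, form a tight set of \<open>H\<close>.\<close>
  have tq: "tight H MH ({v \<in> verts H. ?p v \<and> v \<notin> \<Union>D} \<union> \<Union>D')" if "D' \<subseteq> D" for D'
    by (rule tight_in_quotient[OF X, folded D_def]) (fact S1, fact S2, fact that)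
  have triv: "card Y = 1 \<or> card (verts H - Y) = 1" if "tight H MH Y" for Y
    using bob that unfolding BoB_def trivial_set_def by blast
  have not1: "card A \<noteq> 1" if "x \<in> A" "y \<in> A" "x \<noteq> y" for A and x y :: "'v set"
    using that by (metis card_1_singletonE singletonD)
  define O0 where "O0 = {v \<in> verts H. ?p v \<and> v \<notin> \<Union>D}"
  have "D = {}"
  proof (rule ccontr)
    assume "D \<noteq> {}"
    then obtain e where e: "e \<in> D" by blast
    then have "e \<in> edges H" unfolding D_def by blast
    then obtain a0 b0 where ab0: "e = {a0, b0}" "a0 \<in> verts H" "b0 \<in> verts H" "a0 \<noteq> b0" by (rule edgeHE)
    obtain a b where ab: "e = {a, b}" "?p a" "\<not> ?p b"
      using S2[of a0 b0] e ab0(1) by (metis insert_commute)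
    have abV: "a \<in> verts H" "b \<in> verts H" "a \<noteq> b" using edgeH[of a b] \<open>e \<in> edges H\<close> ab by blast+
    have abD: "{a, b} \<in> D" using e ab by simp
    have abO: "a \<notin> O0" "b \<notin> O0" unfolding O0_def using abD by blast+
    have "tight H MH O0" "tight H MH (O0 \<union> {a, b})"
      using tq[of "{}"] tq[of "{{a, b}}"] abD unfolding O0_def by simp_all
    then have t: "card O0 = 1" "card (O0 \<union> {a, b}) = 1 \<or> card (verts H - (O0 \<union> {a, b})) = 1"
      using triv[of O0] triv[of "O0 \<union> {a, b}"] not1[of a "verts H - O0" b] abV abO by blast+
    then obtain z where z: "O0 = {z}" by (meson card_1_singletonE)
    show False
    \<comment> \<open>Any neighbour of \<open>a\<close> other than \<open>b\<close> is an odd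
      vertex off \<open>D\<close>, so it is \<open>z\<close>.\<close>
    proof (rule deg[OF abV(1), of b z])
      fix t assume "{a, t} \<in> edges H"
      then obtain m where m: "m \<in> MM" "partner m a = t" "partner m t = a" by (rule edge_real)
      show "t = b \<or> t = z"
      proof (cases "t = b")
        case False
        have tV: "t \<in> verts H" "t \<noteq> a" using edgeH[OF \<open>{a, t} \<in> edges H\<close>] by blast+
        note A = unit_unmatched[OF m(1) X DE(1)[OF abD] _ DE(2)[OF abD], unfolded m(2), OF False]
        have mat: "partner m x = y" if "{x, y} \<in> D" "{x, y} \<noteq> {a, b}" for x y
          using A(2)[OF DE(1)[OF that(1)] _ DE(2)[OF that(1)]] that(2) by blast
        have tW: "t \<notin> \<Union>D"
        proof
          assume "t \<in> \<Union>D"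
          then obtain f where f: "f \<in> D" "t \<in> f" by blast
          then have "f \<in> edges H" unfolding D_def by blast
          then obtain x y where "f = {x, y}" "x \<in> verts H" "y \<in> verts H" "x \<noteq> y" by (rule edgeHE)
          then obtain c where c: "{t, c} \<in> D" using f by (metis insertE insert_commute singletonD)
          have "{t, c} \<noteq> {a, b}" using tV False by blast
          then have "c = a" using mat[OF c] m(3) by simp
          then have "{a, t} \<in> D" using c by (simp add: insert_commute)
          then show False using S1[OF abD] False by blast
        qed
        then have "{a, t} \<notin> D" by blast
        then have "\<not> odd_cut (X \<inter> \<epsilon> {a, t})" using \<open>{a, t} \<in> edges H\<close> unfolding D_def by blast
        then have "?p t" using A(1)[OF abV(1)] m(2) ab(2) by simp
        then have "t \<in> O0" unfolding O0_def using tV tW by blast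
        then show ?thesis using z by blast
      qed blast
    qed
  qed
  then show "\<And>e. e \<in> edges H \<Longrightarrow> \<not> odd_cut (X \<inter> \<epsilon> e)" unfolding D_def by blast
  have O0: "O0 = {v \<in> verts H. ?p v}" unfolding O0_def using \<open>D = {}\<close> by blast
  have "tight H MH O0" using tq[of "{}"] unfolding O0_def by simp
  then have "card O0 = 1" using triv[of O0] not1[of v1 "verts H - O0" v2] v12 O0 by blast
  then obtain z where "O0 = {z}" by (meson card_1_singletonE)
  then have "O0 = {v0}" using v0 O0 by blast
  then show "?p v \<longleftrightarrow> v = v0" if "v \<in> verts H" for v using that O0 by blast
qed

end

section \<open>Torsoids are determined by their vertices\<close>

lemma collapse_simps: "verts (collapse G \<P>) = \<P>"
  "{v, w} \<in> edges (collapse G \<P>) \<longleftrightarrow> v \<in> \<P> \<and> w \<in> \<P> \<and> v \<noteq> w \<and> edge_between (edges G) v w"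
proof -
  show "verts (collapse G \<P>) = \<P>" unfolding collapse_def by simp
  have sym: "edge_between (edges G) v w \<longleftrightarrow> edge_between (edges G) w v" for v w
    unfolding edge_between_def by (metis insert_commute)
  have "{v, w} \<in> edges (collapse G \<P>) \<longleftrightarrow>
      (\<exists>P Q. {v, w} = {P, Q} \<and> P \<in> \<P> \<and> Q \<in> \<P> \<and> P \<noteq> Q \<and> edge_between (edges G) P Q)"
    unfolding collapse_def quotient_edges_def by simp
  then show "{v, w} \<in> edges (collapse G \<P>) \<longleftrightarrow>
      v \<in> \<P> \<and> w \<in> \<P> \<and> v \<noteq> w \<and> edge_between (edges G) v w"
    using sym by (metis doubleton_eq_iff)
qed

lemma torsoidD:
  assumes "torsoid G M (H, \<epsilon>)"
  shows "matching_covered H (torsoid_matching M H \<epsilon>)"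
    "infinite (verts H) \<or> 4 \<le> card (verts H)"
    "BoB H (torsoid_matching M H \<epsilon>) \<or> is_cycle H"
    "\<forall>v\<in>verts H. tight G M v"
    "\<epsilon> \<in> edges H \<rightarrow>\<^sub>E Pow (verts G)" "disjoint (verts H)" "disjoint_family_on \<epsilon> (edges H)"
    "\<forall>v\<in>verts H. \<forall>e\<in>edges H. v \<inter> \<epsilon> e = {}" "\<Union>(verts H) \<union> \<Union>(\<epsilon> ` edges H) = verts G"
    "\<forall>v w. {v, w} \<in> edges H \<longrightarrow>
        edge_between (edges G) (v \<union> \<epsilon> {v, w}) w \<and>
        passable G M (\<epsilon> {v, w}) v \<and> passable G M (\<epsilon> {v, w}) w \<and>
        (\<forall>S. S \<subseteq> v \<union> \<epsilon> {v, w} \<union> w \<and> passable G M S v \<and> passable G M S w \<longrightarrow>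
             S \<subseteq> \<epsilon> {v, w})"
    "\<forall>v\<in>verts H. \<forall>w\<in>verts H. v \<noteq> w \<and> {v, w} \<notin> edges H \<longrightarrow>
        \<not> edge_between (edges G) v w"
    "is_cycle H \<longrightarrow> (\<forall>u v w. {u, v} \<in> edges H \<and> {v, w} \<in> edges H \<and> u \<noteq> w \<longrightarrow>
        \<not> (\<exists>P1 P2 P3. tight G M P1 \<and> tight G M P2 \<and> tight G M P3 \<and>
             P1 \<inter> P2 = {} \<and> P1 \<inter> P3 = {} \<and> P2 \<inter> P3 = {} \<and>
             P1 \<union> P2 \<union> P3 = \<epsilon> {u, v} \<union> v \<union> \<epsilon> {v, w} \<and>
             tight G M (u \<union> P1 \<union> P2) \<and> tight G M (P2 \<union> P3 \<union> w)))"
  using assms unfolding torsoid_def prod.case by - (elim conjE, assumption)+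

lemma frame_if_torsoid:
  assumes "matching_covered G M" "torsoid G M (H, \<epsilon>)"
  shows "frame G M H \<epsilon>"
proof -
  note t = torsoidD[OF assms(2)]
  note t1 = t(1,4-9)
  have t5: "edge_between (edges G) (v \<union> \<epsilon> {v, w}) w" "passable G M (\<epsilon> {v, w}) v"
    if "{v, w} \<in> edges H" for v w
    using t(10) that by blast+
  have t6: "\<not> edge_between (edges G) v w"
    if "v \<in> verts H" "w \<in> verts H" "v \<noteq> w" "{v, w} \<notin> edges H" for v w
    using t(11) that by blast
  interpret matching_covered_graph G M by unfold_locales (rule assms(1))
  show ?thesis
  proof (unfold_locales)
    show "simple_graph H" using t1(1) unfolding matching_covered_def by blast
    show "T v" if "v \<in> verts H" for v using t1(2) that by blast
    show "v \<inter> w = {}" if "v \<in> verts H" "w \<in> verts H" "v \<noteq> w" for v w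
      using t1(4) that by (simp add: disjointD)
    show "\<epsilon> e \<inter> \<epsilon> f = {}" if "e \<in> edges H" "f \<in> edges H" "e \<noteq> f" for e f
      using t1(5) that unfolding disjoint_family_on_def by blast
    show "v \<inter> \<epsilon> e = {}" if "v \<in> verts H" "e \<in> edges H" for v e using t1(6) that by blast
    show "(\<exists>v\<in>verts H. x \<in> v) \<or> (\<exists>e\<in>edges H. x \<in> \<epsilon> e)" if "x \<in> V" for x
      using t1(7) that by blast
    show "\<epsilon> e \<subseteq> V" if "e \<in> edges H" for e using t1(7) that by blast
    show "\<exists>x\<in>v \<union> \<epsilon> {v, w}. \<exists>y\<in>w. {x, y} \<in> edges G" if "{v, w} \<in> edges H" for v w
      using t5(1)[OF that] unfolding edge_between_def .
    show "T (v \<union> \<epsilon> {v, w})" if "{v, w} \<in> edges H" for v w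
      using t5(2)[OF that] unfolding passable_def by blast
    show "{v, w} \<in> edges H"
      if "v \<in> verts H" "w \<in> verts H" "v \<noteq> w" "x \<in> v" "y \<in> w" "{x, y} \<in> edges G" for v w x y
      using t6[OF that(1-3)] that(4-6) unfolding edge_between_def by blast
  qed
qed

locale maximal_frame = frame +
  assumes maximal: "{v, w} \<in> edges H \<Longrightarrow> S \<subseteq> v \<union> \<epsilon> {v, w} \<union> w \<Longrightarrow> passable G M S v \<Longrightarrow>
    passable G M S w \<Longrightarrow> S \<subseteq> \<epsilon> {v, w}"

lemma maximal_frame_if_torsoid:
  assumes "matching_covered G M" "torsoid G M (H, \<epsilon>)"
  shows "maximal_frame G M H \<epsilon>"
proof -
  interpret frame G M H \<epsilon> by (rule frame_if_torsoid[OF assms])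
  show ?thesis
  proof unfold_locales
    fix v w S
    assume "{v, w} \<in> edges H" "S \<subseteq> v \<union> \<epsilon> {v, w} \<union> w" "passable G M S v" "passable G M S w"
    then show "S \<subseteq> \<epsilon> {v, w}" using torsoidD(10)[OF assms(2)] by blast
  qed
qed

context maximal_frame
begin

text \<open>Parts of a vertex \<open>v\<close> that only see one link can be moved into
  \<open>\<epsilon>\<close>; as \<open>\<epsilon>\<close> is largest, they are empty.\<close>

lemma pocket:
  assumes "{v, w} \<in> edges H" "K \<subseteq> v" "T (v - K)"
    "\<And>x y. x \<in> K \<Longrightarrow> y \<notin> v \<Longrightarrow> {x, y} \<in> edges G \<Longrightarrow> y \<in> link v w"
  shows "K = {}"
proof -
  have vw: "v \<in> verts H" "w \<in> verts H" "v \<noteq> w" using edgeH[OF assms(1)] by blast+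
  let ?E = "\<epsilon> {v, w}"
  let ?Z = "K \<union> ?E"
  have vE: "v \<inter> ?E = {}" "w \<inter> ?E = {}" "v \<inter> w = {}" using disve assms(1) vw disjv by blast+
  have Kv: "K = v - (v - K)" using assms(2) by blast
  have fK: "fin_cut K" using fin_cut_Diff[OF fin_cut_tight[OF tightv[OF vw(1)]] fin_cut_tight[OF assms(3)]] Kv by simp
  have "odd_cut K \<longleftrightarrow> odd_cut v \<noteq> odd_cut (v - K)"
    using odd_cut_Diff_sub[OF fin_cut_tight[OF tightv[OF vw(1)]] fin_cut_tight[OF assms(3)]] Kv by auto
  then have eK: "\<not> odd_cut K" using odd_cut_tight assms(3) tightv[OF vw(1)] by blast
  have "odd_cut ?Z \<longleftrightarrow> odd_cut K \<noteq> odd_cut ?E"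
    by (rule odd_cut_Un_disjoint[OF fK fin_cut_eps[OF assms(1)]]) (use assms(2) vE in blast)
  then have eZ: "\<not> odd_cut ?Z" using eK even_eps[OF assms(1)] by blast
  have ZV: "?Z \<subseteq> V" using fin_cut_sub[OF fK] subV[OF assms(1)] by blast
  have "v - ?Z = v - K" "w - ?Z = w" using vE assms(2) by blast+
  then have tt: "T (v - ?Z)" "T (w - ?Z)" using assms(3) tightv[OF vw(2)] by simp_all
  have N: "\<forall>x\<in>?Z. \<forall>y. {x, y} \<in> edges G \<longrightarrow> y \<in> ?Z \<union> v \<union> w"
  proof (intro ballI allI impI)
    fix x y assume x: "x \<in> ?Z" and e: "{x, y} \<in> edges G"
    show "y \<in> ?Z \<union> v \<union> w"
    proof (cases "x \<in> K")
      case True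
      then show ?thesis using assms(4)[OF True _ e] unfolding link_def by blast
    next
      case False
      then show ?thesis using N_eps[OF assms(1) _ e] x unfolding link_def by blast
    qed
  qed
  have "passable G M ?Z v \<and> passable G M ?Z w"
    unfolding passable_iff[OF tightv[OF vw(1)] tightv[OF vw(2)] vE(3) ZV] using tt eZ N by blast
  then have "?Z \<subseteq> ?E" using maximal[OF assms(1), of ?Z] assms(2) by blast
  then show ?thesis using assms(2) vE by blast
qed

end

context frame
begin

text \<open>If \<open>\<epsilon> e\<close> and \<open>\<epsilon>' e'\<close> overlap for different
  edges, then the overlap has edges to at most one vertex, a common end of \<open>e\<close> and
  \<open>e'\<close>, contradicting \<open>pendant\<close>.\<close>

lemma eps_overlap:
  assumes F: "frame G M H' \<epsilon>'" and vs: "verts H' = verts H"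
    and e: "e \<in> edges H" and e': "e' \<in> edges H'" and x: "x \<in> \<epsilon> e" "x \<in> \<epsilon>' e'"
  shows "e = e'"
proof (rule ccontr)
  assume ne: "e \<noteq> e'"
  interpret F: frame G M H' \<epsilon>' by (rule F)
  obtain v w where vw: "e = {v, w}" "v \<in> verts H" "w \<in> verts H" "v \<noteq> w" by (rule edgeHE[OF e])
  obtain v' w' where vw': "e' = {v', w'}" "v' \<in> verts H'" "w' \<in> verts H'" "v' \<noteq> w'" by (rule F.edgeHE[OF e'])
  obtain s t where st: "e = {s, t}" "s \<noteq> t" "t \<notin> e'"
  proof (cases "w \<in> e'")
    case True
    then have "v \<notin> e'" using ne vw vw' by auto
    then show ?thesis using that[of w v] vw by (simp add: insert_commute)
  next
    case False
    then show ?thesis using that[of v w] vw by blast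
  qed
  have sV: "s \<in> verts H" "t \<in> verts H" "{s, t} \<in> edges H" using edgeH[of s t] e st by simp_all
  let ?K = "\<epsilon> e \<inter> \<epsilon>' e'"
  have "V = ?K \<union> s"
  proof (rule pendant[OF tightv[OF sV(1)]])
    show "?K \<subseteq> V" using subV[OF e] by blast
    show "?K \<inter> s = {}" using disve[OF sV(1) e] by blast
    show "?K \<noteq> {}" using x by blast
    fix a b assume a: "a \<in> ?K" and ab: "{a, b} \<in> edges G"
    have 1: "b \<in> s \<or> b \<in> \<epsilon> e \<or> b \<in> t" using N_eps[OF sV(3) _ ab] a st(1) unfolding link_def by blast
    have 2: "b \<in> v' \<or> b \<in> \<epsilon>' e' \<or> b \<in> w'" using F.N_eps[of v' w' a b] a ab vw'(1) e' unfolding F.link_def by blast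
    have "b \<notin> t"
    proof
      assume bt: "b \<in> t"
      have "b \<notin> \<epsilon>' e'" using F.vert_eps[OF _ e' bt] sV vs by blast
      then have "t = v' \<or> t = w'" using 2 F.vert_eq[OF _ _ bt] sV(2) vs vw' by blast
      then show False using st vw' by blast
    qed
    moreover have "b \<in> \<epsilon>' e'" if b: "b \<in> \<epsilon> e"
      using 2 vert_eps[OF _ e _ b] vw'(2,3) vs by blast
    ultimately show "b \<in> ?K \<union> s" using 1 by blast
  qed
  moreover obtain z where "z \<in> t" using vert_ne[OF sV(2)] by blast
  moreover have "z \<in> V" if "z \<in> t" using vert_sub[OF sV(2)] that by blast
  ultimately show False using vert_eps[OF sV(2) e] vert_eq[OF sV(1,2)] st(2) by blast
qed

lemma same_verts_partner:
  assumes F: "frame G M H' \<epsilon>'" and vs: "verts H' = verts H" and m: "m \<in> MM" and v: "v \<in> verts H"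
  shows "frame.partner H' \<epsilon>' m v = partner m v"
proof (rule ccontr)
  interpret F: frame G M H' \<epsilon>' by (rule F)
  assume ne: "F.partner m v \<noteq> partner m v"
  have v': "v \<in> verts H'" using v vs by simp
  let ?b = "m (exit_point m v)"
  have 1: "?b \<in> \<epsilon> {v, partner m v} \<union> partner m v" by (rule exit_partner[OF m v])
  have 2: "?b \<in> \<epsilon>' {v, F.partner m v} \<union> F.partner m v" by (rule F.exit_partner[OF m v'])
  have E: "{v, partner m v} \<in> edges H" "{v, F.partner m v} \<in> edges H'" using partnerD[OF m v] F.partnerD[OF m v'] by blast+
  have W: "partner m v \<in> verts H" "F.partner m v \<in> verts H" using partnerD[OF m v] F.partnerD[OF m v'] vs by blast+
  have "?b \<notin> partner m v"
    using 2 ne vert_eq[OF W] F.vert_eps[OF _ E(2)] W vs by blast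
  moreover have "?b \<notin> F.partner m v"
    using 1 ne vert_eq[OF W] vert_eps[OF _ E(1)] W by blast
  ultimately have "{v, partner m v} = {v, F.partner m v}" using 1 2 eps_overlap[OF F vs E] by blast
  then show False using ne by (simp add: doubleton_eq_iff)
qed

lemma same_verts_subset:
  assumes F: "frame G M H' \<epsilon>'" and vs: "verts H' = verts H"
  shows "edges H \<subseteq> edges H'" "\<And>e. e \<in> edges H \<Longrightarrow> e \<in> edges H' \<Longrightarrow> \<epsilon> e \<subseteq> \<epsilon>' e"
proof -
  interpret F: frame G M H' \<epsilon>' by (rule F)
  show "edges H \<subseteq> edges H'"
  proof
    fix e assume e: "e \<in> edges H"
    obtain v w where vw: "e = {v, w}" "v \<in> verts H" by (rule edgeHE[OF e])
    then have "{v, w} \<in> edges H" using e by simp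
    then obtain m where m: "m \<in> MM" "partner m v = w" "partner m w = v" by (rule edge_real)
    then have "F.partner m v = w" using same_verts_partner[OF F vs m(1) vw(2)] by simp
    then show "e \<in> edges H'" using F.partnerD(1)[OF m(1), of v] vw vs by simp
  qed
  show "\<epsilon> e \<subseteq> \<epsilon>' e" if e: "e \<in> edges H" "e \<in> edges H'" for e
  proof
    fix x assume x: "x \<in> \<epsilon> e"
    then have "x \<in> V" using subV[OF e(1)] by blast
    moreover have "\<not> (\<exists>v\<in>verts H'. x \<in> v)" using vert_eps[OF _ e(1) _ x] vs by blast
    ultimately obtain e' where e': "e' \<in> edges H'" "x \<in> \<epsilon>' e'" using F.cover by blast
    then have "e = e'" using eps_overlap[OF F vs e(1) e'(1) x e'(2)] by blast
    then show "x \<in> \<epsilon>' e" using e' by simp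
  qed
qed

end

text \<open>Frames on the same vertices induce the same matchings, hence have the same edges, and
  then the sets \<open>\<epsilon> e\<close> partition what the vertices leave over.\<close>

lemma torsoid_determined_by_vertices:
  assumes mc: "matching_covered G M" and t: "torsoid G M (H, \<epsilon>)" "torsoid G M (H', \<epsilon>')"
    and vs: "verts H = verts H'"
  shows "(H, \<epsilon>) = (H', \<epsilon>')"
proof -
  have F: "frame G M H \<epsilon>" "frame G M H' \<epsilon>'" using frame_if_torsoid[OF mc] t by blast+
  note a = frame.same_verts_subset[OF F(1,2) vs[symmetric]]
  note b = frame.same_verts_subset[OF F(2,1) vs]
  have E: "edges H = edges H'" using a(1) b(1) by blast
  have eq: "\<epsilon> e = \<epsilon>' e" if "e \<in> edges H" for e using a(2)[of e] b(2)[of e] that E by blast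
  have "\<epsilon> \<in> edges H \<rightarrow>\<^sub>E Pow (verts G)" "\<epsilon>' \<in> edges H' \<rightarrow>\<^sub>E Pow (verts G)"
    using torsoidD(5)[OF t(1)] torsoidD(5)[OF t(2)] .
  then have "\<epsilon> = \<epsilon>'" using eq E by (metis PiE_ext)
  moreover have "H = H'" using vs E by simp
  ultimately show ?thesis by simp
qed

context matching_covered_graph
begin

lemma collapse_frame:
  assumes "tight_set_partition G M \<P>"
  shows "frame G M (collapse G \<P>) (\<lambda>_. {})"
proof -
  have part: "\<Union>\<P> = V" "\<And>P Q. P \<in> \<P> \<Longrightarrow> Q \<in> \<P> \<Longrightarrow> P \<noteq> Q \<Longrightarrow> P \<inter> Q = {}"
    and tt: "\<And>P. P \<in> \<P> \<Longrightarrow> T P"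
    using assms unfolding tight_set_partition_def partition_on_def disjoint_def by auto
  show ?thesis
  proof unfold_locales
    show "simple_graph (collapse G \<P>)"
      unfolding simple_graph_def
    proof
      fix e assume "e \<in> edges (collapse G \<P>)"
      then obtain P Q where "e = {P, Q}" "P \<in> \<P>" "Q \<in> \<P>" "P \<noteq> Q"
        unfolding collapse_def quotient_edges_def by auto
      then show "e \<subseteq> verts (collapse G \<P>) \<and> card e = 2" unfolding collapse_simps by auto
    qed
    show "T v" if "v \<in> verts (collapse G \<P>)" for v using tt that unfolding collapse_simps .
    show "v \<inter> w = {}" if "v \<in> verts (collapse G \<P>)" "w \<in> verts (collapse G \<P>)" "v \<noteq> w" for v w
      using part(2) that unfolding collapse_simps by blast
    show "(\<exists>v\<in>verts (collapse G \<P>). x \<in> v) \<or> (\<exists>e\<in>edges (collapse G \<P>). x \<in> {})" if "x \<in> V" for x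
      using part(1) that unfolding collapse_simps by blast
    show "\<exists>x\<in>v \<union> {}. \<exists>y\<in>w. {x, y} \<in> edges G" if "{v, w} \<in> edges (collapse G \<P>)" for v w
      using that unfolding collapse_simps edge_between_def by simp
    show "T (v \<union> {})" if "{v, w} \<in> edges (collapse G \<P>)" for v w
      using that tt unfolding collapse_simps by simp
    show "{v, w} \<in> edges (collapse G \<P>)"
      if "v \<in> verts (collapse G \<P>)" "w \<in> verts (collapse G \<P>)" "v \<noteq> w" "x \<in> v" "y \<in> w" "{x, y} \<in> edges G"
      for v w x y
      using that unfolding collapse_simps edge_between_def by blast
  qed auto
qed

lemma collapse_matching_eq:
  assumes "tight_set_partition G M \<P>"
  shows "torsoid_matching M (collapse G \<P>) (\<lambda>_. {}) = collapse_matching M \<P>"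
proof -
  have ME: "M \<subseteq> edges G" using perfect unfolding perfect_matching_def by blast
  have e: "edge_between (edges G) P Q" if "edge_between M P Q" for P Q
    using that ME unfolding edge_between_def by blast
  show ?thesis
    unfolding torsoid_matching_def collapse_matching_def quotient_edges_def collapse_simps
    using e by auto
qed

text \<open>The function \<open>r\<close> labels each point of \<open>P - X\<close> with the class
  that it is attached to. Two adjacent points of \<open>P - X\<close> have the same label. The
  notion only refers to \<open>\<P>\<close>, which is why it can identify the vertices of all
  torsoids that are cleaved by \<open>\<P>\<close>.\<close>

definition core :: "'v set set \<Rightarrow> 'v set \<Rightarrow> 'v set \<Rightarrow> bool" where
  "core \<P> P X \<longleftrightarrow> T X \<and> X \<subseteq> P \<and> (\<exists>r. \<forall>x\<in>P - X. r x \<in> \<P> - {P} \<and>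
     (\<forall>y. {x, y} \<in> edges G \<longrightarrow> y \<in> X \<union> r x \<or> (y \<in> P - X \<and> r y = r x)))"

end

locale tight_partition = matching_covered_graph G M for G :: "'v sgraph" and M +
  fixes \<P> :: "'v set set"
  assumes part: "tight_set_partition G M \<P>"
    and largeS: "infinite \<P> \<or> 4 \<le> card \<P>"
begin

sublocale S: frame G M "collapse G \<P>" "\<lambda>_. {}"
  by (rule collapse_frame[OF part])

lemma classes: "x \<in> V \<Longrightarrow> \<exists>P\<in>\<P>. x \<in> P"
  using S.cover unfolding collapse_simps by blast

lemma class_tight: "P \<in> \<P> \<Longrightarrow> T P"
  using S.tightv unfolding collapse_simps .

lemma class_disj: "P \<in> \<P> \<Longrightarrow> Q \<in> \<P> \<Longrightarrow> P \<noteq> Q \<Longrightarrow> P \<inter> Q = {}"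
  using S.disjv unfolding collapse_simps .

lemma class_eq: "P \<in> \<P> \<Longrightarrow> Q \<in> \<P> \<Longrightarrow> x \<in> P \<Longrightarrow> x \<in> Q \<Longrightarrow> P = Q"
  using class_disj by blast

lemma class_link: "S.link P Q = P \<union> Q" unfolding S.link_def by blast

lemma class_partner: assumes "m \<in> MM" "P \<in> \<P>"
  shows "S.partner m P \<in> \<P>" "S.partner m P \<noteq> P" "closed_under m (P \<union> S.partner m P)" "S.partner m (S.partner m P) = P"
    "m (exit_point m P) \<in> S.partner m P"
proof -
  have P: "P \<in> verts (collapse G \<P>)" using assms(2) unfolding collapse_simps .
  show "S.partner m P \<in> \<P>" using S.partnerD(3)[OF assms(1) P] unfolding collapse_simps .
  show "S.partner m P \<noteq> P" "closed_under m (P \<union> S.partner m P)" using S.partnerD[OF assms(1) P] unfolding class_link by blast+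
  show "S.partner m (S.partner m P) = P" by (rule S.partner_partner[OF assms(1) P])
  show "m (exit_point m P) \<in> S.partner m P" using S.exit_partner[OF assms(1) P] by blast
qed

lemma class_partner_eq:
  assumes "m \<in> MM" "P \<in> \<P>" "Q \<in> \<P>" "x \<in> P" "m x \<in> Q" "P \<noteq> Q"
  shows "S.partner m P = Q"
proof -
  have "m x \<in> P \<union> S.partner m P" using closedD[OF class_partner(3)[OF assms(1,2)]] assms(4) by blast
  then show ?thesis using class_eq[OF class_partner(1)[OF assms(1,2)] assms(3)] class_eq[OF assms(2,3)] assms by blast
qed

lemma other_class: obtains C where "C \<in> \<P>" "C \<noteq> P1" "C \<noteq> P2" "C \<noteq> P3"
proof -
  have "\<not> \<P> \<subseteq> {P1, P2, P3}"
  proof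
    assume s: "\<P> \<subseteq> {P1, P2, P3}"
    then have "finite \<P>" by (rule finite_subset) simp
    moreover have "card \<P> \<le> 3" using card_mono[OF _ s] by (simp add: card_insert_if split: if_splits)
    ultimately show False using largeS by simp
  qed
  then show ?thesis using that by blast
qed

end

locale cleaved = maximal_frame G M H \<epsilon> + tight_partition G M \<P>
  for G :: "'v sgraph" and M H \<epsilon> \<P> +
  assumes cleaves: "P \<in> \<P> \<Longrightarrow> \<exists>v\<in>verts H. v \<subseteq> P"
begin

definition vertex_in where "vertex_in P = (SOME v. v \<in> verts H \<and> v \<subseteq> P)"

lemma vertex_in: assumes "P \<in> \<P>" shows "vertex_in P \<in> verts H" "vertex_in P \<subseteq> P"
proof -
  have "\<exists>v. v \<in> verts H \<and> v \<subseteq> P" using cleaves[OF assms] by blast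
  from someI_ex[OF this] show "vertex_in P \<in> verts H" "vertex_in P \<subseteq> P" unfolding vertex_in_def by blast+
qed

lemma vertex_in_disj: "P \<in> \<P> \<Longrightarrow> Q \<in> \<P> \<Longrightarrow> P \<noteq> Q \<Longrightarrow> P \<inter> vertex_in Q = {}"
  using vertex_in(2) class_disj by blast

lemma vertex_in_inj: "P \<in> \<P> \<Longrightarrow> Q \<in> \<P> \<Longrightarrow> vertex_in P = vertex_in Q \<Longrightarrow> P = Q"
  using vertex_in(2)[of P] vertex_in_disj[of P Q] vert_ne[OF vertex_in(1), of P] by (metis Int_absorb1)

lemma vertex_in_odd: assumes "P \<in> \<P>" shows "odd_cut (P \<inter> vertex_in P)"
  using odd_cut_tight[OF tightv[OF vertex_in(1)[OF assms]]] vertex_in(2)[OF assms] by (simp add: Int_absorb1)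

lemma vertex_in_even: "P \<in> \<P> \<Longrightarrow> Q \<in> \<P> \<Longrightarrow> P \<noteq> Q \<Longrightarrow> \<not> odd_cut (P \<inter> vertex_in Q)"
  using vertex_in_disj by simp

lemma odd_class: assumes "v \<in> verts H" shows "\<exists>P\<in>\<P>. odd_cut (P \<inter> v)"
proof -
  note tv = tightv[OF assms]
  obtain P where P: "P \<in> \<P>" "odd_cut (v \<inter> S.link P (S.partner m0 P))"
    using S.odd_unit_ex[OF m0(1) tv] unfolding collapse_simps by auto
  have "{P, S.partner m0 P} \<in> edges (collapse G \<P>)"
    using S.partnerD(1)[OF m0(1)] P(1) unfolding collapse_simps(1) by blast
  then have "odd_cut (v \<inter> P) \<or> odd_cut (v \<inter> S.partner m0 P)" using S.odd_cut_link[OF _ fin_cut_tight[OF tv]] P(2) by auto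
  then show ?thesis using P(1) class_partner(1)[OF m0(1) P(1)] by (metis Int_commute)
qed

end

locale cleaved_brick = cleaved +
  assumes bobH: "BoB H MH" and ncH: "\<not> is_cycle H" and largeH: "infinite (verts H) \<or> 4 \<le> card (verts H)"
begin

lemma pattern:
  assumes X: "T X" and P: "P \<in> \<P>" "odd_cut (X \<inter> vertex_in P)" and "X \<inter> vertex_in C1 = {}" "X \<inter> vertex_in C2 = {}"
    "C1 \<in> \<P>" "C2 \<in> \<P>" "C1 \<noteq> C2"
  shows "\<And>e. e \<in> edges H \<Longrightarrow> \<not> odd_cut (X \<inter> \<epsilon> e)"
    "\<And>v. v \<in> verts H \<Longrightarrow> odd_cut (X \<inter> v) \<longleftrightarrow> v = vertex_in P"
  using brick_or_brace_pattern[OF bobH ncH largeH X vertex_in(1)[OF P(1)] P(2) vertex_in(1)[OF assms(6)] vertex_in(1)[OF assms(7)]]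
    vertex_in_inj[OF assms(6,7)] assms by auto

lemma class_pattern:
  assumes P: "P \<in> \<P>"
  shows "\<And>e. e \<in> edges H \<Longrightarrow> \<not> odd_cut (P \<inter> \<epsilon> e)" "\<And>v. v \<in> verts H \<Longrightarrow> odd_cut (P \<inter> v) \<longleftrightarrow> v = vertex_in P"
proof -
  obtain C1 where C1: "C1 \<in> \<P>" "C1 \<noteq> P" "C1 \<noteq> P" "C1 \<noteq> P" by (rule other_class)
  obtain C2 where C2: "C2 \<in> \<P>" "C2 \<noteq> P" "C2 \<noteq> C1" "C2 \<noteq> P" by (rule other_class)
  note * = pattern[OF class_tight[OF P] P vertex_in_odd[OF P] vertex_in_disj[OF P C1(1)] vertex_in_disj[OF P C2(1)] C1(1) C2(1)]
  show "\<And>e. e \<in> edges H \<Longrightarrow> \<not> odd_cut (P \<inter> \<epsilon> e)" "\<And>v. v \<in> verts H \<Longrightarrow> odd_cut (P \<inter> v) \<longleftrightarrow> v = vertex_in P"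
    using * C1 C2 by auto
qed

text \<open>Some class is odd on \<open>v\<close>, and by \<open>class_pattern\<close> it is odd
  on one vertex only.\<close>

lemma vertex_in_surj: assumes "v \<in> verts H" shows "\<exists>P\<in>\<P>. v = vertex_in P"
  using odd_class[OF assms] class_pattern(2)[OF _ assms] by blast

text \<open>An edge between classes crosses the link of their vertices: its ends are the exits of
  both classes under a matching that contains it.\<close>

lemma class_edge:
  assumes m: "m \<in> MM" and P: "P \<in> \<P>" "Q \<in> \<P>" "P \<noteq> Q" and x: "x \<in> P" "m x \<in> Q"
  shows "partner m (vertex_in P) = vertex_in Q" "x \<in> link (vertex_in P) (vertex_in Q)" "m x \<in> link (vertex_in P) (vertex_in Q)"
    "{vertex_in P, vertex_in Q} \<in> edges H"
proof -
  define w where "w = partner m (vertex_in P)"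
  note v = vertex_in(1)[OF P(1)]
  have w: "{vertex_in P, w} \<in> edges H" "w \<in> verts H" "w \<noteq> vertex_in P" "closed_under m (link (vertex_in P) w)"
    unfolding w_def using partnerD[OF m v] by blast+
  have xV: "x \<in> V" using tight_sub[OF class_tight[OF P(1)]] x by blast
  have PQ: "P \<inter> Q = {}" by (rule class_disj[OF P])
  have "m x \<notin> P" "m (m x) \<notin> Q" using PQ x mateD(2)[OF m xV] by auto
  then have ex: "exit_point m P = x" "exit_point m Q = m x"
    using exit_eq[OF class_tight[OF P(1)] m x(1)] exit_eq[OF class_tight[OF P(2)] m x(2)] by simp_all
  have "odd_cut (P \<inter> link (vertex_in P) w)"
    using odd_cut_link[OF w(1) fin_cut_tight[OF class_tight[OF P(1)]]] class_pattern(1)[OF P(1) w(1)]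
      class_pattern(2)[OF P(1) v] class_pattern(2)[OF P(1) w(2)] w(3) by simp
  then have xU: "x \<in> link (vertex_in P) w"
    using link_odd[OF m v class_tight[OF P(1)]] ex unfolding w_def by simp
  then have mx: "m x \<in> link (vertex_in P) w" by (rule closedD[OF w(4)])
  then have "odd_cut (Q \<inter> link (vertex_in P) w)"
    using link_odd[OF m v class_tight[OF P(2)]] ex unfolding w_def by simp
  then have "w = vertex_in Q"
    using odd_cut_link[OF w(1) fin_cut_tight[OF class_tight[OF P(2)]]] class_pattern(1)[OF P(2) w(1)]
      class_pattern(2)[OF P(2) v] class_pattern(2)[OF P(2) w(2)] vertex_in_inj[OF P(1,2)] P(3) by auto
  then show "partner m (vertex_in P) = vertex_in Q" "x \<in> link (vertex_in P) (vertex_in Q)" "m x \<in> link (vertex_in P) (vertex_in Q)" "{vertex_in P, vertex_in Q} \<in> edges H"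
    using w xU mx unfolding w_def by simp_all
qed

text \<open>A point of \<open>P\<close> outside the vertex lies in some \<open>\<epsilon>
  e\<close>. If \<open>e\<close> were not an edge at the vertex of \<open>P\<close>, the set
  \<open>P \<inter> \<epsilon> e\<close> would have no edges to the outside.\<close>

lemma label_ex:
  assumes P: "P \<in> \<P>" and x: "x \<in> P" "x \<notin> vertex_in P"
  shows "\<exists>Q\<in>\<P> - {P}. {vertex_in P, vertex_in Q} \<in> edges H \<and> x \<in> \<epsilon> {vertex_in P, vertex_in Q}"
proof -
  have xV: "x \<in> V" using tight_sub[OF class_tight[OF P]] x by blast
  have "\<not> (\<exists>v\<in>verts H. x \<in> v)"
  proof
    assume "\<exists>v\<in>verts H. x \<in> v"
    then obtain Q where "Q \<in> \<P>" "x \<in> vertex_in Q" using vertex_in_surj by blast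
    then show False using x vertex_in_disj[OF P] by (cases "Q = P") auto
  qed
  then obtain e where e: "e \<in> edges H" "x \<in> \<epsilon> e" using cover[OF xV] by blast
  obtain v w where vw: "e = {v, w}" "v \<in> verts H" "w \<in> verts H" "v \<noteq> w" by (rule edgeHE[OF e(1)])
  obtain Q R where QR: "Q \<in> \<P>" "R \<in> \<P>" "v = vertex_in Q" "w = vertex_in R" using vertex_in_surj vw by metis
  have "Q = P \<or> R = P"
  proof (rule ccontr)
    assume ne: "\<not> (Q = P \<or> R = P)"
    let ?K = "P \<inter> \<epsilon> e"
    have "?K \<noteq> V" using vert_ne[OF vertex_in(1)[OF P]] vert_sub[OF vertex_in(1)[OF P]] vert_eps[OF vertex_in(1)[OF P] e(1)] by blast
    moreover have "?K \<subseteq> V" "?K \<noteq> {}" using subV[OF e(1)] x e by blast+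
    ultimately obtain m a where a: "m \<in> MM" "a \<in> ?K" "m a \<in> V" "m a \<notin> ?K" "{a, m a} \<in> edges G"
      using cross_mate by metis
    have "m a \<in> link v w" using N_eps[of v w a "m a"] a e(1) vw(1) by blast
    then have "m a \<notin> P" using a(4) vertex_in_disj[OF P QR(1)] vertex_in_disj[OF P QR(2)] ne QR vw(1) unfolding link_def by blast
    then obtain Q' where Q': "Q' \<in> \<P>" "m a \<in> Q'" "P \<noteq> Q'" using classes[OF a(3)] by blast
    note ce = class_edge[OF a(1) P Q'(1,3) _ Q'(2)]
    have "{vertex_in P, vertex_in Q'} \<noteq> {v, w}" using ne QR vertex_in_inj P Q' by (metis doubleton_eq_iff)
    then show False using link_eps_disj[OF ce(4), of v w] ce(2) a e(1) vw(1) by blast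
  qed
  then show ?thesis
  proof
    assume "Q = P"
    then show ?thesis using QR e vw by (intro bexI[of _ R]) auto
  next
    assume "R = P"
    then show ?thesis using QR e vw by (intro bexI[of _ Q]) (auto simp: insert_commute)
  qed
qed

text \<open>The label of \<open>x\<close> is the class \<open>Q\<close> with \<open>x\<close> in
  the \<open>\<epsilon>\<close>-set between the vertices of \<open>P\<close> and
  \<open>Q\<close>.\<close>

lemma core_vertex_in:
  assumes P: "P \<in> \<P>" shows "core \<P> P (vertex_in P)"
proof -
  define r where "r x = (SOME Q. Q \<in> \<P> - {P} \<and> {vertex_in P, vertex_in Q} \<in> edges H \<and> x \<in> \<epsilon> {vertex_in P, vertex_in Q})" for x
  have r: "r x \<in> \<P>" "r x \<noteq> P" "{vertex_in P, vertex_in (r x)} \<in> edges H" "x \<in> \<epsilon> {vertex_in P, vertex_in (r x)}"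
    if "x \<in> P - vertex_in P" for x
  proof -
    have "\<exists>Q. Q \<in> \<P> - {P} \<and> {vertex_in P, vertex_in Q} \<in> edges H \<and> x \<in> \<epsilon> {vertex_in P, vertex_in Q}"
      using label_ex[OF P, of x] that by blast
    from someI_ex[OF this] show "r x \<in> \<P>" "r x \<noteq> P" "{vertex_in P, vertex_in (r x)} \<in> edges H" "x \<in> \<epsilon> {vertex_in P, vertex_in (r x)}"
      unfolding r_def by blast+
  qed
  have "r x \<in> \<P> - {P} \<and> (\<forall>y. {x, y} \<in> edges G \<longrightarrow> y \<in> vertex_in P \<union> r x \<or> (y \<in> P - vertex_in P \<and> r y = r x))"
    if x: "x \<in> P - vertex_in P" for x
  proof (intro conjI allI impI)
    note rx = r[OF x]
    show "r x \<in> \<P> - {P}" using rx by blast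
    fix y assume xy: "{x, y} \<in> edges G"
    have yU: "y \<in> link (vertex_in P) (vertex_in (r x))" by (rule N_eps[OF rx(3,4) xy])
    show "y \<in> vertex_in P \<union> r x \<or> (y \<in> P - vertex_in P \<and> r y = r x)"
    proof (cases "y \<in> P")
      case True
      show ?thesis
      proof (cases "y \<in> vertex_in P")
        case False
        have "y \<notin> vertex_in (r x)" using vertex_in_disj[OF P rx(1)] rx(2) True by blast
        then have y: "y \<in> \<epsilon> {vertex_in P, vertex_in (r x)}" using yU False unfolding link_def by blast
        note ry = r[of y]
        have "{vertex_in P, vertex_in (r y)} = {vertex_in P, vertex_in (r x)}"
          using eps_eq[OF ry(3) rx(3) ry(4) y] True False by blast
        then have "vertex_in (r y) = vertex_in (r x)" by (auto simp: doubleton_eq_iff)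
        then have "r y = r x" using vertex_in_inj ry rx True False by blast
        then show ?thesis using True False by blast
      qed blast
    next
      case False
      obtain m where m: "m \<in> MM" "m x = y" "m y = x" by (rule edge_mate[OF xy])
      obtain Q where Q: "Q \<in> \<P>" "y \<in> Q" using classes edgeD(2)[OF xy] by blast
      then have QP: "P \<noteq> Q" using False by blast
      have ce: "x \<in> link (vertex_in P) (vertex_in Q)" "{vertex_in P, vertex_in Q} \<in> edges H"
        using class_edge[OF m(1) P Q(1) QP, of x] x Q m by blast+
      then have "{vertex_in P, vertex_in Q} = {vertex_in P, vertex_in (r x)}" using link_eps_disj[OF ce(2) rx(3)] rx(4) by blast
      then have "vertex_in Q = vertex_in (r x)" by (auto simp: doubleton_eq_iff)
      then have "Q = r x" using vertex_in_inj Q rx by blast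
      then show ?thesis using Q by blast
    qed
  qed
  then show ?thesis unfolding core_def using tightv[OF vertex_in(1)[OF P]] vertex_in(2)[OF P] by blast
qed

lemma third_neighbour:
  assumes P: "P \<in> \<P>"
  obtains m where "m \<in> MM" "S.partner m P \<noteq> Q1" "S.partner m P \<noteq> Q2"
proof -
  have "\<not> (\<forall>y. {vertex_in P, y} \<in> edges H \<longrightarrow> y = vertex_in Q1 \<or> y = vertex_in Q2)"
    using Q.degree_two_cycle[OF bobH largeH vertex_in(1)[OF P]] ncH by blast
  then obtain y where y: "{vertex_in P, y} \<in> edges H" "y \<noteq> vertex_in Q1" "y \<noteq> vertex_in Q2" by blast
  obtain m where m: "m \<in> MM" "partner m (vertex_in P) = y" "partner m y = vertex_in P" using y(1) by (rule edge_real)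
  have "partner m (vertex_in P) = vertex_in (S.partner m P)"
    using class_edge(1)[OF m(1) P class_partner(1)[OF m(1) P] class_partner(2)[OF m(1) P, symmetric]
        exit_point(1)[OF class_tight[OF P] m(1)] class_partner(5)[OF m(1) P]] .
  then show ?thesis using that[OF m(1)] m(2) y by auto
qed

text \<open>Let \<open>R Q\<close> be the piece of \<open>P - X\<close> with label
  \<open>Q\<close>. No piece is odd: if a matching pairs \<open>P\<close> with another class than
  \<open>Q\<close>, the mate of the exit of \<open>X\<close> lies in \<open>R Q\<close> whenever
  \<open>R Q\<close> is odd. An odd piece forces a second odd one, and for a matching that avoids
  both labels this mate would lie in both pieces. As all pieces are even, \<open>Q \<union> R
  Q\<close> is tight by \<open>bridge\<close>. Uncrossing it with the vertex shows that the part
  of the vertex in \<open>R Q\<close> is a pocket.\<close>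

lemma core_contains:
  assumes P: "P \<in> \<P>" and c: "core \<P> P X"
  shows "vertex_in P \<subseteq> X"
proof -
  obtain r where XT: "T X" "X \<subseteq> P" and r: "\<And>x. x \<in> P - X \<Longrightarrow> r x \<in> \<P> - {P}"
    "\<And>x y. x \<in> P - X \<Longrightarrow> {x, y} \<in> edges G \<Longrightarrow> y \<in> X \<union> r x \<or> (y \<in> P - X \<and> r y = r x)"
    using c unfolding core_def by blast
  define R where "R Q = {x \<in> P - X. r x = Q}" for Q
  have PV: "P \<subseteq> V" using tight_sub[OF class_tight[OF P]] .
  have RV: "R Q \<subseteq> V" for Q using PV unfolding R_def by blast
  have RN: "y \<in> R Q \<union> X \<union> Q" if "x \<in> R Q" "{x, y} \<in> edges G" for x y Q
    using r(2)[of x y] that unfolding R_def by blast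
  have exR: "exits m (R Q) \<subseteq> {m (exit_point m X)}" if m: "m \<in> MM" and Q: "Q \<in> \<P>" "S.partner m P \<noteq> Q" "Q \<noteq> P" for m Q
  proof
    fix x assume x: "x \<in> exits m (R Q)"
    then have xR: "x \<in> R Q" "m x \<notin> R Q" "x \<in> P" "x \<notin> X" "x \<in> V" using RV unfolding exits_def R_def by blast+
    have "m x \<notin> Q" using class_partner_eq[OF m P Q(1) xR(3)] Q by blast
    then have mx: "m x \<in> X" using RN[OF xR(1) mateD(1)[OF m xR(5)]] xR by blast
    have mm: "m (m x) = x" using mateD(2)[OF m xR(5)] .
    then have "exit_point m X = m x" using exit_eq[OF XT(1) m mx] xR by simp
    then show "x \<in> {m (exit_point m X)}" using mm by simp
  qed
  have nod: "\<not> odd_cut (R Q1)" if Q1: "Q1 \<in> \<P>" "Q1 \<noteq> P" for Q1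
  proof
    assume od1: "odd_cut (R Q1)"
    have hit: "m (exit_point m X) \<in> R Q" if "m \<in> MM" "Q \<in> \<P>" "Q \<noteq> P" "S.partner m P \<noteq> Q" "odd_cut (R Q)" for m Q
    proof -
      have "exits m (R Q) \<noteq> {}" using odd_cut_iff[OF RV that(1)] that(5) by auto
      then show ?thesis using exR[OF that(1,2,4,3)] unfolding exits_def by blast
    qed
    obtain m2 where m2: "m2 \<in> MM" "S.partner m2 P \<noteq> Q1" using third_neighbour[OF P] by metis
    define Q2 where "Q2 = S.partner m2 P"
    have Q2: "Q2 \<in> \<P>" "Q2 \<noteq> P" "Q2 \<noteq> Q1" unfolding Q2_def using class_partner[OF m2(1) P] m2(2) by blast+
    have h: "m2 (exit_point m2 X) \<in> R Q1" by (rule hit[OF m2(1) Q1 m2(2) od1])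
    define p where "p = exit_point m2 P"
    have p: "p \<in> P" "m2 p \<notin> P" "m2 p \<in> Q2" "p \<in> V"
      unfolding p_def Q2_def using exit_point(1,2,5)[OF class_tight[OF P] m2(1)] class_partner(5)[OF m2(1) P] by blast+
    have "p \<notin> X"
    proof
      assume "p \<in> X"
      then have "exit_point m2 X = p" using exit_eq[OF XT(1) m2(1)] p(2) XT(2) by blast
      then show False using h p(2) unfolding R_def by simp
    qed
    then have "r p \<in> \<P> - {P}" "m2 p \<in> X \<union> r p \<or> (m2 p \<in> P - X \<and> r (m2 p) = r p)"
      using r(1)[of p] r(2)[of p "m2 p"] p(1) mateD(1)[OF m2(1) p(4)] by blast+
    then have "r p = Q2" using p XT(2) class_eq[OF _ Q2(1) _ p(3)] by blast
    then have pR: "p \<in> R Q2" using p(1) \<open>p \<notin> X\<close> unfolding R_def by blast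
    have "exits m2 (R Q2) = {p}"
    proof
      show "{p} \<subseteq> exits m2 (R Q2)" using pR p(2) unfolding exits_def R_def by blast
      show "exits m2 (R Q2) \<subseteq> {p}"
      proof
        fix x assume "x \<in> exits m2 (R Q2)"
        then have x: "x \<in> R Q2" "m2 x \<notin> R Q2" "x \<in> P" "x \<notin> X" "x \<in> V" using RV unfolding exits_def R_def by blast+
        have "m2 x \<notin> X"
        proof
          assume mx: "m2 x \<in> X"
          have mm: "m2 (m2 x) = x" using mateD(2)[OF m2(1) x(5)] .
          then have "exit_point m2 X = m2 x" using exit_eq[OF XT(1) m2(1) mx] x by simp
          then have "x \<in> R Q1" using h mm by simp
          then show False using x(1) Q2(3) unfolding R_def by blast
        qed
        then have "m2 x \<in> Q2" using RN[OF x(1) mateD(1)[OF m2(1) x(5)]] x(2) by blast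
        then have "m2 x \<notin> P" using class_disj[OF P Q2(1)] Q2(2) by blast
        then show "x \<in> {p}" using exit_eq[OF class_tight[OF P] m2(1) x(3)] unfolding p_def by blast
      qed
    qed
    then have od2: "odd_cut (R Q2)" using odd_cut_iff[OF RV m2(1)] by simp
    obtain m3 where m3: "m3 \<in> MM" "S.partner m3 P \<noteq> Q1" "S.partner m3 P \<noteq> Q2" by (rule third_neighbour[OF P])
    show False using hit[OF m3(1) Q1 m3(2) od1] hit[OF m3(1) Q2(1,2) m3(3) od2] Q2(3) unfolding R_def by blast
  qed
  have "vertex_in P \<inter> R Q = {}" if Q: "Q \<in> \<P>" "Q \<noteq> P" for Q
  proof -
    let ?v = "vertex_in P"
    let ?K = "?v \<inter> R Q"
    let ?Y = "Q \<union> R Q"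
    note v = vertex_in(1)[OF P]
    have QP: "Q \<inter> P = {}" using class_disj[OF Q(1) P Q(2)] .
    have RP: "R Q \<subseteq> P - X" unfolding R_def by blast
    have Y: "T ?Y"
      by (rule bridge[OF class_tight[OF Q(1)] XT(1) _ RV _ _ nod[OF Q]])
        (use QP XT(2) RP RN in blast)+
    obtain C1 where C1: "C1 \<in> \<P>" "C1 \<noteq> P" "C1 \<noteq> Q" "C1 \<noteq> Q" by (rule other_class)
    obtain C2 where C2: "C2 \<in> \<P>" "C2 \<noteq> P" "C2 \<noteq> C1" "C2 \<noteq> Q" by (rule other_class)
    have YC: "?Y \<inter> vertex_in C = {}" if "C \<in> \<P>" "C \<noteq> P" "C \<noteq> Q" for C
      using vertex_in_disj[OF P that(1)] vertex_in_disj[OF Q(1) that(1)] that RP by blast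
    have "?Y \<inter> vertex_in Q = vertex_in Q" using vertex_in(2)[OF Q(1)] by blast
    then have oQ: "odd_cut (?Y \<inter> vertex_in Q)" using odd_cut_tight[OF tightv[OF vertex_in(1)[OF Q(1)]]] by simp
    have pat: "\<And>e. e \<in> edges H \<Longrightarrow> \<not> odd_cut (?Y \<inter> \<epsilon> e)" "\<And>v. v \<in> verts H \<Longrightarrow> odd_cut (?Y \<inter> v) \<longleftrightarrow> v = vertex_in Q"
      by (rule pattern[OF Y Q(1) oQ YC[OF C1(1-3)] YC[OF C2(1,2,4)] C1(1) C2(1) C2(3)[symmetric]]; assumption)+
    have YK: "?Y \<inter> ?v = ?K" using vertex_in(2)[OF P] QP by blast
    have vYK: "?v - ?Y = ?v - ?K" using vertex_in(2)[OF P] QP by blast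
    have "\<not> odd_cut (?v \<inter> ?Y)" using pat(2)[OF v] vertex_in_inj[OF P Q(1)] Q(2) by (metis Int_commute)
    note un = uncross_even[OF tightv[OF v] Y this]
    have tK: "T (?v - ?K)" using un(1) vYK by simp
    have key: "{?v, vertex_in Q} \<in> edges H \<and> y \<in> link ?v (vertex_in Q)" if xy: "x \<in> ?K" "y \<notin> ?v" "{x, y} \<in> edges G" for x y
    proof -
      obtain m where m: "m \<in> MM" "m x = y" "m y = x" by (rule edge_mate[OF xy(3)])
      define w where "w = partner m ?v"
      have w: "{?v, w} \<in> edges H" "closed_under m (link ?v w)" "w \<in> verts H" "w \<noteq> ?v"
        unfolding w_def using partnerD[OF m(1) v] by blast+
      have KV: "?K \<subseteq> V" using RV by blast
      have "\<not> odd_cut ?K" using \<open>\<not> odd_cut (?v \<inter> ?Y)\<close> YK by (simp add: Int_commute)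
      then have "even (card (exits m ?K))" using odd_cut_iff[OF KV m(1)] by blast
      moreover have "x \<in> exits m ?K" unfolding exits_def using xy m by blast
      ultimately have "exits m ?K \<noteq> {x}" by auto
      then obtain x' where x': "x' \<in> ?K" "m x' \<notin> ?K" "x' \<noteq> x"
        using \<open>x \<in> exits m ?K\<close> unfolding exits_def by blast
      have "exit_point m ?v = x" using exit_eq[OF tightv[OF v] m(1)] xy m by blast
      then have mx'v: "m x' \<in> ?v" using exit_eq[OF tightv[OF v] m(1), of x'] x' by blast
      then have "m x' \<notin> ?Y" using x' YK by blast
      then have "exit_point m ?Y = x'" using exit_eq[OF Y m(1), of x'] x' by blast
      then have "exit_point m ?Y \<in> link ?v w" using x' unfolding link_def by blast
      then have "odd_cut (?Y \<inter> link ?v w)" using link_odd[OF m(1) v Y] unfolding w_def by blast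
      then have "odd_cut (?Y \<inter> ?v) \<or> odd_cut (?Y \<inter> w)" using odd_cut_link[OF w(1) fin_cut_tight[OF Y]] pat(1)[OF w(1)] by blast
      then have "w = vertex_in Q" using pat(2)[OF v] pat(2)[OF w(3)] vertex_in_inj[OF P Q(1)] Q(2) by blast
      moreover have "y \<in> link ?v w" using closedD[OF w(2), of x] xy m unfolding link_def by blast
      ultimately show ?thesis using w(1) by blast
    qed
    show "?K = {}"
    proof (cases "{?v, vertex_in Q} \<in> edges H")
      case True
      show ?thesis by (rule pocket[OF True _ tK]) (use key in blast)+
    next
      case False
      show ?thesis by (rule even_pocket[OF tightv[OF v] tK]) (use key False in blast)+
    qed
  qed
  then have "\<not> x \<in> P - X" if "x \<in> vertex_in P" for x using that r(1) unfolding R_def by blast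
  then show ?thesis using vertex_in(2)[OF P] by blast
qed

end

section \<open>Frames over cycles\<close>

lemma Suc_mod_inj:
  assumes "i < n" "j < n" "Suc i mod n = Suc j mod n" shows "i = j"
  using assms by (cases "Suc i = n"; cases "Suc j = n") (auto simp: mod_less)

lemma cycle_rotate:
  assumes "is_cycle H" "v \<in> verts H"
  obtains n c where "n \<ge> 3" "bij_betw c {..<n} (verts H)" "edges H = {{c i, c (Suc i mod n)} | i. i < n}"
    "c 0 = v"
proof -
  obtain n c where n: "n \<ge> 3" and bij: "bij_betw c {..<n} (verts H)"
    and E: "edges H = {{c i, c (Suc i mod n)} | i. i < n}"
    using assms(1) unfolding is_cycle_def by blast
  obtain k where k: "k < n" "c k = v"
    using bij assms(2) unfolding bij_betw_def by (metis imageE lessThan_iff)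
  define d where "d i = c ((i + k) mod n)" for i
  have surj: "\<exists>i<n. (i + k) mod n = j" if "j < n" for j
  proof (cases "k \<le> j")
    case True
    then show ?thesis using that k by (intro exI[of _ "j - k"]) auto
  next
    case False
    then have "(j + n - k) + k = j + n" using k by simp
    then have "((j + n - k) + k) mod n = j" using that by simp
    then show ?thesis using False k by (intro exI[of _ "j + n - k"]) auto
  qed
  have rb: "bij_betw (\<lambda>i. (i + k) mod n) {..<n} {..<n}"
  proof -
    have im: "(\<lambda>i. (i + k) mod n) ` {..<n} = {..<n}" using surj n by (auto simp: image_iff)
    then have "inj_on (\<lambda>i. (i + k) mod n) {..<n}" by (intro eq_card_imp_inj_on) auto
    then show ?thesis unfolding bij_betw_def using im by blast
  qed
  have "bij_betw (c \<circ> (\<lambda>i. (i + k) mod n)) {..<n} (verts H)" by (rule bij_betw_trans[OF rb bij])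
  then have "bij_betw d {..<n} (verts H)" unfolding d_def comp_def .
  moreover have "edges H = {{d i, d (Suc i mod n)} | i. i < n}"
  proof -
    have step: "(Suc i mod n + k) mod n = Suc ((i + k) mod n) mod n" for i
      by (metis add_Suc mod_Suc_eq mod_add_left_eq)
    have "{{d i, d (Suc i mod n)} | i. i < n} = (\<lambda>j. {c j, c (Suc j mod n)}) ` ((\<lambda>i. (i + k) mod n) ` {..<n})"
      unfolding d_def step by auto
    also have "\<dots> = {{c j, c (Suc j mod n)} | j. j < n}" using rb unfolding bij_betw_def by auto
    finally show ?thesis using E by simp
  qed
  moreover have "d 0 = v" unfolding d_def using k by simp
  ultimately show ?thesis using that n by blast
qed

text \<open>A cycle as a successor function. The closure property of \<open>W\<close> expresses
  that \<open>s\<close> is a single orbit.\<close>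

lemma cycle_succ:
  assumes "is_cycle H"
  obtains s where "\<And>v. v \<in> verts H \<Longrightarrow> s v \<in> verts H" "edges H = {{v, s v} | v. v \<in> verts H}"
    "\<And>v. v \<in> verts H \<Longrightarrow> s v \<noteq> v" "\<And>v. v \<in> verts H \<Longrightarrow> s (s v) \<noteq> v" "inj_on s (verts H)"
    "\<And>W. W \<subseteq> verts H \<Longrightarrow> W \<noteq> {} \<Longrightarrow> s ` W \<subseteq> W \<Longrightarrow> W = verts H" "finite (verts H)"
proof -
  obtain n c where n: "n \<ge> 3" and bij: "bij_betw c {..<n} (verts H)"
    and E: "edges H = {{c i, c (Suc i mod n)} | i. i < n}"
    using assms(1) unfolding is_cycle_def by blast
  define ix where "ix = the_inv_into {..<n} c"
  have inj: "inj_on c {..<n}" and im: "c ` {..<n} = verts H" using bij unfolding bij_betw_def by auto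
  have ic: "ix (c i) = i" if "i < n" for i unfolding ix_def using the_inv_into_f_f[OF inj] that by simp
  have ci: "c (ix v) = v" "ix v < n" if "v \<in> verts H" for v
    using that im ic by (metis imageE lessThan_iff)+
  define s where "s v = c (Suc (ix v) mod n)" for v
  have sc: "s (c i) = c (Suc i mod n)" if "i < n" for i unfolding s_def using ic that by simp
  have cV: "c i \<in> verts H" if "i < n" for i using im that by blast
  have ceq: "c i = c j \<longleftrightarrow> i = j" if "i < n" "j < n" for i j using inj that unfolding inj_on_def by auto
  have all: "(\<forall>v\<in>verts H. Q v) \<longleftrightarrow> (\<forall>i<n. Q (c i))" for Q unfolding im[symmetric] by auto
  have m: "Suc i mod n < n" for i using n by simp
  have "\<forall>v\<in>verts H. s v \<in> verts H" unfolding all using sc cV m by simp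
  moreover have "edges H = {{v, s v} | v. v \<in> verts H}"
  proof -
    have "{{c i, c (Suc i mod n)} | i. i < n} = {{c i, s (c i)} | i. i < n}"
      by (rule Collect_cong) (metis sc)
    also have "\<dots> = (\<lambda>v. {v, s v}) ` (c ` {..<n})" by auto
    also have "\<dots> = {{v, s v} | v. v \<in> verts H}" unfolding im by auto
    finally show ?thesis using E by simp
  qed
  moreover have "\<forall>v\<in>verts H. s v \<noteq> v" unfolding all
  proof (intro allI impI)
    fix i assume i: "i < n"
    have "Suc i mod n \<noteq> i" using i n by (cases "Suc i = n") auto
    then show "s (c i) \<noteq> c i" using sc i ceq m by simp
  qed
  moreover have "\<forall>v\<in>verts H. s (s v) \<noteq> v" unfolding all
  proof (intro allI impI)
    fix i assume i: "i < n"
    have "Suc (Suc i mod n) mod n \<noteq> i"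
      using i n by (cases "Suc i = n"; cases "Suc (Suc i) = n") auto
    then show "s (s (c i)) \<noteq> c i" using sc i ceq m by simp
  qed
  moreover have "inj_on s (verts H)"
  proof (rule inj_onI)
    fix x y assume "x \<in> verts H" "y \<in> verts H" "s x = s y"
    then have "Suc (ix x) mod n = Suc (ix y) mod n" unfolding s_def using ceq m by blast
    then have "ix x = ix y" using Suc_mod_inj ci(2) \<open>x \<in> verts H\<close> \<open>y \<in> verts H\<close> by blast
    then show "x = y" using ci(1) \<open>x \<in> verts H\<close> \<open>y \<in> verts H\<close> by metis
  qed
  moreover have "W = verts H" if W: "W \<subseteq> verts H" "W \<noteq> {}" "s ` W \<subseteq> W" for W
  proof
    show "W \<subseteq> verts H" by (rule W(1))
    obtain v where v: "v \<in> W" using W(2) by blast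
    define i where "i = ix v"
    have i: "i < n" "c i = v" using ci W(1) v unfolding i_def by blast+
    have k: "c ((i + k) mod n) \<in> W" for k
    proof (induction k)
      case 0
      then show ?case using i v by simp
    next
      case (Suc k)
      have "s (c ((i + k) mod n)) = c (Suc ((i + k) mod n) mod n)" by (rule sc) (use n in simp)
      also have "Suc ((i + k) mod n) mod n = (i + Suc k) mod n" by (simp add: mod_Suc_eq)
      finally show ?case using Suc W(3) by (metis imageI subsetD)
    qed
    show "verts H \<subseteq> W"
    proof
      fix w assume w: "w \<in> verts H"
      have "i + (ix w + n - i) = ix w + n" using i by simp
      then have "(i + (ix w + n - i)) mod n = ix w" using ci(2)[OF w] by simp
      then show "w \<in> W" using k[of "ix w + n - i"] ci(1)[OF w] by simp
    qed
  qed
  moreover have "finite (verts H)" using im by (metis finite_imageI finite_lessThan)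
  ultimately show ?thesis using that[of s] by blast
qed

lemma cycle_degree:
  assumes "is_cycle H" "v \<in> verts H"
  obtains u w where "u \<noteq> w" "\<And>y. {v, y} \<in> edges H \<longleftrightarrow> y = u \<or> y = w"
proof -
  obtain s where s: "\<And>v. v \<in> verts H \<Longrightarrow> s v \<in> verts H" "edges H = {{v, s v} | v. v \<in> verts H}"
    "\<And>v. v \<in> verts H \<Longrightarrow> s v \<noteq> v" "\<And>v. v \<in> verts H \<Longrightarrow> s (s v) \<noteq> v" "inj_on s (verts H)"
    "\<And>W. W \<subseteq> verts H \<Longrightarrow> W \<noteq> {} \<Longrightarrow> s ` W \<subseteq> W \<Longrightarrow> W = verts H" "finite (verts H)"
    by (rule cycle_succ[OF assms(1)]) blast
  have "s ` verts H = verts H" using s(1,5,7) by (intro endo_inj_surj) auto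
  then obtain u where u: "u \<in> verts H" "s u = v" using assms(2) by (metis imageE)
  have "{v, y} \<in> edges H \<longleftrightarrow> y = u \<or> y = s v" for y
  proof
    assume "{v, y} \<in> edges H"
    then obtain x where x: "x \<in> verts H" "{v, y} = {x, s x}" using s(2) by blast
    then have "v = x \<and> y = s x \<or> v = s x \<and> y = x" by (simp add: doubleton_eq_iff)
    then show "y = u \<or> y = s v" using s(5) u x unfolding inj_on_def by metis
  next
    assume "y = u \<or> y = s v"
    then show "{v, y} \<in> edges H" using s(2) u assms(2) by (auto simp: insert_commute)
  qed
  moreover have "u \<noteq> s v" using s(4)[OF u(1)] u(2) by auto
  ultimately show ?thesis using that by blast
qed

lemma card_image_pairs:
  assumes "finite A" "\<And>x. x \<in> A \<Longrightarrow> g x \<in> A" "\<And>x. x \<in> A \<Longrightarrow> g x \<noteq> x" "\<And>x. x \<in> A \<Longrightarrow> f (g x) = f x"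
  shows "2 * card (f ` A) \<le> card A"
proof -
  have "card A = (\<Sum>y\<in>f ` A. card {x \<in> A. f x = y})"
    using sum.group[OF assms(1) finite_imageI[OF assms(1)], of f f "\<lambda>_. 1 :: nat"] by simp
  also have "\<dots> \<ge> (\<Sum>y\<in>f ` A. 2)"
  proof (rule sum_mono)
    fix y assume "y \<in> f ` A"
    then obtain x where x: "x \<in> A" "f x = y" by blast
    then have "{x, g x} \<subseteq> {x \<in> A. f x = y}" using assms by auto
    then have "card {x, g x} \<le> card {x \<in> A. f x = y}" using assms(1) by (intro card_mono) auto
    then show "2 \<le> card {x \<in> A. f x = y}" using assms(3)[OF x(1)] by (simp add: card_insert_if split: if_splits)
  qed
  finally show ?thesis by simp
qed

context frame
begin

text \<open>On a cycle there are two perfect matchings, and \<open>m\<close> and \<open>n\<close>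
  induce different ones.\<close>

definition opposite :: "('v \<Rightarrow> 'v) \<Rightarrow> ('v \<Rightarrow> 'v) \<Rightarrow> bool" where
  "opposite m n \<longleftrightarrow> m \<in> MM \<and> n \<in> MM \<and> (\<forall>v\<in>verts H. partner m v \<noteq> partner n v)"

lemma oppositeD: "opposite m n \<Longrightarrow> m \<in> MM" "opposite m n \<Longrightarrow> n \<in> MM" "opposite m n \<Longrightarrow> v \<in> verts H \<Longrightarrow> partner m v \<noteq> partner n v"
  "opposite m n \<Longrightarrow> opposite n m"
  unfolding opposite_def by (auto dest: not_sym)

end

locale cycle_frame = frame +
  assumes cyc: "is_cycle H"
begin

text \<open>On a cycle, the edge at one vertex determines the matching, by propagation along the
  edges.\<close>

lemma agree_all:
  assumes m: "m \<in> MM" "n \<in> MM" and v: "v \<in> verts H" "partner m v = partner n v" and w: "w \<in> verts H"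
  shows "partner m w = partner n w"
proof (rule ccontr)
  assume ne: "partner m w \<noteq> partner n w"
  let ?A = "{a \<in> verts H. partner m a = partner n a}"
  have "v \<in> ?A" "w \<notin> ?A" using v ne by blast+
  then have "?A \<subseteq> verts H" "?A \<noteq> {}" "?A \<noteq> verts H" using w by blast+
  then obtain x y where xy: "x \<in> ?A" "y \<in> verts H" "y \<notin> ?A" "{x, y} \<in> edges H" by (rule Q.cross_edge)
  have x: "x \<in> verts H" "partner m x = partner n x" using xy(1) by blast+
  show False
  proof (cases "partner m x = y")
    case True
    then have "partner m y = x" "partner n y = x" using partner_partner[OF m(1) x(1)] partner_partner[OF m(2) x(1)] x(2) by simp_all
    then show False using xy by simp
  next
    case False
    then have ne: "partner m y \<noteq> x" "partner n y \<noteq> x" using partner_partner[OF m(1) xy(2)] partner_partner[OF m(2) xy(2)] x(2) by metis+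
    obtain a b where ab: "a \<noteq> b" "\<And>z. {y, z} \<in> edges H \<longleftrightarrow> z = a \<or> z = b"
      by (rule cycle_degree[OF cyc xy(2)]) blast
    have "x = a \<or> x = b" using ab(2)[of x] xy(4) by (simp add: insert_commute)
    moreover have "partner m y = a \<or> partner m y = b" "partner n y = a \<or> partner n y = b"
      using ab(2) partnerD(1)[OF m(1) xy(2)] partnerD(1)[OF m(2) xy(2)] by blast+
    ultimately show False using ne xy by auto
  qed
qed

lemma oppositeI: "m \<in> MM \<Longrightarrow> n \<in> MM \<Longrightarrow> v \<in> verts H \<Longrightarrow> partner m v \<noteq> partner n v \<Longrightarrow> opposite m n"
  unfolding opposite_def using agree_all by blast

lemma other_mate:
  assumes v: "v \<in> verts H" obtains m where "m \<in> MM" "partner m v \<noteq> w"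
proof -
  obtain a b where ab: "a \<noteq> b" "\<And>z. {v, z} \<in> edges H \<longleftrightarrow> z = a \<or> z = b"
    by (rule cycle_degree[OF cyc v]) blast
  have "\<exists>y. {v, y} \<in> edges H \<and> y \<noteq> w" using ab by (cases "a = w") auto
  then obtain y where y: "{v, y} \<in> edges H" "y \<noteq> w" by blast
  obtain m where "m \<in> MM" "partner m v = y" "partner m y = v" using y(1) by (rule edge_real)
  then show ?thesis using that y by blast
qed

lemma opposite_ex: obtains m n where "opposite m n"
proof -
  obtain v where v: "v \<in> verts H" using vertsH_ne by blast
  obtain n where n: "n \<in> MM" "partner n v \<noteq> partner m0 v" by (rule other_mate[OF v])
  then show ?thesis using that oppositeI[OF n(1) m0(1) v] by blast
qed

lemma opposite_nbr:
  assumes o: "opposite m n" and e: "{v, y} \<in> edges H"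
  shows "y = partner m v \<or> y = partner n v"
proof -
  have v: "v \<in> verts H" using edgeH e by blast
  obtain a b where ab: "a \<noteq> b" "\<And>z. {v, z} \<in> edges H \<longleftrightarrow> z = a \<or> z = b"
    by (rule cycle_degree[OF cyc v]) blast
  then show ?thesis using e partnerD(1)[OF oppositeD(1)[OF o] v] partnerD(1)[OF oppositeD(2)[OF o] v] oppositeD(3)[OF o v] by metis
qed

lemma opposite_cases:
  assumes o: "opposite m n" and k: "k \<in> MM"
  shows "(\<forall>v\<in>verts H. partner k v = partner m v) \<or> (\<forall>v\<in>verts H. partner k v = partner n v)"
proof -
  obtain v where v: "v \<in> verts H" using vertsH_ne by blast
  have "partner k v = partner m v \<or> partner k v = partner n v" using opposite_nbr[OF o partnerD(1)[OF k v]] .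
  then show ?thesis using agree_all[OF k oppositeD(1)[OF o] v] agree_all[OF k oppositeD(2)[OF o] v] by blast
qed

end

text \<open>The condition on torsoids over a cycle that forbids certain three-part
  splittings.\<close>

locale cycle_torsoid = cycle_frame +
  assumes unrefined: "{u, v} \<in> edges H \<Longrightarrow> {v, w} \<in> edges H \<Longrightarrow> u \<noteq> w \<Longrightarrow>
    T P1 \<Longrightarrow> T P2 \<Longrightarrow> T P3 \<Longrightarrow> P1 \<inter> P2 = {} \<Longrightarrow> P1 \<inter> P3 = {} \<Longrightarrow> P2 \<inter> P3 = {} \<Longrightarrow>
    P1 \<union> P2 \<union> P3 = \<epsilon> {u, v} \<union> v \<union> \<epsilon> {v, w} \<Longrightarrow> T (u \<union> P1 \<union> P2) \<Longrightarrow> T (P2 \<union> P3 \<union> w) \<Longrightarrow> False"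
begin

text \<open>Under these parities \<open>X\<close> cuts \<open>\<epsilon> {a, b}\<close> into two
  tight sets \<open>P2\<close> and \<open>P3\<close>. Together with \<open>P1 = a \<union>
  \<epsilon> {u, a}\<close>, where \<open>u\<close> is the other neighbour of \<open>a\<close>,
  they form a forbidden splitting at \<open>a\<close>.\<close>

lemma even_eps_aux:
  assumes X: "T X" and e: "{a, b} \<in> edges H" and p: "odd_cut (X \<inter> a)" "\<not> odd_cut (X \<inter> b)" "odd_cut (X \<inter> \<epsilon> {a, b})"
  shows False
proof -
  have ab: "a \<in> verts H" "b \<in> verts H" "a \<noteq> b" using edgeH[OF e] by blast+
  obtain k where k: "k \<in> MM" "partner k a \<noteq> b" by (rule other_mate[OF ab(1)])
  define u where "u = partner k a"
  have ua: "{a, u} \<in> edges H" "{u, a} \<in> edges H" and u: "u \<in> verts H" "u \<noteq> a" "u \<noteq> b"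
    unfolding u_def using partnerD[OF k(1) ab(1)] k(2) edgeH_sym by blast+
  define E where "E = \<epsilon> {a, b}"
  define E1 where "E1 = \<epsilon> {u, a}"
  have E1': "E1 = \<epsilon> {a, u}" unfolding E1_def by (simp add: insert_commute)
  have dis: "a \<inter> E = {}" "b \<inter> E = {}" "a \<inter> b = {}" "u \<inter> a = {}" "u \<inter> b = {}" "u \<inter> E = {}"
    "a \<inter> E1 = {}" "u \<inter> E1 = {}" "b \<inter> E1 = {}"
    unfolding E_def E1_def using disve e ua ab u disjv by blast+
  have "{u, a} \<noteq> {a, b}" using u by (auto simp: doubleton_eq_iff)
  then have EE: "E \<inter> E1 = {}" unfolding E_def E1_def using dise[OF ua(2) e] by blast
  have tE: "T (a \<union> E)" "T (b \<union> E)" "T (a \<union> E1)" "T (u \<union> E1)"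
    unfolding E_def E1_def using passv[OF e] passw[OF e] passw[OF ua(2)] passv[OF ua(2)] by blast+
  have fE: "fin_cut E" unfolding E_def by (rule fin_cut_eps[OF e])
  have fX: "fin_cut X" using X by blast
  have fa: "fin_cut a" "fin_cut b" using tightv ab by blast+
  have pE: "odd_cut (X \<inter> E)" using p(3) unfolding E_def .
  define P2 where "P2 = X \<inter> E"
  define P3 where "P3 = E - X"
  have od1: "odd_cut (X \<inter> (b \<union> E))"
  proof -
    have "X \<inter> (b \<union> E) = (X \<inter> b) \<union> (X \<inter> E)" by blast
    moreover have "odd_cut ((X \<inter> b) \<union> (X \<inter> E)) \<longleftrightarrow> odd_cut (X \<inter> b) \<noteq> odd_cut (X \<inter> E)"
      by (rule odd_cut_Un_disjoint) (use fX fa fE dis in blast)+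
    ultimately show ?thesis using p pE by simp
  qed
  have "(X \<inter> (b \<union> E)) \<inter> (a \<union> E) = X \<inter> E" using dis by blast
  \<comment> \<open>Intersect with \<open>b \<union> \<epsilon> {a, b}\<close> and then with
    \<open>a \<union> \<epsilon> {a, b}\<close>; both intersections are odd.\<close>
  then have tP2: "T P2" unfolding P2_def
    using uncross_odd(1)[OF uncross_odd(1)[OF X tE(2) od1] tE(1)] pE by simp
  have odX: "odd_cut (b - X)" "odd_cut (E - X)" "\<not> odd_cut (a - X)"
  proof -
    show "odd_cut (b - X)" using odd_cut_split[OF fa(2) fX] odd_cut_tight[OF tightv[OF ab(2)]] p(2) by (simp add: Int_commute)
    show "\<not> odd_cut (a - X)" using odd_cut_split[OF fa(1) fX] odd_cut_tight[OF tightv[OF ab(1)]] p(1) by (simp add: Int_commute)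
    show "odd_cut (E - X)" using odd_cut_split[OF fE fX] even_eps[OF e] pE unfolding E_def by (simp add: Int_commute)
  qed
  have EV: "E \<subseteq> V" "a \<subseteq> V" using fin_cut_sub fE fa by blast+
  have od2: "odd_cut ((V - X) \<inter> (a \<union> E))"
  proof -
    have "(V - X) \<inter> (a \<union> E) = (a - X) \<union> (E - X)" using EV by blast
    moreover have "odd_cut ((a - X) \<union> (E - X)) \<longleftrightarrow> odd_cut (a - X) \<noteq> odd_cut (E - X)"
      by (rule odd_cut_Un_disjoint) (use fX fa fE dis in blast)+
    ultimately show ?thesis using odX by simp
  qed
  have "((V - X) \<inter> (a \<union> E)) \<inter> (b \<union> E) = E - X" using dis EV by blast
  then have tP3: "T P3" unfolding P3_def
    using uncross_odd(1)[OF uncross_odd(1)[OF tight_compl[OF X] tE(1) od2] tE(2)] odX(2) by simp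
  \<comment> \<open>A matching that uses \<open>ab\<close> passes from \<open>P2\<close> to
    \<open>a\<close>, so it leaves the union at the exit of \<open>u\<close>; any other matching
    uses \<open>ua\<close>, and then the exit of \<open>P2\<close> is the exit of the
    union.\<close>
  have tZ: "T (u \<union> (a \<union> E1) \<union> P2)"
  proof (rule tightI)
    let ?Z = "u \<union> (a \<union> E1) \<union> P2"
    show "?Z \<subseteq> V" using tight_sub[OF tP2] vert_sub[OF u(1)] tight_sub[OF tE(3)] by blast
    fix m assume m: "m \<in> MM"
    define s where "s = exit_point m P2"
    have s: "s \<in> P2" "m s \<notin> P2" "s \<in> V" "m s \<in> V" "m (m s) = s"
      unfolding s_def by (rule exit_point[OF tP2 m])+
    show "\<exists>x. exits m ?Z = {x}"
    proof (cases "partner m a = b")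
      case False
      have clE: "closed_under m E" unfolding E_def by (rule closed_eps[OF m e False])
      have "opposite m k \<or> partner m a = u" using oppositeI[OF m k(1) ab(1)] unfolding u_def by blast
      then have "partner m a = u"
        using opposite_nbr[of m k a b] e False k(2) by auto
      then have clU: "closed_under m (link a u)" using partnerD(2)[OF m ab(1)] by simp
      have Ueq: "link a u = u \<union> (a \<union> E1)" unfolding link_def E1' by blast
      have "exits m ?Z = {s}"
      proof
        show "{s} \<subseteq> exits m ?Z"
          using s closedD[OF clE, of s] dis EE unfolding exits_def P2_def by blast
        show "exits m ?Z \<subseteq> {s}"
        proof
          fix x assume "x \<in> exits m ?Z"
          then have x: "x \<in> ?Z" "m x \<notin> ?Z" unfolding exits_def by blast+
          then have "x \<in> P2" using closedD[OF clU, of x] unfolding Ueq by blast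
          then show "x \<in> {s}" using exit_eq[OF tP2 m, of x] x unfolding s_def by blast
        qed
      qed
      then show ?thesis by blast
    next
      case True
      have clE1: "closed_under m E1" unfolding E1' by (rule closed_eps[OF m ua(1)]) (use True u in simp)
      have clU: "closed_under m (link a b)" using partnerD(2)[OF m ab(1)] True by simp
      have Ueq: "link a b = a \<union> E \<union> b" unfolding link_def E_def by blast
      have "\<not> odd_cut (X \<inter> link a b)" using odd_cut_link[OF e fX] p by simp
      then have exX: "exit_point m X \<notin> link a b" using link_odd[OF m ab(1) X] True by simp
      have inX: "m x \<in> X" if "x \<in> X" "x \<in> link a b" for x
        using exit_eq[OF X m that(1)] that exX by blast
      have sU: "s \<in> link a b" "s \<in> X" "s \<in> E" using s(1) unfolding Ueq P2_def by blast+
      have msX: "m s \<in> X" "m s \<in> link a b" using inX[OF sU(2,1)] closedD[OF clU sU(1)] by blast+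
      have "m s \<notin> E" using msX s(2) unfolding P2_def by blast
      moreover have "m s \<notin> b"
      proof
        assume y: "m s \<in> b"
        have sb: "s \<notin> b" using sU dis by blast
        have XbV: "X \<inter> b \<subseteq> V" using tight_sub[OF X] by blast
        have eb: "exit_point m b = m s" using exit_eq[OF tightv[OF ab(2)] m y] s(5) sb by simp
        have "exits m (X \<inter> b) = {m s}"
        proof
          show "{m s} \<subseteq> exits m (X \<inter> b)" using y msX s(5) sb unfolding exits_def by simp
          show "exits m (X \<inter> b) \<subseteq> {m s}"
          proof
            fix x assume "x \<in> exits m (X \<inter> b)"
            then have x: "x \<in> X" "x \<in> b" "m x \<notin> X \<or> m x \<notin> b" unfolding exits_def by blast+
            then have "m x \<notin> b" using inX[OF x(1)] unfolding Ueq by blast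
            then show "x \<in> {m s}" using exit_eq[OF tightv[OF ab(2)] m x(2)] eb by simp
          qed
        qed
        then have "odd_cut (X \<inter> b)" using odd_cut_iff[OF XbV m] by simp
        then show False using p by blast
      qed
      ultimately have msa: "m s \<in> a" using msX unfolding Ueq by blast
      have "s \<notin> a" using sU dis by blast
      then have ea: "exit_point m a = m s" using exit_eq[OF tightv[OF ab(1)] m msa] s(5) by simp
      define t where "t = exit_point m u"
      have t: "t \<in> u" "m t \<notin> u" unfolding t_def using exit_point(1,2)[OF tightv[OF u(1)] m] by blast+
      define u' where "u' = partner m u"
      have u': "u' \<in> verts H" "{u, u'} \<in> edges H" "u' \<noteq> u" "m t \<in> \<epsilon> {u, u'} \<union> u'"
        unfolding u'_def t_def using partnerD[OF m u(1)] exit_partner[OF m u(1)] by blast+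
      have "u' \<noteq> a" using True u partner_partner[OF m u(1)] unfolding u'_def by auto
      then have ne: "{u, u'} \<noteq> {u, a}" "{u, u'} \<noteq> {a, b}" using u by (auto simp: doubleton_eq_iff)
      have mt: "m t \<notin> ?Z"
      proof -
        have "m t \<notin> a" using u'(4) disjv[OF u'(1) ab(1) \<open>u' \<noteq> a\<close>] disve[OF ab(1) u'(2)] by blast
        moreover have "m t \<notin> E1"
          using u'(4) dise[OF u'(2) ua(2) ne(1)] disve[OF u'(1) ua(2)] unfolding E1_def by blast
        moreover have "m t \<notin> E"
          using u'(4) dise[OF u'(2) e ne(2)] disve[OF u'(1) e] unfolding E_def by blast
        ultimately show ?thesis using t(2) unfolding P2_def by blast
      qed
      have "exits m ?Z = {t}"
      proof
        show "{t} \<subseteq> exits m ?Z" using t mt unfolding exits_def by blast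
        show "exits m ?Z \<subseteq> {t}"
        proof
          fix x assume "x \<in> exits m ?Z"
          then have x: "x \<in> ?Z" "m x \<notin> ?Z" unfolding exits_def by blast+
          have "x \<notin> E1" using closedD[OF clE1] x by blast
          moreover have "x \<notin> a"
          proof
            assume "x \<in> a"
            then have "x = m s" using exit_eq[OF tightv[OF ab(1)] m, of x] ea x by simp
            then show False using x s by simp
          qed
          moreover have "x \<notin> P2"
          proof
            assume "x \<in> P2"
            then have "x = s" using exit_eq[OF tP2 m, of x] x unfolding s_def by blast
            then show False using x msa by simp
          qed
          ultimately have "x \<in> u" using x by blast
          then show "x \<in> {t}" using exit_eq[OF tightv[OF u(1)] m, of x] x unfolding t_def by blast
        qed
      qed
      then show ?thesis by blast
    qed
  qed
  have eq: "P2 \<union> P3 \<union> b = b \<union> E" unfolding P2_def P3_def by blast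
  show False
  proof (rule unrefined[OF ua(2) e u(3) tE(3) tP2 tP3])
    show "a \<union> E1 \<union> P2 \<union> P3 = \<epsilon> {u, a} \<union> a \<union> \<epsilon> {a, b}"
      unfolding P2_def P3_def E_def E1_def by blast
    show "T (u \<union> (a \<union> E1) \<union> P2)" by (rule tZ)
    show "T (P2 \<union> P3 \<union> b)" unfolding eq by (rule tE(2))
  qed (use dis EE in \<open>auto simp: P2_def P3_def\<close>)
qed

text \<open>An \<open>\<epsilon> e\<close> on which \<open>X\<close> is odd has ends of equal
  parity by \<open>even_eps_aux\<close>. Following the two matchings around the cycle then shows
  that the parity of \<open>X\<close> on vertices is constant.\<close>

theorem cycle_even_eps:
  assumes X: "T X" and v0: "v0 \<in> verts H" "odd_cut (X \<inter> v0)" and v1: "v1 \<in> verts H" "\<not> odd_cut (X \<inter> v1)"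
    and e: "e \<in> edges H"
  shows "\<not> odd_cut (X \<inter> \<epsilon> e)"
proof
  assume qe: "odd_cut (X \<inter> \<epsilon> e)"
  obtain v w where vw: "e = {v, w}" "v \<in> verts H" "w \<in> verts H" "v \<noteq> w" by (rule edgeHE[OF e])
  have E: "{v, w} \<in> edges H" "{w, v} \<in> edges H" and q: "odd_cut (X \<inter> \<epsilon> {v, w})" "odd_cut (X \<inter> \<epsilon> {w, v})"
    using e qe vw(1) by (simp_all add: insert_commute)
  have eq: "odd_cut (X \<inter> v) = odd_cut (X \<inter> w)"
    using even_eps_aux[OF X E(1) _ _ q(1)] even_eps_aux[OF X E(2) _ _ q(2)] by blast
  obtain m where m: "m \<in> MM" "partner m v \<noteq> w" by (rule other_mate[OF vw(2)])
  obtain n where n: "n \<in> MM" "partner n v = w" "partner n w = v" using E(1) by (rule edge_real)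
  have o: "opposite m n" using oppositeI[OF m(1) n(1) vw(2)] m n by simp
  note A = unit_unmatched[OF m(1) X E(1) m(2) q(1)]
  have "odd_cut (X \<inter> link v (partner n v))" using odd_cut_link[OF E(1) fin_cut_tight[OF X]] eq q n by simp
  note B = unit_matched[OF n(1) X vw(2) this]
  have "odd_cut (X \<inter> x) = odd_cut (X \<inter> y)" if xy: "{x, y} \<in> edges H" for x y
  proof (cases "{x, y} = {v, w}")
    case True
    then show ?thesis using eq by (auto simp: doubleton_eq_iff)
  next
    case False
    have x: "x \<in> verts H" using edgeH[OF xy] by blast
    from opposite_nbr[OF o xy] show ?thesis
    proof
      assume y: "y = partner m x"
      then have "partner n x \<noteq> y" using oppositeD(3)[OF o x] by simp
      then have "\<not> odd_cut (X \<inter> \<epsilon> {x, y})" using B(2)[OF xy] by blast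
      then show ?thesis using A(1)[OF x] y by simp
    next
      assume y: "y = partner n x"
      then have "partner m x \<noteq> y" using oppositeD(3)[OF o x] by simp
      then have nq: "\<not> odd_cut (X \<inter> \<epsilon> {x, y})" using A(2)[OF xy] False by blast
      have "x \<noteq> v" "x \<noteq> partner n v" using False y n by (auto simp: insert_commute)
      then show ?thesis using B(1)[OF x] y nq by simp
    qed
  qed
  then have "odd_cut (X \<inter> v0) = odd_cut (X \<inter> v1)" using parity_constant[of "\<lambda>v. odd_cut (X \<inter> v)"] v0(1) v1(1) by blast
  then show False using v0 v1 by blast
qed

end

section \<open>Classes and vertices on a cycle\<close>

locale cleaved_cycle = cleaved G M H \<epsilon> \<P> + cycle_torsoid G M H \<epsilon>
  for G :: "'v sgraph" and M H \<epsilon> \<P>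
begin

lemma even_class_eps:
  assumes P: "P \<in> \<P>" and e: "e \<in> edges H" shows "\<not> odd_cut (P \<inter> \<epsilon> e)"
proof -
  obtain C where C: "C \<in> \<P>" "C \<noteq> P" "C \<noteq> P" "C \<noteq> P" by (rule other_class)
  show ?thesis
    by (rule cycle_even_eps[OF class_tight[OF P] vertex_in(1)[OF P] vertex_in_odd[OF P] vertex_in(1)[OF C(1)] _ e])
      (use vertex_in_even[OF P C(1)] C in blast)
qed

lemma class_odd_cut_link:
  assumes P: "P \<in> \<P>" and e: "{v, w} \<in> edges H"
  shows "odd_cut (P \<inter> link v w) \<longleftrightarrow> odd_cut (P \<inter> v) \<noteq> odd_cut (P \<inter> w)"
  using odd_cut_link[OF e fin_cut_tight[OF class_tight[OF P]]] even_class_eps[OF P e] by blast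

lemma class_exit_unit:
  assumes m: "m \<in> MM" and P: "P \<in> \<P>"
  shows "\<exists>v\<in>verts H. exit_point m P \<in> link v (partner m v)"
  using unit_cases[OF m exit_point(5)[OF class_tight[OF P] m]]
    eps_odd[OF m _ _ class_tight[OF P]] even_class_eps[OF P] by blast

lemma unit_unique:
  assumes m: "m \<in> MM" and v: "v \<in> verts H" "w \<in> verts H" and x: "x \<in> link v (partner m v)" "x \<in> link w (partner m w)"
  shows "{v, partner m v} = {w, partner m w}"
proof (rule ccontr)
  assume ne: "{v, partner m v} \<noteq> {w, partner m w}"
  have 1: "v \<noteq> w" using ne by blast
  have 2: "v \<noteq> partner m w"
  proof
    assume "v = partner m w"
    then show False using ne partner_partner[OF m v(2)] by (simp add: insert_commute)
  qed
  have 3: "partner m v \<noteq> w" using 2 partner_partner[OF m v(1)] by metis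
  have 4: "partner m v \<noteq> partner m w" using 1 partner_partner[OF m v(1)] partner_partner[OF m v(2)] by metis
  show False using link_disj[OF partnerD(1)[OF m v(1)] partnerD(1)[OF m v(2)] 1 2 3 4] x by blast
qed

text \<open>The classes whose parity on \<open>v\<close> is odd. The aim is to show that this is
  always a single class.\<close>

definition odd_classes where "odd_classes v = {P \<in> \<P>. odd_cut (P \<inter> v)}"

text \<open>The matched edge of \<open>H\<close> in whose link the exit of \<open>P\<close>
  lies.\<close>

definition border_pair where "border_pair m P = (THE e. \<exists>v\<in>verts H. e = {v, partner m v} \<and> exit_point m P \<in> link v (partner m v))"

lemma border_pair_eq:
  assumes m: "m \<in> MM" and v: "v \<in> verts H" and x: "exit_point m P \<in> link v (partner m v)"
  shows "border_pair m P = {v, partner m v}"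
  unfolding border_pair_def by (rule the_equality) (use assms unit_unique[OF m] in blast)+

lemma border_pair_partner:
  assumes m: "m \<in> MM" and P: "P \<in> \<P>" shows "border_pair m (S.partner m P) = border_pair m P"
proof -
  obtain v where v: "v \<in> verts H" "exit_point m P \<in> link v (partner m v)" using class_exit_unit[OF m P] by blast
  let ?Q = "S.partner m P"
  have Q: "?Q \<in> \<P>" "P \<inter> ?Q = {}" using class_partner[OF m P] class_disj[OF P] by blast+
  have "m (m (exit_point m P)) \<notin> ?Q" using exit_point(1,7)[OF class_tight[OF P] m] Q by auto
  then have "exit_point m ?Q = m (exit_point m P)"
    using exit_eq[OF class_tight[OF Q(1)] m class_partner(5)[OF m P]] by blast
  then have "exit_point m ?Q \<in> link v (partner m v)" using closedD[OF partnerD(2)[OF m v(1)] v(2)] by simp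
  then show ?thesis using border_pair_eq[OF m v(1)] v(2) by metis
qed

lemma finite_verts: "finite (verts H)"
  by (rule cycle_succ[OF cyc]) blast

lemma finite_classes: "finite \<P>"
proof (rule finite_imageD)
  show "finite (vertex_in ` \<P>)" using finite_verts vertex_in(1) by (meson finite_subset image_subsetI)
  show "inj_on vertex_in \<P>" using vertex_in_inj by (rule inj_onI)
qed

lemma odd_classes_vertex_in: "P \<in> \<P> \<Longrightarrow> odd_classes (vertex_in P) = {P}"
  unfolding odd_classes_def using vertex_in_odd vertex_in_even by blast

text \<open>If \<open>odd_classes\<close> changes along a matched edge, the exit of some class is
  in the link of that edge. A class and its partner have the same border pair, so there are at
  most half as many changes as classes.\<close>

lemma changes_le:
  assumes m: "m \<in> MM"
  shows "2 * card {{v, partner m v} | v. v \<in> verts H \<and> odd_classes v \<noteq> odd_classes (partner m v)} \<le> card \<P>"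
proof -
  let ?C = "{{v, partner m v} | v. v \<in> verts H \<and> odd_classes v \<noteq> odd_classes (partner m v)}"
  have "?C \<subseteq> border_pair m ` \<P>"
  proof
    fix e assume "e \<in> ?C"
    then obtain v where v: "e = {v, partner m v}" "v \<in> verts H" "odd_classes v \<noteq> odd_classes (partner m v)" by blast
    then obtain P where P: "P \<in> \<P>" "odd_cut (P \<inter> v) \<noteq> odd_cut (P \<inter> partner m v)" unfolding odd_classes_def by blast
    then have "odd_cut (P \<inter> link v (partner m v))" using class_odd_cut_link[OF P(1) partnerD(1)[OF m v(2)]] by blast
    then have "exit_point m P \<in> link v (partner m v)" using link_odd[OF m v(2) class_tight[OF P(1)]] by blast
    then show "e \<in> border_pair m ` \<P>" using border_pair_eq[OF m v(2)] v(1) P(1) by blast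
  qed
  then have "card ?C \<le> card (border_pair m ` \<P>)" by (rule card_mono[OF finite_imageI[OF finite_classes]])
  moreover have "2 * card (border_pair m ` \<P>) \<le> card \<P>"
    by (rule card_image_pairs[OF finite_classes, of "S.partner m"]) (use class_partner[OF m] border_pair_partner[OF m] in auto)
  ultimately show ?thesis by linarith
qed

text \<open>If some vertex had another value than a singleton, then \<open>odd_classes\<close>
  would take more values than there are classes, since each singleton occurs at \<open>vertex_in
  P\<close>. A cyclic sequence changes at least as often as it has values, but by
  \<open>changes_le\<close> it changes on the two matchings together at most \<open>card
  \<P>\<close> times.\<close>

theorem unique_class:
  assumes v: "v \<in> verts H" shows "\<exists>P\<in>\<P>. odd_classes v = {P}"
proof (rule ccontr)
  assume no: "\<not> ?thesis"
  obtain s where s: "\<And>v. v \<in> verts H \<Longrightarrow> s v \<in> verts H" "edges H = {{v, s v} | v. v \<in> verts H}"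
    "\<And>v. v \<in> verts H \<Longrightarrow> s v \<noteq> v" "\<And>v. v \<in> verts H \<Longrightarrow> s (s v) \<noteq> v" "inj_on s (verts H)"
    "\<And>W. W \<subseteq> verts H \<Longrightarrow> W \<noteq> {} \<Longrightarrow> s ` W \<subseteq> W \<Longrightarrow> W = verts H" "finite (verts H)"
    by (rule cycle_succ[OF cyc]) blast
  obtain m n where o: "opposite m n" by (rule opposite_ex)
  define C where "C = {v \<in> verts H. odd_classes v \<noteq> odd_classes (s v)}"
  define Vals where "Vals = odd_classes ` verts H"
  have big: "card \<P> < card Vals"
  proof -
    have "inj_on (\<lambda>P. {P}) \<P>" by simp
    then have "card ((\<lambda>P. {P}) ` \<P>) = card \<P>" by (rule card_image)
    moreover have "(\<lambda>P. {P}) ` \<P> \<subset> Vals"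
    proof
      show "(\<lambda>P. {P}) ` \<P> \<subseteq> Vals"
      proof
        fix y assume "y \<in> (\<lambda>P. {P}) ` \<P>"
        then obtain P where "P \<in> \<P>" "y = {P}" by blast
        then have "y = odd_classes (vertex_in P)" "vertex_in P \<in> verts H" using odd_classes_vertex_in vertex_in by simp_all
        then show "y \<in> Vals" unfolding Vals_def by blast
      qed
      have "odd_classes v \<in> Vals" "odd_classes v \<notin> (\<lambda>P. {P}) ` \<P>" unfolding Vals_def using v no by blast+
      then show "(\<lambda>P. {P}) ` \<P> \<noteq> Vals" by blast
    qed
    moreover have "finite Vals" unfolding Vals_def using s(7) by blast
    ultimately show ?thesis using psubset_card_mono by metis
  qed
  \<comment> \<open>Each value has a last occurrence before it changes, as it would otherwise be
    the only value.\<close>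
  have "Vals \<subseteq> odd_classes ` C"
  proof
    fix y assume y: "y \<in> Vals"
    show "y \<in> odd_classes ` C"
    proof (rule ccontr)
      assume nC: "y \<notin> odd_classes ` C"
      let ?W = "{w \<in> verts H. odd_classes w = y}"
      have "s ` ?W \<subseteq> ?W"
      proof
        fix z assume "z \<in> s ` ?W"
        then obtain w where w: "w \<in> verts H" "odd_classes w = y" "z = s w" by blast
        then have "w \<notin> C" using nC by blast
        then have "odd_classes (s w) = y" using w unfolding C_def by blast
        then show "z \<in> ?W" using w s(1) by blast
      qed
      moreover have "?W \<noteq> {}" using y unfolding Vals_def by blast
      ultimately have W: "?W = verts H" using s(6)[of ?W] by blast
      then have "Vals = {y}" using y unfolding Vals_def by blast
      then have "card \<P> < 1" using big by simp
      then have "\<P> = {}" using finite_classes by simp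
      then show False using largeS by simp
    qed
  qed
  moreover have fC: "finite C" unfolding C_def using s(7) by simp
  ultimately have c1: "card Vals \<le> card C"
    by (meson card_image_le card_mono finite_imageI order_trans)
  let ?D = "\<lambda>m. {{v, partner m v} | v. v \<in> verts H \<and> odd_classes v \<noteq> odd_classes (partner m v)}"
  have "(\<lambda>v. {v, s v}) ` C \<subseteq> ?D m \<union> ?D n"
  proof
    fix e assume "e \<in> (\<lambda>v. {v, s v}) ` C"
    then obtain w where w: "w \<in> verts H" "odd_classes w \<noteq> odd_classes (s w)" "e = {w, s w}" unfolding C_def by blast
    then have "{w, s w} \<in> edges H" using s(2) by blast
    from opposite_nbr[OF o this] show "e \<in> ?D m \<union> ?D n"
    proof
      assume a: "s w = partner m w"
      have "{w, partner m w} \<in> ?D m" using w(1,2) unfolding a by blast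
      then show ?thesis unfolding w(3) a by blast
    next
      assume a: "s w = partner n w"
      have "{w, partner n w} \<in> ?D n" using w(1,2) unfolding a by blast
      then show ?thesis unfolding w(3) a by blast
    qed
  qed
  moreover have fD: "finite (?D m \<union> ?D n)"
  proof (rule finite_subset)
    show "?D m \<union> ?D n \<subseteq> Pow (verts H)" using partnerD(3)[OF oppositeD(1)[OF o]] partnerD(3)[OF oppositeD(2)[OF o]] by auto
    show "finite (Pow (verts H))" using s(7) by simp
  qed
  ultimately have "card ((\<lambda>v. {v, s v}) ` C) \<le> card (?D m \<union> ?D n)" by (intro card_mono)
  also have "\<dots> \<le> card (?D m) + card (?D n)" by (rule card_Un_le)
  finally have "card ((\<lambda>v. {v, s v}) ` C) \<le> card (?D m) + card (?D n)" .
  moreover have "card ((\<lambda>v. {v, s v}) ` C) = card C"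
  proof (rule card_image, rule inj_onI)
    fix x y assume xy: "x \<in> C" "y \<in> C" "{x, s x} = {y, s y}"
    then have V: "x \<in> verts H" "y \<in> verts H" unfolding C_def by blast+
    show "x = y"
    proof (rule ccontr)
      assume "x \<noteq> y"
      then have "x = s y" "y = s x" using xy(3) by (auto simp: doubleton_eq_iff)
      then have "s (s x) = x" by simp
      then show False using s(4)[OF V(1)] by blast
    qed
  qed
  ultimately show False
    using c1 big changes_le[OF oppositeD(1)[OF o]] changes_le[OF oppositeD(2)[OF o]] by linarith
qed

text \<open>By \<open>unique_class\<close> every vertex has exactly one class that is odd on
  it.\<close>

definition class_of where "class_of v = (THE P. odd_classes v = {P})"

lemma class_of:
  assumes "v \<in> verts H"
  shows "class_of v \<in> \<P>" "\<And>P. P \<in> \<P> \<Longrightarrow> odd_cut (P \<inter> v) \<longleftrightarrow> P = class_of v"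
proof -
  obtain P where P: "P \<in> \<P>" "odd_classes v = {P}" using unique_class[OF assms] by blast
  then have "class_of v = P" unfolding class_of_def by simp
  then show "class_of v \<in> \<P>" "\<And>P. P \<in> \<P> \<Longrightarrow> odd_cut (P \<inter> v) \<longleftrightarrow> P = class_of v" using P unfolding odd_classes_def by blast+
qed

text \<open>The cyclic order of the vertices refines that of the classes: each matching crosses
  from \<open>P\<close> to its partner class along one of its edges in \<open>H\<close>.\<close>

lemma border:
  assumes m: "m \<in> MM" and P: "P \<in> \<P>"
  obtains a where "a \<in> verts H" "class_of a = P" "class_of (partner m a) = S.partner m P" "exit_point m P \<in> link a (partner m a)"
proof -
  obtain v where v: "v \<in> verts H" "exit_point m P \<in> link v (partner m v)" using class_exit_unit[OF m P] by blast
  define w where "w = partner m v"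
  have w: "w \<in> verts H" "{v, w} \<in> edges H" "partner m w = v" unfolding w_def using partnerD[OF m v(1)] partner_partner[OF m v(1)] by blast+
  let ?Q = "S.partner m P"
  have Q: "?Q \<in> \<P>" "P \<noteq> ?Q" using class_partner(1,2)[OF m P] by auto
  have PU: "odd_cut (P \<inter> link v w)" using link_odd[OF m v(1) class_tight[OF P]] v(2) unfolding w_def by blast
  have "m (m (exit_point m P)) \<notin> ?Q"
    using exit_point(1,7)[OF class_tight[OF P] m] class_disj[OF P Q] by auto
  then have "exit_point m ?Q = m (exit_point m P)"
    using exit_eq[OF class_tight[OF Q(1)] m class_partner(5)[OF m P]] by blast
  then have "exit_point m ?Q \<in> link v w" using closedD[OF partnerD(2)[OF m v(1)] v(2)] unfolding w_def by simp
  then have QU: "odd_cut (?Q \<inter> link v w)" using link_odd[OF m v(1) class_tight[OF Q(1)]] unfolding w_def by blast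
  have P': "(P = class_of v) \<noteq> (P = class_of w)" using PU class_odd_cut_link[OF P w(2)] class_of(2)[OF v(1) P] class_of(2)[OF w(1) P] by blast
  have Q': "(?Q = class_of v) \<noteq> (?Q = class_of w)"
    using QU class_odd_cut_link[OF Q(1) w(2)] class_of(2)[OF v(1) Q(1)] class_of(2)[OF w(1) Q(1)] by blast
  show ?thesis
  proof (cases "P = class_of v")
    case True
    then show ?thesis using that[of v] v Q' Q unfolding w_def by auto
  next
    case False
    have "exit_point m P \<in> link w (partner m w)" using v(2) link_commute w(3) unfolding w_def by metis
    then show ?thesis using that[of w] False w P' Q' Q by auto
  qed
qed

lemma same_class_partner:
  assumes m: "m \<in> MM" "n \<in> MM" and same: "\<And>v. v \<in> verts H \<Longrightarrow> partner m v = partner n v" and P: "P \<in> \<P>"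
  shows "S.partner m P = S.partner n P"
proof -
  obtain a where a: "a \<in> verts H" "class_of a = P" "class_of (partner m a) = S.partner m P" "exit_point m P \<in> link a (partner m a)"
    by (rule border[OF m(1) P])
  define b where "b = partner m a"
  have b: "b \<in> verts H" "{a, b} \<in> edges H" "partner n a = b" unfolding b_def using partnerD[OF m(1) a(1)] same[OF a(1)] by auto
  have clb: "class_of b \<noteq> P" using a(3) class_partner(2)[OF m(1) P] unfolding b_def by simp
  let ?Q = "S.partner n P"
  have Q: "?Q \<in> \<P>" "P \<noteq> ?Q" using class_partner(1,2)[OF m(2) P] by auto
  have "odd_cut (P \<inter> link a b)" using class_odd_cut_link[OF P b(2)] class_of(2)[OF a(1) P] class_of(2)[OF b(1) P] a(2) clb by blast
  then have "exit_point n P \<in> link a (partner n a)" using link_odd[OF m(2) a(1) class_tight[OF P]] b(3) by simp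
  moreover have "m' (m' (exit_point m' P)) \<notin> S.partner m' P" if "m' \<in> MM" for m'
    using exit_point(1,7)[OF class_tight[OF P] that] class_disj[OF P class_partner(1)[OF that P]] class_partner(2)[OF that P] by auto
  then have "exit_point n ?Q = n (exit_point n P)"
    using exit_eq[OF class_tight[OF Q(1)] m(2) class_partner(5)[OF m(2) P]] m(2) by blast
  ultimately have "exit_point n ?Q \<in> link a (partner n a)" using closedD[OF partnerD(2)[OF m(2) a(1)]] by simp
  then have "odd_cut (?Q \<inter> link a b)" using link_odd[OF m(2) a(1) class_tight[OF Q(1)]] b(3) by simp
  then have "?Q = class_of a \<or> ?Q = class_of b"
    using class_odd_cut_link[OF Q(1) b(2)] class_of(2)[OF a(1) Q(1)] class_of(2)[OF b(1) Q(1)] by blast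
  then show ?thesis using a Q unfolding b_def by auto
qed

lemma opposite_class_partner_cases:
  assumes o: "opposite m n" and k: "k \<in> MM" and P: "P \<in> \<P>"
  shows "S.partner k P = S.partner m P \<or> S.partner k P = S.partner n P"
  using opposite_cases[OF o k] same_class_partner[OF k oppositeD(1)[OF o] _ P] same_class_partner[OF k oppositeD(2)[OF o] _ P] by blast

lemma opposite_class_partner:
  assumes o: "opposite m n" and P: "P \<in> \<P>"
  shows "S.partner m P \<noteq> S.partner n P"
proof
  assume eq: "S.partner m P = S.partner n P"
  let ?Q = "S.partner m P"
  have "P \<union> ?Q = V"
  proof (rule all_closed_V)
    show "P \<union> ?Q \<subseteq> V" using tight_sub class_tight P class_partner(1)[OF oppositeD(1)[OF o] P] by blast
    show "P \<union> ?Q \<noteq> {}" using tight_ne class_tight P by blast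
    fix k assume k: "k \<in> MM"
    then show "closed_under k (P \<union> ?Q)" using opposite_class_partner_cases[OF o k P] class_partner(3)[OF k P] eq by simp
  qed
  moreover obtain C where C: "C \<in> \<P>" "C \<noteq> P" "C \<noteq> ?Q" "C \<noteq> ?Q" by (rule other_class)
  moreover have "C \<subseteq> V" "C \<noteq> {}" using tight_sub tight_ne class_tight C by blast+
  ultimately show False
    using class_disj[OF C(1) P C(2)] class_disj[OF C(1) class_partner(1)[OF oppositeD(1)[OF o] P] C(3)] by blast
qed

lemma opposite_type:
  assumes o: "opposite m n" and k: "k \<in> MM" and P: "P \<in> \<P>" "S.partner k P = S.partner m P" and v: "v \<in> verts H"
  shows "partner k v = partner m v"
proof (rule ccontr)
  assume "partner k v \<noteq> partner m v"
  then have "\<And>v. v \<in> verts H \<Longrightarrow> partner k v = partner n v" using opposite_cases[OF o k] v by blast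
  then have "S.partner k P = S.partner n P" using same_class_partner[OF k oppositeD(2)[OF o] _ P(1)] by blast
  then show False using opposite_class_partner[OF o P(1)] P(2) by simp
qed

lemma edge_class_partner:
  assumes P: "P \<in> \<P>" "Q \<in> \<P>" "P \<noteq> Q" and e: "x \<in> P" "y \<in> Q" "{x, y} \<in> edges G"
  obtains m where "m \<in> MM" "m x = y" "m y = x" "S.partner m P = Q" "S.partner m Q = P"
proof -
  obtain m where m: "m \<in> MM" "m x = y" "m y = x" by (rule edge_mate[OF e(3)])
  have "S.partner m P = Q" using class_partner_eq[OF m(1) P(1,2) e(1)] m e P(3) by simp
  then show ?thesis using that m class_partner(4)[OF m(1) P(1)] by blast
qed

text \<open>For another class \<open>Q\<close>, the set \<open>v \<inter> Q\<close> is even. An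
  edge that leaves \<open>v\<close> from there belongs to a matching that pairs \<open>Q\<close>
  with the class of \<open>v\<close>. This fixes the matching induced on \<open>H\<close>, so
  \<open>v \<inter> Q\<close> only sees one link and \<open>pocket\<close> applies.\<close>

lemma vertex_in_class:
  assumes v: "v \<in> verts H" shows "v \<subseteq> class_of v"
proof -
  let ?A = "class_of v"
  note A = class_of(1)[OF v]
  have tv: "T v" by (rule tightv[OF v])
  obtain m1 m2 where o: "opposite m1 m2" by (rule opposite_ex)
  have "v \<inter> Q = {}" if Q: "Q \<in> \<P>" "Q \<noteq> ?A" for Q
  proof -
    let ?K = "v \<inter> Q"
    have nod: "\<not> odd_cut ?K" using class_of(2)[OF v Q(1)] Q(2) by (simp add: Int_commute)
    note un = uncross_even[OF tv class_tight[OF Q(1)] nod]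
    have "v - ?K = v - Q" by blast
    then have tK: "T (v - ?K)" using un(1) by simp
    \<comment> \<open>A matching that pairs the class of \<open>v\<close> with \<open>Q\<close>,
      if there is one; otherwise \<open>v \<inter> Q\<close> has no edges that leave
      \<open>v\<close>, and the choice does not matter.\<close>
    define n where "n = (if S.partner m1 ?A = Q then m1 else m2)"
    have n: "n \<in> MM" unfolding n_def using oppositeD[OF o] by simp
    show ?thesis
    proof (rule pocket[OF partnerD(1)[OF n v] _ tK])
      show "?K \<subseteq> v" by blast
      fix x y assume xy: "x \<in> ?K" "y \<notin> v" "{x, y} \<in> edges G"
      obtain m where m: "m \<in> MM" "m x = y" "m y = x" by (rule edge_mate[OF xy(3)])
      have ev: "exit_point m v = x" using exit_eq[OF tv m(1)] xy m by blast
      have clQ: "closed_under m (Q \<union> S.partner m Q)" by (rule class_partner(3)[OF m(1) Q(1)])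
      have QV: "Q \<union> S.partner m Q \<subseteq> V" using tight_sub class_tight Q class_partner(1)[OF m(1) Q(1)] by blast
      have "odd_cut (v \<inter> (Q \<union> S.partner m Q))" using exit_in_closed[OF tv m(1) clQ QV] ev xy(1) by blast
      moreover have "v \<inter> (Q \<union> S.partner m Q) = ?K \<union> (v \<inter> S.partner m Q)" by blast
      moreover have "odd_cut (?K \<union> (v \<inter> S.partner m Q)) \<longleftrightarrow> odd_cut ?K \<noteq> odd_cut (v \<inter> S.partner m Q)"
        by (rule odd_cut_Un_disjoint) (use tv class_tight Q class_partner(1,2)[OF m(1) Q(1)] class_disj in blast)+
      ultimately have "odd_cut (v \<inter> S.partner m Q)" using nod by simp
      then have "S.partner m Q = ?A" using class_of(2)[OF v class_partner(1)[OF m(1) Q(1)]] by (simp add: Int_commute)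
      then have SA: "S.partner m ?A = Q" using class_partner(4)[OF m(1) Q(1)] by simp
      have "partner m v = partner n v"
      proof (cases "S.partner m1 ?A = Q")
        case True
        then show ?thesis using opposite_type[OF o m(1) A _ v] SA unfolding n_def by simp
      next
        case False
        then have "S.partner m2 ?A = Q" using opposite_class_partner_cases[OF o m(1) A] SA by auto
        then show ?thesis using opposite_type[OF oppositeD(4)[OF o] m(1) A _ v] SA False unfolding n_def by simp
      qed
      moreover have "m x \<in> link v (partner m v)"
        using closedD[OF partnerD(2)[OF m(1) v], of x] xy(1) unfolding link_def by blast
      ultimately show "y \<in> link v (partner n v)" using m by simp
    qed
  qed
  then show ?thesis using classes tight_sub[OF tv] by blast
qed

lemma class_of_eq: "v \<in> verts H \<Longrightarrow> P \<in> \<P> \<Longrightarrow> x \<in> v \<Longrightarrow> x \<in> P \<Longrightarrow> class_of v = P"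
  using vertex_in_class class_of(1) class_eq by blast

text \<open>Number the cycle as \<open>c 0, c 1, ...\<close> with \<open>c 0 = v\<close>. It
  passes a vertex \<open>c t\<close> that is disjoint from the class \<open>A\<close> of
  \<open>v\<close>, so \<open>A - v\<close> splits into the points before and after \<open>c
  t\<close>, without edges between the two sides. The class \<open>A\<close> ends on both sides of
  \<open>c t\<close>, once along each of the two matchings, and so each side is attached to one of
  the two classes that matchings pair with \<open>A\<close>.\<close>

theorem core_vertex:
  assumes v: "v \<in> verts H" shows "core \<P> (class_of v) v"
proof -
  let ?A = "class_of v"
  note A = class_of(1)[OF v]
  obtain n c where n: "n \<ge> 3" and bij: "bij_betw c {..<n} (verts H)"
    and E: "edges H = {{c i, c (Suc i mod n)} | i. i < n}" and c0: "c 0 = v"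
    by (rule cycle_rotate[OF cyc v])
  have cV: "c i \<in> verts H" if "i < n" for i using bij that unfolding bij_betw_def by blast
  have ceq: "i = j" if "i < n" "j < n" "c i = c j" for i j
    using bij that unfolding bij_betw_def inj_on_def by simp
  have csur: "\<exists>i<n. w = c i" if "w \<in> verts H" for w using bij that unfolding bij_betw_def by auto
  define ed where "ed i = {c i, c (Suc i mod n)}" for i
  have edE: "ed i \<in> edges H" if "i < n" for i unfolding ed_def E using that by blast
  have edE': "{c i, c (Suc i mod n)} \<in> edges H" if "i < n" for i using edE[OF that] unfolding ed_def .
  have mn: "Suc i mod n < n" for i using n by simp
  have edeq: "i = j" if ij: "i < n" "j < n" "ed i = ed j" for i j
  proof (rule ccontr)
    assume ne: "i \<noteq> j"
    then have "c i = c (Suc j mod n)" "c (Suc i mod n) = c j"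
      using ij ceq unfolding ed_def by (auto simp: doubleton_eq_iff)
    then have 1: "i = Suc j mod n" "Suc i mod n = j" using ceq ij mn by blast+
    show False using 1 ij n by (cases "Suc i = n"; cases "Suc j = n") auto
  qed
  obtain C where C: "C \<in> \<P>" "C \<noteq> ?A" "C \<noteq> ?A" "C \<noteq> ?A" by (rule other_class)
  obtain t where t: "t < n" "vertex_in C = c t" using csur[OF vertex_in(1)[OF C(1)]] by blast
  have At: "?A \<inter> c t = {}" using vertex_in_disj[OF A C(1)] C(2) t(2) by simp
  have vA: "v \<subseteq> ?A" by (rule vertex_in_class[OF v])
  define p where "p i = odd_cut (?A \<inter> c i)" for i
  have p0: "p 0" unfolding p_def c0 using class_of(2)[OF v A] by simp
  have pt: "\<not> p t" unfolding p_def At by simp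
  \<comment> \<open>Parities of the class change between \<open>0\<close> and \<open>t\<close>,
    and again between \<open>t\<close> and \<open>n\<close>.\<close>
  have "\<exists>i<t. p i \<noteq> p (Suc i mod n)"
  proof (rule ccontr)
    assume no: "\<not> ?thesis"
    have "i \<le> t \<Longrightarrow> p i" for i
    proof (induction i)
      case (Suc i)
      then have "p i = p (Suc i mod n)" using no by simp
      moreover have "Suc i mod n = Suc i" using Suc.prems t by simp
      ultimately show ?case using Suc by simp
    qed (use p0 in simp)
    then show False using pt by blast
  qed
  then obtain j where j: "j < t" "p j \<noteq> p (Suc j mod n)" by blast
  have "\<exists>i<n. t \<le> i \<and> p i \<noteq> p (Suc i mod n)"
  proof (rule ccontr)
    assume no: "\<not> ?thesis"
    have "t + i < n \<Longrightarrow> \<not> p (t + i)" for i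
    proof (induction i)
      case (Suc i)
      then have "p (t + i) = p (Suc (t + i) mod n)" using no by simp
      moreover have "Suc (t + i) mod n = t + Suc i" using Suc.prems by simp
      ultimately show ?case using Suc by simp
    qed (use pt in simp)
    from this[of "n - 1 - t"] have "\<not> p (n - 1)" using t n by simp
    moreover have "p (n - 1) = p (Suc (n - 1) mod n)" using no t n by simp
    moreover have "Suc (n - 1) mod n = 0" using n by simp
    ultimately show False using p0 by simp
  qed
  then obtain k where k: "k < n" "t \<le> k" "p k \<noteq> p (Suc k mod n)" by blast
  have jn: "j < n" using j t by simp
  obtain n1 where n1: "n1 \<in> MM" "partner n1 (c j) = c (Suc j mod n)" "partner n1 (c (Suc j mod n)) = c j"
    using edE'[OF jn] by (rule edge_real)
  obtain n2 where n2: "n2 \<in> MM" "partner n2 (c k) = c (Suc k mod n)" "partner n2 (c (Suc k mod n)) = c k"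
    using edE'[OF k(1)] by (rule edge_real)
  have exitA: "exit_point m ?A \<in> link (c i) (c (Suc i mod n))"
    if m: "m \<in> MM" "partner m (c i) = c (Suc i mod n)" and i: "i < n" "p i \<noteq> p (Suc i mod n)" for m i
  proof -
    have "odd_cut (?A \<inter> link (c i) (c (Suc i mod n)))" using class_odd_cut_link[OF A edE'[OF i(1)]] i(2) unfolding p_def by blast
    then show ?thesis using link_odd[OF m(1) cV[OF i(1)] class_tight[OF A]] m(2) by simp
  qed
  \<comment> \<open>One matching cannot pair both changing edges, as the exit of the class lies in
    one link only.\<close>
  have o: "opposite n1 n2"
  proof (rule oppositeI[OF n1(1) n2(1) cV[OF k(1)]])
    show "partner n1 (c k) \<noteq> partner n2 (c k)"
    proof
      assume "partner n1 (c k) = partner n2 (c k)"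
      then have "partner n1 (c k) = c (Suc k mod n)" using n2 by simp
      then have "exit_point n1 ?A \<in> link (c k) (partner n1 (c k))" "exit_point n1 ?A \<in> link (c j) (partner n1 (c j))"
        using exitA[OF n1(1) _ k(1,3)] exitA[OF n1(1,2) jn j(2)] n1(2) by simp_all
      then have "{c k, partner n1 (c k)} = {c j, partner n1 (c j)}"
        by (rule unit_unique[OF n1(1) cV[OF k(1)] cV[OF jn]])
      then have "ed k = ed j" unfolding ed_def using \<open>partner n1 (c k) = c (Suc k mod n)\<close> n1(2) by simp
      then show False using edeq[OF k(1) jn] j k by simp
    qed
  qed
  \<comment> \<open>Marks the points strictly between \<open>v\<close> and \<open>c t\<close> in
    the direction of increasing index.\<close>
  define lab where "lab x \<longleftrightarrow> (\<exists>i<t. (0 < i \<and> x \<in> c i) \<or> x \<in> \<epsilon> (ed i))" for x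
  have lab1: "lab x \<longleftrightarrow> 0 < i \<and> i < t" if x: "x \<in> c i" "i < n" for x i
  proof -
    have "x \<notin> \<epsilon> (ed l)" if "l < t" for l
      using vert_eps[OF cV[OF x(2)] edE[OF less_trans[OF that t(1)]] x(1)] by blast
    moreover have "l = i" if "l < t" "x \<in> c l" for l
      using vert_eq[OF cV[OF less_trans[OF that(1) t(1)]] cV[OF x(2)] that(2) x(1)]
        ceq[OF less_trans[OF that(1) t(1)] x(2)] by blast
    ultimately show ?thesis unfolding lab_def using x by blast
  qed
  have lab2: "lab x \<longleftrightarrow> i < t" if x: "x \<in> \<epsilon> (ed i)" "i < n" for x i
  proof -
    have "x \<notin> c l" if "l < t" for l
      using vert_eps[OF cV[OF less_trans[OF that t(1)]] edE[OF x(2)] _ x(1)] by blast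
    moreover have "l = i" if "l < t" "x \<in> \<epsilon> (ed l)" for l
      using eps_eq[OF edE[OF less_trans[OF that(1) t(1)]] edE[OF x(2)] that(2) x(1)]
        edeq[OF less_trans[OF that(1) t(1)] x(2)] by blast
    ultimately show ?thesis unfolding lab_def using x by blast
  qed
  have where_x: "(\<exists>i<n. x \<in> c i \<and> i \<noteq> 0 \<and> i \<noteq> t) \<or> (\<exists>i<n. x \<in> \<epsilon> (ed i))" if x: "x \<in> ?A" "x \<notin> v" for x
  proof -
    have "x \<in> V" using tight_sub[OF class_tight[OF A]] x by blast
    from cover[OF this] show ?thesis
    proof
      assume "\<exists>w\<in>verts H. x \<in> w"
      then obtain i where i: "i < n" "x \<in> c i" using csur by blast
      have "i \<noteq> 0" using i x(2) c0 by metis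
      moreover have "i \<noteq> t" using i x(1) At by blast
      ultimately show ?thesis using i by blast
    next
      assume "\<exists>e\<in>edges H. x \<in> \<epsilon> e"
      then obtain e where e: "e \<in> edges H" "x \<in> \<epsilon> e" by blast
      then obtain i where "i < n" "e = ed i" unfolding E ed_def by blast
      then show ?thesis using e(2) by blast
    qed
  qed
  have nb: "i' = Suc i mod n \<or> i = Suc i' mod n \<or> i = i'"
    if ii: "i < n" "i' < n" "x \<in> c i" "y \<in> c i'" "{x, y} \<in> edges G" for i i' x y
  proof (cases "i = i'")
    case False
    then have "c i \<noteq> c i'" using ceq ii by blast
    then have "{c i, c i'} \<in> edges H" using nonadj[OF cV[OF ii(1)] cV[OF ii(2)] _ ii(3-5)] by blast
    then obtain l where l: "l < n" "{c i, c i'} = {c l, c (Suc l mod n)}" unfolding E by blast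
    then have "c i = c l \<and> c i' = c (Suc l mod n) \<or> c i = c (Suc l mod n) \<and> c i' = c l"
      by (simp add: doubleton_eq_iff)
    then show ?thesis using ceq[OF ii(1) l(1)] ceq[OF ii(2) mn] ceq[OF ii(1) mn] ceq[OF ii(2) l(1)] by blast
  qed blast
  have ve: "i' = i \<or> i' = Suc i mod n"
    if ii: "i < n" "i' < n" "x \<in> \<epsilon> (ed i)" "y \<in> c i'" "{x, y} \<in> edges G" for i i' x y
  proof -
    have "y \<in> link (c i) (c (Suc i mod n))" using N_eps[OF edE'[OF ii(1)], of x y] ii unfolding ed_def by blast
    moreover have "y \<notin> \<epsilon> (ed i)" using vert_eps[OF cV[OF ii(2)] edE[OF ii(1)] ii(4)] by blast
    ultimately have "y \<in> c i \<or> y \<in> c (Suc i mod n)" unfolding link_def ed_def by blast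
    then have "c i' = c i \<or> c i' = c (Suc i mod n)"
      using vert_eq[OF cV[OF ii(2)] cV[OF ii(1)] ii(4)] vert_eq[OF cV[OF ii(2)] cV[OF mn] ii(4)] by blast
    then show ?thesis using ceq[OF ii(2,1)] ceq[OF ii(2) mn] by blast
  qed
  have ee: "i' = i"
    if ii: "i < n" "i' < n" "x \<in> \<epsilon> (ed i)" "y \<in> \<epsilon> (ed i')" "{x, y} \<in> edges G" for i i' x y
  proof -
    have "y \<in> link (c i) (c (Suc i mod n))" using N_eps[OF edE'[OF ii(1)], of x y] ii unfolding ed_def by blast
    moreover have "y \<notin> c l" if "l < n" for l using vert_eps[OF cV[OF that] edE[OF ii(2)]] ii(4) by blast
    ultimately have "y \<in> \<epsilon> (ed i)" unfolding link_def ed_def using ii(1) mn by blast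
    then show ?thesis using eps_eq[OF edE[OF ii(2)] edE[OF ii(1)] ii(4)] edeq[OF ii(2,1)] by blast
  qed
  have lab_adj: "lab x = lab y" if xy: "x \<in> ?A" "x \<notin> v" "y \<in> ?A" "y \<notin> v" "{x, y} \<in> edges G" for x y
  proof -
    have xy': "{y, x} \<in> edges G" using xy(5) by (simp add: insert_commute)
    have wrap: "Suc i mod n = (if Suc i = n then 0 else Suc i)" if "i < n" for i using that by auto
    from where_x[OF xy(1,2)] show ?thesis
    proof
      assume "\<exists>i<n. x \<in> c i \<and> i \<noteq> 0 \<and> i \<noteq> t"
      then obtain i where i: "i < n" "x \<in> c i" "i \<noteq> 0" "i \<noteq> t" by blast
      from where_x[OF xy(3,4)] show ?thesis
      proof
        assume "\<exists>i<n. y \<in> c i \<and> i \<noteq> 0 \<and> i \<noteq> t"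
        then obtain i' where i': "i' < n" "y \<in> c i'" "i' \<noteq> 0" "i' \<noteq> t" by blast
        show ?thesis using nb[OF i(1) i'(1) i(2) i'(2) xy(5)] lab1[OF i(2,1)] lab1[OF i'(2,1)] i i'
          wrap[OF i(1)] wrap[OF i'(1)] by (auto split: if_splits)
      next
        assume "\<exists>i<n. y \<in> \<epsilon> (ed i)"
        then obtain i' where i': "i' < n" "y \<in> \<epsilon> (ed i')" by blast
        show ?thesis using ve[OF i'(1) i(1) i'(2) i(2) xy'] lab1[OF i(2,1)] lab2[OF i'(2,1)] i i'
          wrap[OF i'(1)] by (auto split: if_splits)
      qed
    next
      assume "\<exists>i<n. x \<in> \<epsilon> (ed i)"
      then obtain i where i: "i < n" "x \<in> \<epsilon> (ed i)" by blast
      from where_x[OF xy(3,4)] show ?thesis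
      proof
        assume "\<exists>i<n. y \<in> c i \<and> i \<noteq> 0 \<and> i \<noteq> t"
        then obtain i' where i': "i' < n" "y \<in> c i'" "i' \<noteq> 0" "i' \<noteq> t" by blast
        show ?thesis using ve[OF i(1) i'(1) i(2) i'(2) xy(5)] lab2[OF i(2,1)] lab1[OF i'(2,1)] i i'
          wrap[OF i(1)] by (auto split: if_splits)
      next
        assume "\<exists>i<n. y \<in> \<epsilon> (ed i)"
        then obtain i' where i': "i' < n" "y \<in> \<epsilon> (ed i')" by blast
        show ?thesis using ee[OF i(1) i'(1) i(2) i'(2) xy(5)] lab2[OF i(2,1)] lab2[OF i'(2,1)] by simp
      qed
    qed
  qed
  define r where "r x = (if lab x then S.partner n1 ?A else S.partner n2 ?A)" for x
  have r_in: "r x \<in> \<P> - {?A}" for x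
    unfolding r_def using class_partner(1,2)[OF n1(1) A] class_partner(1,2)[OF n2(1) A] by simp
  have in_unit: "lab x \<longleftrightarrow> i < t"
    if x: "x \<in> ?A" "x \<notin> v" "x \<in> link (c i) (c (Suc i mod n))" "i < n" for x i
  proof -
    have "x \<notin> c 0" "x \<notin> c t" using x c0 At by blast+
    have "x \<in> c i \<or> x \<in> c (Suc i mod n) \<or> x \<in> \<epsilon> (ed i)" using x(3) unfolding link_def ed_def by blast
    then show ?thesis
    proof (elim disjE)
      assume "x \<in> c i"
      moreover have "i \<noteq> 0" using \<open>x \<notin> c 0\<close> calculation by metis
      ultimately show ?thesis using lab1[OF _ x(4)] by simp
    next
      assume a: "x \<in> c (Suc i mod n)"
      then have "Suc i mod n \<noteq> 0" "Suc i mod n \<noteq> t" using \<open>x \<notin> c 0\<close> \<open>x \<notin> c t\<close> by metis+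
      moreover have "Suc i mod n = Suc i" using calculation(1) x(4) by (cases "Suc i = n") auto
      ultimately show ?thesis using lab1[OF a mn] by auto
    next
      assume "x \<in> \<epsilon> (ed i)"
      then show ?thesis using lab2[OF _ x(4)] by blast
    qed
  qed
  have "r x \<in> \<P> - {?A} \<and> (\<forall>y. {x, y} \<in> edges G \<longrightarrow> y \<in> v \<union> r x \<or> (y \<in> ?A - v \<and> r y = r x))"
    if x: "x \<in> ?A - v" for x
  proof (intro conjI allI impI)
    show "r x \<in> \<P> - {?A}" by (rule r_in)
    fix y assume xy: "{x, y} \<in> edges G"
    show "y \<in> v \<union> r x \<or> (y \<in> ?A - v \<and> r y = r x)"
    proof (cases "y \<in> ?A")
      case True
      show ?thesis
      proof (cases "y \<in> v")
        case False
        then have "lab x = lab y" using lab_adj[OF _ _ True False xy] x by blast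
        then show ?thesis using True False unfolding r_def by simp
      qed blast
    next
      case False
      obtain m where m: "m \<in> MM" "m x = y" "m y = x" by (rule edge_mate[OF xy])
      have ex: "exit_point m ?A = x" using exit_eq[OF class_tight[OF A] m(1)] x m False by blast
      then have yS: "y \<in> S.partner m ?A" using class_partner(5)[OF m(1) A] m by simp
      from opposite_cases[OF o m(1)] have "S.partner m ?A = r x"
      proof
        assume s: "\<forall>v\<in>verts H. partner m v = partner n1 v"
        then have "partner m (c j) = c (Suc j mod n)" using n1 cV[OF jn] by simp
        then have "lab x" using in_unit[OF _ _ _ jn] exitA[OF m(1) _ jn j(2)] ex x j by simp
        moreover have "S.partner m ?A = S.partner n1 ?A" using same_class_partner[OF m(1) n1(1) _ A] s by blast
        ultimately show ?thesis unfolding r_def by simp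
      next
        assume s: "\<forall>v\<in>verts H. partner m v = partner n2 v"
        then have "partner m (c k) = c (Suc k mod n)" using n2 cV[OF k(1)] by simp
        then have "\<not> lab x" using in_unit[OF _ _ _ k(1)] exitA[OF m(1) _ k(1,3)] ex x k by simp
        moreover have "S.partner m ?A = S.partner n2 ?A" using same_class_partner[OF m(1) n2(1) _ A] s by blast
        ultimately show ?thesis unfolding r_def by simp
      qed
      then show ?thesis using yS by blast
    qed
  qed
  then show ?thesis unfolding core_def using tightv[OF v] vA by blast
qed

end

section \<open>Cores in a cycle, and uniqueness\<close>

context cycle_torsoid
begin

text \<open>Prepares a forbidden splitting: if \<open>v\<close> splits into three tight sets and
  matchings to the neighbour \<open>u\<close> exit through \<open>Z1\<close>, those to the other
  neighbour through \<open>Z3\<close>, then \<open>Z1\<close> together with the adjacent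
  \<open>\<epsilon>\<close> is tight, and so is the union with \<open>u\<close> and
  \<open>Z2\<close>.\<close>

lemma split_side:
  assumes o: "opposite m1 m2" and v: "v \<in> verts H"
    and Z: "T Z1" "T Z2" "T Z3" "v = Z1 \<union> Z2 \<union> Z3" "Z1 \<inter> Z2 = {}" "Z1 \<inter> Z3 = {}" "Z2 \<inter> Z3 = {}"
    and x1: "\<And>m. m \<in> MM \<Longrightarrow> partner m v = partner m1 v \<Longrightarrow> exit_point m v \<in> Z1"
    and x3: "\<And>m. m \<in> MM \<Longrightarrow> partner m v = partner m2 v \<Longrightarrow> exit_point m v \<in> Z3"
  defines "u \<equiv> partner m1 v"
  shows "T (Z1 \<union> \<epsilon> {u, v})" "T (u \<union> (Z1 \<union> \<epsilon> {u, v}) \<union> Z2)"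
proof -
  define E1 where "E1 = \<epsilon> {u, v}"
  have E1': "E1 = \<epsilon> {v, u}" unfolding E1_def by (simp add: insert_commute)
  have vu: "{v, u} \<in> edges H" "{u, v} \<in> edges H" and u: "u \<in> verts H" "u \<noteq> v"
    unfolding u_def using partnerD[OF oppositeD(1)[OF o] v] edgeH_sym by blast+
  have tv: "T v" "T u" using tightv v u by blast+
  have dis: "u \<inter> v = {}" "u \<inter> E1 = {}" "v \<inter> E1 = {}"
    unfolding E1_def using disjv[OF u(1) v u(2)] disve[OF u(1) vu(2)] disve[OF v vu(2)] by blast+
  have E1V: "E1 \<subseteq> V" unfolding E1_def by (rule subV[OF vu(2)])
  have ex_v: "exit_point m v = y" if "m \<in> MM" "y \<in> v" "m y \<notin> v" for m y
    using exit_eq[OF tv(1)] that by blast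
  have t1: "T (Z1 \<union> E1)"
  proof (rule bridge[OF Z(1) tv(2)])
    show "Z1 \<inter> u = {}" "E1 \<inter> Z1 = {}" "E1 \<inter> u = {}" using dis Z(4) by blast+
    show "E1 \<subseteq> V" by (rule E1V)
    show "\<not> odd_cut E1" unfolding E1_def by (rule even_eps[OF vu(2)])
    fix x y assume x: "x \<in> E1" and e: "{x, y} \<in> edges G"
    have "y \<in> link u v" using N_eps[OF vu(2) _ e] x unfolding E1_def by blast
    then consider "y \<in> u" | "y \<in> E1" | "y \<in> v" unfolding link_def E1_def by blast
    then show "y \<in> E1 \<union> Z1 \<union> u"
    proof cases
      case 3
      obtain m where m: "m \<in> MM" "m x = y" "m y = x" by (rule edge_mate[OF e])
      have "partner m v = u" by (rule partner_pointI[OF m(1) vu(1) 3]) (use m x in \<open>simp add: E1'\<close>)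
      moreover have "exit_point m v = y" using ex_v[OF m(1) 3] m(3) x dis by blast
      ultimately show ?thesis using x1[OF m(1)] unfolding u_def by auto
    qed auto
  qed
  then show "T (Z1 \<union> \<epsilon> {u, v})" unfolding E1_def .
  have "T (u \<union> (Z1 \<union> E1) \<union> Z2)"
  proof (rule tightI)
    let ?Z = "u \<union> (Z1 \<union> E1) \<union> Z2"
    show "?Z \<subseteq> V" using E1V tight_sub tv Z(1,2) by blast
    fix m assume m: "m \<in> MM"
    have mm: "m (m x) = x" if "x \<in> ?Z" for x using mateD(2)[OF m] that \<open>?Z \<subseteq> V\<close> by blast
    define e where "e = exit_point m v"
    have e: "e \<in> v" "m e \<notin> v" "m (m e) = e" unfolding e_def using exit_point(1,2,7)[OF tv(1) m] by blast+
    from opposite_nbr[OF o partnerD(1)[OF m v]] show "\<exists>x. exits m ?Z = {x}"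
    proof
      assume t: "partner m v = partner m1 v"
      then have clU: "closed_under m (link v u)" using partnerD(2)[OF m v] unfolding u_def by simp
      have Ueq: "link v u = ?Z \<union> Z3" unfolding link_def E1' Z(4) by blast
      have eZ: "e \<in> Z1" unfolding e_def by (rule x1[OF m t])
      then have eZ1: "exit_point m Z1 = e" using exit_eq[OF Z(1) m] e Z(4) by blast
      define s where "s = exit_point m Z2"
      have s: "s \<in> Z2" "m s \<notin> Z2" "m (m s) = s" unfolding s_def using exit_point(1,2,7)[OF Z(2) m] by blast+
      have sv: "s \<in> v" using s Z(4) by blast
      have "s \<noteq> e" using s eZ Z(5) by blast
      then have msv: "m s \<in> v" using ex_v[OF m sv] unfolding e_def by blast
      have "m s \<notin> Z1"
      proof
        assume a: "m s \<in> Z1"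
        have "m (m s) \<notin> Z1" using s(1,3) Z(5) by auto
        then have "m s = e" using exit_eq[OF Z(1) m a] eZ1 by simp
        then show False using s(3) e(2) sv by simp
      qed
      then have ms: "m s \<in> Z3" using msv s(2) Z(4) by blast
      have "exits m ?Z = {s}"
      proof
        show "{s} \<subseteq> exits m ?Z" using s ms msv dis Z(6,7) unfolding exits_def by blast
        show "exits m ?Z \<subseteq> {s}"
        proof
          fix x assume "x \<in> exits m ?Z"
          then have x: "x \<in> ?Z" "m x \<notin> ?Z" unfolding exits_def by blast+
          have "m x \<in> link v u" using closedD[OF clU, of x] x(1) Ueq by blast
          then have mx: "m x \<in> Z3" "m x \<in> v" using x(2) Ueq Z(4) by blast+
          have "x \<in> v"
          proof (rule ccontr)
            assume "x \<notin> v"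
            then have "m x = e" using ex_v[OF m mx(2)] mm[OF x(1)] unfolding e_def by simp
            then show False using mx(1) eZ Z(6) by blast
          qed
          moreover have "x \<notin> Z1"
          proof
            assume "x \<in> Z1"
            then have "x = e" using exit_eq[OF Z(1) m] mx Z(6) eZ1 by blast
            then show False using e(2) mx by simp
          qed
          ultimately have "x \<in> Z2" using x(1) dis by blast
          then show "x \<in> {s}" using exit_eq[OF Z(2) m, of x] mx Z(7) unfolding s_def by blast
        qed
      qed
      then show ?thesis by blast
    next
      assume t: "partner m v = partner m2 v"
      then have ne: "partner m v \<noteq> u" using oppositeD(3)[OF o v] unfolding u_def by simp
      have clE: "closed_under m E1" unfolding E1' by (rule closed_eps[OF m vu(1) ne])
      have eZ: "e \<in> Z3" unfolding e_def by (rule x3[OF m t])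
      then have eZ3: "exit_point m Z3 = e" using exit_eq[OF Z(3) m] e Z(4) by blast
      define t where "t = exit_point m u"
      have t: "t \<in> u" "m t \<notin> u" unfolding t_def using exit_point(1,2)[OF tv(2) m] by blast+
      define u' where "u' = partner m u"
      have u': "u' \<in> verts H" "{u, u'} \<in> edges H" "m t \<in> \<epsilon> {u, u'} \<union> u'"
        unfolding u'_def t_def using partnerD[OF m u(1)] exit_partner[OF m u(1)] by blast+
      have u'v: "u' \<noteq> v" using ne partner_partner[OF m u(1)] unfolding u'_def by auto
      then have ne': "{u, u'} \<noteq> {u, v}" by (auto simp: doubleton_eq_iff)
      have mt: "m t \<notin> v" "m t \<notin> E1"
        using u'(3) disjv[OF u'(1) v u'v] disve[OF v u'(2)] dise[OF u'(2) vu(2) ne'] disve[OF u'(1) vu(2)]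
        unfolding E1_def by blast+
      have "exits m ?Z = {t}"
      proof
        show "{t} \<subseteq> exits m ?Z" using t mt Z(4) unfolding exits_def by blast
        show "exits m ?Z \<subseteq> {t}"
        proof
          fix x assume "x \<in> exits m ?Z"
          then have x: "x \<in> ?Z" "m x \<notin> ?Z" unfolding exits_def by blast+
          have "x \<notin> E1" using closedD[OF clE] x by blast
          moreover have "x \<notin> Z1 \<union> Z2"
          proof
            assume a: "x \<in> Z1 \<union> Z2"
            then have xv: "x \<in> v" "x \<noteq> e" "x \<notin> Z3" using Z(4,6,7) eZ by blast+
            then have "m x \<in> v" using ex_v[OF m xv(1)] unfolding e_def by blast
            then have mx: "m x \<in> Z3" using x(2) Z(4) by blast
            then have "m x = e" using exit_eq[OF Z(3) m mx] mm[OF x(1)] xv eZ3 by simp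
            then show False using mm[OF x(1)] e(2) xv by simp
          qed
          ultimately have "x \<in> u" using x by blast
          then show "x \<in> {t}" using exit_eq[OF tv(2) m, of x] x unfolding t_def by blast
        qed
      qed
      then show ?thesis by blast
    qed
  qed
  then show "T (u \<union> (Z1 \<union> \<epsilon> {u, v}) \<union> Z2)" unfolding E1_def .
qed

lemma no_split:
  assumes o: "opposite m1 m2" and v: "v \<in> verts H"
    and Z: "T Z1" "T Z2" "T Z3" "v = Z1 \<union> Z2 \<union> Z3" "Z1 \<inter> Z2 = {}" "Z1 \<inter> Z3 = {}" "Z2 \<inter> Z3 = {}"
    and x1: "\<And>m. m \<in> MM \<Longrightarrow> partner m v = partner m1 v \<Longrightarrow> exit_point m v \<in> Z1"
    and x3: "\<And>m. m \<in> MM \<Longrightarrow> partner m v = partner m2 v \<Longrightarrow> exit_point m v \<in> Z3"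
  shows False
proof -
  define u w where "u = partner m1 v" and "w = partner m2 v"
  have uw: "{u, v} \<in> edges H" "{v, w} \<in> edges H" "u \<noteq> w"
    unfolding u_def w_def using partnerD[OF oppositeD(1)[OF o] v] partnerD[OF oppositeD(2)[OF o] v] edgeH_sym oppositeD(3)[OF o v] by blast+
  have "{u, v} \<noteq> {v, w}" using uw(3) by (auto simp: doubleton_eq_iff)
  then have EE: "\<epsilon> {u, v} \<inter> \<epsilon> {v, w} = {}" using dise uw by blast
  have vE: "v \<inter> \<epsilon> {u, v} = {}" "v \<inter> \<epsilon> {v, w} = {}" using disve v uw by blast+
  note a = split_side[OF o v Z x1 x3, folded u_def]
  have Z': "v = Z3 \<union> Z2 \<union> Z1" "Z3 \<inter> Z2 = {}" "Z3 \<inter> Z1 = {}" "Z2 \<inter> Z1 = {}" using Z by blast+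
  note b = split_side[OF oppositeD(4)[OF o] v Z(3,2,1) Z' x3 x1, folded w_def]
  have w': "\<epsilon> {w, v} = \<epsilon> {v, w}" by (simp add: insert_commute)
  have eq: "Z2 \<union> (Z3 \<union> \<epsilon> {v, w}) \<union> w = w \<union> (Z3 \<union> \<epsilon> {w, v}) \<union> Z2" unfolding w' by blast
  show False
  proof (rule unrefined[OF uw a(1) Z(2) b(1)[unfolded w']])
    show "T (u \<union> (Z1 \<union> \<epsilon> {u, v}) \<union> Z2)" by (rule a(2))
    show "T (Z2 \<union> (Z3 \<union> \<epsilon> {v, w}) \<union> w)" unfolding eq by (rule b(2))
    show "(Z1 \<union> \<epsilon> {u, v}) \<inter> Z2 = {}" "Z2 \<inter> (Z3 \<union> \<epsilon> {v, w}) = {}"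
      "(Z1 \<union> \<epsilon> {u, v}) \<inter> (Z3 \<union> \<epsilon> {v, w}) = {}"
      using vE EE Z(4-7) by blast+
    show "Z1 \<union> \<epsilon> {u, v} \<union> Z2 \<union> (Z3 \<union> \<epsilon> {v, w}) = \<epsilon> {u, v} \<union> v \<union> \<epsilon> {v, w}" using Z(4) by blast
  qed
qed

end

context cleaved_cycle
begin

text \<open>A core \<open>X\<close> of \<open>A\<close> in the cyclic case: the rest of
  \<open>A\<close> consists of \<open>L\<close>, attached to the class that \<open>m2\<close>
  pairs with \<open>A\<close>, and \<open>R\<close>, attached to the class that \<open>m1\<close>
  pairs with \<open>A\<close>.\<close>

definition split where
  "split A X L R m1 m2 \<longleftrightarrow> A \<in> \<P> \<and> T X \<and> A = X \<union> L \<union> R \<and> X \<inter> L = {} \<and> X \<inter> R = {} \<and> L \<inter> R = {} \<and> opposite m1 m2 \<and>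
    (\<forall>x\<in>L. \<forall>y. {x, y} \<in> edges G \<longrightarrow> y \<in> L \<union> X \<union> S.partner m2 A) \<and>
    (\<forall>x\<in>R. \<forall>y. {x, y} \<in> edges G \<longrightarrow> y \<in> R \<union> X \<union> S.partner m1 A)"

lemma split_sym: "split A X L R m1 m2 \<Longrightarrow> split A X R L m2 m1"
  unfolding split_def using oppositeD(4) by blast

lemma splitD:
  assumes "split A X L R m1 m2"
  shows "A \<in> \<P>" "T X" "A = X \<union> L \<union> R" "X \<inter> L = {}" "X \<inter> R = {}" "L \<inter> R = {}" "opposite m1 m2"
    "\<And>x y. x \<in> L \<Longrightarrow> {x, y} \<in> edges G \<Longrightarrow> y \<in> L \<union> X \<union> S.partner m2 A"
    "\<And>x y. x \<in> R \<Longrightarrow> {x, y} \<in> edges G \<Longrightarrow> y \<in> R \<union> X \<union> S.partner m1 A"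
    "S.partner m1 A \<in> \<P>" "S.partner m2 A \<in> \<P>" "S.partner m1 A \<noteq> A" "S.partner m2 A \<noteq> A" "S.partner m1 A \<noteq> S.partner m2 A"
    "A \<subseteq> V" "T A"
proof -
  note s = assms[unfolded split_def]
  show "A \<in> \<P>" "T X" "A = X \<union> L \<union> R" "X \<inter> L = {}" "X \<inter> R = {}" "L \<inter> R = {}" "opposite m1 m2"
    "\<And>x y. x \<in> L \<Longrightarrow> {x, y} \<in> edges G \<Longrightarrow> y \<in> L \<union> X \<union> S.partner m2 A"
    "\<And>x y. x \<in> R \<Longrightarrow> {x, y} \<in> edges G \<Longrightarrow> y \<in> R \<union> X \<union> S.partner m1 A"
    using s by blast+
  have A: "A \<in> \<P>" and o: "opposite m1 m2" using s by blast+
  show "S.partner m1 A \<in> \<P>" "S.partner m2 A \<in> \<P>" "S.partner m1 A \<noteq> A" "S.partner m2 A \<noteq> A"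
    using class_partner[OF oppositeD(1)[OF o] A] class_partner[OF oppositeD(2)[OF o] A] by blast+
  show "S.partner m1 A \<noteq> S.partner m2 A" by (rule opposite_class_partner[OF o A])
  show "T A" by (rule class_tight[OF A])
  then show "A \<subseteq> V" by (rule tight_sub)
qed

text \<open>A matching that pairs \<open>A\<close> with the class on the side of \<open>R\<close>
  can only leave \<open>L\<close> into \<open>X\<close>.\<close>

lemma split_exits:
  assumes s: "split A X L R m1 m2" and m: "m \<in> MM" "S.partner m A = S.partner m1 A"
  shows "exits m L \<subseteq> {m (exit_point m X)}" "odd_cut L \<longleftrightarrow> m (exit_point m X) \<in> L" "fin_cut L"
proof -
  note D = splitD[OF s]
  have LV: "L \<subseteq> V" using D(3,15) by blast
  show sub: "exits m L \<subseteq> {m (exit_point m X)}"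
  proof
    fix x assume "x \<in> exits m L"
    then have x: "x \<in> L" "m x \<notin> L" "x \<in> V" "x \<in> A" using LV D(3) unfolding exits_def by blast+
    have "m x \<notin> S.partner m2 A"
      using class_partner_eq[OF m(1) D(1,11) x(4)] D(13,14) m(2) by metis
    then have mx: "m x \<in> X" using D(8)[OF x(1) mateD(1)[OF m(1) x(3)]] x by blast
    have mm: "m (m x) = x" using mateD(2)[OF m(1) x(3)] .
    then have "exit_point m X = m x" using exit_eq[OF D(2) m(1) mx] x D(4) by auto
    then show "x \<in> {m (exit_point m X)}" using mm by simp
  qed
  show "fin_cut L" by (rule fin_cutI[OF LV m(1)]) (rule finite_subset[OF sub], simp)
  show "odd_cut L \<longleftrightarrow> m (exit_point m X) \<in> L"
  proof
    assume "odd_cut L"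
    then have "exits m L \<noteq> {}" using odd_cut_iff[OF LV m(1)] by auto
    then show "m (exit_point m X) \<in> L" using sub unfolding exits_def by blast
  next
    assume a: "m (exit_point m X) \<in> L"
    have "m (m (exit_point m X)) \<notin> L" using exit_point(1,7)[OF D(2) m(1)] D(4) by auto
    then have "exits m L = {m (exit_point m X)}" using a sub unfolding exits_def by blast
    then show "odd_cut L" using odd_cut_iff[OF LV m(1)] by simp
  qed
qed

lemma split_fin_cut:
  assumes s: "split A X L R m1 m2" shows "fin_cut L" "fin_cut R"
  using split_exits(3)[OF s oppositeD(1)[OF splitD(7)[OF s]] refl]
    split_exits(3)[OF split_sym[OF s] oppositeD(2)[OF splitD(7)[OF s]] refl] .

lemma odd_cut_three:
  assumes "fin_cut A" "fin_cut B" "fin_cut C" "A \<inter> B = {}" "A \<inter> C = {}" "B \<inter> C = {}"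
  shows "odd_cut (A \<union> B \<union> C) \<longleftrightarrow> ((odd_cut A \<noteq> odd_cut B) \<noteq> odd_cut C)"
proof -
  have "odd_cut (A \<union> B \<union> C) \<longleftrightarrow> odd_cut (A \<union> B) \<noteq> odd_cut C" by (rule odd_cut_Un_disjoint) (use assms in blast)+
  then show ?thesis using odd_cut_Un_disjoint[OF assms(1,2,4)] by simp
qed

lemma split_parity:
  assumes s: "split A X L R m1 m2" shows "odd_cut L = odd_cut R"
proof -
  note D = splitD[OF s]
  have "odd_cut A \<longleftrightarrow> ((odd_cut X \<noteq> odd_cut L) \<noteq> odd_cut R)"
    unfolding D(3) by (rule odd_cut_three) (use split_fin_cut[OF s] D in blast)+
  then show ?thesis using odd_cut_tight[OF D(2)] odd_cut_tight[OF D(16)] by blast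
qed

lemma split_even_tight:
  assumes s: "split A X L R m1 m2" and e: "\<not> odd_cut L"
  shows "T (S.partner m2 A \<union> L)"
proof -
  note D = splitD[OF s]
  have dj: "A \<inter> S.partner m2 A = {}" using class_disj[OF D(1,11)] D(13) by metis
  have AX: "X \<subseteq> A" "L \<subseteq> A" using D(3) by blast+
  show ?thesis
  proof (rule bridge[OF class_tight[OF D(11)] D(2) _ _ _ _ e])
    show "S.partner m2 A \<inter> X = {}" "L \<inter> S.partner m2 A = {}" using dj AX by blast+
    show "L \<subseteq> V" using AX D(15) by blast
    show "L \<inter> X = {}" using D(4) by blast
    show "y \<in> L \<union> S.partner m2 A \<union> X" if "x \<in> L" "{x, y} \<in> edges G" for x y
      using D(8)[OF that] by blast
  qed
qed

text \<open>If \<open>L\<close> is odd then so is \<open>R\<close>. Each matching then goes from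
  the exit of \<open>X\<close> into the side that it does not use for leaving
  \<open>A\<close>.\<close>

lemma split_odd_tight:
  assumes s: "split A X L R m1 m2" and odd_cut: "odd_cut L"
  shows "T L" "T (S.partner m2 A \<union> L \<union> X)"
proof -
  note D = splitD[OF s]
  let ?D = "S.partner m2 A"
  have dj: "A \<inter> ?D = {}" using class_disj[OF D(1,11)] D(13) by metis
  have dj2: "S.partner m1 A \<inter> ?D = {}" using class_disj[OF D(10,11,14)] .
  have LV: "L \<subseteq> V" using D(3,15) by blast
  have odR: "odd_cut R" using split_parity[OF s] odd_cut by simp
  have type: "S.partner m A = S.partner m1 A \<or> S.partner m A = ?D" if "m \<in> MM" for m using opposite_class_partner_cases[OF D(7) that D(1)] .
  have t2: "m (exit_point m X) \<in> R" if m: "m \<in> MM" "S.partner m A = ?D" for m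
    using split_exits(2)[OF split_sym[OF s] m] odR by blast
  have t1: "m (exit_point m X) \<in> L" if m: "m \<in> MM" "S.partner m A = S.partner m1 A" for m
    using split_exits(2)[OF s m] odd_cut by blast
  show "T L"
  proof (rule tightI[OF LV])
    fix m assume m: "m \<in> MM"
    have "\<exists>z. exits m L \<subseteq> {z}"
    proof (cases "S.partner m A = S.partner m1 A")
      case True
      then show ?thesis using split_exits(1)[OF s m] by blast
    next
      case False
      then have t: "S.partner m A = ?D" using type[OF m] by blast
      have "exits m L \<subseteq> {exit_point m A}"
      proof
        fix x assume "x \<in> exits m L"
        then have x: "x \<in> L" "m x \<notin> L" "x \<in> V" "x \<in> A" using LV D(3) unfolding exits_def by blast+
        have mm: "m (m x) = x" using mateD(2)[OF m x(3)] .
        have "m x \<notin> X"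
        proof
          assume a: "m x \<in> X"
          then have "exit_point m X = m x" using exit_eq[OF D(2) m a] mm x D(4) by auto
          then have "x \<in> R" using t2[OF m t] mm by simp
          then show False using x D(6) by blast
        qed
        then have "m x \<in> ?D" using D(8)[OF x(1) mateD(1)[OF m x(3)]] x by blast
        then have "m x \<notin> A" using dj by blast
        then show "x \<in> {exit_point m A}" using exit_eq[OF D(16) m x(4)] by simp
      qed
      then show ?thesis by blast
    qed
    then obtain z where z: "exits m L \<subseteq> {z}" by blast
    have "exits m L \<noteq> {}" using odd_cut odd_cut_iff[OF LV m] by auto
    then show "\<exists>x. exits m L = {x}" using z by blast
  qed
  show "T (?D \<union> L \<union> X)"
  proof (rule tightI)
    let ?Y = "?D \<union> L \<union> X"
    have tD: "T ?D" by (rule class_tight[OF D(11)])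
    show "?Y \<subseteq> V" using LV tight_sub[OF tD] tight_sub[OF D(2)] by blast
    fix m assume m: "m \<in> MM"
    define a where "a = exit_point m X"
    have a: "a \<in> X" "m a \<notin> X" "m (m a) = a" unfolding a_def using exit_point(1,2,7)[OF D(2) m] by blast+
    have noL: "m x \<in> ?Y" if "x \<in> L" for x using D(8)[OF that mateD(1)[OF m]] LV that by blast
    have Xa: "x = a" if "x \<in> X" "m x \<notin> X" for x using exit_eq[OF D(2) m that] unfolding a_def by simp
    show "\<exists>x. exits m ?Y = {x}"
    proof (cases "S.partner m A = S.partner m1 A")
      case True
      define d where "d = exit_point m ?D"
      have d: "d \<in> ?D" "m d \<notin> ?D" "m d \<in> S.partner m ?D"
        unfolding d_def using exit_point(1,2)[OF tD m] class_partner(5)[OF m D(11)] by blast+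
      have "S.partner m ?D \<noteq> A" using class_partner(4)[OF m D(11)] True D(14) by auto
      then have "m d \<notin> A" using class_disj[OF class_partner(1)[OF m D(11)] D(1)] d(3) by blast
      then have mdY: "m d \<notin> ?Y" using d(2) D(3) by blast
      have "m a \<in> L" unfolding a_def by (rule t1[OF m True])
      have "exits m ?Y = {d}"
      proof
        show "{d} \<subseteq> exits m ?Y" using d mdY unfolding exits_def by blast
        show "exits m ?Y \<subseteq> {d}"
        proof
          fix x assume "x \<in> exits m ?Y"
          then have x: "x \<in> ?Y" "m x \<notin> ?Y" unfolding exits_def by blast+
          have "x \<notin> X" using Xa[of x] x \<open>m a \<in> L\<close> by blast
          then have "x \<in> ?D" using x noL by blast
          then show "x \<in> {d}" using exit_eq[OF tD m, of x] x unfolding d_def by blast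
        qed
      qed
      then show ?thesis by blast
    next
      case False
      then have t: "S.partner m A = ?D" using type[OF m] by blast
      have maR: "m a \<in> R" unfolding a_def by (rule t2[OF m t])
      have maA: "m a \<in> A" "m a \<notin> L" using maR D(3,6) by blast+
      have "exits m ?Y = {a}"
      proof
        show "{a} \<subseteq> exits m ?Y" using a maA dj unfolding exits_def by blast
        show "exits m ?Y \<subseteq> {a}"
        proof
          fix x assume "x \<in> exits m ?Y"
          then have x: "x \<in> ?Y" "m x \<notin> ?Y" unfolding exits_def by blast+
          have "x \<notin> ?D"
          proof
            assume xD: "x \<in> ?D"
            have xV: "x \<in> V" using tight_sub[OF tD] xD by blast
            have mm: "m (m x) = x" by (rule mateD(2)[OF m xV])
            have "S.partner m ?D = A" using class_partner(4)[OF m D(1)] t by simp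
            then have "m x \<in> ?D \<union> A" using closedD[OF class_partner(3)[OF m D(11)], of x] xD by simp
            then have mxR: "m x \<in> R" using x(2) D(3) by blast
            have "{m x, x} \<in> edges G" using mateD(1)[OF m xV] by (simp add: insert_commute)
            then have "x \<in> R \<union> X \<union> S.partner m1 A" by (rule D(9)[OF mxR])
            then show False using xD dj dj2 D(3) by blast
          qed
          then have "x \<in> X" using x noL by blast
          then show "x \<in> {a}" using Xa x by blast
        qed
      qed
      then show ?thesis by blast
    qed
  qed
qed

lemma even_near_class:
  assumes Y: "T Y" "Q \<subseteq> Y" "Y \<subseteq> Q \<union> A" and Q: "Q \<in> \<P>" "A \<in> \<P>" and e: "e \<in> edges H"
  shows "\<not> odd_cut (Y \<inter> \<epsilon> e)"
proof -
  obtain C where C: "C \<in> \<P>" "C \<noteq> Q" "C \<noteq> A" "C \<noteq> A" by (rule other_class)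
  have "Y \<inter> vertex_in Q = vertex_in Q" using vertex_in(2)[OF Q(1)] Y(2) by blast
  then have 1: "odd_cut (Y \<inter> vertex_in Q)" using odd_cut_tight[OF tightv[OF vertex_in(1)[OF Q(1)]]] by simp
  have "Y \<inter> vertex_in C = {}" using vertex_in_disj[OF Q(1) C(1)] vertex_in_disj[OF Q(2) C(1)] C Y(3) by blast
  then have 2: "\<not> odd_cut (Y \<inter> vertex_in C)" by simp
  show ?thesis by (rule cycle_even_eps[OF Y(1) vertex_in(1)[OF Q(1)] 1 vertex_in(1)[OF C(1)] 2 e])
qed

text \<open>The class \<open>A\<close> and the tight sets of \<open>split_even_tight\<close> and
  \<open>split_odd_tight\<close> are even on \<open>\<epsilon> e\<close>; \<open>X\<close> is a
  combination of them.\<close>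

lemma split_eps:
  assumes s: "split A X L R m1 m2" and e: "e \<in> edges H"
  shows "\<not> odd_cut (X \<inter> \<epsilon> e)"
proof -
  note D = splitD[OF s]
  have fE: "fin_cut (\<epsilon> e)" by (rule fin_cut_eps[OF e])
  have fX: "fin_cut X" using D(2) by blast
  note f = split_fin_cut[OF s]
  have "(X \<union> L \<union> R) \<inter> \<epsilon> e = (X \<inter> \<epsilon> e) \<union> (L \<inter> \<epsilon> e) \<union> (R \<inter> \<epsilon> e)" by blast
  moreover have "odd_cut ((X \<inter> \<epsilon> e) \<union> (L \<inter> \<epsilon> e) \<union> (R \<inter> \<epsilon> e)) \<longleftrightarrow>
      ((odd_cut (X \<inter> \<epsilon> e) \<noteq> odd_cut (L \<inter> \<epsilon> e)) \<noteq> odd_cut (R \<inter> \<epsilon> e))"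
    by (rule odd_cut_three) (use f fX fE D(4-6) in blast)+
  ultimately have A: "\<not> ((odd_cut (X \<inter> \<epsilon> e) \<noteq> odd_cut (L \<inter> \<epsilon> e)) \<noteq> odd_cut (R \<inter> \<epsilon> e))"
    using even_class_eps[OF D(1) e] D(3) by simp
  have ev: "\<not> odd_cut (L \<inter> \<epsilon> e)" if s: "split A X L R m1 m2" and "\<not> odd_cut L" for L R m1 m2
  proof -
    note D = splitD[OF s]
    let ?D = "S.partner m2 A"
    have dj: "A \<inter> ?D = {}" using class_disj[OF D(1,11)] D(13) by metis
    have "\<not> odd_cut ((?D \<union> L) \<inter> \<epsilon> e)"
      by (rule even_near_class[OF split_even_tight[OF s that(2)] _ _ D(11) D(1) e]) (use D(3) in blast)+
    moreover have "(?D \<union> L) \<inter> \<epsilon> e = (?D \<inter> \<epsilon> e) \<union> (L \<inter> \<epsilon> e)" by blast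
    moreover have "odd_cut ((?D \<inter> \<epsilon> e) \<union> (L \<inter> \<epsilon> e)) \<longleftrightarrow> odd_cut (?D \<inter> \<epsilon> e) \<noteq> odd_cut (L \<inter> \<epsilon> e)"
      by (rule odd_cut_Un_disjoint) (use class_tight[OF D(11)] split_fin_cut[OF s] fE dj D(3) in blast)+
    ultimately show ?thesis using even_class_eps[OF D(11) e] by simp
  qed
  have odd: "odd_cut (L \<inter> \<epsilon> e) = odd_cut (X \<inter> \<epsilon> e)" if s: "split A X L R m1 m2" and "odd_cut L" for L R m1 m2
  proof -
    note D = splitD[OF s]
    let ?D = "S.partner m2 A"
    have dj: "A \<inter> ?D = {}" using class_disj[OF D(1,11)] D(13) by metis
    have "\<not> odd_cut ((?D \<union> L \<union> X) \<inter> \<epsilon> e)"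
      by (rule even_near_class[OF split_odd_tight(2)[OF s that(2)] _ _ D(11) D(1) e]) (use D(3) in blast)+
    moreover have "(?D \<union> L \<union> X) \<inter> \<epsilon> e = (?D \<inter> \<epsilon> e) \<union> (L \<inter> \<epsilon> e) \<union> (X \<inter> \<epsilon> e)" by blast
    moreover have "odd_cut ((?D \<inter> \<epsilon> e) \<union> (L \<inter> \<epsilon> e) \<union> (X \<inter> \<epsilon> e)) \<longleftrightarrow>
        ((odd_cut (?D \<inter> \<epsilon> e) \<noteq> odd_cut (L \<inter> \<epsilon> e)) \<noteq> odd_cut (X \<inter> \<epsilon> e))"
      by (rule odd_cut_three) (use class_tight[OF D(11)] split_fin_cut[OF s] fX fE dj D(3,4) in blast)+
    ultimately show ?thesis using even_class_eps[OF D(11) e] by simp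
  qed
  show ?thesis
    using A ev[OF s] ev[OF split_sym[OF s]] odd[OF s] odd[OF split_sym[OF s]] split_parity[OF s] by blast
qed

text \<open>Within \<open>A\<close> the set \<open>L\<close> behaves like a tight set, whatever
  its parity.\<close>

lemma split_side_tight:
  assumes s: "split A X L R m1 m2"
  obtains Y where "T Y" "\<And>v. v \<subseteq> A \<Longrightarrow> v \<inter> Y = v \<inter> L" "\<And>v. v \<subseteq> A \<Longrightarrow> v - Y = v - L"
proof (cases "odd_cut L")
  case True
  then show ?thesis using that[of L] split_odd_tight(1)[OF s] by blast
next
  case False
  note D = splitD[OF s]
  have dj: "A \<inter> S.partner m2 A = {}" using class_disj[OF D(1,11)] D(13) by metis
  show ?thesis by (rule that[OF split_even_tight[OF s False]]) (use dj in blast)+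
qed

lemma split_even_empty:
  assumes s: "split A X L R m1 m2" and v: "v \<in> verts H" "v \<subseteq> A" and ev: "\<not> odd_cut (v \<inter> L)"
  shows "v \<inter> L = {}"
proof -
  note D = splitD[OF s]
  have tv: "T v" by (rule tightv[OF v(1)])
  obtain Y where Y: "T Y" "v \<inter> Y = v \<inter> L" "v - Y = v - L" using split_side_tight[OF s] v(2) by metis
  let ?K = "v \<inter> L"
  have "T (v - Y)" using uncross_even(1)[OF tv Y(1)] Y(2) ev by simp
  moreover have "v - ?K = v - Y" using Y(3) by blast
  ultimately have tK: "T (v - ?K)" by simp
  \<comment> \<open>The matchings that connect the part in \<open>L\<close> with the outside of
    \<open>v\<close> all have the type of \<open>n\<close>, so this part sees one link
    only.\<close>
  define n where "n = (if odd_cut L then m1 else m2)"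
  have n: "n \<in> MM" unfolding n_def using oppositeD[OF D(7)] by simp
  show ?thesis
  proof (rule pocket[OF partnerD(1)[OF n v(1)] _ tK])
    show "?K \<subseteq> v" by blast
    fix x y assume xy: "x \<in> ?K" "y \<notin> v" "{x, y} \<in> edges G"
    obtain m where m: "m \<in> MM" "m x = y" "m y = x" by (rule edge_mate[OF xy(3)])
    have evx: "exit_point m v = x" using exit_eq[OF tv m(1)] xy m by blast
    have KV: "?K \<subseteq> V" using tight_sub[OF tv] by blast
    have "x \<in> exits m ?K" unfolding exits_def using xy m by blast
    moreover have "even (card (exits m ?K))" using odd_cut_iff[OF KV m(1)] ev by blast
    ultimately have "exits m ?K \<noteq> {x}" by auto
    then obtain x' where x': "x' \<in> ?K" "m x' \<notin> ?K" "x' \<noteq> x"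
      using \<open>x \<in> exits m ?K\<close> unfolding exits_def by blast
    have x'V: "x' \<in> V" using x' KV by blast
    have mx'v: "m x' \<in> v" using exit_eq[OF tv m(1), of x'] x' evx by blast
    then have "m x' \<notin> L" "m x' \<in> A" using x' v by blast+
    moreover have "m x' \<in> L \<union> X \<union> S.partner m2 A" using D(8)[OF _ mateD(1)[OF m(1) x'V]] x' by blast
    moreover have "A \<inter> S.partner m2 A = {}" using class_disj[OF D(1,11)] D(13) by metis
    ultimately have mX: "m x' \<in> X" by blast
    have mm: "m (m x') = x'" by (rule mateD(2)[OF m(1) x'V])
    then have "exit_point m X = m x'" using exit_eq[OF D(2) m(1) mX] x' D(4) by auto
    then have inL: "m (exit_point m X) \<in> L" using mm x' by simp
    have type: "S.partner m A = S.partner m1 A \<or> S.partner m A = S.partner m2 A" by (rule opposite_class_partner_cases[OF D(7) m(1) D(1)])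
    have "partner m v = partner n v"
    proof (cases "odd_cut L")
      case True
      have "S.partner m A \<noteq> S.partner m2 A"
        using split_exits(2)[OF split_sym[OF s] m(1)] split_parity[OF s] True inL D(6) by blast
      then show ?thesis using type opposite_type[OF D(7) m(1) D(1) _ v(1)] True unfolding n_def by simp
    next
      case False
      have "S.partner m A \<noteq> S.partner m1 A" using split_exits(2)[OF s m(1)] False inL by blast
      then show ?thesis using type opposite_type[OF oppositeD(4)[OF D(7)] m(1) D(1) _ v(1)] False unfolding n_def by simp
    qed
    moreover have "m x \<in> link v (partner m v)"
      using closedD[OF partnerD(2)[OF m(1) v(1)], of x] xy(1) unfolding link_def by blast
    ultimately show "y \<in> link v (partner n v)" using m by simp
  qed
qed

text \<open>If all three parts of \<open>v\<close> are odd, they are tight, and exits of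
  \<open>v\<close> are in one of the outer parts according to the type of the matching. This
  contradicts \<open>no_split\<close>. The outer part used by a type depends on the parity of
  \<open>L\<close>.\<close>

lemma split_not_three:
  assumes s: "split A X L R m1 m2" and v: "v \<in> verts H" "v \<subseteq> A"
    and odd_cut: "odd_cut (v \<inter> L)" "odd_cut (v \<inter> X)" "odd_cut (v \<inter> R)"
  shows False
proof -
  note D = splitD[OF s]
  have tv: "T v" by (rule tightv[OF v(1)])
  obtain Y where Y: "T Y" "v \<inter> Y = v \<inter> L" "v - Y = v - L" using split_side_tight[OF s] v(2) by metis
  obtain Y' where Y': "T Y'" "v \<inter> Y' = v \<inter> R" "v - Y' = v - R" using split_side_tight[OF split_sym[OF s]] v(2) by metis
  have tt: "T (v \<inter> L)" "T (v \<inter> X)" "T (v \<inter> R)"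
    using uncross_odd(1)[OF tv Y(1)] uncross_odd(1)[OF tv Y'(1)] uncross_odd(1)[OF tv D(2)] Y Y' odd_cut by simp_all
  have veq: "v = (v \<inter> L) \<union> (v \<inter> X) \<union> (v \<inter> R)" using v(2) D(3) by blast
  have dis: "(v \<inter> L) \<inter> (v \<inter> X) = {}" "(v \<inter> L) \<inter> (v \<inter> R) = {}" "(v \<inter> X) \<inter> (v \<inter> R) = {}" using D(4-6) by blast+
  have ty: "S.partner m A = S.partner n A" if "m \<in> MM" "n \<in> MM" "partner m v = partner n v" for m n
    using same_class_partner[OF that(1,2) agree_all[OF that(1,2) v(1) that(3)] D(1)] .
  have xin: "exit_point m v \<in> v" if "m \<in> MM" for m using exit_point(1)[OF tv that] .
  show False
  proof (cases "odd_cut L")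
    case False
    have x: "exit_point m v \<in> v \<inter> L" if s: "split A X L R m1 m2" and m: "m \<in> MM" "partner m v = partner m1 v" and "\<not> odd_cut L" "odd_cut (v \<inter> L)"
      for m L R m1 m2
    proof -
      have "S.partner m A = S.partner m1 A" by (rule ty[OF m(1) oppositeD(1)[OF splitD(7)[OF s]] m(2)])
      note e = split_exits[OF s m(1) this]
      then have "exits m L = {}" using that(4) unfolding exits_def by blast
      then have "closed_under m L" unfolding closed_exits .
      then show ?thesis using exit_in_closed[OF tv m(1)] fin_cut_sub[OF e(3)] that(5) xin[OF m(1)] by blast
    qed
    have R: "\<not> odd_cut R" using split_parity[OF s] False by simp
    show False
      by (rule no_split[OF D(7) v(1) tt veq dis x[OF s _ _ False odd_cut(1)] x[OF split_sym[OF s] _ _ R odd_cut(3)]])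
  next
    case True
    have x: "exit_point m v \<in> v \<inter> R" if s: "split A X L R m1 m2" and m: "m \<in> MM" "partner m v = partner m1 v" and "odd_cut L"
      "odd_cut (v \<inter> L)" for m L R m1 m2
    proof -
      note D = splitD[OF s]
      have t: "S.partner m A = S.partner m1 A" by (rule ty[OF m(1) oppositeD(1)[OF D(7)] m(2)])
      note e = split_exits[OF s m(1) t]
      have "m (exit_point m X) \<in> L" using e(2) that(4) by blast
      have class_of: "closed_under m (X \<union> L)"
        unfolding closed_under_def
      proof
        fix z assume "z \<in> X \<union> L"
        then show "m z \<in> X \<union> L"
        proof
          assume "z \<in> X"
          then show ?thesis using exit_eq[OF D(2) m(1), of z] \<open>m (exit_point m X) \<in> L\<close> by blast
        next
          assume "z \<in> L"
          show ?thesis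
          proof (rule ccontr)
            assume "m z \<notin> X \<union> L"
            then have "z = m (exit_point m X)" using \<open>z \<in> L\<close> e(1) unfolding exits_def by blast
            then have "m z = exit_point m X" using exit_point(7)[OF D(2) m(1)] by simp
            then show False using \<open>m z \<notin> X \<union> L\<close> exit_point(1)[OF D(2) m(1)] by simp
          qed
        qed
      qed
      have "v \<inter> (X \<union> L) = (v \<inter> X) \<union> (v \<inter> L)" by blast
      moreover have "odd_cut ((v \<inter> X) \<union> (v \<inter> L)) \<longleftrightarrow> odd_cut (v \<inter> X) \<noteq> odd_cut (v \<inter> L)"
        by (rule odd_cut_Un_disjoint) (use tv D(2) split_fin_cut[OF s] D(4) in blast)+
      ultimately have "\<not> odd_cut (v \<inter> (X \<union> L))" using odd_cut(2) that(5) by simp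
      moreover have "X \<union> L \<subseteq> V" using D(3,15) by blast
      ultimately have "exit_point m v \<notin> X \<union> L" using exit_in_closed[OF tv m(1) class_of] by blast
      then show ?thesis using xin[OF m(1)] v(2) D(3) by blast
    qed
    have R: "odd_cut R" using split_parity[OF s] True by simp
    show False
      by (rule no_split[OF oppositeD(4)[OF D(7)] v(1) tt veq dis x[OF split_sym[OF s] _ _ R odd_cut(3)] x[OF s _ _ True odd_cut(1)]])
  qed
qed

text \<open>As \<open>X\<close> is even on every \<open>\<epsilon> e\<close>, it is odd on some
  vertex \<open>v\<close>, which lies in \<open>P\<close>. The parts of \<open>v\<close> in
  \<open>L\<close> and \<open>R\<close> have equal parity. If odd, \<open>v\<close> would split
  into three parts; if even, they are empty.\<close>

theorem core_contains_vertex: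
  assumes P: "P \<in> \<P>" and c: "core \<P> P X"
  shows "\<exists>v\<in>verts H. v \<subseteq> X"
proof -
  obtain r where XT: "T X" "X \<subseteq> P" and r: "\<And>x. x \<in> P - X \<Longrightarrow> r x \<in> \<P> - {P}"
    "\<And>x y. x \<in> P - X \<Longrightarrow> {x, y} \<in> edges G \<Longrightarrow> y \<in> X \<union> r x \<or> (y \<in> P - X \<and> r y = r x)"
    using c unfolding core_def by blast
  obtain m1 m2 where o: "opposite m1 m2" by (rule opposite_ex)
  \<comment> \<open>Labels that no matching pairs with \<open>P\<close> are put into
    \<open>R\<close>: points with such labels send no edges to other classes.\<close>
  define L where "L = {x \<in> P - X. r x = S.partner m2 P}"
  define R where "R = {x \<in> P - X. r x \<noteq> S.partner m2 P}"
  have s: "split P X L R m1 m2"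
    unfolding split_def
  proof (intro conjI ballI allI impI)
    show "P \<in> \<P>" "T X" "opposite m1 m2" by fact+
    show "P = X \<union> L \<union> R" "X \<inter> L = {}" "X \<inter> R = {}" "L \<inter> R = {}" using XT unfolding L_def R_def by blast+
    show "y \<in> L \<union> X \<union> S.partner m2 P" if "x \<in> L" "{x, y} \<in> edges G" for x y
      using r(2)[of x y] that unfolding L_def by blast
    show "y \<in> R \<union> X \<union> S.partner m1 P" if x: "x \<in> R" and e: "{x, y} \<in> edges G" for x y
    proof -
      have x': "x \<in> P - X" "r x \<noteq> S.partner m2 P" using x unfolding R_def by blast+
      have rx: "r x \<in> \<P>" "P \<noteq> r x" using r(1)[OF x'(1)] by blast+
      from r(2)[OF x'(1) e] show ?thesis
      proof (elim disjE)
        assume "y \<in> X \<union> r x"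
        then show ?thesis
        proof
          assume y: "y \<in> r x"
          have "x \<in> P" using x' by blast
          then obtain m where m: "m \<in> MM" "S.partner m P = r x" using edge_class_partner[OF P rx _ y e] by metis
          then have "r x = S.partner m1 P" using opposite_class_partner_cases[OF o m(1) P] x'(2) by simp
          then show ?thesis using y by blast
        qed blast
      next
        assume "y \<in> P - X \<and> r y = r x"
        then show ?thesis using x'(2) unfolding R_def by simp
      qed
    qed
  qed
  have "\<exists>v\<in>verts H. odd_cut (X \<inter> v)"
  proof -
    obtain v where v: "v \<in> verts H" "odd_cut (X \<inter> link v (partner m0 v))"
      using odd_unit_ex[OF m0(1) XT(1)] split_eps[OF s] by blast
    then have "odd_cut (X \<inter> v) \<or> odd_cut (X \<inter> partner m0 v)"
      using odd_cut_link[OF partnerD(1)[OF m0(1) v(1)] fin_cut_tight[OF XT(1)]] split_eps[OF s partnerD(1)[OF m0(1) v(1)]] by blast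
    then show ?thesis using v(1) partnerD(3)[OF m0(1) v(1)] by blast
  qed
  then obtain v where v: "v \<in> verts H" "odd_cut (X \<inter> v)" by blast
  then obtain x where x: "x \<in> X" "x \<in> v" by (metis odd_cut_empty disjoint_iff)
  then have "class_of v = P" using class_of_eq[OF v(1) P] XT(2) by blast
  then have vertex_in: "v \<subseteq> P" using vertex_in_class[OF v(1)] by simp
  have tv: "T v" by (rule tightv[OF v(1)])
  have ov: "odd_cut (v \<inter> X)" using v(2) by (simp add: Int_commute)
  note D = splitD[OF s]
  have "v = (v \<inter> X) \<union> (v \<inter> L) \<union> (v \<inter> R)" using vertex_in D(3) by blast
  moreover have "odd_cut ((v \<inter> X) \<union> (v \<inter> L) \<union> (v \<inter> R)) \<longleftrightarrow> ((odd_cut (v \<inter> X) \<noteq> odd_cut (v \<inter> L)) \<noteq> odd_cut (v \<inter> R))"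
    by (rule odd_cut_three) (use tv XT split_fin_cut[OF s] D(4-6) in blast)+
  ultimately have "odd_cut (v \<inter> L) = odd_cut (v \<inter> R)" using odd_cut_tight[OF tv] ov by simp
  then have "\<not> odd_cut (v \<inter> L)" "\<not> odd_cut (v \<inter> R)" using split_not_three[OF s v(1) vertex_in _ ov] by blast+
  then have "v \<inter> L = {}" "v \<inter> R = {}"
    using split_even_empty[OF s v(1) vertex_in] split_even_empty[OF split_sym[OF s] v(1) vertex_in] by blast+
  then have "v \<subseteq> X" using vertex_in D(3) by blast
  then show ?thesis using v(1) by blast
qed

end

lemma (in cleaved) vertices_are_minimal_cores:
  assumes "\<And>v. v \<in> verts H \<Longrightarrow> \<exists>P\<in>\<P>. core \<P> P v"
    and "\<And>P X. P \<in> \<P> \<Longrightarrow> core \<P> P X \<Longrightarrow> \<exists>v\<in>verts H. v \<subseteq> X"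
  shows "verts H = {X. (\<exists>P\<in>\<P>. core \<P> P X) \<and> (\<forall>Y. (\<exists>P\<in>\<P>. core \<P> P Y) \<and> Y \<subseteq> X \<longrightarrow> Y = X)}"
    (is "_ = ?M")
proof
  have eq: "v = w" if "v \<in> verts H" "w \<in> verts H" "v \<subseteq> w" for v w
    using vert_ne[OF that(1)] vert_eq[OF that(1,2)] that(3) by blast
  show "verts H \<subseteq> ?M"
  proof
    fix v assume v: "v \<in> verts H"
    have "Y = v" if Y: "P \<in> \<P>" "core \<P> P Y" "Y \<subseteq> v" for P Y
    proof -
      obtain w where w: "w \<in> verts H" "w \<subseteq> Y" using assms(2)[OF Y(1,2)] by blast
      then have "w = v" using eq[OF w(1) v] Y(3) by blast
      then show ?thesis using w Y by blast
    qed
    then show "v \<in> ?M" using assms(1)[OF v] by blast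
  qed
  show "?M \<subseteq> verts H"
  proof
    fix X assume X: "X \<in> ?M"
    then obtain P where P: "P \<in> \<P>" "core \<P> P X" by blast
    obtain v where v: "v \<in> verts H" "v \<subseteq> X" using assms(2)[OF P] by blast
    then have "v = X" using X assms(1)[OF v(1)] by blast
    then show "X \<in> verts H" using v by simp
  qed
qed

context matching_covered_graph
begin

theorem torsoid_vertices:
  assumes part: "tight_set_partition G M \<P>" "infinite \<P> \<or> 4 \<le> card \<P>"
    and t: "torsoid G M (H, \<epsilon>)" and sub: "\<forall>P\<in>\<P>. \<exists>v\<in>verts H. v \<subseteq> P"
  shows "verts H = {X. (\<exists>P\<in>\<P>. core \<P> P X) \<and> (\<forall>Y. (\<exists>P\<in>\<P>. core \<P> P Y) \<and> Y \<subseteq> X \<longrightarrow> Y = X)}"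
proof -
  interpret maximal_frame G M H \<epsilon> by (rule maximal_frame_if_torsoid[OF mc t])
  interpret cleaved G M H \<epsilon> \<P> by unfold_locales (use part sub in blast)+
  note td = torsoidD[OF t]
  show ?thesis
  proof (cases "is_cycle H")
    case False
    interpret cleaved_brick G M H \<epsilon> \<P> by unfold_locales (use td(2,3) False in blast)+
    show ?thesis
    proof (rule vertices_are_minimal_cores)
      show "\<exists>P\<in>\<P>. core \<P> P v" if v: "v \<in> verts H" for v
        using vertex_in_surj[OF v] core_vertex_in by metis
      show "\<exists>v\<in>verts H. v \<subseteq> X" if P: "P \<in> \<P>" "core \<P> P X" for P X
        using core_contains[OF P] vertex_in(1)[OF P(1)] by metis
    qed
  next
    case True
    interpret cycle_torsoid G M H \<epsilon>
    proof (unfold_locales)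
      show "is_cycle H" by (rule True)
      fix u v w P1 P2 P3
      assume a: "{u, v} \<in> edges H" "{v, w} \<in> edges H" "u \<noteq> w" and
        b: "T P1" "T P2" "T P3" "P1 \<inter> P2 = {}" "P1 \<inter> P3 = {}" "P2 \<inter> P3 = {}"
        "P1 \<union> P2 \<union> P3 = \<epsilon> {u, v} \<union> v \<union> \<epsilon> {v, w}" "T (u \<union> P1 \<union> P2)" "T (P2 \<union> P3 \<union> w)"
      show False using td(12)[THEN mp, OF True, rule_format, of u v w] a b by blast
    qed
    interpret cleaved_cycle G M H \<epsilon> \<P> by unfold_locales
    show ?thesis
    proof (rule vertices_are_minimal_cores)
      show "\<exists>P\<in>\<P>. core \<P> P v" if v: "v \<in> verts H" for v
        using core_vertex[OF v] class_of(1)[OF v] by (rule rev_bexI[rotated])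
      show "\<exists>v\<in>verts H. v \<subseteq> X" if P: "P \<in> \<P>" "core \<P> P X" for P X
        by (rule core_contains_vertex[OF P])
    qed
  qed
qed

theorem torsoid_unique:
  assumes part: "tight_set_partition G M \<P>" "infinite \<P> \<or> 4 \<le> card \<P>"
    and t: "torsoid G M T1" "\<forall>P\<in>\<P>. \<exists>v\<in>verts (fst T1). v \<subseteq> P"
      "torsoid G M T2" "\<forall>P\<in>\<P>. \<exists>v\<in>verts (fst T2). v \<subseteq> P"
  shows "T1 = T2"
proof -
  obtain H1 e1 H2 e2 where T: "T1 = (H1, e1)" "T2 = (H2, e2)" by fastforce
  have "verts H1 = verts H2"
    using torsoid_vertices[OF part, of H1 e1] torsoid_vertices[OF part, of H2 e2] t T by simp
  then show ?thesis using torsoid_determined_by_vertices[OF mc] t T by blast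
qed

end

section \<open>Gaps between the classes of a partition\<close>

context tight_partition
begin

abbreviation "EP \<equiv> edges (collapse G \<P>)"

lemma EPD: "{P, Q} \<in> EP \<Longrightarrow> P \<in> \<P>" "{P, Q} \<in> EP \<Longrightarrow> Q \<in> \<P>" "{P, Q} \<in> EP \<Longrightarrow> P \<noteq> Q"
  unfolding collapse_simps by blast+

lemma EP_sym: "{P, Q} \<in> EP \<Longrightarrow> {Q, P} \<in> EP"
  by (simp add: insert_commute)

lemma EP_class_partner: "m \<in> MM \<Longrightarrow> P \<in> \<P> \<Longrightarrow> {P, S.partner m P} \<in> EP"
  using S.partnerD(1) unfolding collapse_simps(1) by blast

lemma class_sub: "P \<in> \<P> \<Longrightarrow> P \<subseteq> V"
  by (rule tight_sub[OF class_tight])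

lemma other_partner:
  assumes P: "P \<in> \<P>" "Q \<in> \<P>"
  shows "\<exists>m\<in>MM. S.partner m P \<noteq> Q"
proof (rule ccontr)
  assume no: "\<not> ?thesis"
  have "P \<union> Q = V"
  proof (rule all_closed_V)
    show "P \<union> Q \<subseteq> V" using class_sub P by blast
    show "P \<union> Q \<noteq> {}" using tight_ne class_tight P by blast
    fix m assume "m \<in> MM"
    then show "closed_under m (P \<union> Q)" using class_partner(3)[of m P] P no by auto
  qed
  moreover obtain C where C: "C \<in> \<P>" "C \<noteq> P" "C \<noteq> Q" "C \<noteq> Q" by (rule other_class)
  moreover have "C \<subseteq> V" "C \<noteq> {}" using class_sub tight_ne class_tight C by blast+
  ultimately show False using class_disj[OF C(1) P(1) C(2)] class_disj[OF C(1) P(2) C(3)] by blast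
qed

text \<open>By \<open>passable_iff\<close> these are the subsets of \<open>P \<union> Q\<close>
  that are passable for both classes; the evenness of \<open>Z\<close> is a consequence of the
  tightness of \<open>P - Z\<close> and \<open>Q - Z\<close>, see
  \<open>passes_even\<close>.\<close>

definition passes where
  "passes P Q Z \<longleftrightarrow> Z \<subseteq> P \<union> Q \<and> T (P - Z) \<and> T (Q - Z) \<and> (\<forall>x\<in>Z. \<forall>y. {x, y} \<in> edges G \<longrightarrow> y \<in> P \<union> Q)"

lemma passes_sym: "passes P Q Z \<longleftrightarrow> passes Q P Z"
  unfolding passes_def by auto

lemma passes_even:
  assumes P: "P \<in> \<P>" "Q \<in> \<P>" "P \<noteq> Q" and Z: "passes P Q Z"
  shows "\<not> odd_cut (P \<inter> Z)" "\<not> odd_cut Z" "fin_cut Z" "fin_cut (P \<inter> Z)"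
proof -
  have *: "\<not> odd_cut (A \<inter> Z) \<and> fin_cut (A \<inter> Z)" if A: "A \<in> \<P>" "T (A - Z)" for A
  proof -
    have eq: "A \<inter> Z = A - (A - Z)" by blast
    have "fin_cut A" "fin_cut (A - Z)" using class_tight[OF A(1)] A(2) by blast+
    then show ?thesis unfolding eq
      using odd_cut_Diff_sub[of A "A - Z"] odd_cut_tight[OF class_tight[OF A(1)]] odd_cut_tight[OF A(2)] by blast
  qed
  note Z' = Z[unfolded passes_def]
  have p: "\<not> odd_cut (P \<inter> Z)" "fin_cut (P \<inter> Z)" and q: "\<not> odd_cut (Q \<inter> Z)" "fin_cut (Q \<inter> Z)"
    using *[OF P(1)] *[OF P(2)] Z' by blast+
  have eq: "Z = (P \<inter> Z) \<union> (Q \<inter> Z)" using Z' by blast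
  have "fin_cut ((P \<inter> Z) \<union> (Q \<inter> Z))" using p q by blast
  then show "fin_cut Z" using eq by simp
  have "odd_cut ((P \<inter> Z) \<union> (Q \<inter> Z)) \<longleftrightarrow> odd_cut (P \<inter> Z) \<noteq> odd_cut (Q \<inter> Z)"
    by (rule odd_cut_Un_disjoint) (use p q class_disj[OF P] in blast)+
  then show "\<not> odd_cut Z" using eq p q by simp
  show "\<not> odd_cut (P \<inter> Z)" "fin_cut (P \<inter> Z)" by fact+
qed

text \<open>A matching that enters \<open>P - Z\<close> from \<open>Z\<close> enters through the
  exit of \<open>P - Z\<close>. This is also the exit of \<open>P\<close>, whose mate lies in a
  third class and not in \<open>Z\<close>. The same holds for \<open>Q\<close>.\<close>

lemma passes_closed:
  assumes P: "P \<in> \<P>" "Q \<in> \<P>" "P \<noteq> Q" and Z: "passes P Q Z" and m: "m \<in> MM" "S.partner m P \<noteq> Q"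
  shows "closed_under m Z"
proof -
  have *: "m x \<notin> A - Z" if A: "A \<in> \<P>" "B \<in> \<P>" "A \<noteq> B" "passes A B Z" "S.partner m A \<noteq> B" and x: "x \<in> Z" for A B x
  proof
    note Z' = A(4)[unfolded passes_def]
    assume mx: "m x \<in> A - Z"
    have xV: "x \<in> V" using x Z' class_sub A by blast
    have mm: "m (m x) = x" by (rule mateD(2)[OF m(1) xV])
    have tA: "T (A - Z)" using Z' by blast
    have e1: "exit_point m (A - Z) = m x" using exit_eq[OF tA m(1) mx] mm x by simp
    let ?p = "exit_point m A"
    have p: "?p \<in> A" "m ?p \<notin> A" "m ?p \<in> S.partner m A" "?p \<in> V"
      using exit_point(1,2,5)[OF class_tight[OF A(1)] m(1)] class_partner(5)[OF m(1) A(1)] by blast+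
    have "m ?p \<notin> B" using class_eq[OF class_partner(1)[OF m(1) A(1)] A(2) p(3)] A(5) by blast
    then have "?p \<notin> Z" using Z' p mateD(1)[OF m(1) p(4)] by blast
    then have "exit_point m (A - Z) = ?p" using exit_eq[OF tA m(1), of ?p] p by blast
    then have "m ?p = x" using e1 mm by simp
    then show False using x Z' p(2) \<open>m ?p \<notin> B\<close> by blast
  qed
  have m': "S.partner m Q \<noteq> P" using class_partner(4)[OF m(1) P(2)] m(2) by auto
  show ?thesis unfolding closed_under_def
  proof
    fix x assume x: "x \<in> Z"
    have "x \<in> V" using x Z class_sub P unfolding passes_def by blast
    then have "m x \<in> P \<union> Q" using Z x mateD(1)[OF m(1)] unfolding passes_def by blast
    moreover have "m x \<notin> P - Z" by (rule *[OF P Z m(2) x])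
    moreover have "m x \<notin> Q - Z" using *[OF P(2,1) P(3)[symmetric] _ m' x] Z passes_sym by blast
    ultimately show "m x \<in> Z" by blast
  qed
qed

lemma exits_minus:
  assumes P: "P \<in> \<P>" "Q \<in> \<P>" "P \<noteq> Q" and Z: "Z \<subseteq> P \<union> Q" "\<forall>x\<in>Z. \<forall>y. {x, y} \<in> edges G \<longrightarrow> y \<in> P \<union> Q"
    and m: "m \<in> MM" "S.partner m P \<noteq> Q" and cl: "closed_under m Z"
  shows "exits m (P - Z) = {exit_point m P}"
proof -
  let ?p = "exit_point m P"
  have p: "?p \<in> P" "m ?p \<notin> P" "m ?p \<in> S.partner m P" "?p \<in> V"
    using exit_point(1,2,5)[OF class_tight[OF P(1)] m(1)] class_partner(5)[OF m(1) P(1)] by blast+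
  have "m ?p \<notin> Q" using class_eq[OF class_partner(1)[OF m(1) P(1)] P(2) p(3)] m(2) by blast
  then have pZ: "?p \<notin> Z" using Z p mateD(1)[OF m(1) p(4)] by blast
  show ?thesis
  proof
    show "{?p} \<subseteq> exits m (P - Z)" using p pZ unfolding exits_def by blast
    show "exits m (P - Z) \<subseteq> {?p}"
    proof
      fix x assume "x \<in> exits m (P - Z)"
      then have x: "x \<in> P" "x \<notin> Z" "m x \<notin> P \<or> m x \<in> Z" unfolding exits_def by blast+
      have "m x \<notin> Z"
      proof
        assume "m x \<in> Z"
        then have "m (m x) \<in> Z" by (rule closedD[OF cl])
        then show False using mateD(2)[OF m(1), of x] x class_sub[OF P(1)] by auto
      qed
      then show "x \<in> {?p}" using exit_eq[OF class_tight[OF P(1)] m(1) x(1)] x(3) by simp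
    qed
  qed
qed

text \<open>A matching that pairs \<open>P\<close> with a third class shows that \<open>P - (Z1
  \<union> Z2)\<close>, an intersection of two tight sets, is odd.\<close>

lemma passes_Un:
  assumes P: "P \<in> \<P>" "Q \<in> \<P>" "P \<noteq> Q" and Z: "passes P Q Z1" "passes P Q Z2"
  shows "passes P Q (Z1 \<union> Z2)"
proof -
  have *: "T (A - (Z1 \<union> Z2))" if A: "A \<in> \<P>" "B \<in> \<P>" "A \<noteq> B" "passes A B Z1" "passes A B Z2" for A B
  proof -
    note Z1 = A(4)[unfolded passes_def] and Z2 = A(5)[unfolded passes_def]
    obtain m where m: "m \<in> MM" "S.partner m A \<noteq> B" using other_partner[OF A(1,2)] by blast
    have "closed_under m (Z1 \<union> Z2)"
      by (rule closed_Un[OF passes_closed[OF A(1-4) m] passes_closed[OF A(1-3,5) m]])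
    then have "exits m (A - (Z1 \<union> Z2)) = {exit_point m A}"
      by (intro exits_minus[OF A(1-3) _ _ m]) (use Z1 Z2 in blast)+
    moreover have "A - (Z1 \<union> Z2) \<subseteq> V" using class_sub[OF A(1)] by blast
    ultimately have "odd_cut (A - (Z1 \<union> Z2))" using odd_cut_iff[OF _ m(1)] by simp
    moreover have eq: "A - (Z1 \<union> Z2) = (A - Z1) \<inter> (A - Z2)" by blast
    ultimately show ?thesis using tight_Int_odd[of "A - Z1" "A - Z2"] Z1 Z2 by simp
  qed
  have "passes Q P Z1" "passes Q P Z2" using Z passes_sym by blast+
  then have "T (P - (Z1 \<union> Z2))" "T (Q - (Z1 \<union> Z2))"
    using *[OF P Z] *[OF P(2,1) P(3)[symmetric]] by blast+
  then show ?thesis using Z unfolding passes_def by blast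
qed

lemma passes_empty: "P \<in> \<P> \<Longrightarrow> Q \<in> \<P> \<Longrightarrow> passes P Q {}"
  unfolding passes_def using class_tight by simp

definition gap where "gap P Q = \<Union>{Z. passes P Q Z}"

lemma gap_sym: "gap P Q = gap Q P"
proof -
  have "{Z. passes P Q Z} = {Z. passes Q P Z}" using passes_sym by blast
  then show ?thesis unfolding gap_def by simp
qed

lemma gap_sub: "gap P Q \<subseteq> P \<union> Q"
  unfolding gap_def passes_def by blast

text \<open>The union of all passable sets is passable. A violation of tightness concerns two
  exits, and these already show up in the union of two passable sets.\<close>

lemma passes_gap:
  assumes P: "P \<in> \<P>" "Q \<in> \<P>" "P \<noteq> Q" shows "passes P Q (gap P Q)"
proof -
  have N: "\<forall>x\<in>gap A B. \<forall>y. {x, y} \<in> edges G \<longrightarrow> y \<in> A \<union> B" for A B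
    unfolding gap_def passes_def by blast
  have *: "T (A - gap A B)" if A: "A \<in> \<P>" "B \<in> \<P>" "A \<noteq> B" for A B
  proof (rule tightI)
    show AV: "A - gap A B \<subseteq> V" using class_sub[OF A(1)] by blast
    have cl: "closed_under m (gap A B)" if "m \<in> MM" "S.partner m A \<noteq> B" for m
      unfolding closed_under_def gap_def using closedD[OF passes_closed[OF A _ that]] by blast
    have ex: "exits m (A - gap A B) = {exit_point m A}" if "m \<in> MM" "S.partner m A \<noteq> B" for m
      by (rule exits_minus[OF A gap_sub N that cl[OF that]])
    obtain m1 where m1: "m1 \<in> MM" "S.partner m1 A \<noteq> B" using other_partner[OF A(1,2)] by blast
    have odd_cut: "odd_cut (A - gap A B)" using ex[OF m1] odd_cut_iff[OF AV m1(1)] by simp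
    fix m assume m: "m \<in> MM"
    show "\<exists>x. exits m (A - gap A B) = {x}"
    proof (cases "S.partner m A = B")
      case False
      then show ?thesis using ex[OF m] by blast
    next
      case True
      have "exits m (A - gap A B) \<noteq> {}" using odd_cut odd_cut_iff[OF AV m] by auto
      then obtain x where x: "x \<in> exits m (A - gap A B)" by blast
      have "y = x" if y: "y \<in> exits m (A - gap A B)" for y
      proof -
        \<comment> \<open>The mate of an exit is outside \<open>A\<close> or already in a single
          passable set.\<close>
        have ch: "\<exists>Z. passes A B Z \<and> m z \<notin> A - Z" if "z \<in> exits m (A - gap A B)" for z
        proof (cases "m z \<in> A")
          case True
          then have "m z \<in> gap A B" using that unfolding exits_def by blast
          then show ?thesis unfolding gap_def by blast
        next
          case False
          then show ?thesis using passes_empty[OF A(1,2)] by blast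
        qed
        obtain Z1 Z2 where Z: "passes A B Z1" "m x \<notin> A - Z1" "passes A B Z2" "m y \<notin> A - Z2"
          using ch[OF x] ch[OF y] by blast
        have link: "passes A B (Z1 \<union> Z2)" by (rule passes_Un[OF A Z(1,3)])
        have t: "T (A - (Z1 \<union> Z2))" "Z1 \<union> Z2 \<subseteq> gap A B"
          using link[unfolded passes_def] Z(1,3) unfolding gap_def by blast+
        have "x \<in> A - (Z1 \<union> Z2)" "y \<in> A - (Z1 \<union> Z2)" using x y t(2) unfolding exits_def by blast+
        then have "exit_point m (A - (Z1 \<union> Z2)) = x" "exit_point m (A - (Z1 \<union> Z2)) = y"
          using exit_eq[OF t(1) m] Z by blast+
        then show ?thesis by simp
      qed
      then show ?thesis using x by blast
    qed
  qed
  show ?thesis unfolding passes_def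
    using *[OF P] *[OF P(2,1) P(3)[symmetric]] gap_sub N gap_sym by simp
qed

lemma passes_sub_gap: "passes P Q Z \<Longrightarrow> Z \<subseteq> gap P Q"
  unfolding gap_def by blast

lemma gap_N: "x \<in> gap P Q \<Longrightarrow> {x, y} \<in> edges G \<Longrightarrow> y \<in> P \<union> Q"
  unfolding gap_def passes_def by blast

lemma gap_closed: "P \<in> \<P> \<Longrightarrow> Q \<in> \<P> \<Longrightarrow> P \<noteq> Q \<Longrightarrow> m \<in> MM \<Longrightarrow> S.partner m P \<noteq> Q \<Longrightarrow> closed_under m (gap P Q)"
  using passes_closed passes_gap by blast

lemma gap_tight: "P \<in> \<P> \<Longrightarrow> Q \<in> \<P> \<Longrightarrow> P \<noteq> Q \<Longrightarrow> T (P - gap P Q)"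
  using passes_gap unfolding passes_def by blast

lemma gap_exit:
  assumes P: "P \<in> \<P>" "Q \<in> \<P>" "P \<noteq> Q" and m: "m \<in> MM" "S.partner m P \<noteq> Q"
  shows "exit_point m P \<notin> gap P Q"
proof -
  have "gap P Q \<subseteq> V" using gap_sub class_sub P by blast
  then show ?thesis
    using exit_in_closed[OF class_tight[OF P(1)] m(1) gap_closed[OF P m]] passes_even(1)[OF P passes_gap[OF P]] by blast
qed

text \<open>The overlap of the gaps to \<open>Q\<close> and to \<open>Q'\<close> only has edges
  into \<open>P\<close>, and what remains of \<open>P\<close> is tight by uncrossing.\<close>

lemma gap_overlap:
  assumes P: "{P, Q} \<in> EP" "{P, Q'} \<in> EP" "Q \<noteq> Q'" and odd_cut: "odd_cut ((P - gap P Q) \<inter> (P - gap P Q'))"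
  shows "gap P Q \<inter> gap P Q' = {}"
proof -
  note H = EPD[OF P(1)] EPD[OF P(2)]
  let ?K = "gap P Q \<inter> gap P Q'"
  have QQ: "Q \<inter> Q' = {}" "P \<inter> Q = {}" "P \<inter> Q' = {}" using class_disj H P(3) by blast+
  have KP: "?K \<subseteq> P" using gap_sub[of P Q] gap_sub[of P Q'] QQ by blast
  have "T ((P - gap P Q) \<union> (P - gap P Q'))"
    by (rule uncross_odd(2)[OF gap_tight[OF H(1-3)] gap_tight[OF H(4-6)] odd_cut])
  moreover have "(P - gap P Q) \<union> (P - gap P Q') = P - ?K" by blast
  ultimately have t: "T (P - ?K)" by simp
  show ?thesis
  proof (rule even_pocket[OF class_tight[OF H(1)] t KP])
    fix x y assume "x \<in> ?K" "{x, y} \<in> edges G"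
    then have "y \<in> P \<union> Q" "y \<in> P \<union> Q'" using gap_N by blast+
    then show "y \<in> P" using QQ by blast
  qed
qed

lemma gap_disjoint_third:
  assumes P: "{P, Q} \<in> EP" "{P, Q'} \<in> EP" "Q \<noteq> Q'" and m: "m \<in> MM" "S.partner m P \<noteq> Q" "S.partner m P \<noteq> Q'"
  shows "gap P Q \<inter> gap P Q' = {}"
proof (rule gap_overlap[OF P])
  note H = EPD[OF P(1)] EPD[OF P(2)]
  have eq: "(P - gap P Q) \<inter> (P - gap P Q') = P - (gap P Q \<union> gap P Q')" by blast
  have cl: "closed_under m (gap P Q \<union> gap P Q')"
    by (rule closed_Un[OF gap_closed[OF H(1-3) m(1,2)] gap_closed[OF H(4-6) m(1,3)]])
  let ?p = "exit_point m P"
  have p: "?p \<in> P" "m ?p \<notin> P" using exit_point(1,2)[OF class_tight[OF H(1)] m(1)] by blast+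
  have pn: "?p \<notin> gap P Q \<union> gap P Q'" using gap_exit[OF H(1-3) m(1,2)] gap_exit[OF H(4-6) m(1,3)] by blast
  have "exits m (P - (gap P Q \<union> gap P Q')) = {?p}"
  proof
    show "{?p} \<subseteq> exits m (P - (gap P Q \<union> gap P Q'))" using p pn unfolding exits_def by blast
    show "exits m (P - (gap P Q \<union> gap P Q')) \<subseteq> {?p}"
    proof
      fix x assume "x \<in> exits m (P - (gap P Q \<union> gap P Q'))"
      then have x: "x \<in> P" "x \<notin> gap P Q \<union> gap P Q'" "m x \<notin> P \<or> m x \<in> gap P Q \<union> gap P Q'"
        unfolding exits_def by blast+
      have "m x \<notin> gap P Q \<union> gap P Q'"
      proof
        assume "m x \<in> gap P Q \<union> gap P Q'"
        then have "m (m x) \<in> gap P Q \<union> gap P Q'" by (rule closedD[OF cl])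
        then show False using mateD(2)[OF m(1), of x] x(1,2) class_sub[OF H(1)] by auto
      qed
      then show "x \<in> {?p}" using exit_eq[OF class_tight[OF H(1)] m(1) x(1)] x(3) by simp
    qed
  qed
  moreover have "P - (gap P Q \<union> gap P Q') \<subseteq> V" using class_sub[OF H(1)] by blast
  ultimately show "odd_cut ((P - gap P Q) \<inter> (P - gap P Q'))" unfolding eq using odd_cut_iff[OF _ m(1)] by simp
qed

end

text \<open>The condition under which the gaps can be cut off.\<close>

locale separated_partition = tight_partition G M \<P> for G :: "'v sgraph" and M \<P> +
  assumes gap_disj: "{P, Q} \<in> EP \<Longrightarrow> {P, Q'} \<in> EP \<Longrightarrow> Q \<noteq> Q' \<Longrightarrow> gap P Q \<inter> gap P Q' = {}"
begin

text \<open>The vertex of the torsoid inside the class \<open>P\<close>.\<close>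

definition trim where "trim P = P - \<Union>{gap P Q | Q. {P, Q} \<in> EP}"

definition trimmed_graph :: "'v set sgraph" where
  "trimmed_graph = \<lparr>verts = trim ` \<P>, edges = {{trim P, trim Q} | P Q. {P, Q} \<in> EP}\<rparr>"

text \<open>The union has one member, see \<open>trimmed_eps_eq\<close>; \<open>restrict\<close>
  provides the extensionality that torsoids require.\<close>

definition trimmed_eps :: "'v set set \<Rightarrow> 'v set" where
  "trimmed_eps = restrict (\<lambda>e. \<Union>{gap P Q | P Q. {P, Q} \<in> EP \<and> e = {trim P, trim Q}}) (edges trimmed_graph)"

lemma trim_sub: "trim P \<subseteq> P"
  unfolding trim_def by blast

lemma trim_gap: "{P, Q} \<in> EP \<Longrightarrow> trim P \<inter> gap P Q = {}"
  unfolding trim_def by blast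

text \<open>Gaps of edges without a common class are disjoint as the classes are; a common class
  is the case of the locale assumption.\<close>

lemma gap_disj4:
  assumes "{P, Q} \<in> EP" "{P', Q'} \<in> EP" "{P, Q} \<noteq> {P', Q'}"
  shows "gap P Q \<inter> gap P' Q' = {}"
proof -
  note H = EPD[OF assms(1)] EPD[OF assms(2)]
  have sy: "{Q, P} \<in> EP" "{Q', P'} \<in> EP" using EP_sym assms by blast+
  consider "P = P'" | "P = Q'" | "Q = P'" | "Q = Q'" | "P \<noteq> P'" "P \<noteq> Q'" "Q \<noteq> P'" "Q \<noteq> Q'" by blast
  then show ?thesis
  proof cases
    case 1
    then show ?thesis using gap_disj[of P Q Q'] assms by auto
  next
    case 2
    then have "gap P Q \<inter> gap Q' P' = {}" using gap_disj[of P Q P'] assms sy by (auto simp: insert_commute)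
    then show ?thesis using gap_sym by metis
  next
    case 3
    then have "gap Q P \<inter> gap P' Q' = {}" using gap_disj[of Q P Q'] assms sy by (auto simp: insert_commute)
    then show ?thesis using gap_sym by metis
  next
    case 4
    then have "gap Q P \<inter> gap Q' P' = {}" using gap_disj[of Q P P'] assms sy by (auto simp: insert_commute)
    then show ?thesis using gap_sym by metis
  next
    case 5
    then have "(P \<union> Q) \<inter> (P' \<union> Q') = {}" using class_disj H by blast
    then show ?thesis using gap_sub[of P Q] gap_sub[of P' Q'] by blast
  qed
qed

lemma trim_tight:
  assumes P: "P \<in> \<P>" shows "T (trim P)"
proof (rule tightI)
  show "trim P \<subseteq> V" using trim_sub class_sub[OF P] by blast
  fix m assume m: "m \<in> MM"
  define Q where "Q = S.partner m P"
  have Q: "{P, Q} \<in> EP" "Q \<in> \<P>" "P \<noteq> Q" unfolding Q_def using EP_class_partner[OF m P] class_partner(1,2)[OF m P] by auto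
  have cl: "closed_under m (gap P R)" if "{P, R} \<in> EP" "R \<noteq> Q" for R
    using gap_closed[OF P EPD(2)[OF that(1)] EPD(3)[OF that(1)] m] that(2) unfolding Q_def by blast
  have mm: "m (m x) = x" if "x \<in> P" for x using mateD(2)[OF m] class_sub[OF P] that by blast
  have tQ: "T (P - gap P Q)" by (rule gap_tight[OF P Q(2,3)])
  define z where "z = exit_point m (P - gap P Q)"
  have z: "z \<in> P" "z \<notin> gap P Q" "m z \<notin> P - gap P Q"
    unfolding z_def using exit_point(1,2)[OF tQ m] by blast+
  have zv: "z \<in> trim P"
  proof (rule ccontr)
    assume "z \<notin> trim P"
    then obtain R where R: "{P, R} \<in> EP" "z \<in> gap P R" "R \<noteq> Q" using z unfolding trim_def by blast
    have mz: "m z \<in> gap P R" using closedD[OF cl[OF R(1,3)] R(2)] .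
    moreover have "gap P R \<inter> gap P Q = {}" by (rule gap_disj[OF R(1) Q(1) R(3)])
    ultimately have "m z \<notin> P" using z(3) by blast
    then have "exit_point m P = z" using exit_eq[OF class_tight[OF P] m z(1)] by blast
    then have "m z \<in> Q" using class_partner(5)[OF m P] unfolding Q_def by simp
    moreover have "m z \<in> R" using mz gap_sub[of P R] \<open>m z \<notin> P\<close> by blast
    ultimately show False using class_eq[OF Q(2) EPD(2)[OF R(1)]] R(3) by blast
  qed
  have "exits m (trim P) = {z}"
  proof
    have "m z \<notin> trim P" using z(3) Q(1) trim_sub trim_gap by blast
    then show "{z} \<subseteq> exits m (trim P)" using zv unfolding exits_def by blast
    show "exits m (trim P) \<subseteq> {z}"
    proof
      fix x assume "x \<in> exits m (trim P)"
      then have x: "x \<in> trim P" "x \<in> P" "m x \<notin> trim P" using trim_sub unfolding exits_def by blast+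
      have "m x \<notin> gap P R" if "{P, R} \<in> EP" "R \<noteq> Q" for R
      proof
        assume "m x \<in> gap P R"
        then have "m (m x) \<in> gap P R" by (rule closedD[OF cl[OF that]])
        then show False using mm[OF x(2)] x(1) trim_gap[OF that(1)] by auto
      qed
      then have "m x \<notin> P - gap P Q" using x(3) unfolding trim_def by blast
      moreover have "x \<in> P - gap P Q" using x trim_gap[OF Q(1)] by blast
      ultimately show "x \<in> {z}" using exit_eq[OF tQ m, of x] unfolding z_def by blast
    qed
  qed
  then show "\<exists>x. exits m (trim P) = {x}" by blast
qed

lemma trim_inj: "P \<in> \<P> \<Longrightarrow> Q \<in> \<P> \<Longrightarrow> trim P = trim Q \<Longrightarrow> P = Q"
proof -
  assume a: "P \<in> \<P>" "Q \<in> \<P>" "trim P = trim Q"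
  obtain x where "x \<in> trim P" using tight_ne[OF trim_tight[OF a(1)]] by blast
  then have "x \<in> P" "x \<in> Q" using trim_sub a(3) by blast+
  then show ?thesis using class_eq a by blast
qed

lemma trimmed_graph_verts: "verts trimmed_graph = trim ` \<P>"
  unfolding trimmed_graph_def by simp

lemma trimmed_graph_edges: "e \<in> edges trimmed_graph \<longleftrightarrow> (\<exists>P Q. e = {trim P, trim Q} \<and> {P, Q} \<in> EP)"
  unfolding trimmed_graph_def by simp

lemma trim_pair_eq:
  assumes "{P, Q} \<in> EP" "{P', Q'} \<in> EP" "{trim P, trim Q} = {trim P', trim Q'}" shows "{P, Q} = {P', Q'}"
proof -
  note H = EPD[OF assms(1)] EPD[OF assms(2)]
  have "trim P = trim P' \<and> trim Q = trim Q' \<or> trim P = trim Q' \<and> trim Q = trim P'"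
    using assms(3) by (simp add: doubleton_eq_iff)
  then show ?thesis using trim_inj H by (metis insert_commute)
qed

lemma trimmed_graph_edge_iff: "P \<in> \<P> \<Longrightarrow> Q \<in> \<P> \<Longrightarrow> {trim P, trim Q} \<in> edges trimmed_graph \<longleftrightarrow> {P, Q} \<in> EP"
proof
  assume PQ: "P \<in> \<P>" "Q \<in> \<P>" "{trim P, trim Q} \<in> edges trimmed_graph"
  then obtain P' Q' where P': "{trim P, trim Q} = {trim P', trim Q'}" "{P', Q'} \<in> EP" unfolding trimmed_graph_edges by blast
  note H = EPD[OF P'(2)]
  have "trim P = trim P' \<and> trim Q = trim Q' \<or> trim P = trim Q' \<and> trim Q = trim P'"
    using P'(1) by (simp add: doubleton_eq_iff)
  then have "{P, Q} = {P', Q'}" using trim_inj H PQ by (metis insert_commute)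
  then show "{P, Q} \<in> EP" using P'(2) by simp
qed (use trimmed_graph_edges in blast)

lemma trimmed_graph_edgeE:
  assumes "{v, w} \<in> edges trimmed_graph"
  obtains P Q where "v = trim P" "w = trim Q" "{P, Q} \<in> EP"
proof -
  obtain P Q where PQ: "{v, w} = {trim P, trim Q}" "{P, Q} \<in> EP" using assms unfolding trimmed_graph_edges by blast
  then have "v = trim P \<and> w = trim Q \<or> v = trim Q \<and> w = trim P" by (simp add: doubleton_eq_iff)
  then show ?thesis using that PQ(2) EP_sym by blast
qed

lemma trimmed_eps_eq: assumes "{P, Q} \<in> EP" shows "trimmed_eps {trim P, trim Q} = gap P Q"
proof -
  have e: "{trim P, trim Q} \<in> edges trimmed_graph" using trimmed_graph_edges assms by blast
  have "gap P' Q' = gap P Q" if "{P', Q'} \<in> EP" "{trim P, trim Q} = {trim P', trim Q'}" for P' Q'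
  proof -
    have "{P, Q} = {P', Q'}" by (rule trim_pair_eq[OF assms that])
    then have "P = P' \<and> Q = Q' \<or> P = Q' \<and> Q = P'" by (simp add: doubleton_eq_iff)
    then show ?thesis using gap_sym by metis
  qed
  note same = this
  have "{gap P' Q' | P' Q'. {P', Q'} \<in> EP \<and> {trim P, trim Q} = {trim P', trim Q'}} = {gap P Q}"
    (is "?A = _")
  proof
    show "?A \<subseteq> {gap P Q}"
    proof
      fix Z assume "Z \<in> ?A"
      then obtain P' Q' where Z: "Z = gap P' Q'" "{P', Q'} \<in> EP" "{trim P, trim Q} = {trim P', trim Q'}"
        by (elim CollectE exE conjE) (rule that)
      then show "Z \<in> {gap P Q}" using same[OF Z(2,3)] by simp
    qed
    have "gap P Q \<in> ?A" using assms by (intro CollectI exI[of _ P] exI[of _ Q]) simp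
    then show "{gap P Q} \<subseteq> ?A" by simp
  qed
  then have "\<Union>{gap P' Q' | P' Q'. {P', Q'} \<in> EP \<and> {trim P, trim Q} = {trim P', trim Q'}} = gap P Q"
    by simp
  then show ?thesis unfolding trimmed_eps_def using e by simp
qed

lemma trim_gap_disj:
  assumes "P \<in> \<P>" "{Q, R} \<in> EP" shows "trim P \<inter> gap Q R = {}"
proof -
  consider "P = Q" | "P = R" | "P \<noteq> Q" "P \<noteq> R" by blast
  then show ?thesis
  proof cases
    case 1
    then show ?thesis using trim_gap assms by blast
  next
    case 2
    then show ?thesis using trim_gap[OF EP_sym[OF assms(2)]] gap_sym by metis
  next
    case 3
    then show ?thesis
      using class_disj[OF assms(1) EPD(1)[OF assms(2)]] class_disj[OF assms(1) EPD(2)[OF assms(2)]]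
        gap_sub[of Q R] trim_sub[of P] by blast
  qed
qed

lemma gap_N_trim:
  assumes e: "{P, Q} \<in> EP" and x: "x \<in> gap P Q" "{x, y} \<in> edges G"
  shows "y \<in> gap P Q \<union> trim P \<union> trim Q"
proof (rule ccontr)
  assume no: "y \<notin> gap P Q \<union> trim P \<union> trim Q"
  have *: False if e: "{A, B} \<in> EP" and EAB: "gap A B = gap P Q" and y: "y \<in> A" "y \<notin> trim A" for A B
  proof -
    note H = EPD[OF e]
    obtain R where R: "{A, R} \<in> EP" "y \<in> gap A R" using y unfolding trim_def by blast
    note HR = EPD[OF R(1)]
    have RB: "R \<noteq> B" using R(2) no EAB by blast
    have dj: "gap A R \<inter> gap A B = {}" by (rule gap_disj[OF R(1) e RB])
    obtain m where m: "m \<in> MM" "m x = y" "m y = x" by (rule edge_mate[OF x(2)])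
    show False
    proof (cases "S.partner m A = R")
      case False
      then have "closed_under m (gap A R)" by (rule gap_closed[OF HR m(1)])
      then have "x \<in> gap A R" using closedD[OF _ R(2)] m(3) by metis
      then show False using dj x(1) EAB by blast
    next
      case True
      then have "closed_under m (gap A B)" using gap_closed[OF H m(1)] RB by simp
      then have "y \<in> gap A B" using closedD[of m "gap A B" x] x(1) EAB m(2) by simp
      then show False using no EAB by blast
    qed
  qed
  have "y \<in> P \<or> y \<in> Q" using gap_N[OF x] by blast
  then show False
    using *[OF e refl] *[OF EP_sym[OF e] gap_sym] no by blast
qed

lemma class_partner_closed_other: "{P, Q} \<in> EP \<Longrightarrow> m \<in> MM \<Longrightarrow> S.partner m P \<noteq> Q \<Longrightarrow> closed_under m (gap P Q)"
  using gap_closed EPD by blast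

text \<open>The matching of the classes reappears on the trimmed classes.\<close>

lemma unit_trim:
  assumes m: "m \<in> MM" and P: "P \<in> \<P>" and Q: "Q = S.partner m P"
  shows "m (exit_point m (trim P)) \<in> trim Q \<union> gap P Q"
proof -
  define z where "z = exit_point m (trim P)"
  have z: "z \<in> trim P" "m z \<notin> trim P" "m (m z) = z"
    unfolding z_def using exit_point(1,2,7)[OF trim_tight[OF P] m] by blast+
  have PQ: "{P, Q} \<in> EP" unfolding Q by (rule EP_class_partner[OF m P])
  have no: "m z \<notin> gap A R" if "{A, R} \<in> EP" "S.partner m A \<noteq> R" for A R
  proof
    assume "m z \<in> gap A R"
    then have "z \<in> gap A R" using closedD[OF class_partner_closed_other[OF that(1) m that(2)]] z(3) by metis
    then show False using trim_gap_disj[OF P that(1)] z(1) by blast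
  qed
  have noP: "m z \<notin> gap P R" if "{P, R} \<in> EP" "R \<noteq> Q" for R using no[OF that(1)] that(2) Q by blast
  have SQ: "S.partner m Q = P" unfolding Q by (rule class_partner(4)[OF m P])
  have noQ: "m z \<notin> gap Q R" if "{Q, R} \<in> EP" "R \<noteq> P" for R using no[OF that(1)] that(2) SQ by blast
  have "z \<in> P" using z(1) trim_sub by blast
  then have "m z \<in> P \<union> Q" using closedD[OF class_partner(3)[OF m P], of z] Q by blast
  then show ?thesis
  proof
    assume "m z \<in> P"
    then obtain R where R: "{P, R} \<in> EP" "m z \<in> gap P R" using z(2) unfolding trim_def by blast
    then have "R = Q" using noP by blast
    then show ?thesis using R(2) z_def by simp
  next
    assume mQ: "m z \<in> Q"
    show ?thesis
    proof (cases "m z \<in> trim Q")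
      case False
      then obtain R where R: "{Q, R} \<in> EP" "m z \<in> gap Q R" using mQ unfolding trim_def by blast
      then have "R = P" using noQ by blast
      then show ?thesis using R(2) gap_sym z_def by simp
    qed (simp add: z_def)
  qed
qed

lemma trimmed_graph_frame: "frame G M trimmed_graph trimmed_eps"
proof
  have E2: "\<exists>P Q. e = {trim P, trim Q} \<and> {P, Q} \<in> EP" if "e \<in> edges trimmed_graph" for e using that trimmed_graph_edges by blast
  show "simple_graph trimmed_graph"
    unfolding simple_graph_def
  proof
    fix e assume "e \<in> edges trimmed_graph"
    then obtain P Q where PQ: "e = {trim P, trim Q}" "{P, Q} \<in> EP" unfolding trimmed_graph_edges by blast
    note H = EPD[OF PQ(2)]
    have "trim P \<noteq> trim Q" using trim_inj H by blast
    then show "e \<subseteq> verts trimmed_graph \<and> card e = 2" unfolding trimmed_graph_verts PQ(1) using H by simp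
  qed
  show "T v" if "v \<in> verts trimmed_graph" for v using that trim_tight unfolding trimmed_graph_verts by blast
  show "v \<inter> w = {}" if vw: "v \<in> verts trimmed_graph" "w \<in> verts trimmed_graph" "v \<noteq> w" for v w
  proof -
    obtain P Q where "v = trim P" "w = trim Q" "P \<in> \<P>" "Q \<in> \<P>" using vw unfolding trimmed_graph_verts by blast
    then show ?thesis using vw(3) class_disj[of P Q] trim_sub[of P] trim_sub[of Q] by blast
  qed
  show "trimmed_eps e \<inter> trimmed_eps f = {}" if ef: "e \<in> edges trimmed_graph" "f \<in> edges trimmed_graph" "e \<noteq> f" for e f
  proof -
    obtain P Q P' Q' where PQ: "e = {trim P, trim Q}" "{P, Q} \<in> EP" "f = {trim P', trim Q'}" "{P', Q'} \<in> EP"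
      using E2[OF ef(1)] E2[OF ef(2)] by blast
    have "{P, Q} \<noteq> {P', Q'}" using PQ ef(3) by (auto simp: doubleton_eq_iff)
    then show ?thesis using gap_disj4[OF PQ(2,4)] trimmed_eps_eq[OF PQ(2)] trimmed_eps_eq[OF PQ(4)] PQ(1,3) by simp
  qed
  show "v \<inter> trimmed_eps e = {}" if ve: "v \<in> verts trimmed_graph" "e \<in> edges trimmed_graph" for v e
  proof -
    obtain P where "v = trim P" "P \<in> \<P>" using ve unfolding trimmed_graph_verts by blast
    moreover obtain Q R where "e = {trim Q, trim R}" "{Q, R} \<in> EP" using E2[OF ve(2)] by blast
    ultimately show ?thesis using trim_gap_disj trimmed_eps_eq by simp
  qed
  show "(\<exists>v\<in>verts trimmed_graph. x \<in> v) \<or> (\<exists>e\<in>edges trimmed_graph. x \<in> trimmed_eps e)" if "x \<in> V" for x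
  proof -
    obtain P where P: "P \<in> \<P>" "x \<in> P" using classes[OF \<open>x \<in> V\<close>] by blast
    show ?thesis
    proof (cases "x \<in> trim P")
      case True
      then show ?thesis unfolding trimmed_graph_verts using P by blast
    next
      case False
      then obtain Q where Q: "{P, Q} \<in> EP" "x \<in> gap P Q" using P unfolding trim_def by blast
      have "{trim P, trim Q} \<in> edges trimmed_graph" using trimmed_graph_edge_iff[OF EPD(1,2)[OF Q(1)]] Q(1) by simp
      moreover have "x \<in> trimmed_eps {trim P, trim Q}" using trimmed_eps_eq[OF Q(1)] Q(2) by simp
      ultimately show ?thesis by blast
    qed
  qed
  show "trimmed_eps e \<subseteq> V" if e: "e \<in> edges trimmed_graph" for e
  proof -
    obtain P Q where PQ: "e = {trim P, trim Q}" "{P, Q} \<in> EP" using E2[OF e] by blast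
    then show ?thesis using trimmed_eps_eq[OF PQ(2)] gap_sub[of P Q] class_sub EPD[OF PQ(2)] by blast
  qed
  show "\<exists>x\<in>v \<union> trimmed_eps {v, w}. \<exists>y\<in>w. {x, y} \<in> edges G" if vw: "{v, w} \<in> edges trimmed_graph" for v w
  proof -
    obtain P Q where PQ: "v = trim P" "w = trim Q" "{P, Q} \<in> EP" using vw by (rule trimmed_graph_edgeE)
    have Pv: "P \<in> verts (collapse G \<P>)" "Q \<in> \<P>" using EPD[OF PQ(3)] unfolding collapse_simps by blast+
    obtain m where m: "m \<in> MM" "S.partner m P = Q" "S.partner m Q = P" using PQ(3) by (rule S.edge_real)
    let ?y = "exit_point m (trim Q)"
    have "m ?y \<in> trim P \<union> gap Q P" by (rule unit_trim[OF m(1) Pv(2) m(3)[symmetric]])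
    then have "m ?y \<in> v \<union> trimmed_eps {v, w}" using trimmed_eps_eq[OF PQ(3)] PQ gap_sym by metis
    moreover have "?y \<in> w" "?y \<in> V" using exit_point(1,5)[OF trim_tight[OF Pv(2)] m(1)] PQ by simp_all
    moreover have "{m ?y, ?y} \<in> edges G" using mateD(1)[OF m(1) \<open>?y \<in> V\<close>] by (simp add: insert_commute)
    ultimately show ?thesis by blast
  qed
  show "T (v \<union> trimmed_eps {v, w})" if vw: "{v, w} \<in> edges trimmed_graph" for v w
  proof -
    obtain P Q where PQ: "v = trim P" "w = trim Q" "{P, Q} \<in> EP" using vw by (rule trimmed_graph_edgeE)
    note H = EPD[OF PQ(3)]
    have "T (trim P \<union> gap P Q)"
    proof (rule bridge[OF trim_tight[OF H(1)] trim_tight[OF H(2)]])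
      show "trim P \<inter> trim Q = {}" using class_disj[OF H] trim_sub[of P] trim_sub[of Q] by blast
      show "gap P Q \<subseteq> V" using gap_sub[of P Q] class_sub H by blast
      show "gap P Q \<inter> trim P = {}" "gap P Q \<inter> trim Q = {}" using trim_gap_disj[OF _ PQ(3)] H by blast+
      show "\<not> odd_cut (gap P Q)" by (rule passes_even(2)[OF H passes_gap[OF H]])
      show "y \<in> gap P Q \<union> trim P \<union> trim Q" if "x \<in> gap P Q" "{x, y} \<in> edges G" for x y
        by (rule gap_N_trim[OF PQ(3) that])
    qed
    then show ?thesis using PQ trimmed_eps_eq by simp
  qed
  show "{v, w} \<in> edges trimmed_graph"
    if vw: "v \<in> verts trimmed_graph" "w \<in> verts trimmed_graph" "v \<noteq> w" "x \<in> v" "y \<in> w" "{x, y} \<in> edges G" for v w x y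
  proof -
    obtain P Q where PQ: "v = trim P" "w = trim Q" "P \<in> \<P>" "Q \<in> \<P>" using vw unfolding trimmed_graph_verts by blast
    have "P \<noteq> Q" "x \<in> P" "y \<in> Q" using PQ vw(3-5) trim_sub by blast+
    then have "{P, Q} \<in> EP" unfolding collapse_simps edge_between_def using PQ vw(6) by blast
    then show ?thesis using trimmed_graph_edge_iff PQ by simp
  qed
qed

sublocale F: frame G M trimmed_graph trimmed_eps
  by (rule trimmed_graph_frame)

text \<open>A set passable for two trimmed classes becomes passable for the classes when the gap
  is added, so it lies in the gap.\<close>

lemma trimmed_graph_maximal:
  assumes vw: "{v, w} \<in> edges trimmed_graph" and Z: "Z \<subseteq> v \<union> trimmed_eps {v, w} \<union> w" "passable G M Z v" "passable G M Z w"
  shows "Z \<subseteq> trimmed_eps {v, w}"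
proof -
  obtain P Q where PQ: "v = trim P" "w = trim Q" "{P, Q} \<in> EP" using vw by (rule trimmed_graph_edgeE)
  note H = EPD[OF PQ(3)]
  have eq: "trimmed_eps {v, w} = gap P Q" using PQ trimmed_eps_eq by simp
  have dj: "v \<inter> w = {}" using F.disjv[OF F.edgeH[OF vw]] .
  have ZV: "Z \<subseteq> V" using Z(2) unfolding passable_def by blast
  have pz: "T (v - Z)" "T (w - Z)" "\<not> odd_cut Z" "\<forall>x\<in>Z. \<forall>y. {x, y} \<in> edges G \<longrightarrow> y \<in> Z \<union> v \<union> w"
    using passable_iff[OF F.tightv[OF F.edgeH(1)[OF vw]] F.tightv[OF F.edgeH(2)[OF vw]] dj ZV] Z(2,3) by blast+
  have *: "T (A - (Z \<union> gap P Q))"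
    if A: "A \<in> \<P>" "B \<in> \<P>" "{A, B} \<in> EP" "gap A B = gap P Q" "Z \<subseteq> trim A \<union> gap P Q \<union> trim B" "passable G M Z (trim B)" "T (trim A - Z)"
    for A B
  proof -
    note HA = EPD[OF A(3)]
    let ?X = "A - gap P Q" and ?Y = "trim B \<union> Z"
    have X: "T ?X" using gap_tight[OF HA] A(4) by simp
    have Y: "T ?Y" using A(6) unfolding passable_def by blast
    have dAB: "A \<inter> B = {}" by (rule class_disj[OF HA])
    have XY: "?X \<inter> ?Y = trim A \<inter> Z" using A(5) trim_sub[of A] trim_sub[of B] dAB trim_gap_disj[OF A(1,3)] A(4) by blast
    have "trim A \<inter> Z = trim A - (trim A - Z)" by blast
    moreover have "\<not> odd_cut (trim A - (trim A - Z))"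
      using odd_cut_Diff_sub[of "trim A" "trim A - Z"] trim_tight[OF A(1)] A(7) odd_cut_tight by blast
    ultimately have "\<not> odd_cut (?X \<inter> ?Y)" using XY by simp
    then have "T (?X - ?Y)" by (rule uncross_even(1)[OF X Y])
    moreover have "?X - ?Y = A - (Z \<union> gap P Q)" using trim_sub[of B] dAB by blast
    ultimately show ?thesis by simp
  qed
  have Z': "Z \<subseteq> trim P \<union> gap P Q \<union> trim Q" "Z \<subseteq> trim Q \<union> gap P Q \<union> trim P" using Z(1) PQ eq by blast+
  have "passes P Q (Z \<union> gap P Q)"
    unfolding passes_def
  proof (intro conjI ballI allI impI)
    show "Z \<union> gap P Q \<subseteq> P \<union> Q" using Z'(1) gap_sub[of P Q] trim_sub[of P] trim_sub[of Q] by blast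
    show "T (P - (Z \<union> gap P Q))"
      by (rule *[OF H(1,2) PQ(3) refl Z'(1)]) (use Z(3) pz PQ in simp_all)
    show "T (Q - (Z \<union> gap P Q))"
      by (rule *[OF H(2,1) EP_sym[OF PQ(3)] gap_sym Z'(2)]) (use Z(2) pz PQ in simp_all)
    fix x y assume x: "x \<in> Z \<union> gap P Q" and xy: "{x, y} \<in> edges G"
    show "y \<in> P \<union> Q"
    proof (cases "x \<in> Z")
      case True
      then have "y \<in> Z \<union> v \<union> w" using pz(4) xy by blast
      then show ?thesis using Z'(1) PQ gap_sub[of P Q] trim_sub[of P] trim_sub[of Q] by blast
    next
      case False
      then show ?thesis using gap_N[of x P Q y] x xy by blast
    qed
  qed
  then show ?thesis using passes_sub_gap eq by blast
qed

lemma partner_trim: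
  assumes m: "m \<in> MM" and P: "P \<in> \<P>" shows "F.partner m (trim P) = trim (S.partner m P)"
proof (rule F.partner_pointI[OF m])
  have PQ: "{P, S.partner m P} \<in> EP" by (rule EP_class_partner[OF m P])
  then show "{trim P, trim (S.partner m P)} \<in> edges trimmed_graph" using trimmed_graph_edges by blast
  show "exit_point m (trim P) \<in> trim P" by (rule exit_point(1)[OF trim_tight[OF P] m])
  show "m (exit_point m (trim P)) \<in> trim (S.partner m P) \<union> trimmed_eps {trim P, trim (S.partner m P)}"
    using unit_trim[OF m P refl] trimmed_eps_eq[OF PQ] by simp
qed

lemma card_trimmed_graph: "infinite (verts trimmed_graph) \<or> 4 \<le> card (verts trimmed_graph)"
proof -
  have "inj_on trim \<P>" using trim_inj by (rule inj_onI)
  then show ?thesis unfolding trimmed_graph_verts using largeS by (simp add: card_image finite_image_iff)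
qed

lemma trimmed_graph_torsoid:
  assumes "BoB trimmed_graph F.MH \<or> is_cycle trimmed_graph"
    and unrefined: "\<And>u v w P1 P2 P3. is_cycle trimmed_graph \<Longrightarrow> {u, v} \<in> edges trimmed_graph \<Longrightarrow> {v, w} \<in> edges trimmed_graph \<Longrightarrow> u \<noteq> w \<Longrightarrow>
      T P1 \<Longrightarrow> T P2 \<Longrightarrow> T P3 \<Longrightarrow> P1 \<inter> P2 = {} \<Longrightarrow> P1 \<inter> P3 = {} \<Longrightarrow> P2 \<inter> P3 = {} \<Longrightarrow>
      P1 \<union> P2 \<union> P3 = trimmed_eps {u, v} \<union> v \<union> trimmed_eps {v, w} \<Longrightarrow> T (u \<union> P1 \<union> P2) \<Longrightarrow> T (P2 \<union> P3 \<union> w) \<Longrightarrow> False"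
  shows "torsoid G M (trimmed_graph, trimmed_eps)"
  unfolding torsoid_def prod.case
proof (intro conjI)
  show "matching_covered trimmed_graph F.MH" by (rule F.matching_covered_H)
  show "infinite (verts trimmed_graph) \<or> 4 \<le> card (verts trimmed_graph)" by (rule card_trimmed_graph)
  show "BoB trimmed_graph F.MH \<or> is_cycle trimmed_graph" by fact
  show "\<forall>v\<in>verts trimmed_graph. T v" using F.tightv by blast
  show "trimmed_eps \<in> edges trimmed_graph \<rightarrow>\<^sub>E Pow V"
  proof (rule PiE_I)
    show "trimmed_eps e \<in> Pow V" if "e \<in> edges trimmed_graph" for e using F.subV[OF that] by blast
    show "trimmed_eps e = undefined" if "e \<notin> edges trimmed_graph" for e using that unfolding trimmed_eps_def by simp
  qed
  show "disjoint (verts trimmed_graph)" unfolding disjoint_def using F.disjv by blast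
  show "disjoint_family_on trimmed_eps (edges trimmed_graph)" unfolding disjoint_family_on_def using F.dise by blast
  show "\<forall>v\<in>verts trimmed_graph. \<forall>e\<in>edges trimmed_graph. v \<inter> trimmed_eps e = {}" using F.disve by blast
  show "\<Union>(verts trimmed_graph) \<union> \<Union>(trimmed_eps ` edges trimmed_graph) = V"
  proof
    show "\<Union>(verts trimmed_graph) \<union> \<Union>(trimmed_eps ` edges trimmed_graph) \<subseteq> V" using F.vert_sub F.subV by blast
    show "V \<subseteq> \<Union>(verts trimmed_graph) \<union> \<Union>(trimmed_eps ` edges trimmed_graph)" using F.cover by blast
  qed
  show "\<forall>v w. {v, w} \<in> edges trimmed_graph \<longrightarrow>
        edge_between (edges G) (v \<union> trimmed_eps {v, w}) w \<and>
        passable G M (trimmed_eps {v, w}) v \<and> passable G M (trimmed_eps {v, w}) w \<and>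
        (\<forall>S. S \<subseteq> v \<union> trimmed_eps {v, w} \<union> w \<and> passable G M S v \<and> passable G M S w \<longrightarrow>
             S \<subseteq> trimmed_eps {v, w})"
  proof (intro allI impI conjI)
    fix v w assume vw: "{v, w} \<in> edges trimmed_graph"
    have vs: "v \<in> verts trimmed_graph" "w \<in> verts trimmed_graph" using F.edgeH vw by blast+
    show "edge_between (edges G) (v \<union> trimmed_eps {v, w}) w" unfolding edge_between_def by (rule F.edgeb[OF vw])
    have d: "v - trimmed_eps {v, w} = v" "w - trimmed_eps {v, w} = w" using F.disve[OF _ vw] vs by blast+
    show "passable G M (trimmed_eps {v, w}) v" "passable G M (trimmed_eps {v, w}) w"
      unfolding passable_def d using F.subV[OF vw] F.tightv vs F.passv[OF vw] F.passw[OF vw] by blast+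
    fix S assume "S \<subseteq> v \<union> trimmed_eps {v, w} \<union> w \<and> passable G M S v \<and> passable G M S w"
    then show "S \<subseteq> trimmed_eps {v, w}" using trimmed_graph_maximal[OF vw] by blast
  qed
  show "\<forall>v\<in>verts trimmed_graph. \<forall>w\<in>verts trimmed_graph. v \<noteq> w \<and> {v, w} \<notin> edges trimmed_graph \<longrightarrow> \<not> edge_between (edges G) v w"
    unfolding edge_between_def using F.nonadj by blast
  show "is_cycle trimmed_graph \<longrightarrow> (\<forall>u v w. {u, v} \<in> edges trimmed_graph \<and> {v, w} \<in> edges trimmed_graph \<and> u \<noteq> w \<longrightarrow>
        \<not> (\<exists>P1 P2 P3. T P1 \<and> T P2 \<and> T P3 \<and>
             P1 \<inter> P2 = {} \<and> P1 \<inter> P3 = {} \<and> P2 \<inter> P3 = {} \<and>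
             P1 \<union> P2 \<union> P3 = trimmed_eps {u, v} \<union> v \<union> trimmed_eps {v, w} \<and>
             T (u \<union> P1 \<union> P2) \<and> T (P2 \<union> P3 \<union> w)))"
    using unrefined by (intro impI allI notI) (elim exE conjE, blast)
qed

end

section \<open>Refining a cyclic partition\<close>

context tight_partition
begin

text \<open>Each class has a third neighbour, so gaps are disjoint. Trimming is an isomorphism of
  matched graphs, which carries the brick or brace property over.\<close>

theorem brick_torsoid:
  assumes bob: "BoB (collapse G \<P>) (collapse_matching M \<P>)" and nc: "\<not> is_cycle (collapse G \<P>)"
  shows "\<exists>T. torsoid G M T \<and> (\<forall>P\<in>\<P>. \<exists>v\<in>verts (fst T). v \<subseteq> P)"
proof -
  have SM: "S.MH = collapse_matching M \<P>" by (rule collapse_matching_eq[OF part])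
  have bob': "BoB (collapse G \<P>) S.MH" using bob SM by simp
  have deg: "\<exists>Q. {P, Q} \<in> EP \<and> Q \<noteq> Q1 \<and> Q \<noteq> Q2" if P: "P \<in> \<P>" for P Q1 Q2
    using S.Q.degree_two_cycle[OF bob', of P Q1 Q2] nc largeS P unfolding collapse_simps(1) by blast
  interpret separated_partition G M \<P>
  proof unfold_locales
    fix P Q Q' assume a: "{P, Q} \<in> EP" "{P, Q'} \<in> EP" "Q \<noteq> Q'"
    obtain R where R: "{P, R} \<in> EP" "R \<noteq> Q" "R \<noteq> Q'" using deg[OF EPD(1)[OF a(1)], of Q Q'] by blast
    obtain m where m: "m \<in> MM" "S.partner m P = R" "S.partner m R = P" using R(1) by (rule S.edge_real)
    show "gap P Q \<inter> gap P Q' = {}" by (rule gap_disjoint_third[OF a m(1)]) (use m R in simp_all)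
  qed
  have ncH: "\<not> is_cycle trimmed_graph"
  proof
    assume c: "is_cycle trimmed_graph"
    obtain C where C: "C \<in> \<P>" by (rule other_class)
    then have "trim C \<in> verts trimmed_graph" unfolding trimmed_graph_verts by blast
    then obtain a b where ab: "a \<noteq> b" "\<And>y. {trim C, y} \<in> edges trimmed_graph \<longleftrightarrow> y = a \<or> y = b"
      by (rule cycle_degree[OF c]) blast
    have e: "{trim C, a} \<in> edges trimmed_graph" "{trim C, b} \<in> edges trimmed_graph" using ab(2) by blast+
    have nbr: "\<exists>Q. y = trim Q \<and> Q \<in> \<P>" if e: "{trim C, y} \<in> edges trimmed_graph" for y
    proof -
      obtain P Q where "trim C = trim P" "y = trim Q" "{P, Q} \<in> EP" using e by (rule trimmed_graph_edgeE)
      then show ?thesis using EPD(2) by blast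
    qed
    obtain Q1 Q2 where Q: "a = trim Q1" "Q1 \<in> \<P>" "b = trim Q2" "Q2 \<in> \<P>"
      using nbr[OF e(1)] nbr[OF e(2)] by blast
    obtain R where R: "{C, R} \<in> EP" "R \<noteq> Q1" "R \<noteq> Q2" using deg[OF C] by blast
    have "{trim C, trim R} \<in> edges trimmed_graph" using trimmed_graph_edge_iff EPD R(1) by blast
    then have "trim R = trim Q1 \<or> trim R = trim Q2" using ab(2) Q by blast
    then show False using trim_inj EPD(2)[OF R(1)] R Q by blast
  qed
  have inj: "inj_on trim \<P>" using trim_inj by (rule inj_onI)
  have "BoB trimmed_graph F.MH"
    unfolding BoB_def
  proof (intro conjI allI impI)
    show "matching_covered trimmed_graph F.MH" by (rule F.matching_covered_H)
    fix Y assume Y: "tight trimmed_graph F.MH Y"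
    have YV: "Y \<subseteq> trim ` \<P>" using F.Q.tight_sub[OF Y] unfolding trimmed_graph_verts .
    define X where "X = {P \<in> \<P>. trim P \<in> Y}"
    have YX: "Y = trim ` X" using YV unfolding X_def by blast
    have "tight (collapse G \<P>) S.MH X"
    proof (rule S.Q.tightI)
      show "X \<subseteq> verts (collapse G \<P>)" unfolding X_def collapse_simps by blast
      fix n assume "n \<in> mates (collapse G \<P>) S.MH"
      then obtain m where m: "m \<in> MM" "\<forall>P\<in>\<P>. S.partner m P = n P" using S.lift unfolding collapse_simps by blast
      obtain y where y: "exits (F.partner m) Y = {y}" using F.Q.exit_point(4)[OF Y F.partner_mates[OF m(1)]] by blast
      have ex: "P \<in> exits n X \<longleftrightarrow> trim P \<in> exits (F.partner m) Y" if P: "P \<in> \<P>" for P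
      proof -
        have nP: "n P = S.partner m P" using m(2) P by simp
        then have "n P \<in> \<P>" using class_partner(1)[OF m(1) P] by simp
        then show ?thesis unfolding exits_def X_def mem_Collect_eq partner_trim[OF m(1) P] nP[symmetric]
          using P by simp
      qed
      obtain P where P: "P \<in> \<P>" "y = trim P" using y YV unfolding exits_def by blast
      have "exits n X = {P}"
      proof
        show "{P} \<subseteq> exits n X" using ex[OF P(1)] y P(2) by simp
        show "exits n X \<subseteq> {P}"
        proof
          fix Q assume Q: "Q \<in> exits n X"
          then have QP: "Q \<in> \<P>" unfolding exits_def X_def by blast
          then have "trim Q = trim P" using Q ex[OF QP] y P(2) by simp
          then show "Q \<in> {P}" using trim_inj[OF QP P(1)] by simp
        qed
      qed
      then show "\<exists>P. exits n X = {P}" by blast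
    qed
    then have t: "card X = 1 \<or> card (\<P> - X) = 1"
      using bob' unfolding BoB_def trivial_set_def collapse_simps(1) by blast
    have XP: "X \<subseteq> \<P>" unfolding X_def by blast
    have "card Y = card X" unfolding YX by (rule card_image[OF inj_on_subset[OF inj XP]])
    moreover have "verts trimmed_graph - Y = trim ` (\<P> - X)"
      unfolding trimmed_graph_verts YX using inj_on_image_set_diff[OF inj, of \<P> X] XP by simp
    then have "card (verts trimmed_graph - Y) = card (\<P> - X)"
      using card_image[OF inj_on_subset[OF inj], of "\<P> - X"] by simp
    ultimately show "trivial_set trimmed_graph Y" unfolding trivial_set_def using t by simp
  qed
  then have "torsoid G M (trimmed_graph, trimmed_eps)" by (intro trimmed_graph_torsoid) (use ncH in blast)+
  moreover have "\<forall>P\<in>\<P>. \<exists>v\<in>verts (fst (trimmed_graph, trimmed_eps)). v \<subseteq> P" unfolding fst_conv trimmed_graph_verts using trim_sub by blast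
  ultimately show ?thesis by blast
qed

text \<open>Replaces the class at position \<open>0\<close> by three classes. The middle part is
  tight as a matching traverses it: matchings exit \<open>Q\<close> in \<open>Z1\<close> or in
  \<open>Z3\<close>, and \<open>Z2\<close> is then joined to the opposite part. Edges of the new
  collapse are checked with a matching that contains them.\<close>

lemma refine_cycle_aux:
  assumes n: "n \<ge> 3" and bij: "bij_betw c {..<n} \<P>" and E: "EP = {{c i, c (Suc i mod n)} | i. i < n}"
    and c0: "c 0 = Q"
    and Z: "T Z1" "T Z3" "Q = Z1 \<union> Z2 \<union> Z3" "Z1 \<inter> Z2 = {}" "Z1 \<inter> Z3 = {}" "Z2 \<inter> Z3 = {}"
    and x1: "\<And>m. m \<in> MM \<Longrightarrow> S.partner m Q = c (n - 1) \<Longrightarrow> exit_point m Q \<in> Z1"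
    and x3: "\<And>m. m \<in> MM \<Longrightarrow> S.partner m Q = c 1 \<Longrightarrow> exit_point m Q \<in> Z3"
  defines "\<Q> \<equiv> (\<P> - {Q}) \<union> {Z1, Z2, Z3}"
  shows "tight_set_partition G M \<Q>" "is_cycle (collapse G \<Q>)" "card \<Q> = card \<P> + 2"
proof -
  have cP: "c i \<in> \<P>" if "i < n" for i using bij that unfolding bij_betw_def by blast
  have ceq: "i = j" if "i < n" "j < n" "c i = c j" for i j
    using bij that unfolding bij_betw_def inj_on_def by simp
  have csur: "\<exists>i<n. P = c i" if "P \<in> \<P>" for P using bij that unfolding bij_betw_def by auto
  have Q: "Q \<in> \<P>" using cP[of 0] n c0 by simp
  have tQ: "T Q" by (rule class_tight[OF Q])
  have QV: "Q \<subseteq> V" by (rule class_sub[OF Q])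
  have nb: "P = c 1 \<or> P = c (n - 1)" if e: "{Q, P} \<in> EP" for P
  proof -
    obtain i where i: "i < n" "{Q, P} = {c i, c (Suc i mod n)}" using e unfolding E by blast
    have z: "0 < n" "Suc i mod n < n" using n by simp_all
    have "Q = c i \<and> P = c (Suc i mod n) \<or> Q = c (Suc i mod n) \<and> P = c i"
      using i(2) by (simp add: doubleton_eq_iff)
    then show ?thesis
    proof
      assume a: "Q = c i \<and> P = c (Suc i mod n)"
      then have "i = 0" using ceq[OF i(1) z(1)] c0 by simp
      then show ?thesis using a n by simp
    next
      assume a: "Q = c (Suc i mod n) \<and> P = c i"
      then have "Suc i mod n = 0" using ceq[OF z(2) z(1)] c0 by simp
      then have "Suc i = n" using i(1) by (cases "Suc i = n") auto
      then show ?thesis using a by auto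
    qed
  qed
  have type: "S.partner m Q = c 1 \<or> S.partner m Q = c (n - 1)" if "m \<in> MM" for m
    using nb[OF EP_class_partner[OF that Q]] .
  have e1: "{Q, c 1} \<in> EP" unfolding E using c0 n by (intro CollectI exI[of _ 0]) simp
  have en: "{c (n - 1), Q} \<in> EP" unfolding E using c0 n by (intro CollectI exI[of _ "n - 1"]) simp
  obtain ma where ma: "ma \<in> MM" "S.partner ma Q = c (n - 1)"
    using S.edge_real[OF EP_sym[OF en]] by metis
  obtain mb where mb: "mb \<in> MM" "S.partner mb Q = c 1" using S.edge_real[OF e1] by metis
  have exit_Z1: "exit_point m Z1 = exit_point m Q" if "m \<in> MM" "S.partner m Q = c (n - 1)" for m
    using exit_eq[OF Z(1) that(1) x1[OF that]] exit_point(2)[OF tQ that(1)] Z(3) by blast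
  have exit_Z3: "exit_point m Z3 = exit_point m Q" if "m \<in> MM" "S.partner m Q = c 1" for m
    using exit_eq[OF Z(2) that(1) x3[OF that]] exit_point(2)[OF tQ that(1)] Z(3) by blast
  have ZV: "Z1 \<subseteq> V" "Z2 \<subseteq> V" "Z3 \<subseteq> V" using QV Z(3) by blast+
  have mm: "m (m x) = x" if "m \<in> MM" "x \<in> Q" for m x using mateD(2)[OF that(1)] QV that(2) by blast
  have mQ: "m x \<in> Q" if "m \<in> MM" "x \<in> Q" "x \<noteq> exit_point m Q" for m x
    using exit_eq[OF tQ that(1,2)] that(3) by blast
  have noZ1: "m x \<notin> Z1" if m: "m \<in> MM" "S.partner m Q = c (n - 1)" and x: "x \<in> Q" "x \<notin> Z1" for m x
  proof
    assume a: "m x \<in> Z1"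
    have "m x = exit_point m Q" using exit_eq[OF Z(1) m(1) a] mm[OF m(1) x(1)] x(2) exit_Z1[OF m] by simp
    then have "m (exit_point m Q) = x" using mm[OF m(1) x(1)] by simp
    then show False using exit_point(2)[OF tQ m(1)] x(1) by simp
  qed
  have noZ3: "m x \<notin> Z3" if m: "m \<in> MM" "S.partner m Q = c 1" and x: "x \<in> Q" "x \<notin> Z3" for m x
  proof
    assume a: "m x \<in> Z3"
    have "m x = exit_point m Q" using exit_eq[OF Z(2) m(1) a] mm[OF m(1) x(1)] x(2) exit_Z3[OF m] by simp
    then have "m (exit_point m Q) = x" using mm[OF m(1) x(1)] by simp
    then show False using exit_point(2)[OF tQ m(1)] x(1) by simp
  qed
  have tZ2: "T Z2"
  proof (rule tightI[OF ZV(2)])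
    have eq: "Z2 = Q - (Z1 \<union> Z3)" using Z by blast
    have f: "fin_cut Q" "fin_cut (Z1 \<union> Z3)" using tQ Z(1,2) by blast+
    have "odd_cut (Z1 \<union> Z3) \<longleftrightarrow> odd_cut Z1 \<noteq> odd_cut Z3" by (rule odd_cut_Un_disjoint) (use Z in blast)+
    then have "\<not> odd_cut (Z1 \<union> Z3)" using odd_cut_tight Z(1,2) by blast
    then have odd_cut: "odd_cut Z2" unfolding eq using odd_cut_Diff_sub[OF f] odd_cut_tight[OF tQ] Z(3) by blast
    fix m assume m: "m \<in> MM"
    have "\<exists>z. exits m Z2 \<subseteq> {z}"
      using type[OF m]
    proof
      assume t: "S.partner m Q = c 1"
      have "exits m Z2 \<subseteq> {m (exit_point m Z1)}"
      proof
        fix x assume "x \<in> exits m Z2"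
        then have x: "x \<in> Z2" "m x \<notin> Z2" "x \<in> Q" "x \<notin> Z1" "x \<notin> Z3" using Z unfolding exits_def by blast+
        have "x \<noteq> exit_point m Q" using x3[OF m t] x by blast
        then have "m x \<in> Z1" using mQ[OF m x(3)] noZ3[OF m t x(3,5)] x(2) Z(3) by blast
        then have "exit_point m Z1 = m x" using exit_eq[OF Z(1) m] mm[OF m x(3)] x(4) by simp
        then show "x \<in> {m (exit_point m Z1)}" using mm[OF m x(3)] by simp
      qed
      then show ?thesis by blast
    next
      assume t: "S.partner m Q = c (n - 1)"
      have "exits m Z2 \<subseteq> {m (exit_point m Z3)}"
      proof
        fix x assume "x \<in> exits m Z2"
        then have x: "x \<in> Z2" "m x \<notin> Z2" "x \<in> Q" "x \<notin> Z1" "x \<notin> Z3" using Z unfolding exits_def by blast+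
        have "x \<noteq> exit_point m Q" using x1[OF m t] x by blast
        then have "m x \<in> Z3" using mQ[OF m x(3)] noZ1[OF m t x(3,4)] x(2) Z(3) by blast
        then have "exit_point m Z3 = m x" using exit_eq[OF Z(2) m] mm[OF m x(3)] x(5) by simp
        then show "x \<in> {m (exit_point m Z3)}" using mm[OF m x(3)] by simp
      qed
      then show ?thesis by blast
    qed
    then obtain z where "exits m Z2 \<subseteq> {z}" by blast
    moreover have "exits m Z2 \<noteq> {}" using odd_cut odd_cut_iff[OF ZV(2) m] by auto
    ultimately show "\<exists>x. exits m Z2 = {x}" by blast
  qed
  have Zne: "Z1 \<noteq> {}" "Z2 \<noteq> {}" "Z3 \<noteq> {}" using tight_ne Z(1,2) tZ2 by blast+
  have Zin: "Z1 \<subseteq> Q" "Z2 \<subseteq> Q" "Z3 \<subseteq> Q" using Z(3) by blast+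
  have Zdist: "Z1 \<noteq> Z2" "Z1 \<noteq> Z3" "Z2 \<noteq> Z3" using Z(4-6) Zne by blast+
  have Znew: "A \<notin> \<P> - {Q}" if "A \<subseteq> Q" "A \<noteq> {}" for A using class_disj[OF Q] that by blast
  have dj: "A \<inter> B = {}" if AB: "A \<in> \<Q>" "B \<in> \<Q>" "A \<noteq> B" for A B
  proof -
    have 1: "C \<inter> D = {}" if "C \<subseteq> Q" "D \<in> \<P> - {Q}" for C D using class_disj[OF Q] that by blast
    consider "A \<in> \<P> - {Q}" "B \<in> \<P> - {Q}" | "A \<in> {Z1, Z2, Z3}" "B \<in> \<P> - {Q}"
      | "A \<in> \<P> - {Q}" "B \<in> {Z1, Z2, Z3}" | "A \<in> {Z1, Z2, Z3}" "B \<in> {Z1, Z2, Z3}"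
      using AB(1,2) unfolding \<Q>_def by (elim UnE) blast+
    then show ?thesis
    proof cases
      case 1
      then show ?thesis using class_disj AB(3) by blast
    next
      case 2
      then show ?thesis using 1[of A B] Zin by blast
    next
      case 3
      then show ?thesis using 1[of B A] Zin by blast
    next
      case 4
      then show ?thesis using Z(4-6) AB(3) by blast
    qed
  qed
  show tsp: "tight_set_partition G M \<Q>"
    unfolding tight_set_partition_def
  proof
    have "\<Union>\<P> = V" using classes class_sub by blast
    moreover have "\<Union>\<Q> = \<Union>\<P>" unfolding \<Q>_def using Z(3) Q by blast
    moreover have "{} \<notin> \<Q>" unfolding \<Q>_def using Zne tight_ne class_tight by blast
    ultimately show "partition_on V \<Q>" unfolding partition_on_def disjoint_def using dj by blast
    show "\<forall>P\<in>\<Q>. T P" unfolding \<Q>_def using Z(1,2) tZ2 class_tight by blast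
  qed
  have finP: "finite \<P>" using bij bij_betw_finite by blast
  have cardP: "card \<P> = n" using bij bij_betw_same_card by fastforce
  show cardQ: "card \<Q> = card \<P> + 2"
  proof -
    have "(\<P> - {Q}) \<inter> {Z1, Z2, Z3} = {}" using Znew Zin Zne by blast
    then have "card \<Q> = card (\<P> - {Q}) + card {Z1, Z2, Z3}"
      unfolding \<Q>_def using finP by (intro card_Un_disjoint) auto
    moreover have "card {Z1, Z2, Z3} = 3" using Zdist by simp
    moreover have "card (\<P> - {Q}) = n - 1" using Q finP cardP by simp
    ultimately show ?thesis using n cardP by simp
  qed
  \<comment> \<open>The new cyclic numbering: \<open>Z1, Z2, Z3\<close>, followed by the old
    classes from position \<open>1\<close> on.\<close>
  define d where "d i = (if i = 0 then Z1 else if i = 1 then Z2 else if i = 2 then Z3 else c (i - 2))" for i :: nat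
  have d: "d 0 = Z1" "d 1 = Z2" "d 2 = Z3" "\<And>i. d (Suc (Suc (Suc i))) = c (Suc i)" unfolding d_def by simp_all
  have dbij: "bij_betw d {..<n + 2} \<Q>"
  proof -
    have im: "d ` {..<n + 2} = \<Q>"
    proof
      show "d ` {..<n + 2} \<subseteq> \<Q>"
      proof
        fix P assume "P \<in> d ` {..<n + 2}"
        then obtain i where i: "i < n + 2" "P = d i" by blast
        show "P \<in> \<Q>"
        proof (cases "i \<le> 2")
          case True
          then have "i = 0 \<or> i = 1 \<or> i = 2" by auto
          then show ?thesis using i d unfolding \<Q>_def by auto
        next
          case False
          then have "P = c (i - 2)" "i - 2 < n" "i - 2 \<noteq> 0" using i unfolding d_def by auto
          then have "P \<in> \<P>" "P \<noteq> Q" using cP ceq[of "i - 2" 0] c0 n by auto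
          then show ?thesis unfolding \<Q>_def by blast
        qed
      qed
      show "\<Q> \<subseteq> d ` {..<n + 2}"
      proof
        fix P assume "P \<in> \<Q>"
        then consider "P = Z1" | "P = Z2" | "P = Z3" | "P \<in> \<P>" "P \<noteq> Q" unfolding \<Q>_def by blast
        then have "\<exists>i<n + 2. P = d i"
        proof cases
          case 1
          then show ?thesis using d by (intro exI[of _ 0]) simp
        next
          case 2
          then show ?thesis using d by (intro exI[of _ 1]) simp
        next
          case 3
          then show ?thesis using d n by (intro exI[of _ 2]) simp
        next
          case 4
          then obtain i where i: "i < n" "P = c i" using csur by blast
          then have "i \<noteq> 0" using c0 4 by metis
          then obtain k where "i = Suc k" by (cases i) auto
          then show ?thesis using i d(4)[of k] by (intro exI[of _ "Suc (Suc (Suc k))"]) simp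
        qed
        then show "P \<in> d ` {..<n + 2}" by blast
      qed
    qed
    moreover have "inj_on d {..<n + 2}"
      by (rule eq_card_imp_inj_on) (use im cardQ cardP in simp_all)
    ultimately show ?thesis unfolding bij_betw_def by blast
  qed
  have EQ: "{A, B} \<in> edges (collapse G \<Q>) \<longleftrightarrow> A \<in> \<Q> \<and> B \<in> \<Q> \<and> A \<noteq> B \<and> edge_between (edges G) A B" for A B
    by (rule collapse_simps)
  have ebI: "edge_between (edges G) A B" if "m \<in> MM" "x \<in> A" "m x \<in> B" "x \<in> V" for m x A B
    unfolding edge_between_def using mateD(1)[OF that(1,4)] that by blast
  have inQ: "Z1 \<in> \<Q>" "Z2 \<in> \<Q>" "Z3 \<in> \<Q>" unfolding \<Q>_def by blast+
  have c1Q: "c 1 \<in> \<Q>" "c (n - 1) \<in> \<Q>" "c 1 \<noteq> Q" "c (n - 1) \<noteq> Q"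
    using cP[of 1] cP[of "n - 1"] ceq[of 1 0] ceq[of "n - 1" 0] c0 n unfolding \<Q>_def by auto
  have old_iff: "{A, B} \<in> edges (collapse G \<Q>) \<longleftrightarrow> {A, B} \<in> EP" if "A \<in> \<P> - {Q}" "B \<in> \<P> - {Q}" for A B
    unfolding EQ collapse_simps \<Q>_def using that by blast
  have new1: "{c (n - 1), Z1} \<in> edges (collapse G \<Q>)"
  proof -
    let ?e = "exit_point ma Q"
    have e: "?e \<in> Z1" "?e \<in> V" "ma ?e \<in> c (n - 1)"
      using x1[OF ma] exit_point(5)[OF tQ ma(1)] class_partner(5)[OF ma(1) Q] ma(2) by simp_all
    have "Z1 \<noteq> c (n - 1)" using Znew[OF Zin(1) Zne(1)] cP[of "n - 1"] c1Q(4) n by auto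
    then have "{Z1, c (n - 1)} \<in> edges (collapse G \<Q>)"
      unfolding EQ using ebI[OF ma(1) e(1,3,2)] inQ(1) c1Q(2) by blast
    then show ?thesis by (simp add: insert_commute)
  qed
  have new3: "{Z3, c 1} \<in> edges (collapse G \<Q>)"
  proof -
    let ?e = "exit_point mb Q"
    have e: "?e \<in> Z3" "?e \<in> V" "mb ?e \<in> c 1"
      using x3[OF mb] exit_point(5)[OF tQ mb(1)] class_partner(5)[OF mb(1) Q] mb(2) by simp_all
    have "Z3 \<noteq> c 1" using Znew[OF Zin(3) Zne(3)] cP[of 1] c1Q(3) n by auto
    then show ?thesis
      unfolding EQ using ebI[OF mb(1) e(1,3,2)] inQ(3) c1Q(1) by blast
  qed
  have new23: "{Z2, Z3} \<in> edges (collapse G \<Q>)"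
  proof -
    let ?e = "exit_point ma Z2"
    have e: "?e \<in> Z2" "ma ?e \<notin> Z2" "?e \<in> V" using exit_point(1,2,5)[OF tZ2 ma(1)] by blast+
    then have "?e \<in> Q" "?e \<notin> Z1" using Zin Z(4) by blast+
    moreover have "?e \<noteq> exit_point ma Q" using x1[OF ma] calculation by metis
    ultimately have "ma ?e \<in> Z3" using mQ[OF ma(1)] noZ1[OF ma] e(2) Z(3) by blast
    then show ?thesis unfolding EQ using ebI[OF ma(1) e(1) _ e(3)] inQ Zdist by blast
  qed
  have new12: "{Z1, Z2} \<in> edges (collapse G \<Q>)"
  proof -
    let ?e = "exit_point mb Z2"
    have e: "?e \<in> Z2" "mb ?e \<notin> Z2" "?e \<in> V" using exit_point(1,2,5)[OF tZ2 mb(1)] by blast+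
    then have "?e \<in> Q" "?e \<notin> Z3" using Zin Z(6) by blast+
    moreover have "?e \<noteq> exit_point mb Q" using x3[OF mb] calculation by metis
    ultimately have "mb ?e \<in> Z1" using mQ[OF mb(1)] noZ3[OF mb] e(2) Z(3) by blast
    then have "{Z2, Z1} \<in> edges (collapse G \<Q>)" unfolding EQ using ebI[OF mb(1) e(1) _ e(3)] inQ Zdist by blast
    then show ?thesis by (simp add: insert_commute)
  qed
  have old: "{c (Suc i), c (Suc (Suc i))} \<in> edges (collapse G \<Q>)" if i: "Suc (Suc i) < n" for i
  proof -
    have "{c (Suc i), c (Suc (Suc i))} \<in> EP" unfolding E using i by (intro CollectI exI[of _ "Suc i"]) simp
    moreover have "c (Suc i) \<in> \<P> - {Q}" "c (Suc (Suc i)) \<in> \<P> - {Q}"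
      using cP[of "Suc i"] cP[of "Suc (Suc i)"] ceq[of "Suc i" 0] ceq[of "Suc (Suc i)" 0] i c0 by auto
    ultimately show ?thesis using old_iff by blast
  qed
  define D where "D = {{d i, d (Suc i mod (n + 2))} | i. i < n + 2}"
  have Dmem: "{d i, d (Suc i mod (n + 2))} \<in> D" if "i < n + 2" for i unfolding D_def using that by blast
  have mods: "Suc 0 mod (n + 2) = 1" "Suc 1 mod (n + 2) = 2" "Suc 2 mod (n + 2) = 3" using n by simp_all
  have d3: "d 3 = c 1" unfolding d_def by simp
  have D0: "{Z1, Z2} \<in> D" using Dmem[of 0] unfolding mods d by simp
  have D1: "{Z2, Z3} \<in> D" using Dmem[of 1] unfolding mods d by simp
  have D2: "{Z3, c 1} \<in> D" using Dmem[of 2] unfolding mods d d3 using n by simp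
  have Dn: "{c (n - 1), Z1} \<in> D"
  proof -
    have "n = Suc (Suc (n - 2))" using n by simp
    then obtain k where k: "n = Suc (Suc k)" by blast
    have "d (Suc n) = c (n - 1)" using d(4)[of k] k by simp
    moreover have "Suc (Suc n) mod (n + 2) = 0" by simp
    ultimately show ?thesis using Dmem[of "Suc n"] d(1) by simp
  qed
  have Dold: "{c (Suc i), c (Suc (Suc i))} \<in> D" if "Suc (Suc i) < n" for i
    using Dmem[of "Suc (Suc (Suc i))"] d(4)[of i] d(4)[of "Suc i"] that by simp
  have sub1: "D \<subseteq> edges (collapse G \<Q>)"
  proof
    fix e assume "e \<in> D"
    then obtain i where i: "i < n + 2" "e = {d i, d (Suc i mod (n + 2))}" unfolding D_def by blast
    consider "i = 0" | "i = 1" | "i = 2" | k where "i = Suc (Suc (Suc k))"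
    proof -
      have "i = 0 \<or> i = 1 \<or> i = 2 \<or> i = Suc (Suc (Suc (i - 3)))" by arith
      then show thesis using that by blast
    qed
    then show "e \<in> edges (collapse G \<Q>)"
    proof cases
      case 1
      then show ?thesis using i new12 mods d by simp
    next
      case 2
      have "e = {d 1, d 2}" using i(2) mods(2) unfolding 2 by simp
      then show ?thesis using new23 d by simp
    next
      case 3
      have "e = {d 2, d 3}" using i(2) mods(3) unfolding 3 by simp
      then show ?thesis using new3 d d3 by simp
    next
      case 4
      show ?thesis
      proof (cases "Suc (Suc k) = n")
        case True
        have k: "n - 1 = Suc k" using True by linarith
        have "d i = c (n - 1)" unfolding 4 k by (rule d(4))
        moreover have "Suc i mod (n + 2) = 0" unfolding 4 True[symmetric] by simp
        ultimately have "e = {c (n - 1), Z1}" unfolding i(2) using d(1) by simp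
        then show ?thesis using new1 by simp
      next
        case False
        then have "Suc (Suc k) < n" using i 4 by simp
        moreover have "Suc i mod (n + 2) = Suc i" using calculation unfolding 4 by simp
        then have "e = {c (Suc k), c (Suc (Suc k))}"
          unfolding i(2) 4 using d(4)[of k] d(4)[of "Suc k"] by simp
        ultimately show ?thesis using old by simp
      qed
    qed
  qed
  have part_out: "{A, B} \<in> D" if A: "A \<in> {Z1, Z2, Z3}" and B: "B \<in> \<P> - {Q}" and m: "m \<in> MM" and x: "x \<in> A" "m x \<in> B"
    for A B m x
  proof -
    have xQ: "x \<in> Q" using A x Zin by blast
    have "m x \<notin> Q" using class_disj[OF Q] B x(2) by blast
    then have ex: "exit_point m Q = x" by (rule exit_eq[OF tQ m xQ])
    then have BS: "B = S.partner m Q" using class_partner(5)[OF m Q] class_eq[OF _ class_partner(1)[OF m Q] x(2)] B by simp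
    from type[OF m] show ?thesis
    proof
      assume t: "S.partner m Q = c 1"
      then have "x \<in> Z3" using x3[OF m t] ex by simp
      then have "A = Z3" using A x Z by blast
      then show ?thesis using D2 BS t by simp
    next
      assume t: "S.partner m Q = c (n - 1)"
      then have "x \<in> Z1" using x1[OF m t] ex by simp
      then have "A = Z1" using A x Z by blast
      then show ?thesis using Dn BS t by (simp add: insert_commute)
    qed
  qed
  have part_in: "{A, B} \<in> D" if A: "A \<in> {Z1, Z2, Z3}" and B: "B \<in> {Z1, Z2, Z3}" "A \<noteq> B" and m: "m \<in> MM" and x: "x \<in> A" "m x \<in> B"
    for A B m x
  proof -
    have xQ: "x \<in> Q" "m x \<in> Q" using A B x Zin by blast+
    have mmx: "m (m x) = x" by (rule mm[OF m xQ(1)])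
    from type[OF m] show ?thesis
    proof
      assume t: "S.partner m Q = c 1"
      have "B \<noteq> Z3"
      proof
        assume a: "B = Z3"
        then have "x \<notin> Z3" using A B x Z by blast
        then show False using noZ3[OF m t xQ(1)] x a by blast
      qed
      moreover have "A \<noteq> Z3"
      proof
        assume a: "A = Z3"
        then have "m x \<notin> Z3" using A B x Z by blast
        then show False using noZ3[OF m t xQ(2)] x a mmx by simp
      qed
      ultimately have "{A, B} = {Z1, Z2}" using A B by blast
      then show ?thesis using D0 by simp
    next
      assume t: "S.partner m Q = c (n - 1)"
      have "B \<noteq> Z1"
      proof
        assume a: "B = Z1"
        then have "x \<notin> Z1" using A B x Z by blast
        then show False using noZ1[OF m t xQ(1)] x a by blast
      qed
      moreover have "A \<noteq> Z1"
      proof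
        assume a: "A = Z1"
        then have "m x \<notin> Z1" using A B x Z by blast
        then show False using noZ1[OF m t xQ(2)] x a mmx by simp
      qed
      ultimately have "{A, B} = {Z2, Z3}" using A B by blast
      then show ?thesis using D1 by simp
    qed
  qed
  have sub2: "edges (collapse G \<Q>) \<subseteq> D"
  proof
    fix e assume "e \<in> edges (collapse G \<Q>)"
    then obtain A B where AB: "e = {A, B}" "A \<in> \<Q>" "B \<in> \<Q>" "A \<noteq> B" "edge_between (edges G) A B"
      unfolding collapse_def quotient_edges_def by auto
    then obtain x y where xy: "x \<in> A" "y \<in> B" "{x, y} \<in> edges G" unfolding edge_between_def by blast
    obtain m where m: "m \<in> MM" "m x = y" "m y = x" by (rule edge_mate[OF xy(3)])
    consider "A \<in> {Z1, Z2, Z3}" "B \<in> {Z1, Z2, Z3}" | "A \<in> {Z1, Z2, Z3}" "B \<in> \<P> - {Q}"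
      | "B \<in> {Z1, Z2, Z3}" "A \<in> \<P> - {Q}" | "A \<in> \<P> - {Q}" "B \<in> \<P> - {Q}"
      using AB(2,3) unfolding \<Q>_def by (elim UnE) blast+
    then show "e \<in> D"
    proof cases
      case 1
      show ?thesis using part_in[OF 1 AB(4) m(1) xy(1)] xy(2) m(2) AB(1) by simp
    next
      case 2
      show ?thesis using part_out[OF 2 m(1) xy(1)] xy(2) m(2) AB(1) by simp
    next
      case 3
      show ?thesis using part_out[OF 3 m(1) xy(2)] xy(1) m(3) AB(1) by (simp add: insert_commute)
    next
      case 4
      then have "{A, B} \<in> EP" using old_iff AB \<open>e \<in> edges (collapse G \<Q>)\<close> by blast
      then obtain i where i: "i < n" "{A, B} = {c i, c (Suc i mod n)}" unfolding E by blast
      have "c i \<noteq> Q" "c (Suc i mod n) \<noteq> Q" using i(2) 4 by blast+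
      then have "i \<noteq> 0" "Suc i mod n \<noteq> 0" using c0 by metis+
      then obtain k where k: "i = Suc k" by (cases i) auto
      have "Suc i < n" using \<open>Suc i mod n \<noteq> 0\<close> i(1) by (cases "Suc i = n") auto
      then have "{A, B} = {c (Suc k), c (Suc (Suc k))}" using i k by simp
      then show ?thesis using Dold[of k] \<open>Suc i < n\<close> k AB(1) by simp
    qed
  qed
  show "is_cycle (collapse G \<Q>)"
    unfolding is_cycle_def
  proof (intro exI conjI)
    show "3 \<le> n + 2" using n by simp
    show "bij_betw d {..<n + 2} (verts (collapse G \<Q>))" using dbij unfolding collapse_simps(1) .
    show "edges (collapse G \<Q>) = {{d i, d (Suc i mod (n + 2))} | i. i < n + 2}"
      using sub1 sub2 unfolding D_def by (rule subset_antisym[rotated])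
  qed
qed

text \<open>Index-free form; the sense of rotation decides which of the neighbours comes
  first.\<close>

theorem refine_cycle:
  assumes cyc: "is_cycle (collapse G \<P>)" and Q: "Q \<in> \<P>" and o: "S.opposite m1 m2"
    and Z: "T Z1" "T Z3" "Q = Z1 \<union> Z2 \<union> Z3" "Z1 \<inter> Z2 = {}" "Z1 \<inter> Z3 = {}" "Z2 \<inter> Z3 = {}"
    and x1: "\<And>m. m \<in> MM \<Longrightarrow> S.partner m Q = S.partner m1 Q \<Longrightarrow> exit_point m Q \<in> Z1"
    and x3: "\<And>m. m \<in> MM \<Longrightarrow> S.partner m Q = S.partner m2 Q \<Longrightarrow> exit_point m Q \<in> Z3"
  shows "\<exists>\<Q>. tight_set_partition G M \<Q> \<and> is_cycle (collapse G \<Q>) \<and> card \<Q> = card \<P> + 2 \<and>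
    (\<forall>A\<in>\<Q>. \<exists>P\<in>\<P>. A \<subseteq> P)"
proof -
  have Qv: "Q \<in> verts (collapse G \<P>)" using Q unfolding collapse_simps .
  obtain n c where c: "n \<ge> 3" "bij_betw c {..<n} (verts (collapse G \<P>))"
    "EP = {{c i, c (Suc i mod n)} | i. i < n}" "c 0 = Q" by (rule cycle_rotate[OF cyc Qv])
  note c2 = c(2)[unfolded collapse_simps(1)]
  let ?\<Q> = "(\<P> - {Q}) \<union> {Z1, Z2, Z3}"
  have Zin: "Z1 \<subseteq> Q" "Z2 \<subseteq> Q" "Z3 \<subseteq> Q" unfolding Z(3) by blast+
  have sub: "\<forall>A\<in>?\<Q>. \<exists>P\<in>\<P>. A \<subseteq> P"
  proof
    fix A assume "A \<in> ?\<Q>"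
    then consider "A \<in> \<P>" | "A \<subseteq> Q" using Zin by (elim UnE insertE) blast+
    then show "\<exists>P\<in>\<P>. A \<subseteq> P" by cases (use Q in blast)+
  qed
  interpret C: cycle_frame G M "collapse G \<P>" "\<lambda>_. {}" by unfold_locales (rule cyc)
  have e1: "{Q, c 1} \<in> EP" unfolding c(3) using c(1,4) by (intro CollectI exI[of _ 0]) simp
  have en: "{Q, c (n - 1)} \<in> EP" unfolding c(3) using c(1,4)
    by (intro CollectI exI[of _ "n - 1"]) (simp add: insert_commute)
  have ne: "c 1 \<noteq> c (n - 1)" using inj_onD[OF bij_betw_imp_inj_on[OF c2], of 1 "n - 1"] c(1) by auto
  have "c 1 = S.partner m1 Q \<or> c 1 = S.partner m2 Q" "c (n - 1) = S.partner m1 Q \<or> c (n - 1) = S.partner m2 Q"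
    using C.opposite_nbr[OF o e1] C.opposite_nbr[OF o en] by blast+
  then consider "c 1 = S.partner m2 Q" "c (n - 1) = S.partner m1 Q" | "c 1 = S.partner m1 Q" "c (n - 1) = S.partner m2 Q"
    using ne by metis
  then show ?thesis
  proof cases
    case 1
    note r = refine_cycle_aux[OF c(1) c2 c(3,4) Z, unfolded 1, OF x1 x3]
    show ?thesis using r sub by blast
  next
    case 2
    have Z': "Q = Z3 \<union> Z2 \<union> Z1" "Z3 \<inter> Z2 = {}" "Z3 \<inter> Z1 = {}" "Z2 \<inter> Z1 = {}" using Z by blast+
    note r = refine_cycle_aux[OF c(1) c2 c(3,4) Z(2,1) Z', unfolded 2, OF x3 x1]
    have "(\<P> - {Q}) \<union> {Z3, Z2, Z1} = ?\<Q>" by blast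
    then show ?thesis using r sub by metis
  qed
qed

end

section \<open>Existence of the torsoid\<close>

context frame
begin

text \<open>The exit of \<open>w\<close> stays the exit when \<open>Y\<close> is added, so all
  points of \<open>Y\<close> are matched within \<open>Y\<close>.\<close>

lemma closed_beside:
  assumes e: "{u, v} \<in> edges H" "{v, w} \<in> edges H" "u \<noteq> w"
    and Y: "Y \<subseteq> \<epsilon> {u, v} \<union> v \<union> \<epsilon> {v, w}" "T (Y \<union> w)" and m: "m \<in> MM" "partner m w \<noteq> v"
  shows "closed_under m Y"
proof -
  note ve = edgeH[OF e(1)] edgeH[OF e(2)]
  let ?R = "\<epsilon> {u, v} \<union> v \<union> \<epsilon> {v, w}"
  define y where "y = exit_point m w"
  define w' where "w' = partner m w"
  have y: "y \<in> w" "m y \<notin> w" unfolding y_def using exit_point(1,2)[OF tightv[OF ve(5)] m(1)] by blast+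
  have w': "{w, w'} \<in> edges H" "w' \<in> verts H" "m y \<in> \<epsilon> {w, w'} \<union> w'" "w' \<noteq> v"
    unfolding w'_def y_def using partnerD[OF m(1) ve(5)] exit_partner[OF m(1) ve(5)] m(2) by blast+
  have ne: "{w, w'} \<noteq> {u, v}" "{w, w'} \<noteq> {v, w}" using ve w'(4) e(3) by (auto simp: doubleton_eq_iff)
  have "\<epsilon> {w, w'} \<inter> ?R = {}"
    using dise[OF w'(1) e(1) ne(1)] dise[OF w'(1) e(2) ne(2)] disve[OF ve(4) w'(1)] by blast
  moreover have "w' \<inter> ?R = {}" using disve[OF w'(2) e(1)] disve[OF w'(2) e(2)] disjv[OF w'(2) ve(4) w'(4)] by blast
  ultimately have my: "m y \<notin> ?R" using w'(3) by blast
  have wR: "w \<inter> ?R = {}" using disve[OF ve(5) e(1)] disve[OF ve(5) e(2)] disjv[OF ve(4,5)] ve(6) by blast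
  have "m y \<notin> Y \<union> w" using my y(2) Y(1) by blast
  then have ey: "exit_point m (Y \<union> w) = y" using exit_eq[OF Y(2) m(1), of y] y(1) by blast
  show ?thesis unfolding closed_under_def
  proof
    fix x assume x: "x \<in> Y"
    have xw: "x \<notin> w" using x Y(1) wR by blast
    then have "x \<noteq> y" using y(1) by blast
    then have "m x \<in> Y \<union> w" using exit_eq[OF Y(2) m(1), of x] x ey by blast
    moreover have "m x \<notin> w"
    proof
      assume a: "m x \<in> w"
      have "x \<in> V" using x tight_sub[OF Y(2)] by blast
      then have mm: "m (m x) = x" by (rule mateD(2)[OF m(1)])
      then have "y = m x" using exit_eq[OF tightv[OF ve(5)] m(1) a] xw unfolding y_def by simp
      then have "m y = x" using mm by simp
      then show False using my x Y(1) by blast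
    qed
    ultimately show "m x \<in> Y" by blast
  qed
qed

end

text \<open>Maximality with respect to the step of \<open>refine_cycle\<close>.\<close>

locale max_cycle = tight_partition G M \<P> for G :: "'v sgraph" and M \<P> +
  assumes cycS: "is_cycle (collapse G \<P>)"
    and finest: "tight_set_partition G M \<Q> \<Longrightarrow> is_cycle (collapse G \<Q>) \<Longrightarrow> card \<Q> = card \<P> + 2 \<Longrightarrow>
      \<forall>A\<in>\<Q>. \<exists>P\<in>\<P>. A \<subseteq> P \<Longrightarrow> False"
begin

sublocale C: cycle_frame G M "collapse G \<P>" "\<lambda>_. {}"
  by unfold_locales (rule cycS)

lemma no_refinement:
  assumes e: "{Q, A} \<in> EP" "{Q, B} \<in> EP" "A \<noteq> B"
    and Z: "T Z1" "T Z3" "Q = Z1 \<union> Z2 \<union> Z3" "Z1 \<inter> Z2 = {}" "Z1 \<inter> Z3 = {}" "Z2 \<inter> Z3 = {}"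
    and x1: "\<And>m. m \<in> MM \<Longrightarrow> S.partner m Q = A \<Longrightarrow> exit_point m Q \<in> Z1"
    and x3: "\<And>m. m \<in> MM \<Longrightarrow> S.partner m Q = B \<Longrightarrow> exit_point m Q \<in> Z3"
  shows False
proof -
  obtain m1 where m1: "m1 \<in> MM" "S.partner m1 Q = A" "S.partner m1 A = Q" using e(1) by (rule S.edge_real)
  obtain m2 where m2: "m2 \<in> MM" "S.partner m2 Q = B" "S.partner m2 B = Q" using e(2) by (rule S.edge_real)
  have Q: "Q \<in> \<P>" by (rule EPD(1)[OF e(1)])
  have "Q \<in> verts (collapse G \<P>)" using Q unfolding collapse_simps .
  then have o: "S.opposite m1 m2" by (rule C.oppositeI[OF m1(1) m2(1)]) (use m1 m2 e in simp)
  have "\<exists>\<Q>. tight_set_partition G M \<Q> \<and> is_cycle (collapse G \<Q>) \<and> card \<Q> = card \<P> + 2 \<and>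
    (\<forall>A\<in>\<Q>. \<exists>P\<in>\<P>. A \<subseteq> P)"
    by (rule refine_cycle[OF cycS Q o Z]) (use x1 x3 m1(2) m2(2) in simp_all)
  then show False using finest by blast
qed

lemma two_neighbours:
  assumes e: "{Q, A} \<in> EP" "{Q, B} \<in> EP" "A \<noteq> B" "{Q, R} \<in> EP"
  shows "R = A \<or> R = B"
proof -
  have Q: "Q \<in> verts (collapse G \<P>)" using EPD(1)[OF e(1)] unfolding collapse_simps .
  obtain a b where ab: "a \<noteq> b" "\<And>z. {Q, z} \<in> EP \<longleftrightarrow> z = a \<or> z = b"
    by (rule cycle_degree[OF cycS Q]) blast
  then show ?thesis using e by metis
qed

lemma other_neighbour:
  assumes "Q \<in> \<P>" "A \<in> \<P>" obtains B where "{Q, B} \<in> EP" "B \<noteq> A"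
  using other_partner[OF assms] EP_class_partner[OF _ assms(1)] that by blast

text \<open>If the gaps at \<open>P\<close> overlap, \<open>P\<close> minus one gap and
  \<open>P\<close> minus the other uncross to two tight sets, which are the outer parts of a
  refinement of \<open>P\<close>.\<close>

lemma gap_separated:
  assumes e: "{P, Q} \<in> EP" "{P, Q'} \<in> EP" "Q \<noteq> Q'"
  shows "gap P Q \<inter> gap P Q' = {}"
proof (cases "odd_cut ((P - gap P Q) \<inter> (P - gap P Q'))")
  case True
  then show ?thesis by (rule gap_overlap[OF e])
next
  case False
  note H = EPD[OF e(1)] EPD[OF e(2)]
  define X where "X = P - gap P Q"
  define Y where "Y = P - gap P Q'"
  have XY: "T X" "T Y" "\<not> odd_cut (X \<inter> Y)" "X \<subseteq> P" "Y \<subseteq> P"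
    unfolding X_def Y_def using gap_tight[OF H(1-3)] gap_tight[OF H(4-6)] False by blast+
  note t = uncross_even[OF XY(1-3)]
  \<comment> \<open>By \<open>uncross_even\<close>, the even intersection sends no edges to the
    outside of \<open>P\<close>.\<close>
  have ni: "exit_point m P \<notin> X \<inter> Y" if m: "m \<in> MM" for m
  proof -
    have p: "m (exit_point m P) \<notin> P" "exit_point m P \<in> V"
      using exit_point(2,5)[OF class_tight[OF H(1)] m] by blast+
    then show ?thesis using t(3)[of "exit_point m P" "m (exit_point m P)"] mateD(1)[OF m p(2)] XY(4,5) by blast
  qed
  have pP: "exit_point m P \<in> P" if m: "m \<in> MM" for m
    by (rule exit_point(1)[OF class_tight[OF H(1)] m])
  have False
  proof (rule no_refinement[OF e t(2,1)])
    show "P = (Y - X) \<union> (P - (Y - X) - (X - Y)) \<union> (X - Y)" using XY(4,5) by blast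
    fix m assume m: "m \<in> MM"
    show "exit_point m P \<in> Y - X" if "S.partner m P = Q"
    proof -
      have "exit_point m P \<notin> gap P Q'" by (rule gap_exit[OF H(4-6) m]) (use that e(3) in simp)
      then have "exit_point m P \<in> Y" using pP[OF m] unfolding Y_def by blast
      then show ?thesis using ni[OF m] by blast
    qed
    show "exit_point m P \<in> X - Y" if "S.partner m P = Q'"
    proof -
      have "exit_point m P \<notin> gap P Q" by (rule gap_exit[OF H(1-3) m]) (use that e(3) in simp)
      then have "exit_point m P \<in> X" using pP[OF m] unfolding X_def by blast
      then show ?thesis using ni[OF m] by blast
    qed
  qed blast+
  then show ?thesis ..
qed

sublocale separated_partition G M \<P>
  by unfold_locales (rule gap_separated)

lemma trimmed_graph_cycle: "is_cycle trimmed_graph"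
proof -
  obtain n c where c: "n \<ge> 3" "bij_betw c {..<n} \<P>" "EP = {{c i, c (Suc i mod n)} | i. i < n}"
    using cycS unfolding is_cycle_def collapse_simps(1) by blast
  have "inj_on trim \<P>" using trim_inj by (rule inj_onI)
  then have "bij_betw trim \<P> (trim ` \<P>)" by (rule inj_on_imp_bij_betw)
  then have b: "bij_betw (trim \<circ> c) {..<n} (verts trimmed_graph)" unfolding trimmed_graph_verts by (rule bij_betw_trans[OF c(2)])
  have "edges trimmed_graph = {{(trim \<circ> c) i, (trim \<circ> c) (Suc i mod n)} | i. i < n}"
  proof (rule set_eqI)
    fix e
    have "e \<in> edges trimmed_graph \<longleftrightarrow> (\<exists>P Q. e = trim ` {P, Q} \<and> {P, Q} \<in> EP)" using trimmed_graph_edges by simp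
    also have "\<dots> \<longleftrightarrow> (\<exists>f\<in>EP. e = trim ` f)" unfolding c(3) by blast
    also have "\<dots> \<longleftrightarrow> (\<exists>i<n. e = trim ` {c i, c (Suc i mod n)})" unfolding c(3) by blast
    finally show "e \<in> edges trimmed_graph \<longleftrightarrow> e \<in> {{(trim \<circ> c) i, (trim \<circ> c) (Suc i mod n)} | i. i < n}"
      by (simp add: conj_commute)
  qed
  then show ?thesis unfolding is_cycle_def using c(1) b by blast
qed

text \<open>A refinement of the class \<open>A\<close> from a forbidden splitting at its neighbour
  \<open>B\<close>: the parts are \<open>A\<close> without the gap to \<open>B\<close>, and the
  two pieces into which the gap is cut inside \<open>A\<close>.\<close>

lemma no_odd_split_beside:
  assumes e: "{A, B} \<in> EP"
    and P1: "T P1" "odd_cut (A \<inter> P1)" and K: "T (A \<inter> K)" "P1 \<inter> K = {}" and AR: "A \<inter> (P1 \<union> K) = A \<inter> gap A B"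
    and cl: "\<And>m. m \<in> MM \<Longrightarrow> S.partner m B = A \<Longrightarrow> closed_under m K" and KV: "K \<subseteq> V"
  shows False
proof -
  note H = EPD[OF e]
  obtain D where D: "{A, D} \<in> EP" "D \<noteq> B" using H(1,2) by (rule other_neighbour)
  show False
  proof (rule no_refinement[OF D(1) e D(2) gap_tight[OF H] K(1)])
    show "A = (A - gap A B) \<union> (A \<inter> P1) \<union> (A \<inter> K)" using AR by blast
    show "(A - gap A B) \<inter> (A \<inter> P1) = {}" "(A - gap A B) \<inter> (A \<inter> K) = {}" using AR by blast+
    show "(A \<inter> P1) \<inter> (A \<inter> K) = {}" using K(2) by blast
    fix m assume m: "m \<in> MM"
    have pA: "exit_point m A \<in> A" by (rule exit_point(1)[OF class_tight[OF H(1)] m])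
    show "exit_point m A \<in> A - gap A B" if "S.partner m A = D"
      using gap_exit[OF H m] that D(2) pA by blast
    show "exit_point m A \<in> A \<inter> K" if t: "S.partner m A = B"
    proof -
      have "S.partner m B = A" using class_partner(4)[OF m H(1)] unfolding t .
      then have "closed_under m K" by (rule cl[OF m])
      then show ?thesis using exit_in_closed[OF class_tight[OF H(1)] m _ KV] odd_cut_tight[OF K(1)] pA by blast
    qed
  qed
qed

text \<open>Given a forbidden splitting \<open>P1, P2, P3\<close> at the trimmed class of
  \<open>B\<close>, distribute the three sets over \<open>A\<close>, \<open>B\<close> and
  \<open>C\<close>. If \<open>P1\<close> is odd on \<open>A\<close> then \<open>A\<close> can be
  refined, if \<open>P3\<close> is odd on \<open>C\<close> then \<open>C\<close> can be refined,
  and otherwise all three sets are odd on \<open>B\<close>, which can then be refined into its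
  intersections with them.\<close>

lemma trimmed_graph_unrefined:
  assumes e: "{u, v} \<in> edges trimmed_graph" "{v, w} \<in> edges trimmed_graph" "u \<noteq> w"
    and t: "T P1" "T P2" "T P3" and dj: "P1 \<inter> P2 = {}" "P1 \<inter> P3 = {}" "P2 \<inter> P3 = {}"
    and R: "P1 \<union> P2 \<union> P3 = trimmed_eps {u, v} \<union> v \<union> trimmed_eps {v, w}"
    and tu: "T (u \<union> P1 \<union> P2)" and tw: "T (P2 \<union> P3 \<union> w)"
  shows False
proof -
  obtain A B where AB: "u = trim A" "v = trim B" "{A, B} \<in> EP" using e(1) by (rule trimmed_graph_edgeE)
  obtain B' C where BC': "v = trim B'" "w = trim C" "{B', C} \<in> EP" using e(2) by (rule trimmed_graph_edgeE)
  have "B' = B" using trim_inj EPD(2)[OF AB(3)] EPD(1)[OF BC'(3)] AB(2) BC'(1) by metis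
  then have BC: "{B, C} \<in> EP" using BC'(3) by simp
  have BA: "{B, A} \<in> EP" and CB: "{C, B} \<in> EP" using EP_sym AB(3) BC by blast+
  note HA = EPD[OF AB(3)] and HC = EPD[OF BC]
  have AC: "A \<noteq> C" using e(3) AB(1) BC'(2) by blast
  have djAC: "A \<inter> B = {}" "A \<inter> C = {}" "B \<inter> C = {}" using class_disj HA HC AC by blast+
  have R': "P1 \<union> P2 \<union> P3 = gap A B \<union> trim B \<union> gap B C" using R trimmed_eps_eq[OF AB(3)] trimmed_eps_eq[OF BC] AB BC'(2) by simp
  have Esub: "gap A B \<subseteq> A \<union> B" "gap B C \<subseteq> B \<union> C" "trim B \<subseteq> B" "u \<subseteq> A" "w \<subseteq> C"
    using gap_sub trim_sub AB(1) BC'(2) by blast+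
  have AR: "A \<inter> (P1 \<union> P2 \<union> P3) = A \<inter> gap A B" unfolding R' using Esub djAC by blast
  have CR: "C \<inter> (P1 \<union> P2 \<union> P3) = C \<inter> gap B C" unfolding R' using Esub djAC by blast
  have BR: "B \<subseteq> P1 \<union> P2 \<union> P3"
  proof
    fix x assume x: "x \<in> B"
    show "x \<in> P1 \<union> P2 \<union> P3"
    proof (cases "x \<in> trim B")
      case True
      then show ?thesis unfolding R' by blast
    next
      case False
      then obtain Q where Q: "{B, Q} \<in> EP" "x \<in> gap B Q" using x unfolding trim_def by blast
      have "Q = A \<or> Q = C" by (rule two_neighbours[OF BA BC AC Q(1)])
      then have "x \<in> gap A B \<union> gap B C" using Q(2) gap_sym by blast
      then show ?thesis unfolding R' by blast
    qed
  qed
  have Rsub: "P1 \<union> P2 \<union> P3 \<subseteq> A \<union> B \<union> C" unfolding R' using Esub by blast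
  have cl3: "closed_under m (P2 \<union> P3)" if m: "m \<in> MM" "S.partner m B = A" for m
  proof (rule F.closed_beside[OF e _ tw m(1)])
    show "P2 \<union> P3 \<subseteq> trimmed_eps {u, v} \<union> v \<union> trimmed_eps {v, w}" using R by blast
    have "S.partner m C \<noteq> B" using class_partner(4)[OF m(1) HC(2)] m(2) AC by auto
    then show "F.partner m w \<noteq> v" unfolding BC'(2) AB(2) partner_trim[OF m(1) HC(2)]
      using trim_inj[OF class_partner(1)[OF m(1) HC(2)] HC(1)] by blast
  qed
  have cl1: "closed_under m (P1 \<union> P2)" if m: "m \<in> MM" "S.partner m B = C" for m
  proof (rule F.closed_beside[where u = w and v = v and w = u])
    show "{w, v} \<in> edges trimmed_graph" "{v, u} \<in> edges trimmed_graph" "w \<noteq> u" using e by (simp_all add: insert_commute)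
    have "trimmed_eps {w, v} = trimmed_eps {v, w}" "trimmed_eps {v, u} = trimmed_eps {u, v}" by (simp_all add: insert_commute)
    then show "P1 \<union> P2 \<subseteq> trimmed_eps {w, v} \<union> v \<union> trimmed_eps {v, u}" using R by blast
    show "T (P1 \<union> P2 \<union> u)" using tu by (simp add: Un_ac)
    have "S.partner m A \<noteq> B" using class_partner(4)[OF m(1) HA(1)] m(2) AC by auto
    then show "F.partner m u \<noteq> v" unfolding AB(1,2) partner_trim[OF m(1) HA(1)]
      using trim_inj[OF class_partner(1)[OF m(1) HA(1)] HA(2)] by blast
  qed (rule m(1))
  have PV: "P1 \<subseteq> V" "P2 \<subseteq> V" "P3 \<subseteq> V" using tight_sub t by blast+
  obtain ma where ma: "ma \<in> MM" "S.partner ma B = A" "S.partner ma A = B" using BA by (rule S.edge_real)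
  obtain mc where mc: "mc \<in> MM" "S.partner mc B = C" "S.partner mc C = B" using BC by (rule S.edge_real)
  have f: "fin_cut A" "fin_cut B" "fin_cut C" "fin_cut P1" "fin_cut P2" "fin_cut P3" using class_tight HA HC t by blast+
  have U2: "odd_cut (X \<inter> (Y \<union> Z)) \<longleftrightarrow> odd_cut (X \<inter> Y) \<noteq> odd_cut (X \<inter> Z)" if "fin_cut X" "fin_cut Y" "fin_cut Z" "Y \<inter> Z = {}" for X Y Z
  proof -
    have "odd_cut ((X \<inter> Y) \<union> (X \<inter> Z)) \<longleftrightarrow> odd_cut (X \<inter> Y) \<noteq> odd_cut (X \<inter> Z)"
      by (rule odd_cut_Un_disjoint) (use that in blast)+
    then show ?thesis unfolding Int_Un_distrib .
  qed
  \<comment> \<open>A matching that pairs \<open>B\<close> with \<open>A\<close> exits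
    \<open>C\<close> outside the gap between \<open>B\<close> and \<open>C\<close>.\<close>
  have C23: "\<not> odd_cut (C \<inter> (P2 \<union> P3))"
  proof
    assume "odd_cut (C \<inter> (P2 \<union> P3))"
    then have "exit_point ma C \<in> P2 \<union> P3"
      using exit_in_closed[OF class_tight[OF HC(2)] ma(1) cl3[OF ma(1,2)]] PV by blast
    then have "exit_point ma C \<in> gap C B"
      using exit_point(1)[OF class_tight[OF HC(2)] ma(1)] CR gap_sym by blast
    moreover have "S.partner ma C \<noteq> B" using class_partner(4)[OF ma(1) HC(2)] ma(2) AC by auto
    ultimately show False using gap_exit[OF HC(2,1) HC(3)[symmetric] ma(1)] by blast
  qed
  have A12: "\<not> odd_cut (A \<inter> (P1 \<union> P2))"
  proof
    assume "odd_cut (A \<inter> (P1 \<union> P2))"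
    then have "exit_point mc A \<in> P1 \<union> P2"
      using exit_in_closed[OF class_tight[OF HA(1)] mc(1) cl1[OF mc(1,2)]] PV by blast
    then have "exit_point mc A \<in> gap A B"
      using exit_point(1)[OF class_tight[OF HA(1)] mc(1)] AR by blast
    moreover have "S.partner mc A \<noteq> B" using class_partner(4)[OF mc(1) HA(1)] mc(2) AC by auto
    ultimately show False using gap_exit[OF HA mc(1)] by blast
  qed
  have A123: "\<not> odd_cut (A \<inter> (P1 \<union> P2 \<union> P3))" unfolding AR by (rule passes_even(1)[OF HA passes_gap[OF HA]])
  have C123: "\<not> odd_cut (C \<inter> (P1 \<union> (P2 \<union> P3)))"
  proof -
    have "C \<inter> (P1 \<union> (P2 \<union> P3)) = C \<inter> gap C B" using CR gap_sym by (simp add: Un_assoc)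
    then show ?thesis using passes_even(1)[OF HC(2,1) HC(3)[symmetric] passes_gap[OF HC(2,1) HC(3)[symmetric]]] by simp
  qed
  have d: "(P1 \<union> P2) \<inter> P3 = {}" "P1 \<inter> (P2 \<union> P3) = {}" using dj by blast+
  have f2: "fin_cut (P1 \<union> P2)" "fin_cut (P2 \<union> P3)" using f by blast+
  have pA: "odd_cut (A \<inter> P1) \<longleftrightarrow> odd_cut (A \<inter> P2)" "\<not> odd_cut (A \<inter> P3)"
    using U2[OF f(1) f(4,5) dj(1)] U2[OF f(1) f2(1) f(6) d(1)] A12 A123 by blast+
  have pC: "odd_cut (C \<inter> P3) \<longleftrightarrow> odd_cut (C \<inter> P2)" "\<not> odd_cut (C \<inter> P1)"
    using U2[OF f(3) f(5,6) dj(3)] U2[OF f(3) f(4) f2(2) d(2)] C23 C123 by blast+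
  have nA: "\<not> odd_cut (A \<inter> P1)"
  proof
    assume a: "odd_cut (A \<inter> P1)"
    have "odd_cut (A \<inter> (P2 \<union> P3))" using U2[OF f(1) f(5,6) dj(3)] pA a by blast
    moreover have eq: "A \<inter> (P2 \<union> P3 \<union> w) = A \<inter> (P2 \<union> P3)" using Esub(5) djAC by blast
    ultimately have "T (A \<inter> (P2 \<union> P3))" using tight_Int_odd[OF class_tight[OF HA(1)] tw] by simp
    then show False
      by (rule no_odd_split_beside[OF AB(3) t(1) a _ d(2)]) (use AR cl3 PV in \<open>simp_all add: Un_assoc\<close>)
  qed
  have nC: "\<not> odd_cut (C \<inter> P3)"
  proof
    assume a: "odd_cut (C \<inter> P3)"
    have "odd_cut (C \<inter> (P1 \<union> P2))" using U2[OF f(3) f(4,5) dj(1)] pC a by blast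
    moreover have eq: "C \<inter> (u \<union> P1 \<union> P2) = C \<inter> (P1 \<union> P2)" using Esub(4) djAC by blast
    ultimately have "T (C \<inter> (P1 \<union> P2))" using tight_Int_odd[OF class_tight[OF HC(2)] tu] by simp
    moreover have "P3 \<inter> (P1 \<union> P2) = {}" using d by blast
    moreover have "C \<inter> (P3 \<union> (P1 \<union> P2)) = C \<inter> gap C B" using CR gap_sym by (simp add: Un_ac)
    ultimately show False
      by (rule no_odd_split_beside[OF CB t(3) a]) (use cl1 PV in simp_all)
  qed
  have odB: "odd_cut (B \<inter> P)" if P: "T P" "P \<subseteq> P1 \<union> P2 \<union> P3" "\<not> odd_cut (A \<inter> P)" "\<not> odd_cut (C \<inter> P)" for P
  proof -
    have fP: "fin_cut P" using P(1) by blast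
    have eq: "P = (P \<inter> B) \<union> (P \<inter> (A \<union> C))" "B \<inter> (A \<union> C) = {}" using P(2) Rsub djAC by blast+
    have fAC: "fin_cut (A \<union> C)" using f by blast
    have "odd_cut ((P \<inter> B) \<union> (P \<inter> (A \<union> C))) \<longleftrightarrow> odd_cut (P \<inter> B) \<noteq> odd_cut (P \<inter> (A \<union> C))"
      by (rule odd_cut_Un_disjoint) (use fP fAC f eq(2) in blast)+
    moreover have "\<not> odd_cut (P \<inter> (A \<union> C))" using U2[OF fP f(1,3) djAC(2)] P(3,4) by (simp add: Int_commute)
    ultimately show ?thesis using odd_cut_tight[OF P(1)] eq(1) by (simp add: Int_commute)
  qed
  have oB: "odd_cut (B \<inter> P1)" "odd_cut (B \<inter> P2)" "odd_cut (B \<inter> P3)"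
    using odB[OF t(1)] odB[OF t(2)] odB[OF t(3)] pA pC nA nC by blast+
  note tB = class_tight[OF HC(1)]
  show False
  proof (rule no_refinement[OF BA BC AC])
    show "T (B \<inter> P1)" "T (B \<inter> P3)" using tight_Int_odd[OF tB] t oB by blast+
    show "B = (B \<inter> P1) \<union> (B \<inter> P2) \<union> (B \<inter> P3)" using BR by blast
    show "(B \<inter> P1) \<inter> (B \<inter> P2) = {}" "(B \<inter> P1) \<inter> (B \<inter> P3) = {}" "(B \<inter> P2) \<inter> (B \<inter> P3) = {}"
      using dj by blast+
    fix m assume m: "m \<in> MM"
    have pB: "exit_point m B \<in> B" by (rule exit_point(1)[OF tB m])
    show "exit_point m B \<in> B \<inter> P1" if "S.partner m B = A"
    proof -
      have "\<not> odd_cut (B \<inter> (P2 \<union> P3))" using U2[OF f(2) f(5,6) dj(3)] oB by blast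
      then have "exit_point m B \<notin> P2 \<union> P3"
        using exit_in_closed[OF tB m cl3[OF m that]] PV by blast
      then show ?thesis using pB BR by blast
    qed
    show "exit_point m B \<in> B \<inter> P3" if "S.partner m B = C"
    proof -
      have "\<not> odd_cut (B \<inter> (P1 \<union> P2))" using U2[OF f(2) f(4,5) dj(1)] oB by blast
      then have "exit_point m B \<notin> P1 \<union> P2"
        using exit_in_closed[OF tB m cl1[OF m that]] PV by blast
      then show ?thesis using pB BR by blast
    qed
  qed
qed

theorem max_cycle_torsoid: "\<exists>T. torsoid G M T \<and> (\<forall>P\<in>\<P>. \<exists>v\<in>verts (fst T). v \<subseteq> P)"
proof -
  have "torsoid G M (trimmed_graph, trimmed_eps)"
  proof (rule trimmed_graph_torsoid)
    show "BoB trimmed_graph F.MH \<or> is_cycle trimmed_graph" using trimmed_graph_cycle by blast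
  qed (rule trimmed_graph_unrefined)
  moreover have "\<forall>P\<in>\<P>. \<exists>v\<in>verts (fst (trimmed_graph, trimmed_eps)). v \<subseteq> P" unfolding fst_conv trimmed_graph_verts using trim_sub by blast
  ultimately show ?thesis by blast
qed

end

context tight_partition
begin

text \<open>Two matchings that disagree on the cycle \<open>\<P>\<close> disagree at every class
  of a cyclic refinement, and so at the exit of that class.\<close>

lemma cyclic_refinement_bound:
  assumes o: "S.opposite m1 m2" and \<Q>: "tight_set_partition G M \<Q>" "is_cycle (collapse G \<Q>)" "\<forall>A\<in>\<Q>. \<exists>P\<in>\<P>. A \<subseteq> P"
  shows "card \<Q> \<le> card {x \<in> V. m1 x \<noteq> m2 x}"
proof -
  interpret K: frame G M "collapse G \<Q>" "\<lambda>_. {}" by (rule collapse_frame[OF \<Q>(1)])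
  interpret K: cycle_frame G M "collapse G \<Q>" "\<lambda>_. {}" by unfold_locales (rule \<Q>(2))
  have m: "m1 \<in> MM" "m2 \<in> MM" using S.oppositeD(1,2)[OF o] by blast+
  have QP: "Q \<subseteq> P" if "Q \<in> \<Q>" "P \<in> \<P>" "x \<in> Q" "x \<in> P" for Q P x
  proof -
    obtain P' where P': "P' \<in> \<P>" "Q \<subseteq> P'" using \<Q>(3) \<open>Q \<in> \<Q>\<close> by blast
    then have "P' = P" using class_eq[of P' P x] that by blast
    then show ?thesis using P' by blast
  qed
  have ne: "K.partner m1 Q \<noteq> K.partner m2 Q" if Q: "Q \<in> verts (collapse G \<Q>)" for Q
  proof
    assume a: "K.partner m1 Q = K.partner m2 Q"
    obtain P where P: "P \<in> \<P>" by (rule other_class)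
    define p where "p = exit_point m1 P"
    have p: "p \<in> P" "m1 p \<notin> P" "p \<in> V" "m1 p \<in> S.partner m1 P"
      unfolding p_def using exit_point(1,2,5)[OF class_tight[OF P] m(1)] class_partner(5)[OF m(1) P] by blast+
    obtain Q0 where Q0: "Q0 \<in> verts (collapse G \<Q>)" "p \<in> Q0" using K.cover[OF p(3)] by blast
    have Q0\<Q>: "Q0 \<in> \<Q>" using Q0(1) unfolding collapse_simps .
    have Q0P: "Q0 \<subseteq> P" by (rule QP[OF Q0\<Q> P Q0(2) p(1)])
    define Q1 where "Q1 = K.partner m1 Q0"
    have Q1: "Q1 \<in> \<Q>" unfolding Q1_def using K.partnerD(3)[OF m(1) Q0(1)] unfolding collapse_simps .
    have "m1 p \<in> K.link Q0 Q1" unfolding Q1_def by (rule closedD[OF K.partnerD(2)[OF m(1) Q0(1)]]) (use Q0 in \<open>simp add: K.link_def\<close>)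
    then have "m1 p \<in> Q1" using p(2) Q0P unfolding K.link_def by blast
    then have Q1P: "Q1 \<subseteq> S.partner m1 P" by (rule QP[OF Q1 class_partner(1)[OF m(1) P] _ p(4)])
    have Q2: "K.partner m2 Q0 = Q1" unfolding Q1_def using K.agree_all[OF m Q a Q0(1)] by simp
    let ?q = "exit_point m2 Q0"
    have "?q \<in> Q0" by (rule exit_point(1)[OF K.tightv[OF Q0(1)] m(2)])
    moreover have "m2 ?q \<in> Q1" using K.exit_partner[OF m(2) Q0(1)] unfolding Q2 by blast
    ultimately have "S.partner m2 P = S.partner m1 P"
      using class_partner_eq[OF m(2) P class_partner(1)[OF m(1) P], of ?q] class_partner(2)[OF m(1) P] Q0P Q1P by auto
    moreover have "P \<in> verts (collapse G \<P>)" using P unfolding collapse_simps .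
    ultimately show False using S.oppositeD(3)[OF o] by metis
  qed
  show ?thesis
  proof (rule card_inj_on_le[of "exit_point m1"])
    show "inj_on (exit_point m1) \<Q>" using K.exit_point_inj[OF m(1)] unfolding collapse_simps .
    show "finite {x \<in> V. m1 x \<noteq> m2 x}" by (rule mates_differ_finite[OF m])
    show "exit_point m1 ` \<Q> \<subseteq> {x \<in> V. m1 x \<noteq> m2 x}"
    proof
      fix x assume "x \<in> exit_point m1 ` \<Q>"
      then obtain Q where Q: "Q \<in> \<Q>" "x = exit_point m1 Q" by blast
      have Qv: "Q \<in> verts (collapse G \<Q>)" using Q(1) unfolding collapse_simps .
      have "x \<in> V" unfolding Q(2) by (rule exit_point(5)[OF K.tightv[OF Qv] m(1)])
      moreover have "m1 x \<noteq> m2 x" using K.partner_differ[OF m Qv] ne[OF Qv] unfolding Q(2) by metis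
      ultimately show "x \<in> {x \<in> V. m1 x \<noteq> m2 x}" by simp
    qed
  qed
qed

theorem cyclic_torsoid:
  assumes cyc: "is_cycle (collapse G \<P>)"
  shows "\<exists>T. torsoid G M T \<and> (\<forall>P\<in>\<P>. \<exists>v\<in>verts (fst T). v \<subseteq> P)"
proof -
  interpret C: cycle_frame G M "collapse G \<P>" "\<lambda>_. {}" by unfold_locales (rule cyc)
  obtain m1 m2 where o: "S.opposite m1 m2" by (rule C.opposite_ex)
  define good where "good \<Q> \<longleftrightarrow> tight_set_partition G M \<Q> \<and> is_cycle (collapse G \<Q>) \<and> (\<forall>A\<in>\<Q>. \<exists>P\<in>\<P>. A \<subseteq> P)" for \<Q>
  have gP: "good \<P>" unfolding good_def using part cyc by blast
  have "\<forall>\<Q>. good \<Q> \<longrightarrow> card \<Q> < Suc (card {x \<in> V. m1 x \<noteq> m2 x})"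
    unfolding good_def less_Suc_eq_le using cyclic_refinement_bound[OF o] by blast
  then have "\<exists>\<Q>. good \<Q> \<and> (\<forall>\<R>. good \<R> \<longrightarrow> card \<R> \<le> card \<Q>)"
    by (rule ex_has_greatest_nat[of good \<P> card, OF gP])
  then obtain \<Q> where \<Q>: "good \<Q>" "\<And>\<R>. good \<R> \<Longrightarrow> card \<R> \<le> card \<Q>" by blast
  have g: "tight_set_partition G M \<Q>" "is_cycle (collapse G \<Q>)" "\<forall>A\<in>\<Q>. \<exists>P\<in>\<P>. A \<subseteq> P"
    using \<Q>(1) unfolding good_def by blast+
  have "finite \<P>" using cyc unfolding is_cycle_def collapse_simps(1) using bij_betw_finite by blast
  then have "4 \<le> card \<Q>" using largeS \<Q>(2)[OF gP] by simp
  then have large: "infinite \<Q> \<or> 4 \<le> card \<Q>" by blast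
  interpret Q: max_cycle G M \<Q>
  proof unfold_locales
    show "tight_set_partition G M \<Q>" "is_cycle (collapse G \<Q>)" "infinite \<Q> \<or> 4 \<le> card \<Q>" by fact+
    fix \<R> assume r: "tight_set_partition G M \<R>" "is_cycle (collapse G \<R>)" "card \<R> = card \<Q> + 2" "\<forall>A\<in>\<R>. \<exists>P\<in>\<Q>. A \<subseteq> P"
    have "\<forall>A\<in>\<R>. \<exists>P\<in>\<P>. A \<subseteq> P"
    proof
      fix A assume "A \<in> \<R>"
      then obtain B where B: "B \<in> \<Q>" "A \<subseteq> B" using r(4) by blast
      then obtain P where "P \<in> \<P>" "B \<subseteq> P" using g(3) by blast
      then show "\<exists>P\<in>\<P>. A \<subseteq> P" using B by blast
    qed
    then have "good \<R>" unfolding good_def using r by blast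
    then show False using \<Q>(2)[of \<R>] r(3) by simp
  qed
  obtain T where T: "torsoid G M T" "\<forall>Q\<in>\<Q>. \<exists>v\<in>verts (fst T). v \<subseteq> Q" using Q.max_cycle_torsoid by blast
  have "\<exists>v\<in>verts (fst T). v \<subseteq> P" if P: "P \<in> \<P>" for P
  proof -
    obtain x where x: "x \<in> P" "x \<in> V" using tight_ne[OF class_tight[OF P]] class_sub[OF P] by blast
    obtain Q where Q: "Q \<in> \<Q>" "x \<in> Q" using Q.classes[OF x(2)] by blast
    obtain P' where P': "P' \<in> \<P>" "Q \<subseteq> P'" using g(3) Q(1) by blast
    have "P' = P" using class_eq[OF P'(1) P, of x] P'(2) Q(2) x(1) by blast
    moreover obtain v where "v \<in> verts (fst T)" "v \<subseteq> Q" using T(2) Q(1) by blast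
    ultimately show ?thesis using P'(2) by blast
  qed
  then show ?thesis using T(1) by blast
qed

end

theorem lemma7p5:
  fixes G :: "'v sgraph" and M :: "'v set set" and S :: "'v set sgraph"
  assumes "matching_covered G M"
    and "torso G M S"
  shows "\<exists>!T. torsoid G M T \<and> cleaves S T"
proof -
  obtain \<C> \<P> where star: "maximal_star G M \<C> \<P>" and S: "S = collapse G \<P>"
    using assms(2) unfolding torso_def by blast
  have p: "tight_set_partition G M \<P>" "infinite \<P> \<or> 4 \<le> card \<P>"
    "BoB (collapse G \<P>) (collapse_matching M \<P>)"
    using star unfolding maximal_star_def by blast+
  interpret tight_partition G M \<P>
    by unfold_locales (rule assms(1) p)+
  have cl: "cleaves S T \<longleftrightarrow> (\<forall>P\<in>\<P>. \<exists>v\<in>verts (fst T). v \<subseteq> P)" for T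
    unfolding cleaves_def S collapse_simps(1) ..
  show ?thesis unfolding cl
  proof (rule ex_ex1I)
    show "\<exists>T. torsoid G M T \<and> (\<forall>P\<in>\<P>. \<exists>v\<in>verts (fst T). v \<subseteq> P)"
      using brick_torsoid[OF p(3)] cyclic_torsoid by blast
    fix T1 T2
    assume "torsoid G M T1 \<and> (\<forall>P\<in>\<P>. \<exists>v\<in>verts (fst T1). v \<subseteq> P)"
      and "torsoid G M T2 \<and> (\<forall>P\<in>\<P>. \<exists>v\<in>verts (fst T2). v \<subseteq> P)"
    then show "T1 = T2" using torsoid_unique[OF p(1,2)] by blast
  qed
qed

end
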